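(* Let $\mathsf{T}$ be a big tt-category and assume that the frame $\mathscr{S}(\mathsf{T})$ of smashing ideals is spatial. Then the space $\mathrm{Spc}^{\mathrm{s}}(\mathsf{T})$ (the sober space corresponding to $\mathscr{S}(\mathsf{T})$ under Stone duality) has points given by the prime smashing ideals of $\mathsf{T}$. It is equipped with a continuous map $$\psi\colon \mathrm{Spc}^{\mathrm{s}}(\mathsf{T}) \longrightarrow (\mathrm{Spc}(\mathsf{T}^c))^\vee, \qquad \psi(\mathsf{S}) = \mathsf{S}\cap \mathsf{T}^c,$$ where $(\mathrm{Spc}(\mathsf{T}^c))^\vee$ is the Hochster dual of the Balmer spectrum $\mathrm{Spc}(\mathsf{T}^c)$. This map is compatible with supports in the sense that $\psi^{-1}(\mathrm{supp}(t)) = \mathrm{supp}^{\mathrm{s}}(t)$ for every $t\in \mathsf{T}^c$. Moreover, $\psi$ is a homeomorphism if and only if the telescope conjecture holds for tensor ideals of $\mathsf{T}$, i.e. if and only if every smashing ideal $\mathsf{S}$ of $\mathsf{T}$ is generated, as a localizing subcategory, by compact objects of $\mathsf{T}$.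
   Context: A big tt-category is a rigidly-compactly generated tensor-triangulated category $(\mathsf{T},\otimes,\mathbf{1})$: a triangulated category with all small coproducts and a compatible closed symmetric monoidal structure, in which compact and rigid objects coincide and form an essentially small subcategory $\mathsf{T}^c$ generating $\mathsf{T}$ as a localizing subcategory. A localizing subcategory is a full triangulated subcategory closed under coproducts; a localizing ideal is one closed under tensoring with arbitrary objects of $\mathsf{T}$. A smashing ideal is a localizing ideal $\mathsf{S}$ for which there is an exact triangle $E_\mathsf{S}\to \mathbf{1}\to F_\mathsf{S}\to \Sigma E_\mathsf{S}$ with $E_\mathsf{S}\otimes F_\mathsf{S}\cong 0$ and $\mathsf{S}=\{X\mid X\otimes F_\mathsf{S}\cong 0\}$. The smashing ideals form a set $\mathscr{S}(\mathsf{T})$ which, ordered by inclusion, is a frame: finite meets are intersections, joins are the localizing subcategories generated by unions, and finite meets distribute over arbitrary joins. A point of a frame $L$ is a frame map $p\colon L\to\{0\leq 1\}$; $\mathrm{Spec}(L)$ is the set of points with open sets $U_a=\{p\mid p(a)=1\}$, $a\in L$. $L$ is spatial if whenever $a\nleq b$ there is a point $p$ with $p(a)=1$, $p(b)=0$. $\mathrm{Spc}^{\mathrm{s}}(\mathsf{T})$ denotes $\mathrm{Spec}(\mathscr{S}(\mathsf{T}))$. A prime (= meet-prime) smashing ideal is a proper smashing ideal $\mathsf{P}$ such that for smashing ideals $\mathsf{S},\mathsf{R}$, $\mathsf{S}\cap\mathsf{R}\subseteq\mathsf{P}$ implies $\mathsf{S}\subseteq\mathsf{P}$ or $\mathsf{R}\subseteq\mathsf{P}$;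 it corresponds to the point $p$ with $p(\mathsf{S})=0$ iff $\mathsf{S}\subseteq\mathsf{P}$. In these terms the open subsets are $U_\mathsf{S}=\{\mathsf{P}\mid \mathsf{S}\nsubseteq\mathsf{P}\}$ for $\mathsf{S}\in\mathscr{S}(\mathsf{T})$. The smashing support of $X\in\mathsf{T}$ is $\mathrm{supp}^{\mathrm{s}}(X)=\{\mathsf{P}\in\mathrm{Spc}^{\mathrm{s}}(\mathsf{T})\mid X\notin\mathsf{P}\}$. The Balmer spectrum $\mathrm{Spc}(\mathsf{T}^c)$ is the set of prime thick tensor ideals of $\mathsf{T}^c$ (proper thick tensor ideals $\mathbf{p}$ such that $a\otimes b\in\mathbf{p}$ implies $a\in\mathbf{p}$ or $b\in\mathbf{p}$), with basis of closed sets the supports $\mathrm{supp}(t)=\{\mathbf{p}\mid t\notin\mathbf{p}\}$, $t\in\mathsf{T}^c$; it is a spectral space. For a spectral space $X$, the Hochster dual $X^\vee$ has the same points, and its open sets are generated by the closed subsets of $X$ with quasi-compact complement. *)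

theory Defs
  imports "HOL-Analysis.Abstract_Topology" "HOL-Algebra.Product_Groups"
    "HOL-Algebra.Free_Abelian_Groups"
begin

unbundle cardinal_syntax

section \<open>Categories\<close>

text \<open>
  Every element of \<open>'o\<close> is an object and every element of \<open>'m\<close> is an arrow with a definite source
  and target. Composition, addition and the other operations on arrows are total functions, but
  they are only constrained on arguments of matching type.
\<close>

record ('o, 'm) cat =
  src :: "'m \<Rightarrow> 'o"
  tgt :: "'m \<Rightarrow> 'o"
  idn :: "'o \<Rightarrow> 'm"
  cmp :: "'m \<Rightarrow> 'm \<Rightarrow> 'm"  (infixl \<open>\<cdot>\<index>\<close> 70)

definition Hom :: "('o, 'm, 'z) cat_scheme \<Rightarrow> 'o \<Rightarrow> 'o \<Rightarrow> 'm set" where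
  "Hom C X Y = {f. src C f = X \<and> tgt C f = Y}"

definition inverse_arrows :: "('o, 'm, 'z) cat_scheme \<Rightarrow> 'm \<Rightarrow> 'm \<Rightarrow> bool" where
  "inverse_arrows C f g \<longleftrightarrow>
     src C g = tgt C f \<and> tgt C g = src C f \<and>
     g \<cdot>\<^bsub>C\<^esub> f = idn C (src C f) \<and> f \<cdot>\<^bsub>C\<^esub> g = idn C (tgt C f)"

definition iso_arrow :: "('o, 'm, 'z) cat_scheme \<Rightarrow> 'm \<Rightarrow> bool" where
  "iso_arrow C f \<longleftrightarrow> (\<exists>g. inverse_arrows C f g)"

definition arrow_inv :: "('o, 'm, 'z) cat_scheme \<Rightarrow> 'm \<Rightarrow> 'm" where
  "arrow_inv C f = (THE g. inverse_arrows C f g)"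

definition isomorphic :: "('o, 'm, 'z) cat_scheme \<Rightarrow> 'o \<Rightarrow> 'o \<Rightarrow> bool" where
  "isomorphic C X Y \<longleftrightarrow> (\<exists>f \<in> Hom C X Y. iso_arrow C f)"

definition retract_of :: "('o, 'm, 'z) cat_scheme \<Rightarrow> 'o \<Rightarrow> 'o \<Rightarrow> bool" where
  "retract_of C X Y \<longleftrightarrow> (\<exists>i \<in> Hom C X Y. \<exists>r \<in> Hom C Y X. r \<cdot>\<^bsub>C\<^esub> i = idn C X)"

definition zero_object :: "('o, 'm, 'z) cat_scheme \<Rightarrow> 'o \<Rightarrow> bool" where
  "zero_object C Z \<longleftrightarrow> (\<forall>X. (\<exists>!f. f \<in> Hom C Z X) \<and> (\<exists>!f. f \<in> Hom C X Z))"

definition is_coproduct ::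
  "('o, 'm, 'z) cat_scheme \<Rightarrow> 'i set \<Rightarrow> ('i \<Rightarrow> 'o) \<Rightarrow> 'o \<Rightarrow> ('i \<Rightarrow> 'm) \<Rightarrow> bool" where
  "is_coproduct C I X S \<iota> \<longleftrightarrow>
     (\<forall>i \<in> I. \<iota> i \<in> Hom C (X i) S) \<and>
     (\<forall>Y f. (\<forall>i \<in> I. f i \<in> Hom C (X i) Y) \<longrightarrow>
        (\<exists>!h. h \<in> Hom C S Y \<and> (\<forall>i \<in> I. h \<cdot>\<^bsub>C\<^esub> \<iota> i = f i)))"

locale category =
  fixes C :: "('o, 'm, 'z) cat_scheme" (structure)
  assumes idn_Hom: "idn C X \<in> Hom C X X"
    and cmp_Hom: "\<lbrakk>f \<in> Hom C X Y; g \<in> Hom C Y Z\<rbrakk> \<Longrightarrow> g \<cdot> f \<in> Hom C X Z"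
    and cmp_idn: "f \<in> Hom C X Y \<Longrightarrow> f \<cdot> idn C X = f"
    and idn_cmp: "f \<in> Hom C X Y \<Longrightarrow> idn C Y \<cdot> f = f"
    and cmp_assoc: "\<lbrakk>f \<in> Hom C W X; g \<in> Hom C X Y; h \<in> Hom C Y Z\<rbrakk>
      \<Longrightarrow> h \<cdot> (g \<cdot> f) = (h \<cdot> g) \<cdot> f"

section \<open>Additive and triangulated categories\<close>

record ('o, 'm) precat = "('o, 'm) cat" +
  madd :: "'m \<Rightarrow> 'm \<Rightarrow> 'm"  (infixl \<open>\<uplus>\<index>\<close> 65)
  mzero :: "'o \<Rightarrow> 'o \<Rightarrow> 'm"

text \<open>The additive group of arrows, in the multiplicative vocabulary of \<^theory>\<open>HOL-Algebra.Group\<close>.\<close>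

definition hom_group :: "('o, 'm, 'z) precat_scheme \<Rightarrow> 'o \<Rightarrow> 'o \<Rightarrow> 'm monoid" where
  "hom_group C X Y = \<lparr>carrier = Hom C X Y, monoid.mult = madd C, one = mzero C X Y\<rparr>"

definition mneg :: "('o, 'm, 'z) precat_scheme \<Rightarrow> 'm \<Rightarrow> 'm" where
  "mneg C f = inv\<^bsub>hom_group C (src C f) (tgt C f)\<^esub> f"

locale additive_category = category C
  for C :: "('o, 'm, 'z) precat_scheme" (structure) +
  assumes hom_comm_group: "comm_group (hom_group C X Y)"
    and cmp_madd: "\<lbrakk>f \<in> Hom C X Y; f' \<in> Hom C X Y; g \<in> Hom C Y Z\<rbrakk>
      \<Longrightarrow> g \<cdot> (f \<uplus> f') = g \<cdot> f \<uplus> g \<cdot> f'"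
    and madd_cmp: "\<lbrakk>f \<in> Hom C X Y; g \<in> Hom C Y Z; g' \<in> Hom C Y Z\<rbrakk>
      \<Longrightarrow> (g \<uplus> g') \<cdot> f = g \<cdot> f \<uplus> g' \<cdot> f"
    and ex_zero_object: "\<exists>Z. zero_object C Z"
    and ex_binary_coproduct: "\<exists>S \<iota>. is_coproduct C (UNIV :: bool set) XX S \<iota>"

text \<open>
  The suspension is an autoequivalence (not necessarily an automorphism), acting as \<open>sobj\<close> on
  objects and as \<open>sarr\<close> on arrows. \<open>dtri f g h\<close> says that \<open>X \<rightarrow> Y \<rightarrow> Z \<rightarrow> \<Sigma>X\<close>, with arrows
  \<open>f\<close>, \<open>g\<close>, \<open>h\<close>, is a distinguished (exact) triangle. In \<open>octahedral\<close> the three given triangles are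
  \<open>X \<rightarrow> Y \<rightarrow> A\<close>, \<open>Y \<rightarrow> Z \<rightarrow> B\<close> and \<open>X \<rightarrow> Z \<rightarrow> D\<close> on \<open>f\<close>, \<open>g\<close> and \<open>g \<cdot> f\<close>.
\<close>

record ('o, 'm) tricat = "('o, 'm) precat" +
  sobj :: "'o \<Rightarrow> 'o"
  sarr :: "'m \<Rightarrow> 'm"
  dtri :: "'m \<Rightarrow> 'm \<Rightarrow> 'm \<Rightarrow> bool"

locale triangulated_category = additive_category C
  for C :: "('o, 'm, 'z) tricat_scheme" (structure) +
  assumes sarr_Hom: "f \<in> Hom C X Y \<Longrightarrow> sarr C f \<in> Hom C (sobj C X) (sobj C Y)"
    and sarr_idn: "sarr C (idn C X) = idn C (sobj C X)"
    and sarr_cmp: "\<lbrakk>f \<in> Hom C X Y; g \<in> Hom C Y Z\<rbrakk> \<Longrightarrow> sarr C (g \<cdot> f) = sarr C g \<cdot> sarr C f"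
    and sarr_madd: "\<lbrakk>f \<in> Hom C X Y; f' \<in> Hom C X Y\<rbrakk>
      \<Longrightarrow> sarr C (f \<uplus> f') = sarr C f \<uplus> sarr C f'"
    and sarr_bij: "bij_betw (sarr C) (Hom C X Y) (Hom C (sobj C X) (sobj C Y))"
    and sobj_ess_surj: "\<exists>X. isomorphic C (sobj C X) Y"
    and dtri_Hom: "dtri C f g h \<Longrightarrow>
      \<exists>X Y Z. f \<in> Hom C X Y \<and> g \<in> Hom C Y Z \<and> h \<in> Hom C Z (sobj C X)"
    and dtri_iso: "\<lbrakk>dtri C f g h;
        f \<in> Hom C X Y; g \<in> Hom C Y Z; h \<in> Hom C Z (sobj C X);
        f' \<in> Hom C X' Y'; g' \<in> Hom C Y' Z'; h' \<in> Hom C Z' (sobj C X');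
        u \<in> Hom C X X'; v \<in> Hom C Y Y'; w \<in> Hom C Z Z';
        iso_arrow C u; iso_arrow C v; iso_arrow C w;
        v \<cdot> f = f' \<cdot> u; w \<cdot> g = g' \<cdot> v; sarr C u \<cdot> h = h' \<cdot> w\<rbrakk>
      \<Longrightarrow> dtri C f' g' h'"
    and dtri_idn: "zero_object C Z
      \<Longrightarrow> dtri C (idn C X) (mzero C X Z) (mzero C Z (sobj C X))"
    and dtri_complete: "\<exists>g h. dtri C f g h"
    and dtri_rotate: "\<lbrakk>f \<in> Hom C X Y; g \<in> Hom C Y Z; h \<in> Hom C Z (sobj C X)\<rbrakk>
      \<Longrightarrow> dtri C f g h \<longleftrightarrow> dtri C g h (mneg C (sarr C f))"
    and dtri_morphism: "\<lbrakk>dtri C f g h; dtri C f' g' h';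
        u \<in> Hom C (src C f) (src C f'); v \<in> Hom C (tgt C f) (tgt C f'); v \<cdot> f = f' \<cdot> u\<rbrakk>
      \<Longrightarrow> \<exists>w \<in> Hom C (tgt C g) (tgt C g'). w \<cdot> g = g' \<cdot> v \<and> sarr C u \<cdot> h = h' \<cdot> w"
    and octahedral: "\<lbrakk>f \<in> Hom C X Y; g \<in> Hom C Y Z;
        dtri C f f' f''; dtri C g g' g''; dtri C (g \<cdot> f) h' h'';
        f' \<in> Hom C Y A; g' \<in> Hom C Z B; h' \<in> Hom C Z D\<rbrakk>
      \<Longrightarrow> \<exists>u \<in> Hom C A D. \<exists>v \<in> Hom C D B.
            dtri C u v (sarr C f' \<cdot> g'') \<and>
            u \<cdot> f' = h' \<cdot> g \<and> h'' \<cdot> u = f'' \<and> v \<cdot> h' = g' \<and> g'' \<cdot> v = sarr C f \<cdot> h''"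

text \<open>
  A full triangulated subcategory is given by its class of objects, which is always taken to be
  closed under isomorphism.
\<close>

definition triangulated_subcategory :: "('o, 'm, 'z) tricat_scheme \<Rightarrow> 'o set \<Rightarrow> bool" where
  "triangulated_subcategory C A \<longleftrightarrow>
     (\<forall>Z. zero_object C Z \<longrightarrow> Z \<in> A) \<and>
     (\<forall>X Y. X \<in> A \<and> isomorphic C X Y \<longrightarrow> Y \<in> A) \<and>
     (\<forall>X. sobj C X \<in> A \<longleftrightarrow> X \<in> A) \<and>
     (\<forall>f g h. dtri C f g h \<and> src C f \<in> A \<and> tgt C f \<in> A \<longrightarrow> tgt C g \<in> A)"

section \<open>Tensor triangulated categories\<close>

text \<open>
  \<open>tobj\<close> and \<open>tarr\<close> are the tensor product of objects and of arrows; \<open>assoc\<close>, \<open>lunit\<close>, \<open>runit\<close>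
  and \<open>braid\<close> are the structure isomorphisms, and \<open>tsusp X Y\<close> is the isomorphism
  \<open>\<Sigma>X \<otimes> Y \<rightarrow> \<Sigma>(X \<otimes> Y)\<close> expressing that the tensor product is exact.
\<close>

record ('o, 'm) ttcat = "('o, 'm) tricat" +
  tobj :: "'o \<Rightarrow> 'o \<Rightarrow> 'o"  (infixl \<open>\<star>\<index>\<close> 75)
  tarr :: "'m \<Rightarrow> 'm \<Rightarrow> 'm"  (infixl \<open>\<boxtimes>\<index>\<close> 75)
  tunit :: "'o"
  assoc :: "'o \<Rightarrow> 'o \<Rightarrow> 'o \<Rightarrow> 'm"
  lunit :: "'o \<Rightarrow> 'm"
  runit :: "'o \<Rightarrow> 'm"
  braid :: "'o \<Rightarrow> 'o \<Rightarrow> 'm"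
  tsusp :: "'o \<Rightarrow> 'o \<Rightarrow> 'm"

locale closed_symmetric_monoidal_category = category C
  for C :: "('o, 'm, 'z) ttcat_scheme" (structure) +
  assumes tarr_Hom: "\<lbrakk>f \<in> Hom C X X'; g \<in> Hom C Y Y'\<rbrakk> \<Longrightarrow> f \<boxtimes> g \<in> Hom C (X \<star> Y) (X' \<star> Y')"
    and tarr_idn: "idn C X \<boxtimes> idn C Y = idn C (X \<star> Y)"
    and tarr_cmp: "\<lbrakk>f \<in> Hom C X X'; f' \<in> Hom C X' X''; g \<in> Hom C Y Y'; g' \<in> Hom C Y' Y''\<rbrakk>
      \<Longrightarrow> (f' \<cdot> f) \<boxtimes> (g' \<cdot> g) = (f' \<boxtimes> g') \<cdot> (f \<boxtimes> g)"
    and assoc_Hom: "assoc C X Y Z \<in> Hom C ((X \<star> Y) \<star> Z) (X \<star> (Y \<star> Z))"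
    and assoc_iso: "iso_arrow C (assoc C X Y Z)"
    and assoc_natural: "\<lbrakk>f \<in> Hom C X X'; g \<in> Hom C Y Y'; h \<in> Hom C Z Z'\<rbrakk>
      \<Longrightarrow> assoc C X' Y' Z' \<cdot> ((f \<boxtimes> g) \<boxtimes> h) = (f \<boxtimes> (g \<boxtimes> h)) \<cdot> assoc C X Y Z"
    and lunit_Hom: "lunit C X \<in> Hom C (tunit C \<star> X) X"
    and lunit_iso: "iso_arrow C (lunit C X)"
    and lunit_natural: "f \<in> Hom C X X' \<Longrightarrow>
      lunit C X' \<cdot> (idn C (tunit C) \<boxtimes> f) = f \<cdot> lunit C X"
    and runit_Hom: "runit C X \<in> Hom C (X \<star> tunit C) X"
    and runit_iso: "iso_arrow C (runit C X)"
    and runit_natural: "f \<in> Hom C X X' \<Longrightarrow>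
      runit C X' \<cdot> (f \<boxtimes> idn C (tunit C)) = f \<cdot> runit C X"
    and braid_Hom: "braid C X Y \<in> Hom C (X \<star> Y) (Y \<star> X)"
    and braid_natural: "\<lbrakk>f \<in> Hom C X X'; g \<in> Hom C Y Y'\<rbrakk>
      \<Longrightarrow> braid C X' Y' \<cdot> (f \<boxtimes> g) = (g \<boxtimes> f) \<cdot> braid C X Y"
    and braid_symmetric: "braid C Y X \<cdot> braid C X Y = idn C (X \<star> Y)"
    and triangle: "(idn C X \<boxtimes> lunit C Y) \<cdot> assoc C X (tunit C) Y = runit C X \<boxtimes> idn C Y"
    and pentagon: "assoc C W X (Y \<star> Z) \<cdot> assoc C (W \<star> X) Y Z =
      (idn C W \<boxtimes> assoc C X Y Z) \<cdot> assoc C W (X \<star> Y) Z \<cdot> (assoc C W X Y \<boxtimes> idn C Z)"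
    and hexagon: "assoc C Y Z X \<cdot> braid C X (Y \<star> Z) \<cdot> assoc C X Y Z =
      (idn C Y \<boxtimes> braid C X Z) \<cdot> assoc C Y X Z \<cdot> (braid C X Y \<boxtimes> idn C Z)"
    and internal_hom: "\<exists>H. \<exists>ev \<in> Hom C (H \<star> X) Y. \<forall>Z. \<forall>f \<in> Hom C (Z \<star> X) Y.
      \<exists>!g. g \<in> Hom C Z H \<and> ev \<cdot> (g \<boxtimes> idn C X) = f"

text \<open>
  Compatibility of the tensor product with the triangulation means that it is an exact functor in
  each variable. Exactness is stated for the first variable; for the second it follows by symmetry.
\<close>

locale tt_category = triangulated_category C + closed_symmetric_monoidal_category C
  for C :: "('o, 'm, 'z) ttcat_scheme" (structure) +
  assumes tarr_madd_left: "\<lbrakk>f \<in> Hom C X X'; f' \<in> Hom C X X'; g \<in> Hom C Y Y'\<rbrakk>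
      \<Longrightarrow> (f \<uplus> f') \<boxtimes> g = (f \<boxtimes> g) \<uplus> (f' \<boxtimes> g)"
    and tarr_madd_right: "\<lbrakk>f \<in> Hom C X X'; g \<in> Hom C Y Y'; g' \<in> Hom C Y Y'\<rbrakk>
      \<Longrightarrow> f \<boxtimes> (g \<uplus> g') = (f \<boxtimes> g) \<uplus> (f \<boxtimes> g')"
    and tsusp_Hom: "tsusp C X Y \<in> Hom C (sobj C X \<star> Y) (sobj C (X \<star> Y))"
    and tsusp_iso: "iso_arrow C (tsusp C X Y)"
    and tsusp_natural: "\<lbrakk>f \<in> Hom C X X'; g \<in> Hom C Y Y'\<rbrakk>
      \<Longrightarrow> tsusp C X' Y' \<cdot> (sarr C f \<boxtimes> g) = sarr C (f \<boxtimes> g) \<cdot> tsusp C X Y"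
    and tarr_exact: "\<lbrakk>dtri C f g h; f \<in> Hom C X X'\<rbrakk>
      \<Longrightarrow> dtri C (f \<boxtimes> idn C Y) (g \<boxtimes> idn C Y) (tsusp C X Y \<cdot> (h \<boxtimes> idn C Y))"

definition rigid :: "('o, 'm, 'z) ttcat_scheme \<Rightarrow> 'o \<Rightarrow> bool" where
  "rigid C X \<longleftrightarrow>
     (\<exists>D. \<exists>ev \<in> Hom C (D \<star>\<^bsub>C\<^esub> X) (tunit C). \<exists>coev \<in> Hom C (tunit C) (X \<star>\<^bsub>C\<^esub> D).
        runit C X \<cdot>\<^bsub>C\<^esub> (idn C X \<boxtimes>\<^bsub>C\<^esub> ev) \<cdot>\<^bsub>C\<^esub> assoc C X D X \<cdot>\<^bsub>C\<^esub> (coev \<boxtimes>\<^bsub>C\<^esub> idn C X)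
          = lunit C X \<and>
        lunit C D \<cdot>\<^bsub>C\<^esub> (ev \<boxtimes>\<^bsub>C\<^esub> idn C D) \<cdot>\<^bsub>C\<^esub> arrow_inv C (assoc C D X D)
            \<cdot>\<^bsub>C\<^esub> (idn C D \<boxtimes>\<^bsub>C\<^esub> coev)
          = runit C D)"

section \<open>Big tt-categories\<close>

text \<open>
  Smallness is measured by a set-theoretic universe that is part of the data: \<open>univ\<close> is a set of
  inaccessible cardinality, and a set is small if its cardinality is smaller. Small families are
  indexed by small subsets of \<open>univ\<close>, which represent all small sets up to bijection.
\<close>

record ('o, 'm, 'u) big_ttcat = "('o, 'm) ttcat" +
  univ :: "'u set"

definition inaccessible :: "'u set \<Rightarrow> bool" where
  "inaccessible U \<longleftrightarrow>
     |UNIV :: nat set| <o |U| \<and> regularCard |U| \<and> (\<forall>A \<subseteq> U. |A| <o |U| \<longrightarrow> |Pow A| <o |U| )"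

definition small :: "('o, 'm, 'u, 'z) big_ttcat_scheme \<Rightarrow> 'a set \<Rightarrow> bool" where
  "small T A \<longleftrightarrow> |A| <o |univ T|"

definition small_index :: "('o, 'm, 'u, 'z) big_ttcat_scheme \<Rightarrow> 'u set \<Rightarrow> bool" where
  "small_index T I \<longleftrightarrow> I \<subseteq> univ T \<and> small T I"

text \<open>
  \<open>c\<close> is compact if \<open>Hom(c, -)\<close> preserves small coproducts. The map below is the canonical one from
  the direct sum of the groups \<open>Hom(c, X i)\<close>: \<^const>\<open>sum_group\<close> consists of the families with
  finite support, and \<^const>\<open>gfinprod\<close> is the finite sum, written multiplicatively.
\<close>

definition compact_object :: "('o, 'm, 'u, 'z) big_ttcat_scheme \<Rightarrow> 'o \<Rightarrow> bool" where
  "compact_object T c \<longleftrightarrow>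
     (\<forall>I X S \<iota>. small_index T I \<and> is_coproduct T I X S \<iota> \<longrightarrow>
        (\<lambda>x. gfinprod (hom_group T c S) (\<lambda>i. \<iota> i \<cdot>\<^bsub>T\<^esub> x i) I)
          \<in> iso (sum_group I (\<lambda>i. hom_group T c (X i))) (hom_group T c S))"

definition compacts :: "('o, 'm, 'u, 'z) big_ttcat_scheme \<Rightarrow> 'o set" where
  "compacts T = {c. compact_object T c}"

definition localizing_subcategory :: "('o, 'm, 'u, 'z) big_ttcat_scheme \<Rightarrow> 'o set \<Rightarrow> bool" where
  "localizing_subcategory T L \<longleftrightarrow>
     triangulated_subcategory T L \<and>
     (\<forall>I X S \<iota>. small_index T I \<and> is_coproduct T I X S \<iota> \<and> (\<forall>i \<in> I. X i \<in> L) \<longrightarrow> S \<in> L)"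

definition generated_localizing :: "('o, 'm, 'u, 'z) big_ttcat_scheme \<Rightarrow> 'o set \<Rightarrow> 'o set" where
  "generated_localizing T A = \<Inter>{L. localizing_subcategory T L \<and> A \<subseteq> L}"

locale big_tt_category = tt_category T
  for T :: "('o, 'm, 'u, 'z) big_ttcat_scheme" (structure) +
  assumes univ_inaccessible: "inaccessible (univ T)"
    and locally_small: "small T (Hom T X Y)"
    and ex_coproduct: "small_index T I \<Longrightarrow> \<exists>S \<iota>. is_coproduct T I XX S \<iota>"
    and compact_iff_rigid: "compact_object T c \<longleftrightarrow> rigid T c"
    and compacts_essentially_small:
      "\<exists>R \<subseteq> compacts T. small T R \<and> (\<forall>c \<in> compacts T. \<exists>r \<in> R. isomorphic T c r)"
    and compacts_generate: "generated_localizing T (compacts T) = UNIV"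

section \<open>Frames and their points\<close>

text \<open>
  A frame is given as a set \<open>L\<close> of elements of an ordered type with the induced order; its meets
  and joins are the greatest lower and least upper bounds within \<open>L\<close>. A point is a map from \<open>L\<close>
  to \<^typ>\<open>bool\<close>, ordered by \<^prop>\<open>False \<le> True\<close>, that preserves finite meets and arbitrary joins,
  in particular the top and bottom elements.
\<close>

definition lub_in :: "'a::order set \<Rightarrow> 'a set \<Rightarrow> 'a \<Rightarrow> bool" where
  "lub_in L A j \<longleftrightarrow> j \<in> L \<and> (\<forall>a \<in> A. a \<le> j) \<and> (\<forall>b \<in> L. (\<forall>a \<in> A. a \<le> b) \<longrightarrow> j \<le> b)"

definition glb_in :: "'a::order set \<Rightarrow> 'a set \<Rightarrow> 'a \<Rightarrow> bool" where
  "glb_in L A m \<longleftrightarrow> m \<in> L \<and> (\<forall>a \<in> A. m \<le> a) \<and> (\<forall>b \<in> L. (\<forall>a \<in> A. b \<le> a) \<longrightarrow> b \<le> m)"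

definition frame_point :: "'a::order set \<Rightarrow> ('a \<Rightarrow> bool) \<Rightarrow> bool" where
  "frame_point L p \<longleftrightarrow>
     p \<in> extensional L \<and>
     (\<forall>A m. A \<subseteq> L \<and> finite A \<and> glb_in L A m \<longrightarrow> p m = (\<forall>a \<in> A. p a)) \<and>
     (\<forall>A j. A \<subseteq> L \<and> lub_in L A j \<longrightarrow> p j = (\<exists>a \<in> A. p a))"

text \<open>
  For a frame \<open>L\<close> the generating sets are already closed under finite intersections and arbitrary
  unions, so they are all the open sets; likewise for \<open>smashing_spectrum\<close> below.
\<close>

definition frame_spectrum :: "'a::order set \<Rightarrow> ('a \<Rightarrow> bool) topology" where
  "frame_spectrum L = topology_generated_by {{p. frame_point L p \<and> p a} | a. a \<in> L}"

definition spatial :: "'a::order set \<Rightarrow> bool" where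
  "spatial L \<longleftrightarrow> (\<forall>a \<in> L. \<forall>b \<in> L. \<not> a \<le> b \<longrightarrow> (\<exists>p. frame_point L p \<and> p a \<and> \<not> p b))"

section \<open>Topology\<close>

definition irreducible_closed :: "'a topology \<Rightarrow> 'a set \<Rightarrow> bool" where
  "irreducible_closed X C \<longleftrightarrow>
     closedin X C \<and> C \<noteq> {} \<and>
     (\<forall>A B. closedin X A \<and> closedin X B \<and> C \<subseteq> A \<union> B \<longrightarrow> C \<subseteq> A \<or> C \<subseteq> B)"

definition sober :: "'a topology \<Rightarrow> bool" where
  "sober X \<longleftrightarrow>
     (\<forall>C. irreducible_closed X C \<longrightarrow> (\<exists>!x. x \<in> topspace X \<and> X closure_of {x} = C))"

definition hochster_dual :: "'a topology \<Rightarrow> 'a topology" where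
  "hochster_dual X =
     topology_generated_by {C. closedin X C \<and> compactin X (topspace X - C)}"

section \<open>Smashing ideals\<close>

definition localizing_ideal :: "('o, 'm, 'u, 'z) big_ttcat_scheme \<Rightarrow> 'o set \<Rightarrow> bool" where
  "localizing_ideal T L \<longleftrightarrow>
     localizing_subcategory T L \<and> (\<forall>X \<in> L. \<forall>Y. X \<star>\<^bsub>T\<^esub> Y \<in> L)"

definition smashing_ideal :: "('o, 'm, 'u, 'z) big_ttcat_scheme \<Rightarrow> 'o set \<Rightarrow> bool" where
  "smashing_ideal T S \<longleftrightarrow>
     localizing_ideal T S \<and>
     (\<exists>E F. \<exists>e \<in> Hom T E (tunit T). \<exists>f \<in> Hom T (tunit T) F. \<exists>d \<in> Hom T F (sobj T E).
        dtri T e f d \<and> zero_object T (E \<star>\<^bsub>T\<^esub> F) \<and>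
        S = {X. zero_object T (X \<star>\<^bsub>T\<^esub> F)})"

definition smashing_frame :: "('o, 'm, 'u, 'z) big_ttcat_scheme \<Rightarrow> 'o set set" where
  "smashing_frame T = {S. smashing_ideal T S}"

definition prime_smashing_ideal :: "('o, 'm, 'u, 'z) big_ttcat_scheme \<Rightarrow> 'o set \<Rightarrow> bool" where
  "prime_smashing_ideal T P \<longleftrightarrow>
     smashing_ideal T P \<and> P \<noteq> UNIV \<and>
     (\<forall>S R. smashing_ideal T S \<and> smashing_ideal T R \<and> S \<inter> R \<subseteq> P \<longrightarrow> S \<subseteq> P \<or> R \<subseteq> P)"

definition smashing_open :: "('o, 'm, 'u, 'z) big_ttcat_scheme \<Rightarrow> 'o set \<Rightarrow> 'o set set" where
  "smashing_open T S = {P. prime_smashing_ideal T P \<and> \<not> S \<subseteq> P}"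

definition smashing_spectrum :: "('o, 'm, 'u, 'z) big_ttcat_scheme \<Rightarrow> 'o set topology" where
  "smashing_spectrum T = topology_generated_by (smashing_open T ` smashing_frame T)"

text \<open>The frame map to \<^typ>\<open>bool\<close> corresponding to a prime smashing ideal.\<close>

definition point_of_prime ::
  "('o, 'm, 'u, 'z) big_ttcat_scheme \<Rightarrow> 'o set \<Rightarrow> 'o set \<Rightarrow> bool" where
  "point_of_prime T P = restrict (\<lambda>S. \<not> S \<subseteq> P) (smashing_frame T)"

definition smashing_support :: "('o, 'm, 'u, 'z) big_ttcat_scheme \<Rightarrow> 'o \<Rightarrow> 'o set set" where
  "smashing_support T X = {P. prime_smashing_ideal T P \<and> X \<notin> P}"

definition telescope_conjecture :: "('o, 'm, 'u, 'z) big_ttcat_scheme \<Rightarrow> bool" where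
  "telescope_conjecture T \<longleftrightarrow>
     (\<forall>S. smashing_ideal T S \<longrightarrow> (\<exists>A \<subseteq> compacts T. S = generated_localizing T A))"

section \<open>The Balmer spectrum of the compact objects\<close>

text \<open>
  Subcategories of the compact objects are sets of objects contained in \<^term>\<open>compacts T\<close>. As the
  compact objects are closed under retracts, suspensions and cones in the ambient category, the
  closure conditions can be stated there.
\<close>

definition thick_tensor_ideal :: "('o, 'm, 'u, 'z) big_ttcat_scheme \<Rightarrow> 'o set \<Rightarrow> bool" where
  "thick_tensor_ideal T J \<longleftrightarrow>
     J \<subseteq> compacts T \<and> triangulated_subcategory T J \<and>
     (\<forall>X \<in> J. \<forall>Y. retract_of T Y X \<longrightarrow> Y \<in> J) \<and>
     (\<forall>a \<in> J. \<forall>b \<in> compacts T. a \<star>\<^bsub>T\<^esub> b \<in> J)"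

definition prime_thick_ideal :: "('o, 'm, 'u, 'z) big_ttcat_scheme \<Rightarrow> 'o set \<Rightarrow> bool" where
  "prime_thick_ideal T J \<longleftrightarrow>
     thick_tensor_ideal T J \<and> J \<noteq> compacts T \<and>
     (\<forall>a \<in> compacts T. \<forall>b \<in> compacts T. a \<star>\<^bsub>T\<^esub> b \<in> J \<longrightarrow> a \<in> J \<or> b \<in> J)"

definition supp :: "('o, 'm, 'u, 'z) big_ttcat_scheme \<Rightarrow> 'o \<Rightarrow> 'o set set" where
  "supp T t = {J. prime_thick_ideal T J \<and> t \<notin> J}"

definition balmer_spectrum :: "('o, 'm, 'u, 'z) big_ttcat_scheme \<Rightarrow> 'o set topology" where
  "balmer_spectrum T =
     topology_generated_by {{J. prime_thick_ideal T J} - supp T t | t. t \<in> compacts T}"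

definition psi :: "('o, 'm, 'u, 'z) big_ttcat_scheme \<Rightarrow> 'o set \<Rightarrow> 'o set" where
  "psi T S = S \<inter> compacts T"

end

theory Submission
  imports Defs
begin

text \<open>
  The one construction behind everything is this. Given a small family of maps \<open>a i : A i \<rightarrow> \<one>\<close> and
  objects \<open>B i\<close> such that \<open>a i \<otimes> B i\<close> is a split epimorphism, let \<open>u : \<one> \<rightarrow> U\<close> be the cone of
  \<open>\<Oplus> A i \<rightarrow> \<one>\<close> and let \<open>F\<close> be the telescope of \<open>\<one> \<rightarrow> U \<rightarrow> U \<otimes> U \<rightarrow> \<dots>\<close>. Then \<open>u \<otimes> B i = 0\<close>, so
  \<open>F \<otimes> B i = 0\<close>, whereas \<open>u \<otimes> Y\<close> and hence \<open>Y \<rightarrow> F \<otimes> Y\<close> is invertible if \<open>A i \<otimes> Y = 0\<close> for all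
  \<open>i\<close>. The kernel of \<open>F\<close> is therefore the smallest smashing ideal containing all \<open>B i\<close>. With
  \<open>A i = B i = E\<close> for smashing ideals this yields joins and binary meets in the frame, with
  \<open>A = c\<^sup>\<or> \<otimes> c\<close>, \<open>B = c\<close> for compact \<open>c\<close> it yields finite localization, without Brown representability.

  Joins of arbitrary families require that the smashing ideals form a small set. Following Krause,
  a smashing ideal is determined by the maps between compact objects that factor through it; this
  rests on \<open>Hom(c, - \<otimes> F)\<close> being the left Kan extension of its restriction to compact objects.

  The points of the frame are then the prime smashing ideals. As \<open>\<psi>\<close> pulls \<open>supp t\<close> back to the
  open set of the smashing ideal generated by \<open>t\<close>, and as the open sets of the Hochster dual are the
  unions of the \<open>supp t\<close>, the map \<open>\<psi>\<close> is a homeomorphism only if all smashing ideals are generated by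
  compact objects. The converse uses that a thick tensor ideal \<open>p\<close> consists of all compact objects of
  the localizing subcategory generated by \<open>p\<close>.
\<close>

section \<open>Categories\<close>

text \<open>The obstacle throughout is that cones and telescopes are not functorial. Weak kernels
  and cokernels of single triangles replace long exact sequences, coproducts of triangles are
  compared with a chosen cone by hand, and membership of E in a localizing ideal is seen by
  comparing the telescope with a constant one through two octahedra.

  That the kernel of F is minimal rests on a Galois connection: if every B i kills Y, then Y is
  isomorphic to F tensor Y, so whatever is killed by F also kills Y. Smashing ideals are therefore
  handled as double orthogonals \<open>bhull A\<close>.

  Compactness is given by direct sums of Hom groups; the arguments use an equivalent condition, that
  a map from a compact object into a coproduct is supported on finitely many summands.

  Spatiality enters through one fact: if U_S is contained in U_R, then S is contained in R. The
  topological input on the other side is that the complement of supp t is quasi-compact in the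
  Balmer spectrum. This comes from a prime avoidance argument and makes the sets supp t exactly the
  generating open sets of the Hochster dual.\<close>

lemma Hom_iff [simp]: "f \<in> Hom C X Y \<longleftrightarrow> src C f = X \<and> tgt C f = Y"
  by (simp add: Hom_def)

context category
begin

lemma idn_ends [simp]: "src C (idn C X) = X" "tgt C (idn C X) = X"
  using idn_Hom[of X] by auto

text \<open>Typing is expressed by equations on \<open>src\<close> and \<open>tgt\<close> instead of
  membership in \<open>Hom\<close>, so that the side condition of every composition law is an
  equation the simplifier can discharge.\<close>

lemma cmp_ends [simp]:
  assumes "tgt C f = src C g"
  shows "src C (g \<cdot> f) = src C f" "tgt C (g \<cdot> f) = tgt C g"
  using cmp_Hom[of f "src C f" "src C g" g "tgt C g"] assms by auto

lemma cmp_idn_src [simp]: "src C f = X \<Longrightarrow> f \<cdot> idn C X = f"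
  using cmp_idn[of f X "tgt C f"] by auto

lemma idn_tgt_cmp [simp]: "tgt C f = X \<Longrightarrow> idn C X \<cdot> f = f"
  using idn_cmp[of f "src C f" X] by auto

lemma cmp_assoc_right [simp]:
  "\<lbrakk>tgt C f = src C g; tgt C g = src C h\<rbrakk> \<Longrightarrow> (h \<cdot> g) \<cdot> f = h \<cdot> (g \<cdot> f)"
  using cmp_assoc[of f "src C f" "src C g" g "src C h" h "tgt C h"] by auto

text \<open>Composites are normalized to the right, so an equation \<open>g \<cdot> f = k\<close> is
  hidden as soon as something is composed on the right. This is the form in which such an equation
  still rewrites.\<close>

lemma cmp_reassoc:
  "\<lbrakk>g \<cdot> f = k; tgt C f = src C g; tgt C x = src C f\<rbrakk> \<Longrightarrow> g \<cdot> (f \<cdot> x) = k \<cdot> x"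
  using cmp_assoc_right[of x f g] by simp

lemma iso_arrowE:
  assumes "iso_arrow C f"
  obtains g where "src C g = tgt C f" "tgt C g = src C f"
    "g \<cdot> f = idn C (src C f)" "f \<cdot> g = idn C (tgt C f)" "iso_arrow C g"
  using assms unfolding iso_arrow_def inverse_arrows_def by metis

lemma iso_arrowI:
  "\<lbrakk>src C g = tgt C f; tgt C g = src C f; g \<cdot> f = idn C (src C f); f \<cdot> g = idn C (tgt C f)\<rbrakk>
    \<Longrightarrow> iso_arrow C f"
  unfolding iso_arrow_def inverse_arrows_def by blast

text \<open>Inverses are unique, by
  \<open>k = k \<cdot> (f \<cdot> g) = (k \<cdot> f) \<cdot> g = g\<close>; this gives the definite
  description behind \<open>arrow_inv\<close> its meaning.\<close>

lemma arrow_inv: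
  assumes "iso_arrow C f"
  shows "src C (arrow_inv C f) = tgt C f" "tgt C (arrow_inv C f) = src C f"
    "arrow_inv C f \<cdot> f = idn C (src C f)" "f \<cdot> arrow_inv C f = idn C (tgt C f)"
proof -
  obtain g where g: "inverse_arrows C f g"
    using assms by (auto simp: iso_arrow_def)
  have "arrow_inv C f = g"
    unfolding arrow_inv_def
  proof (rule the_equality)
    show "inverse_arrows C f g" by (rule g)
    fix k assume k: "inverse_arrows C f k"
    have "k = k \<cdot> (f \<cdot> g)"
      using g k by (simp add: inverse_arrows_def)
    also have "\<dots> = (k \<cdot> f) \<cdot> g"
      using g k unfolding inverse_arrows_def by (subst cmp_assoc_right) auto
    also have "\<dots> = g"
      using g k by (simp add: inverse_arrows_def)
    finally show "k = g" .
  qed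
  then show "src C (arrow_inv C f) = tgt C f" "tgt C (arrow_inv C f) = src C f"
    "arrow_inv C f \<cdot> f = idn C (src C f)" "f \<cdot> arrow_inv C f = idn C (tgt C f)"
    using g by (auto simp: inverse_arrows_def)
qed

lemma iso_arrow_inv: "iso_arrow C f \<Longrightarrow> iso_arrow C (arrow_inv C f)"
  using arrow_inv[of f] by (intro iso_arrowI[of f]) auto

lemma iso_idn [simp]: "iso_arrow C (idn C X)"
  by (rule iso_arrowI[of "idn C X"]) auto

lemma iso_cmp:
  assumes "iso_arrow C f" "iso_arrow C g" "tgt C f = src C g"
  shows "iso_arrow C (g \<cdot> f)"
proof -
  obtain f' where f': "src C f' = tgt C f" "tgt C f' = src C f"
    "f' \<cdot> f = idn C (src C f)" "f \<cdot> f' = idn C (tgt C f)"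
    using assms(1) by (rule iso_arrowE)
  obtain g' where g': "src C g' = tgt C g" "tgt C g' = src C g"
    "g' \<cdot> g = idn C (src C g)" "g \<cdot> g' = idn C (tgt C g)"
    using assms(2) by (rule iso_arrowE)
  show ?thesis
    using assms(3) f' g'
    by (intro iso_arrowI[of "f' \<cdot> g'"]) (simp_all add: cmp_reassoc[OF g'(3)] cmp_reassoc[OF f'(4)])
qed


lemma iso_cancel_left:
  assumes "iso_arrow C h" "h \<cdot> f = h \<cdot> g" "tgt C f = src C h" "tgt C g = src C h"
  shows "f = g"
proof -
  obtain k where k: "src C k = tgt C h" "tgt C k = src C h" "k \<cdot> h = idn C (src C h)"
    using assms(1) by (rule iso_arrowE)
  have "f = k \<cdot> (h \<cdot> f)" "g = k \<cdot> (h \<cdot> g)"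
    using assms(3,4) k by (simp_all add: cmp_reassoc[OF k(3)])
  with assms(2) show ?thesis by simp
qed

lemma iso_cancel_right:
  assumes "iso_arrow C h" "f \<cdot> h = g \<cdot> h" "src C f = tgt C h" "src C g = tgt C h"
  shows "f = g"
proof -
  obtain k where k: "src C k = tgt C h" "tgt C k = src C h" "h \<cdot> k = idn C (tgt C h)"
    using assms(1) by (rule iso_arrowE)
  have "f = (f \<cdot> h) \<cdot> k" "g = (g \<cdot> h) \<cdot> k"
    using assms(3,4) k by simp_all
  with assms(2) show ?thesis by simp
qed

lemma iso_cmp_cancel_left:
  assumes "iso_arrow C (g \<cdot> f)" "iso_arrow C g" "tgt C f = src C g"
  shows "iso_arrow C f"
proof -
  obtain k where k: "src C k = tgt C g" "tgt C k = src C g" "k \<cdot> g = idn C (src C g)" "iso_arrow C k"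
    using assms(2) by (rule iso_arrowE)
  have "f = k \<cdot> (g \<cdot> f)"
    using assms k by (simp add: cmp_reassoc[OF k(3)])
  then show ?thesis
    using iso_cmp[OF assms(1) k(4)] assms k by simp
qed

lemma iso_cmp_cancel_right:
  assumes "iso_arrow C (g \<cdot> f)" "iso_arrow C f" "tgt C f = src C g"
  shows "iso_arrow C g"
proof -
  obtain k where k: "src C k = tgt C f" "tgt C k = src C f" "f \<cdot> k = idn C (tgt C f)" "iso_arrow C k"
    using assms(2) by (rule iso_arrowE)
  have "g = (g \<cdot> f) \<cdot> k"
    using assms k by simp
  then show ?thesis
    using iso_cmp[OF k(4) assms(1)] assms k by simp
qed

lemma isomorphicI: "iso_arrow C f \<Longrightarrow> src C f = X \<Longrightarrow> tgt C f = Y \<Longrightarrow> isomorphic C X Y"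
  by (auto simp: isomorphic_def)

lemma isomorphicE:
  assumes "isomorphic C X Y"
  obtains f where "iso_arrow C f" "src C f = X" "tgt C f = Y"
  using assms by (auto simp: isomorphic_def)

lemma isomorphic_refl [simp]: "isomorphic C X X"
  by (rule isomorphicI[of "idn C X"]) auto

lemma isomorphic_sym: "isomorphic C X Y \<Longrightarrow> isomorphic C Y X"
  by (metis iso_arrowE isomorphicE isomorphicI)

lemma isomorphic_trans [trans]: "isomorphic C X Y \<Longrightarrow> isomorphic C Y Z \<Longrightarrow> isomorphic C X Z"
  by (metis cmp_ends iso_cmp isomorphicE isomorphicI)

lemma retract_ofI:
  "\<lbrakk>src C i = X; tgt C i = Y; src C r = Y; tgt C r = X; r \<cdot> i = idn C X\<rbrakk> \<Longrightarrow> retract_of C X Y"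
  unfolding retract_of_def Hom_iff by (metis (mono_tags, lifting) Hom_iff)

lemma retract_ofE:
  assumes "retract_of C X Y"
  obtains i r where "src C i = X" "tgt C i = Y" "src C r = Y" "tgt C r = X" "r \<cdot> i = idn C X"
  using assms by (auto simp: retract_of_def)

lemma isomorphic_retract: "isomorphic C X Y \<Longrightarrow> retract_of C X Y"
  by (metis isomorphicE iso_arrowE retract_ofI)

section \<open>Coproducts: the universal property split into existence and uniqueness\<close>

lemma coproduct_inj: "is_coproduct C I X S \<iota> \<Longrightarrow> i \<in> I \<Longrightarrow> src C (\<iota> i) = X i \<and> tgt C (\<iota> i) = S"
  by (auto simp: is_coproduct_def)

lemma coproduct_ex1:
  assumes "is_coproduct C I X S \<iota>" "\<And>i. i \<in> I \<Longrightarrow> src C (f i) = X i \<and> tgt C (f i) = Y"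
  shows "\<exists>!h. (src C h = S \<and> tgt C h = Y) \<and> (\<forall>i \<in> I. h \<cdot> \<iota> i = f i)"
proof -
  have "\<forall>Y f. (\<forall>i \<in> I. f i \<in> Hom C (X i) Y) \<longrightarrow>
        (\<exists>!h. h \<in> Hom C S Y \<and> (\<forall>i \<in> I. h \<cdot> \<iota> i = f i))"
    using assms(1)[unfolded is_coproduct_def] by (rule conjunct2)
  from this[THEN spec, THEN spec, of f Y] show ?thesis
    using assms(2) by (simp only: Hom_iff) simp
qed

lemma coproduct_desc:
  assumes "is_coproduct C I X S \<iota>" "\<And>i. i \<in> I \<Longrightarrow> src C (f i) = X i \<and> tgt C (f i) = Y"
  obtains h where "src C h = S" "tgt C h = Y" "\<And>i. i \<in> I \<Longrightarrow> h \<cdot> \<iota> i = f i"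
proof -
  from coproduct_ex1[of I X S \<iota> f Y] assms
  have "\<exists>h. (src C h = S \<and> tgt C h = Y) \<and> (\<forall>i \<in> I. h \<cdot> \<iota> i = f i)"
    by (simp add: ex1_implies_ex)
  with that show thesis by blast
qed

lemma coproduct_ext:
  assumes "is_coproduct C I X S \<iota>" "src C h = S" "src C k = S" "tgt C h = tgt C k"
    "\<And>i. i \<in> I \<Longrightarrow> h \<cdot> \<iota> i = k \<cdot> \<iota> i"
  shows "h = k"
proof -
  have "\<exists>!h. (src C h = S \<and> tgt C h = tgt C k) \<and> (\<forall>i \<in> I. h \<cdot> \<iota> i = k \<cdot> \<iota> i)"
    using assms coproduct_inj[OF assms(1)] by (intro coproduct_ex1[OF assms(1)]) auto
  then show ?thesis
    by (rule ex1E) (use assms(2-) in metis)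
qed

lemma is_coproductI:
  assumes "\<And>i. i \<in> I \<Longrightarrow> src C (\<iota> i) = X i \<and> tgt C (\<iota> i) = S"
    and "\<And>Y f. (\<And>i. i \<in> I \<Longrightarrow> src C (f i) = X i \<and> tgt C (f i) = Y)
      \<Longrightarrow> \<exists>h. src C h = S \<and> tgt C h = Y \<and> (\<forall>i \<in> I. h \<cdot> \<iota> i = f i)"
    and "\<And>h k. \<lbrakk>src C h = S; src C k = S; tgt C h = tgt C k; \<And>i. i \<in> I \<Longrightarrow> h \<cdot> \<iota> i = k \<cdot> \<iota> i\<rbrakk> \<Longrightarrow> h = k"
  shows "is_coproduct C I X S \<iota>"
  unfolding is_coproduct_def
proof (intro conjI ballI allI impI)
  fix Y f assume "\<forall>i \<in> I. f i \<in> Hom C (X i) Y"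
  then obtain h where h: "src C h = S \<and> tgt C h = Y \<and> (\<forall>i \<in> I. h \<cdot> \<iota> i = f i)"
    using assms(2)[of f Y] by auto
  show "\<exists>!h. h \<in> Hom C S Y \<and> (\<forall>i \<in> I. h \<cdot> \<iota> i = f i)"
  proof (rule ex1I[of _ h])
    show "h \<in> Hom C S Y \<and> (\<forall>i \<in> I. h \<cdot> \<iota> i = f i)" using h by auto
    fix k assume "k \<in> Hom C S Y \<and> (\<forall>i \<in> I. k \<cdot> \<iota> i = f i)"
    with h show "k = h" using assms(3)[of k h] by auto
  qed
qed (use assms(1) in auto)

lemma coproduct_reindex:
  assumes "is_coproduct C I X S \<iota>" "bij_betw \<phi> J I"
  shows "is_coproduct C J (X \<circ> \<phi>) S (\<iota> \<circ> \<phi>)"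
proof (rule is_coproductI)
  have \<phi>: "\<And>j. j \<in> J \<Longrightarrow> \<phi> j \<in> I" using assms(2) by (auto simp: bij_betw_def)
  show "\<And>j. j \<in> J \<Longrightarrow> src C ((\<iota> \<circ> \<phi>) j) = (X \<circ> \<phi>) j \<and> tgt C ((\<iota> \<circ> \<phi>) j) = S"
    using coproduct_inj[OF assms(1)] \<phi> by auto
  fix Y f assume f: "\<And>j. j \<in> J \<Longrightarrow> src C (f j) = (X \<circ> \<phi>) j \<and> tgt C (f j) = Y"
  have inv: "\<And>i. i \<in> I \<Longrightarrow> inv_into J \<phi> i \<in> J \<and> \<phi> (inv_into J \<phi> i) = i"
    using assms(2) by (auto simp: bij_betw_def inv_into_into f_inv_into_f)
  have "\<And>i. i \<in> I \<Longrightarrow> src C (f (inv_into J \<phi> i)) = X i \<and> tgt C (f (inv_into J \<phi> i)) = Y"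
    using f inv by simp
  then obtain h where h: "src C h = S" "tgt C h = Y" "\<And>i. i \<in> I \<Longrightarrow> h \<cdot> \<iota> i = f (inv_into J \<phi> i)"
    using coproduct_desc[OF assms(1), of "\<lambda>i. f (inv_into J \<phi> i)" Y thesis] by blast
  have "\<forall>j \<in> J. h \<cdot> (\<iota> \<circ> \<phi>) j = f j"
    using h \<phi> assms(2) by (auto simp: bij_betw_def)
  with h show "\<exists>h. src C h = S \<and> tgt C h = Y \<and> (\<forall>j \<in> J. h \<cdot> (\<iota> \<circ> \<phi>) j = f j)" by auto
next
  fix h k assume "src C h = S" "src C k = S" "tgt C h = tgt C k"
    "\<And>j. j \<in> J \<Longrightarrow> h \<cdot> (\<iota> \<circ> \<phi>) j = k \<cdot> (\<iota> \<circ> \<phi>) j"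
  then show "h = k"
    using assms(2) by - (rule coproduct_ext[OF assms(1)], auto simp: bij_betw_def)
qed


end

section \<open>Additive categories\<close>

context additive_category
begin

lemma hom_group_simps [simp]:
  "carrier (hom_group C X Y) = Hom C X Y" "monoid.mult (hom_group C X Y) = madd C"
  "one (hom_group C X Y) = mzero C X Y"
  by (simp_all add: hom_group_def)

lemma hom_group_axioms: "group (hom_group C X Y)" "comm_monoid (hom_group C X Y)"
  using hom_comm_group[of X Y] by (auto simp: comm_group_def)

lemma mzero_ends [simp]: "src C (mzero C X Y) = X" "tgt C (mzero C X Y) = Y"
  using comm_groupE(2)[OF hom_comm_group[of X Y]] by (simp_all only: hom_group_simps Hom_iff)

lemma madd_ends [simp]:
  assumes "src C f = src C g" "tgt C f = tgt C g"
  shows "src C (f \<uplus> g) = src C g" "tgt C (f \<uplus> g) = tgt C g"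
  using comm_groupE(1)[OF hom_comm_group[of "src C g" "tgt C g"], of f g] assms
  by (simp_all only: hom_group_simps Hom_iff)

lemma mneg_ends [simp]: "src C (mneg C f) = src C f" "tgt C (mneg C f) = tgt C f"
  using group.inv_closed[OF hom_group_axioms(1), of f "src C f" "tgt C f"]
  by (simp_all only: hom_group_simps Hom_iff mneg_def)

lemma madd_assoc:
  assumes "src C f = src C g" "src C g = src C h" "tgt C f = tgt C g" "tgt C g = tgt C h"
  shows "(f \<uplus> g) \<uplus> h = f \<uplus> (g \<uplus> h)"
  using comm_groupE(3)[OF hom_comm_group[of "src C h" "tgt C h"], of f g h] assms
  by (simp only: hom_group_simps Hom_iff)

lemma madd_commute:
  assumes "src C f = src C g" "tgt C f = tgt C g"
  shows "f \<uplus> g = g \<uplus> f"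
  using comm_groupE(4)[OF hom_comm_group[of "src C g" "tgt C g"], of f g] assms
  by (simp only: hom_group_simps Hom_iff)

lemma madd_zero [simp]:
  assumes "src C f = X" "tgt C f = Y"
  shows "f \<uplus> mzero C X Y = f" "mzero C X Y \<uplus> f = f"
proof -
  show "mzero C X Y \<uplus> f = f"
    using comm_groupE(5)[OF hom_comm_group[of X Y], of f] assms
    by (simp only: hom_group_simps Hom_iff)
  then show "f \<uplus> mzero C X Y = f"
    using madd_commute[of f "mzero C X Y"] assms by simp
qed

lemma madd_neg [simp]:
  "f \<uplus> mneg C f = mzero C (src C f) (tgt C f)" "mneg C f \<uplus> f = mzero C (src C f) (tgt C f)"
proof -
  show "mneg C f \<uplus> f = mzero C (src C f) (tgt C f)"
    using group.l_inv[OF hom_group_axioms(1), of f "src C f" "tgt C f"]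
    by (simp only: hom_group_simps Hom_iff mneg_def)
  then show "f \<uplus> mneg C f = mzero C (src C f) (tgt C f)"
    using madd_commute[of f "mneg C f"] by simp
qed

lemma madd_left_cancel:
  assumes "f \<uplus> g = f \<uplus> h" "src C f = src C g" "tgt C f = tgt C g" "src C f = src C h" "tgt C f = tgt C h"
  shows "g = h"
proof -
  have "g = (mneg C f \<uplus> f) \<uplus> g" "h = (mneg C f \<uplus> f) \<uplus> h"
    using assms(2-) by simp_all
  moreover have "(mneg C f \<uplus> f) \<uplus> g = mneg C f \<uplus> (f \<uplus> g)"
    by (rule madd_assoc) (use assms(2-) in simp_all)
  moreover have "(mneg C f \<uplus> f) \<uplus> h = mneg C f \<uplus> (f \<uplus> h)"
    by (rule madd_assoc) (use assms(2-) in simp_all)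
  ultimately show ?thesis
    using assms(1) by simp
qed

lemma mneg_unique:
  assumes "f \<uplus> g = mzero C (src C f) (tgt C f)" "src C f = src C g" "tgt C f = tgt C g"
  shows "g = mneg C f"
  using assms by - (rule madd_left_cancel[of f], auto)

lemma mneg_mneg [simp]: "mneg C (mneg C f) = f"
  using mneg_unique[of "mneg C f" f] by simp

lemma mneg_zero [simp]: "mneg C (mzero C X Y) = mzero C X Y"
  using mneg_unique[of "mzero C X Y" "mzero C X Y"] by simp

lemma sub_eq_zero:
  assumes "f \<uplus> mneg C g = mzero C X Y" "src C f = X" "tgt C f = Y" "src C g = X" "tgt C g = Y"
  shows "f = g"
proof -
  have "mneg C g = mneg C f"
    using assms by - (rule mneg_unique, auto)
  then have "mneg C (mneg C g) = mneg C (mneg C f)" by simp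
  then show ?thesis by simp
qed

lemma madd_sub [simp]:
  assumes "src C f = src C g" "tgt C f = tgt C g"
  shows "g \<uplus> (f \<uplus> mneg C g) = f"
proof -
  have "g \<uplus> (f \<uplus> mneg C g) = (f \<uplus> mneg C g) \<uplus> g"
    using assms by - (rule madd_commute, auto)
  also have "\<dots> = f \<uplus> (mneg C g \<uplus> g)"
    using assms by - (rule madd_assoc, auto)
  finally show ?thesis
    using assms by simp
qed

lemma cmp_add [simp]:
  "\<lbrakk>src C f = src C f'; tgt C f = tgt C f'; tgt C f' = src C g\<rbrakk> \<Longrightarrow> g \<cdot> (f \<uplus> f') = g \<cdot> f \<uplus> g \<cdot> f'"
  using cmp_madd[of f "src C f" "src C g" f' g "tgt C g"] by auto

lemma add_cmp [simp]:
  "\<lbrakk>src C g = src C g'; tgt C g = tgt C g'; tgt C f = src C g'\<rbrakk> \<Longrightarrow> (g \<uplus> g') \<cdot> f = g \<cdot> f \<uplus> g' \<cdot> f"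
  using madd_cmp[of f "src C f" "src C g" g "tgt C g" g'] by auto

lemma add_self_zero:
  assumes "f \<uplus> f = f" shows "f = mzero C (src C f) (tgt C f)"
  using assms by - (rule madd_left_cancel[of f], auto)

lemma cmp_mzero [simp]: 
  assumes "src C g = Y" shows "g \<cdot> mzero C X Y = mzero C X (tgt C g)"
proof -
  have "g \<cdot> mzero C X Y \<uplus> g \<cdot> mzero C X Y = g \<cdot> (mzero C X Y \<uplus> mzero C X Y)"
    using assms by (subst cmp_add) auto
  then show ?thesis
    using assms add_self_zero[of "g \<cdot> mzero C X Y"] by simp
qed

lemma mzero_cmp [simp]: 
  assumes "tgt C f = Y" shows "mzero C Y Z \<cdot> f = mzero C (src C f) Z"
proof -
  have "mzero C Y Z \<cdot> f \<uplus> mzero C Y Z \<cdot> f = (mzero C Y Z \<uplus> mzero C Y Z) \<cdot> f"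
    using assms by (subst add_cmp) auto
  then show ?thesis
    using assms add_self_zero[of "mzero C Y Z \<cdot> f"] by simp
qed

lemma cmp_neg [simp]:
  assumes "tgt C f = src C g" shows "g \<cdot> mneg C f = mneg C (g \<cdot> f)"
proof (rule mneg_unique)
  show "g \<cdot> f \<uplus> g \<cdot> mneg C f = mzero C (src C (g \<cdot> f)) (tgt C (g \<cdot> f))"
    using assms by (subst cmp_add[symmetric]) auto
qed (use assms in auto)

lemma neg_cmp [simp]:
  assumes "tgt C f = src C g" shows "mneg C g \<cdot> f = mneg C (g \<cdot> f)"
proof (rule mneg_unique)
  show "g \<cdot> f \<uplus> mneg C g \<cdot> f = mzero C (src C (g \<cdot> f)) (tgt C (g \<cdot> f))"
    using assms by (subst add_cmp[symmetric]) auto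
qed (use assms in auto)

lemma zero_object_iff: "zero_object C Z \<longleftrightarrow> idn C Z = mzero C Z Z"
proof
  assume "zero_object C Z"
  then have "\<exists>!f. f \<in> Hom C Z Z" by (simp add: zero_object_def)
  moreover have "idn C Z \<in> Hom C Z Z" "mzero C Z Z \<in> Hom C Z Z" by simp_all
  ultimately show "idn C Z = mzero C Z Z" by blast
next
  assume Z: "idn C Z = mzero C Z Z"
  have "f = mzero C Z X" if "src C f = Z" "tgt C f = X" for f X
    using cmp_idn_src[OF that(1)] Z that by simp
  moreover have "f = mzero C X Z" if "tgt C f = Z" "src C f = X" for f X
    using idn_tgt_cmp[OF that(1)] Z that by simp
  ultimately have "\<exists>!f. f \<in> Hom C Z X" "\<exists>!f. f \<in> Hom C X Z" for X
    by (intro ex1I[of _ "mzero C Z X"] ex1I[of _ "mzero C X Z"]; simp)+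
  then show "zero_object C Z"
    unfolding zero_object_def by blast
qed

lemma arrow_to_zero:
  assumes "zero_object C Z" "tgt C f = Z" shows "f = mzero C (src C f) Z"
proof -
  have "mzero C Z Z \<cdot> f = f"
    using assms idn_tgt_cmp[of f Z] by (simp only: zero_object_iff)
  then show ?thesis
    using mzero_cmp[OF assms(2)] by simp
qed

lemma arrow_from_zero:
  assumes "zero_object C Z" "src C f = Z" shows "f = mzero C Z (tgt C f)"
proof -
  have "f \<cdot> mzero C Z Z = f"
    using assms cmp_idn_src[of f Z] by (simp only: zero_object_iff)
  then show ?thesis
    using cmp_mzero[OF assms(2)] by simp
qed

lemma zero_object_retract:
  assumes "zero_object C Y" "retract_of C X Y"
  shows "zero_object C X"
proof -
  obtain i r where ir: "src C i = X" "tgt C i = Y" "src C r = Y" "tgt C r = X" "r \<cdot> i = idn C X"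
    using assms(2) by (rule retract_ofE)
  then have "idn C X = mzero C X X"
    using arrow_to_zero[OF assms(1), of i] cmp_mzero[of r Y X] by simp
  then show ?thesis by (simp add: zero_object_iff)
qed

lemma zero_object_cong: "isomorphic C X Y \<Longrightarrow> zero_object C X \<longleftrightarrow> zero_object C Y"
  by (meson isomorphic_retract isomorphic_sym zero_object_retract)

lemma zero_objects_iso:
  assumes "zero_object C (src C f)" "zero_object C (tgt C f)"
  shows "iso_arrow C f"
proof (rule iso_arrowI[of "mzero C (tgt C f) (src C f)"])
  show "mzero C (tgt C f) (src C f) \<cdot> f = idn C (src C f)"
    using assms(1) by (simp add: zero_object_iff)
  show "f \<cdot> mzero C (tgt C f) (src C f) = idn C (tgt C f)"
    using assms(2) by (simp add: zero_object_iff)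
qed auto

lemma zero_object_coproduct:
  assumes "is_coproduct C I X S \<iota>" "\<And>i. i \<in> I \<Longrightarrow> zero_object C (X i)"
  shows "zero_object C S"
  unfolding zero_object_iff
proof (rule coproduct_ext[OF assms(1)])
  fix i assume i: "i \<in> I"
  have "\<iota> i = mzero C (X i) S"
    using coproduct_inj[OF assms(1) i] arrow_from_zero[OF assms(2)[OF i], of "\<iota> i"] by auto
  then show "idn C S \<cdot> \<iota> i = mzero C S S \<cdot> \<iota> i" by simp
qed auto

section \<open>Projections from coproducts, and biproducts\<close>

definition is_projection :: "'i set \<Rightarrow> ('i \<Rightarrow> 'o) \<Rightarrow> 'o \<Rightarrow> ('i \<Rightarrow> 'm) \<Rightarrow> 'i \<Rightarrow> 'm \<Rightarrow> bool" where
  "is_projection I X S \<iota> i p \<longleftrightarrow> src C p = S \<and> tgt C p = X i \<and> p \<cdot> \<iota> i = idn C (X i) \<and>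
     (\<forall>j \<in> I - {i}. p \<cdot> \<iota> j = mzero C (X j) (X i))"

lemma coproduct_projection:
  assumes "is_coproduct C I X S \<iota>" "i \<in> I"
  obtains p where "is_projection I X S \<iota> i p"
proof -
  define f where "f = (\<lambda>j. if j = i then idn C (X i) else mzero C (X j) (X i))"
  have "src C (f j) = X j \<and> tgt C (f j) = X i" for j
    by (auto simp: f_def)
  then obtain p where "src C p = S" "tgt C p = X i" "\<And>j. j \<in> I \<Longrightarrow> p \<cdot> \<iota> j = f j"
    using coproduct_desc[OF assms(1), of f "X i"] by metis
  then have "is_projection I X S \<iota> i p"
    using assms(2) by (auto simp: is_projection_def f_def)
  then show thesis by (rule that)
qed


text \<open>The equational form is symmetric: the same five identities yield maps into
  \<open>B\<close> and maps out of \<open>B\<close>.\<close>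

definition biproduct :: "'o \<Rightarrow> 'o \<Rightarrow> 'o \<Rightarrow> 'm \<Rightarrow> 'm \<Rightarrow> 'm \<Rightarrow> 'm \<Rightarrow> bool" where
  "biproduct X Y B in1 in2 p1 p2 \<longleftrightarrow>
    src C in1 = X \<and> tgt C in1 = B \<and> src C in2 = Y \<and> tgt C in2 = B \<and>
    src C p1 = B \<and> tgt C p1 = X \<and> src C p2 = B \<and> tgt C p2 = Y \<and>
    p1 \<cdot> in1 = idn C X \<and> p2 \<cdot> in2 = idn C Y \<and> p1 \<cdot> in2 = mzero C Y X \<and> p2 \<cdot> in1 = mzero C X Y \<and>
    in1 \<cdot> p1 \<uplus> in2 \<cdot> p2 = idn C B"

lemma binary_biproduct: obtains B in1 in2 p1 p2 where "biproduct X Y B in1 in2 p1 p2"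
proof -
  let ?X = "\<lambda>b. if b then X else Y"
  obtain B \<iota> where B: "is_coproduct C (UNIV :: bool set) ?X B \<iota>"
    using ex_binary_coproduct[of ?X] by blast
  note inj = coproduct_inj[OF B, of True] coproduct_inj[OF B, of False]
  obtain p1 where p1: "is_projection UNIV ?X B \<iota> True p1"
    using coproduct_projection[OF B, of True] by auto
  obtain p2 where p2: "is_projection UNIV ?X B \<iota> False p2"
    using coproduct_projection[OF B, of False] by auto
  note p = p1[unfolded is_projection_def, simplified] p2[unfolded is_projection_def, simplified]
  have "\<iota> True \<cdot> p1 \<uplus> \<iota> False \<cdot> p2 = idn C B"
  proof (rule coproduct_ext[OF B])
    fix b show "(\<iota> True \<cdot> p1 \<uplus> \<iota> False \<cdot> p2) \<cdot> \<iota> b = idn C B \<cdot> \<iota> b"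
      using p inj by (cases b) auto
  qed (use p inj in auto)
  then show thesis
    using p inj by (intro that[of B "\<iota> True" "\<iota> False" p1 p2]) (auto simp: biproduct_def)
qed

end

section \<open>Triangulated categories\<close>

context triangulated_category
begin

lemma sarr_ends [simp]: "src C (sarr C f) = sobj C (src C f)" "tgt C (sarr C f) = sobj C (tgt C f)"
  using sarr_Hom[of f "src C f" "tgt C f"] by auto

declare sarr_idn [simp]

lemma sarr_comp [simp]: "tgt C f = src C g \<Longrightarrow> sarr C (g \<cdot> f) = sarr C g \<cdot> sarr C f"
  using sarr_cmp[of f "src C f" "src C g" g "tgt C g"] by auto

lemma sarr_add [simp]:
  "\<lbrakk>src C f = src C f'; tgt C f = tgt C f'\<rbrakk> \<Longrightarrow> sarr C (f \<uplus> f') = sarr C f \<uplus> sarr C f'"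
  using sarr_madd[of f "src C f'" "tgt C f'" f'] by auto

lemma sarr_mzero [simp]: "sarr C (mzero C X Y) = mzero C (sobj C X) (sobj C Y)"
proof -
  have "sarr C (mzero C X Y) \<uplus> sarr C (mzero C X Y) = sarr C (mzero C X Y)"
    by (subst sarr_add[symmetric]) auto
  then show ?thesis
    using add_self_zero[of "sarr C (mzero C X Y)"] by simp
qed

lemma sarr_neg [simp]: "sarr C (mneg C f) = mneg C (sarr C f)"
proof (rule mneg_unique)
  show "sarr C f \<uplus> sarr C (mneg C f) = mzero C (src C (sarr C f)) (tgt C (sarr C f))"
    by (subst sarr_add[symmetric]) auto
qed auto

lemma sarr_inj:
  assumes "sarr C f = sarr C g" "src C f = src C g" "tgt C f = tgt C g"
  shows "f = g"
  using sarr_bij[of "src C g" "tgt C g"] assms unfolding bij_betw_def inj_on_def by auto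

lemma sarr_surj:
  assumes "src C h = sobj C X" "tgt C h = sobj C Y"
  obtains f where "src C f = X" "tgt C f = Y" "sarr C f = h"
proof -
  have "h \<in> Hom C (sobj C X) (sobj C Y)" using assms by simp
  also have "\<dots> = sarr C ` Hom C X Y"
    using sarr_bij[of X Y] by (simp only: bij_betw_def)
  finally have "\<exists>f \<in> Hom C X Y. h = sarr C f"
    by (rule imageE) blast
  then show thesis
    using that by auto
qed

lemma sarr_eq_zero:
  assumes "sarr C f = mzero C (sobj C X) (sobj C Y)" "src C f = X" "tgt C f = Y"
  shows "f = mzero C X Y"
  by (rule sarr_inj) (use assms in auto)

lemma sarr_iso: "iso_arrow C f \<Longrightarrow> iso_arrow C (sarr C f)"
proof (erule iso_arrowE)
  fix g assume g: "src C g = tgt C f" "tgt C g = src C f" "g \<cdot> f = idn C (src C f)" "f \<cdot> g = idn C (tgt C f)"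
  show "iso_arrow C (sarr C f)"
    by (rule iso_arrowI[of "sarr C g"]) (use g in \<open>auto simp flip: sarr_comp\<close>)
qed

lemma sobj_isomorphic: "isomorphic C X Y \<Longrightarrow> isomorphic C (sobj C X) (sobj C Y)"
  by (metis isomorphicE isomorphicI sarr_ends sarr_iso)

lemma desuspend: obtains X where "isomorphic C (sobj C X) Y"
  using sobj_ess_surj by blast

lemma zero_object_sobj [simp]: "zero_object C (sobj C X) \<longleftrightarrow> zero_object C X"
  unfolding zero_object_iff
  using sarr_eq_zero[of "idn C X" X X] sarr_mzero[of X X] sarr_idn[of X] by (auto simp del: sarr_mzero sarr_idn)

lemma dtri_ends:
  assumes "dtri C f g h"
  shows "src C g = tgt C f" "src C h = tgt C g" "tgt C h = sobj C (src C f)"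
  using dtri_Hom[OF assms] by auto

lemma dtri_fill:
  assumes "dtri C f g h" "dtri C f' g' h'" "src C u = src C f" "tgt C u = src C f'"
    "src C v = tgt C f" "tgt C v = tgt C f'" "v \<cdot> f = f' \<cdot> u"
  obtains w where "src C w = tgt C g" "tgt C w = tgt C g'" "w \<cdot> g = g' \<cdot> v" "sarr C u \<cdot> h = h' \<cdot> w"
proof -
  have "\<exists>w \<in> Hom C (tgt C g) (tgt C g'). w \<cdot> g = g' \<cdot> v \<and> sarr C u \<cdot> h = h' \<cdot> w"
    by (rule dtri_morphism[OF assms(1,2) _ _ assms(7)]) (use assms(3-6) in simp_all)
  then obtain w where "w \<in> Hom C (tgt C g) (tgt C g')" "w \<cdot> g = g' \<cdot> v" "sarr C u \<cdot> h = h' \<cdot> w"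
    by blast
  then show thesis by (intro that[of w]) simp_all
qed

lemma dtri_rot: "dtri C f g h \<Longrightarrow> dtri C g h (mneg C (sarr C f))"
  using dtri_rotate[of f "src C f" "tgt C f" g "tgt C g" h] dtri_ends[of f g h] by auto

lemma dtri_rot_back:
  assumes "dtri C g h (mneg C (sarr C f))" "tgt C f = src C g" "tgt C h = sobj C (src C f)"
  shows "dtri C f g h"
  using dtri_rotate[of f "src C f" "tgt C f" g "tgt C g" h] dtri_ends[OF assms(1)] assms by auto

lemma ex_cone: obtains g h where "dtri C f g h"
  using dtri_complete by blast

lemma dtri_change_cone:
  assumes "dtri C f g h" "iso_arrow C w" "src C w = tgt C g"
    "src C h' = tgt C w" "h' \<cdot> w = h"
  shows "dtri C f (w \<cdot> g) h'"
  using assms dtri_ends[OF assms(1)]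
  by (intro dtri_iso[OF assms(1), where u = "idn C (src C f)" and v = "idn C (tgt C f)" and w = w
     and X = "src C f" and Y = "tgt C f" and Z = "tgt C g"
     and X' = "src C f" and Y' = "tgt C f" and Z' = "tgt C w"]) auto

text \<open>The suspension is only an autoequivalence, so the cone of \<open>f\<close> is replaced
  by an isomorphic suspension \<open>sobj C W\<close> before the connecting map is desuspended to
  \<open>k\<close>. The triangle found starts with \<open>mneg C k\<close>, which absorbs the sign
  of the rotation.\<close>

lemma ex_fibre: obtains k h where "dtri C k f h"
proof -
  obtain g h where d: "dtri C f g h" by (rule ex_cone)
  note e = dtri_ends[OF d]
  obtain W where "isomorphic C (sobj C W) (tgt C g)" by (rule desuspend)
  then obtain \<phi> where \<phi>: "iso_arrow C \<phi>" "src C \<phi> = sobj C W" "tgt C \<phi> = tgt C g"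
    by (rule isomorphicE)
  obtain \<psi> where \<psi>: "src C \<psi> = tgt C g" "tgt C \<psi> = sobj C W" "\<psi> \<cdot> \<phi> = idn C (sobj C W)"
    "\<phi> \<cdot> \<psi> = idn C (tgt C g)" "iso_arrow C \<psi>"
    using \<phi> by (metis iso_arrowE)
  obtain k where k: "src C k = W" "tgt C k = src C f" "sarr C k = h \<cdot> \<phi>"
    by (rule sarr_surj[of "h \<cdot> \<phi>" W "src C f"]) (use \<phi> e in auto)
  have "dtri C f (\<psi> \<cdot> g) (h \<cdot> \<phi>)"
    by (rule dtri_change_cone[OF d]) (use \<phi> \<psi> e in auto)
  then have "dtri C (mneg C k) f (\<psi> \<cdot> g)"
    by - (rule dtri_rot_back, use \<phi> \<psi> e k in auto)
  then show thesis by (rule that)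
qed

text \<open>The target of \<open>h\<close> is literally a suspension, so the last map of the
  triangle on a fibre of \<open>h\<close> desuspends without changing \<open>h\<close> or
  \<open>X\<close>. This turns a given map into the connecting map of a triangle.\<close>

lemma ex_dtri_third:
  assumes "tgt C h = sobj C X"
  obtains f g where "dtri C f g h" "src C f = X"
proof -
  obtain g m where d: "dtri C g h m" by (rule ex_fibre)
  note e = dtri_ends[OF d]
  obtain f where f: "src C f = X" "tgt C f = src C g" "sarr C f = m"
    by (rule sarr_surj[of m X "src C g"]) (use e assms in auto)
  have "dtri C (mneg C f) g h"
    by (rule dtri_rot_back) (use d e f assms in auto)
  then show thesis using f by (intro that[of "mneg C f" g]) auto
qed

section \<open>Exactness of triangles: weak kernels and weak cokernels\<close>

lemma dtri_zero_idn: "zero_object C Z \<Longrightarrow> dtri C (mzero C Z W) (idn C W) (mzero C W (sobj C Z))"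
  by (rule dtri_rot_back) (use dtri_idn[of "sobj C Z" W] in simp_all)

lemma dtri_comp_zero:
  assumes "dtri C f g h"
  shows "g \<cdot> f = mzero C (src C f) (tgt C g)" "h \<cdot> g = mzero C (tgt C f) (sobj C (src C f))"
    "sarr C f \<cdot> h = mzero C (tgt C g) (sobj C (tgt C f))"
proof -
  obtain Z where Z: "zero_object C Z" using ex_zero_object by blast
  have 1: "g \<cdot> f = mzero C (src C f) (tgt C g)" if d: "dtri C f g h" for f g h
  proof -
    obtain w where "src C w = Z" "tgt C w = tgt C g" "w \<cdot> mzero C (src C f) Z = g \<cdot> f"
      by (rule dtri_fill[OF dtri_idn[OF Z, of "src C f"] d, of "idn C (src C f)" f])
        (use dtri_ends[OF d] in auto)
    then show ?thesis by simp
  qed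
  show "g \<cdot> f = mzero C (src C f) (tgt C g)" "h \<cdot> g = mzero C (tgt C f) (sobj C (src C f))"
    using 1[OF assms] 1[OF dtri_rot[OF assms]] dtri_ends[OF assms] by simp_all
  have "mneg C (sarr C f \<cdot> h) = mzero C (tgt C g) (sobj C (tgt C f))"
    using 1[OF dtri_rot[OF dtri_rot[OF assms]]] dtri_ends[OF assms] by simp
  then have "mneg C (mneg C (sarr C f \<cdot> h)) = mneg C (mzero C (tgt C g) (sobj C (tgt C f)))" by simp
  then show "sarr C f \<cdot> h = mzero C (tgt C g) (sobj C (tgt C f))" by simp
qed

text \<open>With W the target of \<open>k\<close>, the triangle is mapped to the one on
  \<open>0 \<rightarrow> W\<close> with cone W; the filler is the factorization. Together with its
  rotations this is the exactness of Hom(-, W) on a triangle, stated for individual maps.\<close>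

lemma weak_coker:
  assumes "dtri C f g h" "src C k = tgt C f" "k \<cdot> f = mzero C (src C f) (tgt C k)"
  obtains m where "src C m = tgt C g" "tgt C m = tgt C k" "m \<cdot> g = k"
proof -
  obtain Z where Z: "zero_object C Z" using ex_zero_object by blast
  obtain w where "w \<in> Hom C (tgt C g) (tgt C k)" "w \<cdot> g = idn C (tgt C k) \<cdot> k"
    by (rule dtri_fill[OF assms(1) dtri_zero_idn[OF Z, of "tgt C k"], of "mzero C (src C f) Z" k])
      (use assms in auto)
  then show thesis using assms by (intro that[of w]) auto
qed

lemma weak_coker2:
  assumes "dtri C f g h" "src C k = tgt C g" "k \<cdot> g = mzero C (tgt C f) (tgt C k)"
  obtains m where "src C m = sobj C (src C f)" "tgt C m = tgt C k" "m \<cdot> h = k"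
proof -
  note e = dtri_ends[OF assms(1)]
  obtain m where "src C m = tgt C h" "tgt C m = tgt C k" "m \<cdot> h = k"
    by (rule weak_coker[OF dtri_rot[OF assms(1)], of k]) (use assms e in auto)
  then show thesis using that e by simp
qed


text \<open>With W the source of \<open>k\<close>, the triangle on the identity of W is mapped in.
  The fill-in axiom only produces the third map of a morphism, so both triangles are rotated once
  and the filler is desuspended.\<close>

lemma weak_ker:
  assumes "dtri C f g h" "tgt C k = tgt C f" "g \<cdot> k = mzero C (src C k) (tgt C g)"
  obtains m where "src C m = src C k" "tgt C m = src C f" "f \<cdot> m = k"
proof -
  note e = dtri_ends[OF assms(1)]
  obtain Z where Z: "zero_object C Z" using ex_zero_object by blast
  note d = dtri_rot[OF dtri_idn[OF Z, of "src C k"]]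
  obtain w where w: "src C w = sobj C (src C k)" "tgt C w = sobj C (src C f)"
      "sarr C k \<cdot> mneg C (idn C (sobj C (src C k))) = mneg C (sarr C f) \<cdot> w"
    by (rule dtri_fill[OF d dtri_rot[OF assms(1)], of k "mzero C Z (tgt C g)"]) (use assms e in auto)
  obtain m where m: "src C m = src C k" "tgt C m = src C f" "sarr C m = w"
    using w by (metis sarr_surj)
  have "mneg C (sarr C k) = mneg C (sarr C (f \<cdot> m))"
    using w m assms by simp
  then have "mneg C (mneg C (sarr C k)) = mneg C (mneg C (sarr C (f \<cdot> m)))" by (rule arg_cong)
  then have "sarr C k = sarr C (f \<cdot> m)" by (simp only: mneg_mneg)
  then have "f \<cdot> m = k"
    by - (rule sarr_inj, use m assms in auto)
  then show thesis using m by (intro that) auto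
qed

lemma weak_ker2:
  assumes "dtri C f g h" "tgt C k = tgt C g" "h \<cdot> k = mzero C (src C k) (sobj C (src C f))"
  obtains m where "src C m = src C k" "tgt C m = tgt C f" "g \<cdot> m = k"
proof -
  note e = dtri_ends[OF assms(1)]
  show thesis
    by (rule weak_ker[OF dtri_rot[OF assms(1)], of k]) (use assms e that in auto)
qed

lemma weak_ker3:
  assumes "dtri C f g h" "tgt C k = src C f" "f \<cdot> k = mzero C (src C k) (tgt C f)"
  obtains m where "src C m = sobj C (src C k)" "tgt C m = tgt C g" "h \<cdot> m = sarr C k"
proof -
  note e = dtri_ends[OF assms(1)]
  have z: "mneg C (sarr C f) \<cdot> sarr C k = mzero C (sobj C (src C k)) (sobj C (tgt C f))"
    using assms e by (simp flip: sarr_comp)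
  show thesis
    by (rule weak_ker2[OF dtri_rot[OF assms(1)], of "sarr C k"]) (use assms e that z in auto)
qed

text \<open>If the cone vanishes, the identity of the target lifts to a right inverse
  \<open>m\<close> of \<open>f\<close>. The defect \<open>m \<cdot> f - 1\<close> is killed by
  \<open>f\<close>, so its suspension factors through the connecting map, which is zero. Conversely,
  an invertible \<open>f\<close> forces \<open>g = 0\<close> and \<open>h = 0\<close>, and the
  identity of the cone lifts along \<open>g\<close>.\<close>

lemma zero_cone_iff:
  assumes "dtri C f g h"
  shows "zero_object C (tgt C g) \<longleftrightarrow> iso_arrow C f"
proof
  note e = dtri_ends[OF assms]
  assume Z: "zero_object C (tgt C g)"
  have g: "g = mzero C (tgt C f) (tgt C g)" using arrow_to_zero[OF Z, of g] e by simp
  have h: "h = mzero C (tgt C g) (sobj C (src C f))" using arrow_from_zero[OF Z, of h] e by simp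
  obtain m where m: "src C m = tgt C f" "tgt C m = src C f" "f \<cdot> m = idn C (tgt C f)"
  proof (rule weak_ker[OF assms, of "idn C (tgt C f)"])
    show "g \<cdot> idn C (tgt C f) = mzero C (src C (idn C (tgt C f))) (tgt C g)"
      using g e by simp
  qed auto
  let ?x = "m \<cdot> f \<uplus> mneg C (idn C (src C f))"
  have fmf: "f \<cdot> (m \<cdot> f) = f" using m cmp_reassoc[OF m(3)] by simp
  have "f \<cdot> ?x = mzero C (src C f) (tgt C f)"
    using m by (simp add: fmf)
  then obtain y where y: "src C y = sobj C (src C f)" "tgt C y = tgt C g" "h \<cdot> y = sarr C ?x"
    using weak_ker3[OF assms, of ?x] m by auto
  have "?x = mzero C (src C f) (src C f)"
  proof (rule sarr_eq_zero)
    have "h \<cdot> y = mzero C (tgt C g) (sobj C (src C f)) \<cdot> y"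
      using h by simp
    then show "sarr C ?x = mzero C (sobj C (src C f)) (sobj C (src C f))"
      using y by simp
  qed (use m in auto)
  then have "m \<cdot> f = idn C (src C f)"
    by - (rule sub_eq_zero, use m in auto)
  with m show "iso_arrow C f" by (intro iso_arrowI[of m]) auto
next
  note e = dtri_ends[OF assms] and z = dtri_comp_zero[OF assms]
  assume "iso_arrow C f"
  then obtain k where k: "src C k = tgt C f" "tgt C k = src C f" "k \<cdot> f = idn C (src C f)"
    "f \<cdot> k = idn C (tgt C f)" by (rule iso_arrowE)
  have "g = (g \<cdot> f) \<cdot> k" using k e by simp
  then have g: "g = mzero C (tgt C f) (tgt C g)" using z k by simp
  have "sarr C k \<cdot> sarr C f = idn C (sobj C (src C f))"
    using k by (simp flip: sarr_comp)
  then have "h = sarr C k \<cdot> (sarr C f \<cdot> h)"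
    using k e by (subst cmp_reassoc) auto
  then have h: "h = mzero C (tgt C g) (sobj C (src C f))" using z k by simp
  obtain m where m: "src C m = tgt C g" "tgt C m = tgt C f" "g \<cdot> m = idn C (tgt C g)"
  proof (rule weak_ker2[OF assms, of "idn C (tgt C g)"])
    show "h \<cdot> idn C (tgt C g) = mzero C (src C (idn C (tgt C g))) (sobj C (src C f))"
      using h e by simp
  qed auto
  have "g \<cdot> m = mzero C (tgt C f) (tgt C g) \<cdot> m" using g by simp
  then show "zero_object C (tgt C g)"
    using m by (simp add: zero_object_iff)
qed

text \<open>A diagram chase on maps: \<open>mono\<close> says that \<open>w\<close> annihilates only
  zero, and a right inverse of \<open>w\<close> is built by a lift and a correction. The right
  inverse is then two-sided because \<open>w\<close> can be cancelled on the left.\<close>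

lemma five_lemma:
  assumes d: "dtri C f g h" and d': "dtri C f' g' h'"
    and u: "src C u = src C f" "tgt C u = src C f'" "iso_arrow C u"
    and v: "src C v = tgt C f" "tgt C v = tgt C f'" "iso_arrow C v"
    and w: "src C w = tgt C g" "tgt C w = tgt C g'"
    and sq: "v \<cdot> f = f' \<cdot> u" "w \<cdot> g = g' \<cdot> v" "sarr C u \<cdot> h = h' \<cdot> w"
  shows "iso_arrow C w"
proof -
  note e = dtri_ends[OF d] dtri_ends[OF d'] and z = dtri_comp_zero[OF d] and z' = dtri_comp_zero[OF d']
  have mono: "x = mzero C (src C x) (tgt C g)"
    if x: "tgt C x = tgt C g" "w \<cdot> x = mzero C (src C x) (tgt C g')" for x
  proof -
    have "sarr C u \<cdot> (h \<cdot> x) = h' \<cdot> (w \<cdot> x)"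
      using x e u w sq by (simp add: cmp_reassoc[OF sq(3)])
    also have "\<dots> = sarr C u \<cdot> mzero C (src C x) (sobj C (src C f))"
      using x e u by simp
    finally have "h \<cdot> x = mzero C (src C x) (sobj C (src C f))"
      by (rule iso_cancel_left[OF sarr_iso[OF u(3)]]) (use x e u in auto)
    then obtain y where y: "src C y = src C x" "tgt C y = tgt C f" "g \<cdot> y = x"
      using weak_ker2[OF d x(1)] by blast
    have "g' \<cdot> (v \<cdot> y) = mzero C (src C x) (tgt C g')"
    proof -
      have "g' \<cdot> (v \<cdot> y) = (w \<cdot> g) \<cdot> y" using y e v sq by simp
      also have "\<dots> = w \<cdot> x" using y e w by simp
      finally show ?thesis using x by simp
    qed
    then obtain t where t: "src C t = src C x" "tgt C t = src C f'" "f' \<cdot> t = v \<cdot> y"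
      using weak_ker[OF d', of "v \<cdot> y"] y v by auto
    obtain u' where u': "src C u' = tgt C u" "tgt C u' = src C u" "u \<cdot> u' = idn C (tgt C u)"
      using u(3) by (rule iso_arrowE)
    have "v \<cdot> (f \<cdot> (u' \<cdot> t)) = (v \<cdot> f) \<cdot> (u' \<cdot> t)"
      using t u u' v by simp
    also have "\<dots> = f' \<cdot> (u \<cdot> (u' \<cdot> t))" using t u u' sq by simp
    also have "u \<cdot> (u' \<cdot> t) = t" using t u u' by (simp add: cmp_reassoc[OF u'(3)])
    finally have "v \<cdot> (f \<cdot> (u' \<cdot> t)) = v \<cdot> y" using t by simp
    then have "f \<cdot> (u' \<cdot> t) = y"
      by (rule iso_cancel_left[OF v(3)]) (use t u u' v y in auto)
    then have "x = (g \<cdot> f) \<cdot> (u' \<cdot> t)" using y e t u u' by simp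
    then show ?thesis using z t u' u by simp
  qed
  obtain u' where u': "src C u' = tgt C u" "tgt C u' = src C u" "u' \<cdot> u = idn C (src C u)" "u \<cdot> u' = idn C (tgt C u)"
    using u(3) by (rule iso_arrowE)
  obtain v' where v': "src C v' = tgt C v" "tgt C v' = src C v" "v' \<cdot> v = idn C (src C v)" "v \<cdot> v' = idn C (tgt C v)"
    using v(3) by (rule iso_arrowE)
  have "f \<cdot> u' = v' \<cdot> f'"
  proof -
    have "f \<cdot> u' = v' \<cdot> (v \<cdot> f) \<cdot> u'"
      using u u' v v' by (simp add: cmp_reassoc[OF v'(3)])
    also have "\<dots> = v' \<cdot> (f' \<cdot> (u \<cdot> u'))" using u u' v v' sq by simp
    finally show ?thesis using u u' v v' by simp
  qed
  then have "sarr C f \<cdot> (sarr C u' \<cdot> h') = sarr C v' \<cdot> (sarr C f' \<cdot> h')"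
    using u u' v v' e by (metis cmp_assoc_right sarr_comp sarr_ends)
  then have "sarr C f \<cdot> (sarr C u' \<cdot> h') = mzero C (tgt C g') (sobj C (tgt C f))"
    using z' v v' by simp
  then have "mneg C (sarr C f) \<cdot> (sarr C u' \<cdot> h') = mzero C (tgt C g') (sobj C (tgt C f))"
    using u u' e by simp
  then obtain t where t: "src C t = tgt C g'" "tgt C t = tgt C g" "h \<cdot> t = sarr C u' \<cdot> h'"
    using weak_ker2[OF dtri_rot[OF d], of "sarr C u' \<cdot> h'"] e u u' by auto
  have uu': "sarr C u \<cdot> sarr C u' = idn C (sobj C (src C f'))"
    using u u' by (simp flip: sarr_comp)
  have "h' \<cdot> (w \<cdot> t) = (h' \<cdot> w) \<cdot> t"
    using e t w by simp
  also have "\<dots> = (sarr C u \<cdot> h) \<cdot> t"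
    using sq(3) by simp
  also have "\<dots> = sarr C u \<cdot> (h \<cdot> t)"
    using e t u by (intro cmp_assoc_right) auto
  also have "\<dots> = h'"
    using t e u u' by (simp add: cmp_reassoc[OF uu'])
  finally have "h' \<cdot> (idn C (tgt C g') \<uplus> mneg C (w \<cdot> t)) = mzero C (tgt C g') (sobj C (src C f'))"
    using e t w by simp
  then obtain y' where y': "src C y' = tgt C g'" "tgt C y' = tgt C f'"
      "g' \<cdot> y' = idn C (tgt C g') \<uplus> mneg C (w \<cdot> t)"
    using weak_ker2[OF d', of "idn C (tgt C g') \<uplus> mneg C (w \<cdot> t)"] t w by auto
  \<comment> \<open>\<open>t\<close> is a right inverse of \<open>w\<close> up to an error killed by
    \<open>h'\<close>. That error is \<open>g' \<cdot> y'\<close>, and transporting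
    \<open>y'\<close> back along the inverse of \<open>v\<close> gives the correction.\<close>
  let ?s = "t \<uplus> g \<cdot> (v' \<cdot> y')"
  have "w \<cdot> (g \<cdot> (v' \<cdot> y')) = g' \<cdot> y'"
    using e v v' w y' by (simp add: cmp_reassoc[OF sq(2)] cmp_reassoc[OF v'(4)])
  then have s: "w \<cdot> ?s = idn C (tgt C g')"
    using e v v' w y' t by simp
  have "?s \<cdot> w \<uplus> mneg C (idn C (tgt C g)) = mzero C (tgt C g) (tgt C g)"
  proof -
    have "w \<cdot> (?s \<cdot> w) = w"
      using cmp_reassoc[OF s, of w] e v v' w y' t by simp
    then have "w \<cdot> (?s \<cdot> w \<uplus> mneg C (idn C (tgt C g))) = mzero C (tgt C g) (tgt C g')"
      using e v v' w y' t by (subst cmp_add) (simp_all del: add_cmp cmp_assoc_right)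
    then show ?thesis
      using mono[of "?s \<cdot> w \<uplus> mneg C (idn C (tgt C g))"] e v v' w y' t by simp
  qed
  then have "?s \<cdot> w = idn C (tgt C g)"
    by - (rule sub_eq_zero, use e v v' w y' t in auto)
  with s show ?thesis
    by (intro iso_arrowI[of ?s]) (use e v v' w y' t in auto)
qed

lemma cones_isomorphic:
  assumes "dtri C f g h" "dtri C f g' h'"
  shows "isomorphic C (tgt C g) (tgt C g')"
proof -
  note e = dtri_ends[OF assms(1)] dtri_ends[OF assms(2)]
  obtain w where w: "src C w = tgt C g" "tgt C w = tgt C g'" "w \<cdot> g = g'" "h = h' \<cdot> w"
    by (rule dtri_fill[OF assms, of "idn C (src C f)" "idn C (tgt C f)"]) (use e in auto)
  have "iso_arrow C w"
    by (rule five_lemma[OF assms, of "idn C (src C f)" "idn C (tgt C f)"]) (use w e in auto)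
  with w(1,2) show ?thesis by (intro isomorphicI[of w]) auto
qed

section \<open>Triangulated subcategories: two out of three, sums, weak pushouts\<close>

lemma tri_sub_zero: "triangulated_subcategory C A \<Longrightarrow> zero_object C Z \<Longrightarrow> Z \<in> A"
  by (simp add: triangulated_subcategory_def)

lemma tri_sub_iso: "triangulated_subcategory C A \<Longrightarrow> isomorphic C X Y \<Longrightarrow> X \<in> A \<Longrightarrow> Y \<in> A"
  unfolding triangulated_subcategory_def by blast

lemma tri_sub_shift: "triangulated_subcategory C A \<Longrightarrow> sobj C X \<in> A \<longleftrightarrow> X \<in> A"
  by (simp add: triangulated_subcategory_def)

lemma tri_sub_cone:
  "triangulated_subcategory C A \<Longrightarrow> dtri C f g h \<Longrightarrow> src C f \<in> A \<Longrightarrow> tgt C f \<in> A \<Longrightarrow> tgt C g \<in> A"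
  unfolding triangulated_subcategory_def by blast

lemma tri_sub_fibre:
  assumes "triangulated_subcategory C A" "dtri C f g h" "tgt C f \<in> A" "tgt C g \<in> A"
  shows "src C f \<in> A"
  using tri_sub_cone[OF assms(1) dtri_rot[OF assms(2)]] dtri_ends[OF assms(2)] assms
    tri_sub_shift[OF assms(1)] by simp

lemma tri_sub_middle:
  assumes "triangulated_subcategory C A" "dtri C f g h" "src C f \<in> A" "tgt C g \<in> A"
  shows "tgt C f \<in> A"
  using tri_sub_cone[OF assms(1) dtri_rot[OF dtri_rot[OF assms(2)]]] dtri_ends[OF assms(2)] assms
    tri_sub_shift[OF assms(1)] by simp

text \<open>Since \<open>in1\<close> is split mono, the connecting map of its triangle vanishes, and
  this makes \<open>g \<cdot> in2\<close> an isomorphism from \<open>Y\<close> to the cone. So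
  \<open>B\<close> is the middle term of a triangle whose outer terms lie in
  \<open>A\<close>.\<close>

lemma biproduct_sub:
  assumes "triangulated_subcategory C A" "biproduct X Y B in1 in2 p1 p2" "X \<in> A" "Y \<in> A"
  shows "B \<in> A"
proof -
  note b = assms(2)[unfolded biproduct_def]
  obtain g h where d: "dtri C in1 g h" by (rule ex_cone)
  note e = dtri_ends[OF d]
  have p: "sarr C p1 \<cdot> sarr C in1 = idn C (sobj C X)"
    using b by (simp flip: sarr_comp)
  have "h = sarr C p1 \<cdot> (sarr C in1 \<cdot> h)"
    using b e by (simp add: cmp_reassoc[OF p])
  then have h: "h = mzero C (tgt C g) (sobj C X)"
    using dtri_comp_zero(3)[OF d] b e by simp
  obtain m where m: "src C m = tgt C g" "tgt C m = Y" "m \<cdot> g = p2"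
    by (rule weak_coker[OF d, of p2]) (use b in auto)
  have g: "g \<cdot> in2 \<cdot> p2 = g"
  proof -
    have i: "in1 \<cdot> p1 \<uplus> in2 \<cdot> p2 = idn C B" using b by blast
    have "g = g \<cdot> (in1 \<cdot> p1 \<uplus> in2 \<cdot> p2)" unfolding i using b e by simp
    also have "\<dots> = (g \<cdot> in1) \<cdot> p1 \<uplus> g \<cdot> (in2 \<cdot> p2)"
      using b e by (subst cmp_add) auto
    also have "\<dots> = g \<cdot> (in2 \<cdot> p2)" using b e dtri_comp_zero(1)[OF d] by simp
    finally show ?thesis using b e by simp
  qed
  let ?k = "idn C (tgt C g) \<uplus> mneg C (g \<cdot> (in2 \<cdot> m))"
  have "?k \<cdot> g = mzero C B (tgt C g)"
    using b e m g by simp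
  then obtain n where n: "src C n = sobj C X" "tgt C n = tgt C g" "n \<cdot> h = ?k"
    using weak_coker2[OF d, of ?k] b e m by auto
  have "?k = mzero C (tgt C g) (tgt C g)"
    using n(1,2) unfolding n(3)[symmetric] h by simp
  then have "idn C (tgt C g) = g \<cdot> (in2 \<cdot> m)"
    by (rule sub_eq_zero) (use b e m in auto)
  moreover have "m \<cdot> (g \<cdot> in2) = idn C Y"
    using b e m by (simp add: cmp_reassoc[OF m(3)])
  ultimately have "iso_arrow C (g \<cdot> in2)"
    by (intro iso_arrowI[of m]) (use b e m in auto)
  then have "isomorphic C Y (tgt C g)"
    using b e by (intro isomorphicI[of "g \<cdot> in2"]) auto
  then have "tgt C g \<in> A" using assms tri_sub_iso by blast
  then show ?thesis
    using tri_sub_middle[OF assms(1) d] b assms by simp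
qed

text \<open>\<open>P\<close> is the cone of the map \<open>(v, -w)\<close> into the biproduct of the
  two targets. As a weak cokernel it has the existence half of the pushout property. Its membership
  in every triangulated subcategory containing the three corners is what later keeps it
  compact.\<close>

lemma weak_pushout:
  assumes "src C v = src C w"
  obtains P a b where "src C a = tgt C v" "tgt C a = P" "src C b = tgt C w" "tgt C b = P"
    "a \<cdot> v = b \<cdot> w"
    "\<And>s t. \<lbrakk>src C s = tgt C v; src C t = tgt C w; tgt C s = tgt C t; s \<cdot> v = t \<cdot> w\<rbrakk>
      \<Longrightarrow> \<exists>r. src C r = P \<and> tgt C r = tgt C t \<and> r \<cdot> a = s \<and> r \<cdot> b = t"
    "\<And>A. \<lbrakk>triangulated_subcategory C A; src C v \<in> A; tgt C v \<in> A; tgt C w \<in> A\<rbrakk> \<Longrightarrow> P \<in> A"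
proof -
  obtain B in1 in2 p1 p2 where b: "biproduct (tgt C v) (tgt C w) B in1 in2 p1 p2"
    by (rule binary_biproduct)
  note b' = b[unfolded biproduct_def]
  let ?f = "in1 \<cdot> v \<uplus> mneg C (in2 \<cdot> w)"
  obtain q h where d: "dtri C ?f q h" by (rule ex_cone)
  note e = dtri_ends[OF d]
  have fe: "src C ?f = src C v" "tgt C ?f = B" using b' assms by simp_all
  have "q \<cdot> (in1 \<cdot> v) \<uplus> mneg C (q \<cdot> (in2 \<cdot> w)) = mzero C (src C v) (tgt C q)"
    using dtri_comp_zero(1)[OF d] b' assms e by simp
  then have sq: "q \<cdot> (in1 \<cdot> v) = q \<cdot> (in2 \<cdot> w)"
    by (rule sub_eq_zero) (use b' e assms in auto)
  show thesis
  proof (rule that[of "q \<cdot> in1" "tgt C q" "q \<cdot> in2"])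
    show "(q \<cdot> in1) \<cdot> v = (q \<cdot> in2) \<cdot> w"
      using sq b' assms e by simp
  next
    fix s t assume st: "src C s = tgt C v" "src C t = tgt C w" "tgt C s = tgt C t" "s \<cdot> v = t \<cdot> w"
    let ?k = "s \<cdot> p1 \<uplus> t \<cdot> p2"
    have k: "src C ?k = B" "tgt C ?k = tgt C t" using b' st by auto
    have k1: "?k \<cdot> in1 = s" and k2: "?k \<cdot> in2 = t" using b' st by simp_all
    have "?k \<cdot> ?f = (?k \<cdot> in1) \<cdot> v \<uplus> mneg C ((?k \<cdot> in2) \<cdot> w)"
      using b' st assms k by (simp del: add_cmp)
    also have "\<dots> = mzero C (src C v) (tgt C t)"
      using k1 k2 st assms by simp
    finally obtain r where r: "src C r = tgt C q" "tgt C r = tgt C t" "r \<cdot> q = ?k"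
      using weak_coker[OF d, of ?k] k fe by auto
    have "r \<cdot> (q \<cdot> in1) = s" "r \<cdot> (q \<cdot> in2) = t"
      using r e b' fe k1 k2 by (simp_all add: cmp_reassoc[OF r(3)] del: add_cmp)
    with r show "\<exists>r. src C r = tgt C q \<and> tgt C r = tgt C t \<and> r \<cdot> (q \<cdot> in1) = s \<and> r \<cdot> (q \<cdot> in2) = t"
      by blast
  next
    fix A assume A: "triangulated_subcategory C A" "src C v \<in> A" "tgt C v \<in> A" "tgt C w \<in> A"
    then have "B \<in> A" using biproduct_sub[OF A(1) b] by blast
    then show "tgt C q \<in> A"
      using tri_sub_cone[OF A(1) d] A fe by simp
  qed (use b' e fe in auto)
qed

text \<open>Every object is isomorphic to a suspension, so a cocone on the suspended objects can be
  desuspended, treated by the universal property of \<open>S\<close>, and suspended again.\<close>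

lemma sobj_coproduct:
  assumes "is_coproduct C I X S \<iota>"
  shows "is_coproduct C I (\<lambda>i. sobj C (X i)) (sobj C S) (\<lambda>i. sarr C (\<iota> i))"
proof (rule is_coproductI)
  note inj = coproduct_inj[OF assms]
  show "\<And>i. i \<in> I \<Longrightarrow> src C (sarr C (\<iota> i)) = sobj C (X i) \<and> tgt C (sarr C (\<iota> i)) = sobj C S"
    using inj by simp
  fix Y f assume f: "\<And>i. i \<in> I \<Longrightarrow> src C (f i) = sobj C (X i) \<and> tgt C (f i) = Y"
  obtain W where "isomorphic C (sobj C W) Y" by (rule desuspend)
  then obtain \<phi> where \<phi>: "iso_arrow C \<phi>" "src C \<phi> = sobj C W" "tgt C \<phi> = Y"
    by (rule isomorphicE)
  obtain \<psi> where \<psi>: "src C \<psi> = Y" "tgt C \<psi> = sobj C W" "\<phi> \<cdot> \<psi> = idn C Y"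
    using \<phi> by (metis iso_arrowE)
  have "\<exists>g. src C g = X i \<and> tgt C g = W \<and> sarr C g = \<psi> \<cdot> f i" if "i \<in> I" for i
    by (rule sarr_surj[of "\<psi> \<cdot> f i" "X i" W]) (use f[OF that] \<psi> in auto)
  then obtain g where g: "\<And>i. i \<in> I \<Longrightarrow> src C (g i) = X i \<and> tgt C (g i) = W \<and> sarr C (g i) = \<psi> \<cdot> f i"
    by metis
  obtain k where k: "src C k = S" "tgt C k = W" "\<And>i. i \<in> I \<Longrightarrow> k \<cdot> \<iota> i = g i"
    using coproduct_desc[OF assms, of g W thesis] g by blast
  have "(\<phi> \<cdot> sarr C k) \<cdot> sarr C (\<iota> i) = f i" if i: "i \<in> I" for i
  proof -
    have "(\<phi> \<cdot> sarr C k) \<cdot> sarr C (\<iota> i) = \<phi> \<cdot> sarr C (k \<cdot> \<iota> i)"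
      using k(1,2) inj[OF i] \<phi> by simp
    also have "\<dots> = \<phi> \<cdot> (\<psi> \<cdot> f i)" using k(3)[OF i] g[OF i] by simp
    also have "\<dots> = f i" using \<phi> \<psi> f[OF i] by (simp add: cmp_reassoc[OF \<psi>(3)])
    finally show ?thesis .
  qed
  then show "\<exists>h. src C h = sobj C S \<and> tgt C h = Y \<and> (\<forall>i \<in> I. h \<cdot> sarr C (\<iota> i) = f i)"
    using k \<phi> by (intro exI[of _ "\<phi> \<cdot> sarr C k"]) auto
next
  note inj = coproduct_inj[OF assms]
  fix h k assume hk: "src C h = sobj C S" "src C k = sobj C S" "tgt C h = tgt C k"
    "\<And>i. i \<in> I \<Longrightarrow> h \<cdot> sarr C (\<iota> i) = k \<cdot> sarr C (\<iota> i)"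
  obtain W where "isomorphic C (sobj C W) (tgt C k)" by (rule desuspend)
  then have "isomorphic C (tgt C k) (sobj C W)" by (rule isomorphic_sym)
  then obtain \<psi> where \<psi>: "iso_arrow C \<psi>" "src C \<psi> = tgt C k" "tgt C \<psi> = sobj C W"
    by (rule isomorphicE)
  obtain h' where h': "src C h' = S" "tgt C h' = W" "sarr C h' = \<psi> \<cdot> h"
    by (rule sarr_surj[of "\<psi> \<cdot> h" S W]) (use hk \<psi> in auto)
  obtain k' where k': "src C k' = S" "tgt C k' = W" "sarr C k' = \<psi> \<cdot> k"
    by (rule sarr_surj[of "\<psi> \<cdot> k" S W]) (use hk \<psi> in auto)
  have "h' = k'"
  proof (rule coproduct_ext[OF assms])
    fix i assume i: "i \<in> I"
    show "h' \<cdot> \<iota> i = k' \<cdot> \<iota> i"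
    proof (rule sarr_inj)
      show "sarr C (h' \<cdot> \<iota> i) = sarr C (k' \<cdot> \<iota> i)"
        using h' k' inj[OF i] hk(1-3) hk(4)[OF i] \<psi> by simp
    qed (use h' k' inj[OF i] in auto)
  qed (use h' k' in auto)
  then have "\<psi> \<cdot> h = \<psi> \<cdot> k" using h' k' by simp
  then show "h = k" by (rule iso_cancel_left[OF \<psi>(1)]) (use hk \<psi> in auto)
qed

text \<open>That coproducts of triangles are triangles is not among the axioms. The comparison map
  \<open>W\<close> from the coproduct of the cones to the cone of \<open>F\<close> is shown to be
  split mono and right cancellable against zero; together these make it invertible.\<close>

lemma coproduct_of_triangles:
  assumes X: "is_coproduct C I X SX \<iota>X" and Y: "is_coproduct C I Y SY \<iota>Y"
    and Z: "is_coproduct C I Z SZ \<iota>Z"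
    and t: "\<And>i. i \<in> I \<Longrightarrow> dtri C (f i) (g i) (h i) \<and> src C (f i) = X i \<and> tgt C (f i) = Y i \<and> tgt C (g i) = Z i"
    and F: "src C F = SX" "tgt C F = SY" "\<And>i. i \<in> I \<Longrightarrow> F \<cdot> \<iota>X i = \<iota>Y i \<cdot> f i"
    and d: "dtri C F G H"
  shows "isomorphic C SZ (tgt C G)"
proof -
  note e = dtri_ends[OF d]
  note injX = coproduct_inj[OF X] and injY = coproduct_inj[OF Y] and injZ = coproduct_inj[OF Z]
  note SX = sobj_coproduct[OF X] and SY = sobj_coproduct[OF Y]
  have te: "src C (f i) = X i" "tgt C (f i) = Y i" "src C (g i) = Y i" "tgt C (g i) = Z i"
    "src C (h i) = Z i" "tgt C (h i) = sobj C (X i)" "dtri C (f i) (g i) (h i)" if "i \<in> I" for i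
    using t[OF that] dtri_ends[of "f i" "g i" "h i"] by auto
  have "\<exists>w. src C w = Z i \<and> tgt C w = tgt C G \<and> w \<cdot> g i = G \<cdot> \<iota>Y i \<and> sarr C (\<iota>X i) \<cdot> h i = H \<cdot> w"
    if i: "i \<in> I" for i
  proof -
    obtain w where "src C w = tgt C (g i)" "tgt C w = tgt C G" "w \<cdot> g i = G \<cdot> \<iota>Y i"
        "sarr C (\<iota>X i) \<cdot> h i = H \<cdot> w"
      by (rule dtri_fill[OF te(7)[OF i] d, of "\<iota>X i" "\<iota>Y i"])
        (use te[OF i] injX[OF i] injY[OF i] F(1,2) F(3)[OF i] in auto)
    then show ?thesis using te[OF i] by auto
  qed
  then obtain w where w: "\<And>i. i \<in> I \<Longrightarrow> src C (w i) = Z i \<and> tgt C (w i) = tgt C G \<and>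
      w i \<cdot> g i = G \<cdot> \<iota>Y i \<and> sarr C (\<iota>X i) \<cdot> h i = H \<cdot> w i"
    by metis
  obtain W where W: "src C W = SZ" "tgt C W = tgt C G" "\<And>i. i \<in> I \<Longrightarrow> W \<cdot> \<iota>Z i = w i"
    using coproduct_desc[OF Z, of w "tgt C G" thesis] w by blast
  \<comment> \<open>From \<open>k \<cdot> W = 0\<close> follows \<open>k \<cdot> G = 0\<close>, so
    \<open>k\<close> is \<open>k' \<cdot> H\<close>. On each summand \<open>k'\<close> kills
    \<open>h i\<close> and hence factors over \<open>sarr C (f i)\<close>. These factorizations
    assemble to \<open>M\<close> with \<open>k = M \<cdot> sarr C F \<cdot> H\<close>, and
    consecutive maps of a triangle compose to zero.\<close>
  have epi: "k = mzero C (tgt C G) (tgt C k)" if k: "src C k = tgt C G" "k \<cdot> W = mzero C SZ (tgt C k)" for k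
  proof -
    have kw: "k \<cdot> w i = mzero C (Z i) (tgt C k)" if i: "i \<in> I" for i
    proof -
      have "k \<cdot> w i = (k \<cdot> W) \<cdot> \<iota>Z i"
        using W(1,2) W(3)[OF i] injZ[OF i] k(1) by simp
      then show ?thesis using k injZ[OF i] by simp
    qed
    have "k \<cdot> G = mzero C SY (tgt C k)"
    proof (rule coproduct_ext[OF Y])
      fix i assume i: "i \<in> I"
      have "(k \<cdot> G) \<cdot> \<iota>Y i = k \<cdot> (w i \<cdot> g i)"
        using k(1) e F injY[OF i] w[OF i] by simp
      also have "\<dots> = (k \<cdot> w i) \<cdot> g i" using k(1) w[OF i] te[OF i] by simp
      also have "\<dots> = mzero C SY (tgt C k) \<cdot> \<iota>Y i"
        using kw[OF i] te[OF i] injY[OF i] by simp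
      finally show "(k \<cdot> G) \<cdot> \<iota>Y i = mzero C SY (tgt C k) \<cdot> \<iota>Y i" .
    qed (use k e F in auto)
    then obtain k' where k': "src C k' = sobj C SX" "tgt C k' = tgt C k" "k' \<cdot> H = k"
      using weak_coker2[OF d, of k] k F by auto
    have "\<exists>m. src C m = sobj C (Y i) \<and> tgt C m = tgt C k \<and> m \<cdot> sarr C (f i) = k' \<cdot> sarr C (\<iota>X i)"
      if i: "i \<in> I" for i
    proof -
      have "(k' \<cdot> sarr C (\<iota>X i)) \<cdot> h i = k' \<cdot> (H \<cdot> w i)"
        using k' injX[OF i] te[OF i] w[OF i] by simp
      also have "\<dots> = k \<cdot> w i" 
        using k' e w[OF i] F by (simp add: cmp_reassoc[OF k'(3)])
      finally have "(k' \<cdot> sarr C (\<iota>X i)) \<cdot> h i = mzero C (Z i) (tgt C k)" using kw[OF i] by simp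
      then obtain m where "src C m = sobj C (Y i)" "tgt C m = tgt C k"
          "m \<cdot> mneg C (sarr C (f i)) = k' \<cdot> sarr C (\<iota>X i)"
        using weak_coker2[OF dtri_rot[OF te(7)[OF i]], of "k' \<cdot> sarr C (\<iota>X i)"] k' injX[OF i] te[OF i]
        by auto
      then show ?thesis using te[OF i] by (intro exI[of _ "mneg C m"]) auto
    qed
    then obtain m where m: "\<And>i. i \<in> I \<Longrightarrow> src C (m i) = sobj C (Y i) \<and> tgt C (m i) = tgt C k \<and>
        m i \<cdot> sarr C (f i) = k' \<cdot> sarr C (\<iota>X i)" by metis
    obtain M where M: "src C M = sobj C SY" "tgt C M = tgt C k" "\<And>i. i \<in> I \<Longrightarrow> M \<cdot> sarr C (\<iota>Y i) = m i"
      using coproduct_desc[OF SY, of m "tgt C k" thesis] m by blast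
    have "k' = M \<cdot> sarr C F"
    proof (rule coproduct_ext[OF SX])
      fix i assume i: "i \<in> I"
      have "(M \<cdot> sarr C F) \<cdot> sarr C (\<iota>X i) = M \<cdot> sarr C (F \<cdot> \<iota>X i)"
        using M(1) F(1,2) injX[OF i] by simp
      also have "\<dots> = (M \<cdot> sarr C (\<iota>Y i)) \<cdot> sarr C (f i)"
        using M(1) F(3)[OF i] injY[OF i] te[OF i] by simp
      also have "\<dots> = k' \<cdot> sarr C (\<iota>X i)" using M(3)[OF i] m[OF i] by simp
      finally show "k' \<cdot> sarr C (\<iota>X i) = (M \<cdot> sarr C F) \<cdot> sarr C (\<iota>X i)" by simp
    qed (use k' M F in auto)
    then have "k = (M \<cdot> sarr C F) \<cdot> H" using k' by simp
    also have "\<dots> = M \<cdot> (sarr C F \<cdot> H)" using M F e by simp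
    finally show ?thesis using dtri_comp_zero(3)[OF d] M F e by simp
  qed
  have "\<exists>k. src C k = tgt C G \<and> tgt C k = SZ \<and> k \<cdot> W = idn C SZ"
  proof -
    obtain y where y: "src C y = SY" "tgt C y = SZ" "\<And>i. i \<in> I \<Longrightarrow> y \<cdot> \<iota>Y i = \<iota>Z i \<cdot> g i"
      using coproduct_desc[OF Y, of "\<lambda>i. \<iota>Z i \<cdot> g i" SZ thesis] te injZ by auto
    have "y \<cdot> F = mzero C SX SZ"
    proof (rule coproduct_ext[OF X])
      fix i assume i: "i \<in> I"
      have "(y \<cdot> F) \<cdot> \<iota>X i = (y \<cdot> \<iota>Y i) \<cdot> f i"
        using y(1,2) F(1,2) F(3)[OF i] injX[OF i] injY[OF i] te[OF i] by simp
      also have "\<dots> = \<iota>Z i \<cdot> (g i \<cdot> f i)"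
        using y(3)[OF i] injZ[OF i] te[OF i] by simp
      finally show "(y \<cdot> F) \<cdot> \<iota>X i = mzero C SX SZ \<cdot> \<iota>X i"
        using dtri_comp_zero(1)[OF te(7)[OF i]] te[OF i] injZ[OF i] injX[OF i] by simp
    qed (use y F in auto)
    then obtain k where k: "src C k = tgt C G" "tgt C k = SZ" "k \<cdot> G = y"
      using weak_coker[OF d, of y] y F by auto
    have "\<exists>m. src C m = sobj C (X i) \<and> tgt C m = SZ \<and> m \<cdot> h i = \<iota>Z i \<uplus> mneg C (k \<cdot> w i)" if i: "i \<in> I" for i
    proof -
      have "(k \<cdot> w i) \<cdot> g i = k \<cdot> (G \<cdot> \<iota>Y i)" using k w[OF i] te[OF i] by simp
      also have "\<dots> = \<iota>Z i \<cdot> g i"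
        using k e F injY[OF i] y(3)[OF i] by (simp add: cmp_reassoc[OF k(3)])
      finally have "(\<iota>Z i \<uplus> mneg C (k \<cdot> w i)) \<cdot> g i = mzero C (Y i) SZ"
        using k w[OF i] te[OF i] injZ[OF i] by simp
      then show ?thesis
        using weak_coker2[OF te(7)[OF i], of "\<iota>Z i \<uplus> mneg C (k \<cdot> w i)"] k(1,2) w[OF i] te[OF i] injZ[OF i]
        by (metis madd_ends mneg_ends cmp_ends)
    qed
    then obtain m where m: "\<And>i. i \<in> I \<Longrightarrow> src C (m i) = sobj C (X i) \<and> tgt C (m i) = SZ \<and>
        m i \<cdot> h i = \<iota>Z i \<uplus> mneg C (k \<cdot> w i)" by metis
    obtain M where M: "src C M = sobj C SX" "tgt C M = SZ" "\<And>i. i \<in> I \<Longrightarrow> M \<cdot> sarr C (\<iota>X i) = m i"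
      using coproduct_desc[OF SX, of m SZ thesis] m by blast
    \<comment> \<open>\<open>k\<close> is right only after restriction along each
      \<open>g i\<close>. The discrepancy on the i-th cone factors through \<open>h i\<close>, and
      adding a map through \<open>H\<close> removes it.\<close>
    let ?k = "k \<uplus> M \<cdot> H"
    have ke: "src C ?k = tgt C G" "tgt C ?k = SZ" using k M e F by auto
    have "?k \<cdot> W = idn C SZ"
    proof (rule coproduct_ext[OF Z])
      fix i assume i: "i \<in> I"
      have "M \<cdot> (H \<cdot> w i) = (M \<cdot> sarr C (\<iota>X i)) \<cdot> h i"
        using M(1) injX[OF i] te[OF i] w[OF i] by simp
      also have "\<dots> = \<iota>Z i \<uplus> mneg C (k \<cdot> w i)" using M(3)[OF i] m[OF i] by simp
      finally have "k \<cdot> w i \<uplus> M \<cdot> (H \<cdot> w i) = \<iota>Z i"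
        using k w[OF i] injZ[OF i] by simp
      then show "(?k \<cdot> W) \<cdot> \<iota>Z i = idn C SZ \<cdot> \<iota>Z i"
        using k M W(1,2) W(3)[OF i] e w[OF i] injZ[OF i] F by simp
    qed (use W ke in auto)
    then show ?thesis using ke by blast
  qed
  then obtain k where k: "src C k = tgt C G" "tgt C k = SZ" "k \<cdot> W = idn C SZ" by blast
  let ?r = "W \<cdot> k \<uplus> mneg C (idn C (tgt C G))"
  have "?r \<cdot> W = mzero C SZ (tgt C G)"
    using k W by simp
  then have "?r = mzero C (tgt C G) (tgt C G)"
    using epi[of ?r] k W by simp
  then have "W \<cdot> k = idn C (tgt C G)"
    by (rule sub_eq_zero) (use k W in auto)
  with k W show ?thesis
    by (intro isomorphicI[of W] iso_arrowI[of k]) auto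
qed

end

section \<open>Tensor triangulated categories\<close>

context closed_symmetric_monoidal_category
begin

abbreviation unit_object (\<open>\<one>\<close>) where "\<one> \<equiv> tunit C"

lemma tarr_ends [simp]:
  "src C (f \<boxtimes> g) = src C f \<star> src C g" "tgt C (f \<boxtimes> g) = tgt C f \<star> tgt C g"
  using tarr_Hom[of f "src C f" "tgt C f" g "src C g" "tgt C g"] by auto

declare tarr_idn [simp]

lemma tarr_merge:
  "\<lbrakk>tgt C f = src C f'; tgt C g = src C g'\<rbrakk> \<Longrightarrow> (f' \<boxtimes> g') \<cdot> (f \<boxtimes> g) = (f' \<cdot> f) \<boxtimes> (g' \<cdot> g)"
  using tarr_cmp[of f "src C f" "src C f'" f' "tgt C f'" g "src C g" "src C g'" g' "tgt C g'"] by simp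

lemma tarr_merge_cmp:
  "\<lbrakk>tgt C f = src C f'; tgt C g = src C g'; tgt C x = src C f \<star> src C g\<rbrakk>
    \<Longrightarrow> (f' \<boxtimes> g') \<cdot> ((f \<boxtimes> g) \<cdot> x) = ((f' \<cdot> f) \<boxtimes> (g' \<cdot> g)) \<cdot> x"
  by (rule cmp_reassoc[OF tarr_merge]) auto

lemma struct_ends [simp]:
  "src C (assoc C X Y Z) = (X \<star> Y) \<star> Z" "tgt C (assoc C X Y Z) = X \<star> (Y \<star> Z)"
  "src C (lunit C X) = \<one> \<star> X" "tgt C (lunit C X) = X"
  "src C (runit C X) = X \<star> \<one>" "tgt C (runit C X) = X"
  "src C (braid C X Y) = X \<star> Y" "tgt C (braid C X Y) = Y \<star> X"
  using assoc_Hom[of X Y Z] lunit_Hom[of X] runit_Hom[of X] braid_Hom[of X Y] by simp_all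

lemma braid_iso [simp]: "iso_arrow C (braid C X Y)"
  by (rule iso_arrowI[of "braid C Y X"]) (use braid_symmetric in auto)

declare assoc_iso [simp] lunit_iso [simp] runit_iso [simp]

lemma assoc_nat:
  "assoc C (tgt C f) (tgt C g) (tgt C h) \<cdot> ((f \<boxtimes> g) \<boxtimes> h)
    = (f \<boxtimes> (g \<boxtimes> h)) \<cdot> assoc C (src C f) (src C g) (src C h)"
  by (rule assoc_natural) auto

lemma braid_nat: "braid C (tgt C f) (tgt C g) \<cdot> (f \<boxtimes> g) = (g \<boxtimes> f) \<cdot> braid C (src C f) (src C g)"
  by (rule braid_natural) auto

lemma lunit_nat: "lunit C (tgt C f) \<cdot> (idn C \<one> \<boxtimes> f) = f \<cdot> lunit C (src C f)"
  by (rule lunit_natural) auto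

lemma runit_nat: "runit C (tgt C f) \<cdot> (f \<boxtimes> idn C \<one>) = f \<cdot> runit C (src C f)"
  by (rule runit_natural) auto

lemma tarr_iso:
  assumes "iso_arrow C f" "iso_arrow C g" shows "iso_arrow C (f \<boxtimes> g)"
proof -
  obtain f' where f': "src C f' = tgt C f" "tgt C f' = src C f"
    "f' \<cdot> f = idn C (src C f)" "f \<cdot> f' = idn C (tgt C f)"
    using assms(1) by (rule iso_arrowE)
  obtain g' where g': "src C g' = tgt C g" "tgt C g' = src C g"
    "g' \<cdot> g = idn C (src C g)" "g \<cdot> g' = idn C (tgt C g)"
    using assms(2) by (rule iso_arrowE)
  show ?thesis
    by (rule iso_arrowI[of "f' \<boxtimes> g'"]) (use f' g' in \<open>auto simp: tarr_merge\<close>)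
qed

lemma tobj_cong: "isomorphic C X X' \<Longrightarrow> isomorphic C Y Y' \<Longrightarrow> isomorphic C (X \<star> Y) (X' \<star> Y')"
  by (metis isomorphicE isomorphicI tarr_ends tarr_iso)

lemma tobj_assoc: "isomorphic C ((X \<star> Y) \<star> Z) (X \<star> (Y \<star> Z))"
  by (rule isomorphicI[of "assoc C X Y Z"]) auto

lemma tobj_commute: "isomorphic C (X \<star> Y) (Y \<star> X)"
  by (rule isomorphicI[of "braid C X Y"]) auto

lemma tobj_lunit: "isomorphic C (\<one> \<star> X) X"
  by (rule isomorphicI[of "lunit C X"]) auto

lemma tobj_runit: "isomorphic C (X \<star> \<one>) X"
  by (rule isomorphicI[of "runit C X"]) auto

lemma tobj_left_commute: "isomorphic C (X \<star> (Y \<star> Z)) (Y \<star> (X \<star> Z))"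
proof -
  have "isomorphic C (X \<star> (Y \<star> Z)) ((X \<star> Y) \<star> Z)"
    by (rule isomorphic_sym[OF tobj_assoc])
  also have "isomorphic C ((X \<star> Y) \<star> Z) ((Y \<star> X) \<star> Z)"
    by (rule tobj_cong[OF tobj_commute isomorphic_refl])
  also have "isomorphic C ((Y \<star> X) \<star> Z) (Y \<star> (X \<star> Z))"
    by (rule tobj_assoc)
  finally show ?thesis .
qed

lemma tobj_right_commute: "isomorphic C ((X \<star> Y) \<star> Z) ((X \<star> Z) \<star> Y)"
proof -
  have "isomorphic C ((X \<star> Y) \<star> Z) (X \<star> (Y \<star> Z))"
    by (rule tobj_assoc)
  also have "isomorphic C (X \<star> (Y \<star> Z)) (X \<star> (Z \<star> Y))"
    by (rule tobj_cong[OF isomorphic_refl tobj_commute])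
  also have "isomorphic C (X \<star> (Z \<star> Y)) ((X \<star> Z) \<star> Y)"
    by (rule isomorphic_sym[OF tobj_assoc])
  finally show ?thesis .
qed

lemma iso_whisker_assoc:
  "iso_arrow C (f \<boxtimes> idn C (X \<star> Y)) \<longleftrightarrow> iso_arrow C ((f \<boxtimes> idn C X) \<boxtimes> idn C Y)"
proof -
  have eq: "assoc C (tgt C f) X Y \<cdot> ((f \<boxtimes> idn C X) \<boxtimes> idn C Y) = (f \<boxtimes> idn C (X \<star> Y)) \<cdot> assoc C (src C f) X Y"
    using assoc_nat[of f "idn C X" "idn C Y"] by simp
  show ?thesis
  proof
    assume "iso_arrow C (f \<boxtimes> idn C (X \<star> Y))"
    then have "iso_arrow C ((f \<boxtimes> idn C (X \<star> Y)) \<cdot> assoc C (src C f) X Y)"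
      by (intro iso_cmp) auto
    then show "iso_arrow C ((f \<boxtimes> idn C X) \<boxtimes> idn C Y)"
      unfolding eq[symmetric] by (rule iso_cmp_cancel_left) auto
  next
    assume "iso_arrow C ((f \<boxtimes> idn C X) \<boxtimes> idn C Y)"
    then have "iso_arrow C (assoc C (tgt C f) X Y \<cdot> ((f \<boxtimes> idn C X) \<boxtimes> idn C Y))"
      by (intro iso_cmp) auto
    then show "iso_arrow C (f \<boxtimes> idn C (X \<star> Y))"
      unfolding eq by (rule iso_cmp_cancel_right) auto
  qed
qed

lemma iso_whisker_tensor:
  "iso_arrow C (f \<boxtimes> idn C X) \<Longrightarrow> iso_arrow C (f \<boxtimes> idn C (X \<star> Y))"
  by (simp add: iso_whisker_assoc tarr_iso)

lemma iso_whisker_commute: "iso_arrow C (idn C X \<boxtimes> f) \<longleftrightarrow> iso_arrow C (f \<boxtimes> idn C X)"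
proof -
  have "iso_arrow C (idn C X \<boxtimes> f)" if "iso_arrow C (f \<boxtimes> idn C X)" for f X
  proof -
    have "iso_arrow C ((f \<boxtimes> idn C X) \<cdot> braid C X (src C f))"
      using that by (intro iso_cmp) auto
    moreover have "braid C X (tgt C f) \<cdot> (idn C X \<boxtimes> f) = (f \<boxtimes> idn C X) \<cdot> braid C X (src C f)"
      using braid_nat[of "idn C X" f] by simp
    ultimately have "iso_arrow C (braid C X (tgt C f) \<cdot> (idn C X \<boxtimes> f))" by simp
    then show ?thesis by (rule iso_cmp_cancel_left) auto
  qed
  moreover have "iso_arrow C (f \<boxtimes> idn C X)" if "iso_arrow C (idn C X \<boxtimes> f)" for f X
  proof -
    have "iso_arrow C ((idn C X \<boxtimes> f) \<cdot> braid C (src C f) X)"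
      using that by (intro iso_cmp) auto
    moreover have "braid C (tgt C f) X \<cdot> (f \<boxtimes> idn C X) = (idn C X \<boxtimes> f) \<cdot> braid C (src C f) X"
      using braid_nat[of f "idn C X"] by simp
    ultimately have "iso_arrow C (braid C (tgt C f) X \<cdot> (f \<boxtimes> idn C X))" by simp
    then show ?thesis by (rule iso_cmp_cancel_left) auto
  qed
  ultimately show ?thesis by blast
qed

lemma iso_whisker_iso:
  assumes "iso_arrow C (f \<boxtimes> idn C X)" "isomorphic C X Y"
  shows "iso_arrow C (f \<boxtimes> idn C Y)"
proof -
  obtain k where k: "iso_arrow C k" "src C k = X" "tgt C k = Y"
    using assms(2) by (rule isomorphicE)
  have "iso_arrow C ((idn C (tgt C f) \<boxtimes> k) \<cdot> (f \<boxtimes> idn C X))"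
    by (rule iso_cmp[OF assms(1)]) (use k in \<open>auto intro: tarr_iso\<close>)
  also have "(idn C (tgt C f) \<boxtimes> k) \<cdot> (f \<boxtimes> idn C X) = (f \<boxtimes> idn C Y) \<cdot> (idn C (src C f) \<boxtimes> k)"
    using k by (simp add: tarr_merge)
  finally show ?thesis
    by (rule iso_cmp_cancel_right) (use k in \<open>auto intro: tarr_iso\<close>)
qed

text \<open>Tensoring with \<open>Y\<close> has a right adjoint, the internal Hom, and left adjoints
  preserve coproducts. The adjunction is used map by map: curry into \<open>H\<close>, apply the
  universal property of \<open>S\<close>, uncurry.\<close>

lemma tensor_coproduct:
  assumes "is_coproduct C I X S \<iota>"
  shows "is_coproduct C I (\<lambda>i. X i \<star> Y) (S \<star> Y) (\<lambda>i. \<iota> i \<boxtimes> idn C Y)"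
proof (rule is_coproductI)
  note inj = coproduct_inj[OF assms]
  show "\<And>i. i \<in> I \<Longrightarrow> src C (\<iota> i \<boxtimes> idn C Y) = X i \<star> Y \<and> tgt C (\<iota> i \<boxtimes> idn C Y) = S \<star> Y"
    using inj by simp
  fix W f assume f: "\<And>i. i \<in> I \<Longrightarrow> src C (f i) = X i \<star> Y \<and> tgt C (f i) = W"
  obtain H ev where ev: "ev \<in> Hom C (H \<star> Y) W"
    and uni: "\<forall>Z. \<forall>f \<in> Hom C (Z \<star> Y) W. \<exists>!g. g \<in> Hom C Z H \<and> ev \<cdot> (g \<boxtimes> idn C Y) = f"
    using internal_hom by blast
  have "\<exists>g. src C g = X i \<and> tgt C g = H \<and> ev \<cdot> (g \<boxtimes> idn C Y) = f i" if "i \<in> I" for i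
  proof -
    have "f i \<in> Hom C (X i \<star> Y) W" using f[OF that] by simp
    then have "\<exists>g. g \<in> Hom C (X i) H \<and> ev \<cdot> (g \<boxtimes> idn C Y) = f i"
      using uni by (blast dest: ex1_implies_ex)
    then show ?thesis by simp
  qed
  then obtain g where g: "\<And>i. i \<in> I \<Longrightarrow> src C (g i) = X i \<and> tgt C (g i) = H \<and> ev \<cdot> (g i \<boxtimes> idn C Y) = f i"
    by metis
  obtain k where k: "src C k = S" "tgt C k = H" "\<And>i. i \<in> I \<Longrightarrow> k \<cdot> \<iota> i = g i"
    using coproduct_desc[OF assms, of g H thesis] g by blast
  have "(ev \<cdot> (k \<boxtimes> idn C Y)) \<cdot> (\<iota> i \<boxtimes> idn C Y) = f i" if i: "i \<in> I" for i
    using ev k(1,2) k(3)[OF i] g[OF i] inj[OF i] by (simp add: tarr_merge)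
  then show "\<exists>h. src C h = S \<star> Y \<and> tgt C h = W \<and> (\<forall>i \<in> I. h \<cdot> (\<iota> i \<boxtimes> idn C Y) = f i)"
    using k ev by (intro exI[of _ "ev \<cdot> (k \<boxtimes> idn C Y)"]) auto
next
  note inj = coproduct_inj[OF assms]
  fix h k assume hk: "src C h = S \<star> Y" "src C k = S \<star> Y" "tgt C h = tgt C k"
    "\<And>i. i \<in> I \<Longrightarrow> h \<cdot> (\<iota> i \<boxtimes> idn C Y) = k \<cdot> (\<iota> i \<boxtimes> idn C Y)"
  define W where "W = tgt C k"
  obtain H ev where ev: "ev \<in> Hom C (H \<star> Y) W"
    and uni: "\<forall>Z. \<forall>f \<in> Hom C (Z \<star> Y) W. \<exists>!g. g \<in> Hom C Z H \<and> ev \<cdot> (g \<boxtimes> idn C Y) = f"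
    using internal_hom by blast
  have curry: "\<exists>g. src C g = Z \<and> tgt C g = H \<and> ev \<cdot> (g \<boxtimes> idn C Y) = f"
    if "src C f = Z \<star> Y" "tgt C f = W" for f Z
  proof -
    have "f \<in> Hom C (Z \<star> Y) W" using that by simp
    then have "\<exists>g. g \<in> Hom C Z H \<and> ev \<cdot> (g \<boxtimes> idn C Y) = f"
      using uni by (blast dest: ex1_implies_ex)
    then show ?thesis by simp
  qed
  have uncurry: "g = g'" if "src C g = Z" "src C g' = Z" "tgt C g = H" "tgt C g' = H"
      "ev \<cdot> (g \<boxtimes> idn C Y) = ev \<cdot> (g' \<boxtimes> idn C Y)" for g g' Z
  proof -
    have "ev \<cdot> (g \<boxtimes> idn C Y) \<in> Hom C (Z \<star> Y) W" using ev that by simp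
    then have ex1: "\<exists>!g''. g'' \<in> Hom C Z H \<and> ev \<cdot> (g'' \<boxtimes> idn C Y) = ev \<cdot> (g \<boxtimes> idn C Y)"
      using uni by blast
    show ?thesis
      by (rule ex1E[OF ex1]) (use that in \<open>metis Hom_iff\<close>)
  qed
  obtain h' where h': "src C h' = S" "tgt C h' = H" "ev \<cdot> (h' \<boxtimes> idn C Y) = h"
    using curry[of h S] hk W_def by auto
  obtain k' where k': "src C k' = S" "tgt C k' = H" "ev \<cdot> (k' \<boxtimes> idn C Y) = k"
    using curry[of k S] hk W_def by auto
  have "h' = k'"
  proof (rule coproduct_ext[OF assms])
    fix i assume i: "i \<in> I"
    have "ev \<cdot> ((h' \<cdot> \<iota> i) \<boxtimes> idn C Y) = (ev \<cdot> (h' \<boxtimes> idn C Y)) \<cdot> (\<iota> i \<boxtimes> idn C Y)"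
      using ev h'(1,2) inj[OF i] by (simp add: tarr_merge)
    also have "\<dots> = (ev \<cdot> (k' \<boxtimes> idn C Y)) \<cdot> (\<iota> i \<boxtimes> idn C Y)"
      using hk(4)[OF i] h'(3) k'(3) by simp
    also have "\<dots> = ev \<cdot> ((k' \<cdot> \<iota> i) \<boxtimes> idn C Y)"
      using ev k'(1,2) inj[OF i] by (simp add: tarr_merge)
    finally show "h' \<cdot> \<iota> i = k' \<cdot> \<iota> i"
      by - (rule uncurry[of _ "X i"], use h' k' inj[OF i] in auto)
  qed (use h' k' in auto)
  then show "h = k" using h' k' by simp
qed

lemma unit_whisker_faithful:
  assumes "idn C \<one> \<boxtimes> f = idn C \<one> \<boxtimes> g" "src C f = src C g" "tgt C f = tgt C g"
  shows "f = g"
proof (rule iso_cancel_right[OF lunit_iso])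
  show "f \<cdot> lunit C (src C g) = g \<cdot> lunit C (src C g)"
    using lunit_nat[of f] lunit_nat[of g] assms by simp
qed (use assms in auto)

text \<open>The coherence laws of Kelly, needed to see that the unit object is its own dual.\<close>

lemma lunit_tobj: "lunit C (X \<star> Y) \<cdot> assoc C \<one> X Y = lunit C X \<boxtimes> idn C Y"
proof (rule unit_whisker_faithful)
  let ?I = "idn C \<one>" and ?a = "assoc C"
  let ?z = "?a \<one> (\<one> \<star> X) Y \<cdot> (?a \<one> \<one> X \<boxtimes> idn C Y)"
  have iso: "iso_arrow C ?z" by (intro iso_cmp tarr_iso) auto
  have pent: "?a \<one> \<one> (X \<star> Y) \<cdot> ?a (\<one> \<star> \<one>) X Y = (?I \<boxtimes> ?a \<one> X Y) \<cdot> ?z"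
    using pentagon[of \<one> \<one> X Y] by simp
  have "(?I \<boxtimes> (lunit C (X \<star> Y) \<cdot> ?a \<one> X Y)) \<cdot> ?z = (?I \<boxtimes> lunit C (X \<star> Y)) \<cdot> ((?I \<boxtimes> ?a \<one> X Y) \<cdot> ?z)"
    by (simp add: tarr_merge_cmp)
  also have "\<dots> = (?I \<boxtimes> lunit C (X \<star> Y)) \<cdot> (?a \<one> \<one> (X \<star> Y) \<cdot> ?a (\<one> \<star> \<one>) X Y)"
    using pent by simp
  also have "\<dots> = (runit C \<one> \<boxtimes> idn C (X \<star> Y)) \<cdot> ?a (\<one> \<star> \<one>) X Y"
    by (rule cmp_reassoc[OF triangle]) auto
  also have "\<dots> = ?a \<one> X Y \<cdot> ((runit C \<one> \<boxtimes> idn C X) \<boxtimes> idn C Y)"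
    using assoc_nat[of "runit C \<one>" "idn C X" "idn C Y"] by simp
  also have "(runit C \<one> \<boxtimes> idn C X) \<boxtimes> idn C Y
      = ((?I \<boxtimes> lunit C X) \<boxtimes> idn C Y) \<cdot> (?a \<one> \<one> X \<boxtimes> idn C Y)"
    using triangle[of \<one> X] by (simp add: tarr_merge)
  also have "?a \<one> X Y \<cdot> \<dots> = (?a \<one> X Y \<cdot> ((?I \<boxtimes> lunit C X) \<boxtimes> idn C Y)) \<cdot> (?a \<one> \<one> X \<boxtimes> idn C Y)"
    by simp
  also have "?a \<one> X Y \<cdot> ((?I \<boxtimes> lunit C X) \<boxtimes> idn C Y) = (?I \<boxtimes> (lunit C X \<boxtimes> idn C Y)) \<cdot> ?a \<one> (\<one> \<star> X) Y"
    using assoc_nat[of ?I "lunit C X" "idn C Y"] by simp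
  finally have "(?I \<boxtimes> (lunit C (X \<star> Y) \<cdot> ?a \<one> X Y)) \<cdot> ?z = (?I \<boxtimes> (lunit C X \<boxtimes> idn C Y)) \<cdot> ?z"
    by simp
  then show "?I \<boxtimes> (lunit C (X \<star> Y) \<cdot> ?a \<one> X Y) = ?I \<boxtimes> (lunit C X \<boxtimes> idn C Y)"
    by (rule iso_cancel_right[OF iso]) auto
qed auto

text \<open>Naturality of the left unitor at itself identifies
  \<open>idn C \<one> \<boxtimes> lunit C \<one>\<close> with
  \<open>lunit C (\<one> \<star> \<one>)\<close>. The previous law and the triangle axiom then make
  both unitors agree after tensoring with the unit, and naturality of the right unitor removes that
  factor.\<close>

lemma lunit_unit: "lunit C \<one> = runit C \<one>"
proof -
  have "lunit C \<one> \<cdot> (idn C \<one> \<boxtimes> lunit C \<one>) = lunit C \<one> \<cdot> lunit C (\<one> \<star> \<one>)"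
    using lunit_nat[of "lunit C \<one>"] by simp
  then have l: "idn C \<one> \<boxtimes> lunit C \<one> = lunit C (\<one> \<star> \<one>)"
    by (rule iso_cancel_left[OF lunit_iso]) auto
  have "lunit C \<one> \<boxtimes> idn C \<one> = runit C \<one> \<boxtimes> idn C \<one>"
    using lunit_tobj[of \<one> \<one>] triangle[of \<one> \<one>] l by simp
  then have "lunit C \<one> \<cdot> runit C (\<one> \<star> \<one>) = runit C \<one> \<cdot> runit C (\<one> \<star> \<one>)"
    using runit_nat[of "lunit C \<one>"] runit_nat[of "runit C \<one>"] by simp
  then show ?thesis by (rule iso_cancel_right[OF runit_iso]) auto
qed

text \<open>The unit is its own dual: the left unitor is the evaluation and its inverse
  \<open>k\<close> the coevaluation. Both zigzag identities reduce to the triangle axiom because the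
  two unitors of the unit agree. Compactness of the unit comes from here.\<close>

lemma rigid_unit: "rigid C \<one>"
proof -
  obtain k where k: "src C k = \<one>" "tgt C k = \<one> \<star> \<one>" "k \<cdot> lunit C \<one> = idn C (\<one> \<star> \<one>)"
      "lunit C \<one> \<cdot> k = idn C \<one>"
    using iso_arrowE[OF lunit_iso[of \<one>]] by (metis struct_ends(3,4))
  note tri = triangle[of \<one> \<one>, unfolded lunit_unit[symmetric]]
  note inv = arrow_inv[OF assoc_iso[of \<one> \<one> \<one>]]
  have 1: "runit C \<one> \<cdot> (idn C \<one> \<boxtimes> lunit C \<one>) \<cdot> assoc C \<one> \<one> \<one> \<cdot> (k \<boxtimes> idn C \<one>) = lunit C \<one>"
    using k by (simp add: cmp_reassoc[OF tri] tarr_merge lunit_unit[symmetric])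
  have "(lunit C \<one> \<boxtimes> idn C \<one>) \<cdot> arrow_inv C (assoc C \<one> \<one> \<one>)
      = ((idn C \<one> \<boxtimes> lunit C \<one>) \<cdot> assoc C \<one> \<one> \<one>) \<cdot> arrow_inv C (assoc C \<one> \<one> \<one>)"
    using tri by simp
  also have "\<dots> = idn C \<one> \<boxtimes> lunit C \<one>"
    using inv by simp
  finally have tri': "(lunit C \<one> \<boxtimes> idn C \<one>) \<cdot> arrow_inv C (assoc C \<one> \<one> \<one>) = idn C \<one> \<boxtimes> lunit C \<one>" .
  have 2: "lunit C \<one> \<cdot> (lunit C \<one> \<boxtimes> idn C \<one>) \<cdot> arrow_inv C (assoc C \<one> \<one> \<one>) \<cdot> (idn C \<one> \<boxtimes> k) = runit C \<one>"
    using k inv by (simp add: cmp_reassoc[OF tri'] tarr_merge lunit_unit[symmetric])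
  show ?thesis
    unfolding rigid_def
    by (intro exI[of _ \<one>] bexI[of _ "lunit C \<one>"] bexI[of _ k] conjI 1 2) (use k in auto)
qed

lemma rigidE:
  assumes "rigid C X"
  obtains D ev coev where "src C ev = D \<star> X" "tgt C ev = \<one>" "src C coev = \<one>" "tgt C coev = X \<star> D"
    "runit C X \<cdot> ((idn C X \<boxtimes> ev) \<cdot> (assoc C X D X \<cdot> (coev \<boxtimes> idn C X))) = lunit C X"
proof -
  from assms[unfolded rigid_def] obtain D ev coev where h: "ev \<in> Hom C (D \<star> X) \<one>"
     "coev \<in> Hom C \<one> (X \<star> D)"
     "runit C X \<cdot> (idn C X \<boxtimes> ev) \<cdot> assoc C X D X \<cdot> (coev \<boxtimes> idn C X) = lunit C X"
    by blast
  then show thesis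
    by (intro that[of ev D coev]) auto
qed

text \<open>A zigzag identity makes the composite \<open>?y\<close> invertible, and the braiding
  rewrites it with \<open>ev \<boxtimes> idn C X\<close> as the factor applied last. A right inverse
  of the whole therefore splits that factor. This is the input for finite localization.\<close>

lemma rigid_counit_split_epi:
  assumes "rigid C X"
  obtains D ev s where "src C ev = D \<star> X" "tgt C ev = \<one>"
    "src C s = \<one> \<star> X" "tgt C s = (D \<star> X) \<star> X" "(ev \<boxtimes> idn C X) \<cdot> s = idn C (\<one> \<star> X)"
proof -
  from assms obtain D ev coev where r: "src C ev = D \<star> X" "tgt C ev = \<one>" "src C coev = \<one>" "tgt C coev = X \<star> D"
    "runit C X \<cdot> ((idn C X \<boxtimes> ev) \<cdot> (assoc C X D X \<cdot> (coev \<boxtimes> idn C X))) = lunit C X"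
    by (rule rigidE)
  let ?y = "(idn C X \<boxtimes> ev) \<cdot> (assoc C X D X \<cdot> (coev \<boxtimes> idn C X))"
  have "iso_arrow C ?y"
    by (rule iso_cmp_cancel_left[of "runit C X"]) (use r in auto)
  then have "iso_arrow C (braid C X \<one> \<cdot> ?y)"
    by (rule iso_cmp) (use r in auto)
  also have "braid C X \<one> \<cdot> ?y = (ev \<boxtimes> idn C X) \<cdot> (braid C X (D \<star> X) \<cdot> (assoc C X D X \<cdot> (coev \<boxtimes> idn C X)))"
  proof -
    have b: "braid C X \<one> \<cdot> (idn C X \<boxtimes> ev) = (ev \<boxtimes> idn C X) \<cdot> braid C X (D \<star> X)"
      using braid_nat[of "idn C X" ev] r by simp
    show ?thesis using r by (simp add: cmp_reassoc[OF b])
  qed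
  finally obtain k where "src C k = \<one> \<star> X" "tgt C k = \<one> \<star> X"
    "((ev \<boxtimes> idn C X) \<cdot> (braid C X (D \<star> X) \<cdot> (assoc C X D X \<cdot> (coev \<boxtimes> idn C X)))) \<cdot> k = idn C (\<one> \<star> X)"
    by (rule iso_arrowE) (use r in auto)
  then show thesis
    by (intro that[of ev D "(braid C X (D \<star> X) \<cdot> (assoc C X D X \<cdot> (coev \<boxtimes> idn C X))) \<cdot> k"])
      (use r in auto)
qed

end

section \<open>Exactness of the tensor product\<close>

context tt_category
begin

lemma tarr_add_left [simp]:
  "\<lbrakk>src C f = src C f'; tgt C f = tgt C f'\<rbrakk> \<Longrightarrow> (f \<uplus> f') \<boxtimes> g = (f \<boxtimes> g) \<uplus> (f' \<boxtimes> g)"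
  using tarr_madd_left[of f "src C f'" "tgt C f'" f' g "src C g" "tgt C g"] by simp


lemma tarr_zero_left [simp]: "mzero C X Y \<boxtimes> g = mzero C (X \<star> src C g) (Y \<star> tgt C g)"
proof -
  have "mzero C X Y \<boxtimes> g \<uplus> mzero C X Y \<boxtimes> g = mzero C X Y \<boxtimes> g"
    by (subst tarr_add_left[symmetric]) auto
  then show ?thesis using add_self_zero[of "mzero C X Y \<boxtimes> g"] by simp
qed


lemma tarr_neg_left [simp]: "mneg C f \<boxtimes> g = mneg C (f \<boxtimes> g)"
proof (rule mneg_unique)
  show "f \<boxtimes> g \<uplus> mneg C f \<boxtimes> g = mzero C (src C (f \<boxtimes> g)) (tgt C (f \<boxtimes> g))"
    by (subst tarr_add_left[symmetric]) auto
qed auto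

lemma zero_tensor: "zero_object C X \<Longrightarrow> zero_object C (X \<star> Y)"
  unfolding zero_object_iff using tarr_zero_left[of X X "idn C Y"] tarr_idn[of X Y] by simp

lemma zero_tensor_commute: "zero_object C (X \<star> Y) \<longleftrightarrow> zero_object C (Y \<star> X)"
  by (rule zero_object_cong[OF tobj_commute])

lemma zero_tensor_right: "zero_object C Y \<Longrightarrow> zero_object C (X \<star> Y)"
  using zero_tensor zero_tensor_commute by blast

lemma tsusp_ends [simp]:
  "src C (tsusp C X Y) = sobj C X \<star> Y" "tgt C (tsusp C X Y) = sobj C (X \<star> Y)"
  using tsusp_Hom[of X Y] by simp_all

lemma tobj_sobj_left: "isomorphic C (sobj C X \<star> Y) (sobj C (X \<star> Y))"
  using tsusp_iso by (intro isomorphicI[of "tsusp C X Y"]) auto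

lemma tobj_sobj_swap: "isomorphic C (sobj C X \<star> Y) (X \<star> sobj C Y)"
proof -
  have "isomorphic C (sobj C X \<star> Y) (sobj C (X \<star> Y))"
    by (rule tobj_sobj_left)
  also have "isomorphic C \<dots> (sobj C (Y \<star> X))"
    by (rule sobj_isomorphic[OF tobj_commute])
  also have "isomorphic C \<dots> (sobj C Y \<star> X)"
    by (rule isomorphic_sym[OF tobj_sobj_left])
  also have "isomorphic C \<dots> (X \<star> sobj C Y)"
    by (rule tobj_commute)
  finally show ?thesis .
qed

lemma tensor_dtri:
  "dtri C f g h \<Longrightarrow> dtri C (f \<boxtimes> idn C Y) (g \<boxtimes> idn C Y) (tsusp C (src C f) Y \<cdot> (h \<boxtimes> idn C Y))"
  using tarr_exact[of f g h "src C f" "tgt C f"] by simp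

lemma zero_cone_tensor:
  assumes "dtri C f g h"
  shows "zero_object C (tgt C g \<star> Y) \<longleftrightarrow> iso_arrow C (f \<boxtimes> idn C Y)"
  using zero_cone_iff[OF tensor_dtri[OF assms, of Y]] by simp

text \<open>For the triangle of a smashing ideal this is the basic dictionary: the acyclic part of
  \<open>Y\<close> vanishes exactly when \<open>Y\<close> agrees with its localization. Rotation
  moves the fibre into the position of a cone, at the cost of a suspension.\<close>

lemma zero_fibre_tensor:
  assumes "dtri C e f d"
  shows "zero_object C (src C e \<star> Y) \<longleftrightarrow> iso_arrow C (f \<boxtimes> idn C Y)"
proof -
  have "zero_object C (sobj C (src C e) \<star> Y) \<longleftrightarrow> iso_arrow C (f \<boxtimes> idn C Y)"
    using zero_cone_tensor[OF dtri_rot[OF assms], of Y] dtri_ends[OF assms] by simp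
  then show ?thesis using zero_object_cong[OF tobj_sobj_left] by simp
qed

lemma zero_whisker_tensor:
  assumes "f \<boxtimes> idn C X = mzero C (src C f \<star> X) (tgt C f \<star> X)"
  shows "f \<boxtimes> idn C (X \<star> Y) = mzero C (src C f \<star> (X \<star> Y)) (tgt C f \<star> (X \<star> Y))"
proof (rule iso_cancel_right[OF assoc_iso])
  show "(f \<boxtimes> idn C (X \<star> Y)) \<cdot> assoc C (src C f) X Y
      = mzero C (src C f \<star> (X \<star> Y)) (tgt C f \<star> (X \<star> Y)) \<cdot> assoc C (src C f) X Y"
    using assoc_nat[of f "idn C X" "idn C Y"] assms by simp
qed auto

lemma zero_whisker_iso:
  assumes "f \<boxtimes> idn C X = mzero C (src C f \<star> X) (tgt C f \<star> X)" "isomorphic C X Y"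
  shows "f \<boxtimes> idn C Y = mzero C (src C f \<star> Y) (tgt C f \<star> Y)"
proof -
  obtain k where k: "iso_arrow C k" "src C k = X" "tgt C k = Y"
    using assms(2) by (rule isomorphicE)
  show ?thesis
  proof (rule iso_cancel_right)
    show "iso_arrow C (idn C (src C f) \<boxtimes> k)" using k by (intro tarr_iso) auto
    have "(f \<boxtimes> idn C Y) \<cdot> (idn C (src C f) \<boxtimes> k) = (idn C (tgt C f) \<boxtimes> k) \<cdot> (f \<boxtimes> idn C X)"
      using k by (simp add: tarr_merge)
    then show "(f \<boxtimes> idn C Y) \<cdot> (idn C (src C f) \<boxtimes> k)
        = mzero C (src C f \<star> Y) (tgt C f \<star> Y) \<cdot> (idn C (src C f) \<boxtimes> k)"
      using k assms(1) by simp
  qed (use k in auto)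
qed

lemma tensor_preimage_triangulated:
  assumes "triangulated_subcategory C A"
  shows "triangulated_subcategory C {X. X \<star> Y \<in> A}"
  unfolding triangulated_subcategory_def mem_Collect_eq
proof (intro conjI allI impI)
  show "zero_object C Z \<Longrightarrow> Z \<star> Y \<in> A" for Z
    by (rule tri_sub_zero[OF assms zero_tensor])
  show "X \<star> Y \<in> A \<and> isomorphic C X X' \<Longrightarrow> X' \<star> Y \<in> A" for X X'
    using tri_sub_iso[OF assms tobj_cong[OF _ isomorphic_refl]] by blast
  show "sobj C X \<star> Y \<in> A \<longleftrightarrow> X \<star> Y \<in> A" for X
    using tri_sub_iso[OF assms tobj_sobj_left] tri_sub_iso[OF assms isomorphic_sym[OF tobj_sobj_left]]
      tri_sub_shift[OF assms] by blast
  show "dtri C f g h \<and> src C f \<star> Y \<in> A \<and> tgt C f \<star> Y \<in> A \<Longrightarrow> tgt C g \<star> Y \<in> A" for f g h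
    using tri_sub_cone[OF assms tensor_dtri, of f g h Y] by simp
qed

lemma zero_triangulated: "triangulated_subcategory C {X. zero_object C X}"
  unfolding triangulated_subcategory_def mem_Collect_eq
proof (intro conjI allI impI)
  show "zero_object C X \<and> isomorphic C X X' \<Longrightarrow> zero_object C X'" for X X'
    using zero_object_cong by blast
  show "dtri C f g h \<and> zero_object C (src C f) \<and> zero_object C (tgt C f) \<Longrightarrow> zero_object C (tgt C g)" for f g h
    using zero_cone_iff[of f g h] zero_objects_iso by blast
qed simp_all

text \<open>\<open>(f \<boxtimes> idn C D) \<cdot> \<eta>\<close> is the transpose of \<open>f\<close> under the adjunction between \<open>- \<star> d\<close> and
  \<open>- \<star> D\<close>.\<close>

lemma rigid_transpose_zero:
  assumes "rigid C d"
  obtains D where "\<forall>c. \<exists>\<eta>. src C \<eta> = c \<star> \<one> \<and> tgt C \<eta> = (c \<star> d) \<star> D \<and>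
    (\<forall>f. src C f = c \<star> d \<longrightarrow> (f \<boxtimes> idn C D) \<cdot> \<eta> = mzero C (c \<star> \<one>) (tgt C f \<star> D)
      \<longrightarrow> f = mzero C (c \<star> d) (tgt C f))"
proof -
  from assms obtain D ev coev where r: "src C ev = D \<star> d" "tgt C ev = \<one>" "src C coev = \<one>" "tgt C coev = d \<star> D"
    "runit C d \<cdot> ((idn C d \<boxtimes> ev) \<cdot> (assoc C d D d \<cdot> (coev \<boxtimes> idn C d))) = lunit C d"
    by (rule rigidE)
  let ?y = "(idn C d \<boxtimes> ev) \<cdot> (assoc C d D d \<cdot> (coev \<boxtimes> idn C d))"
  have y_iso: "iso_arrow C ?y"
    by (rule iso_cmp_cancel_left[of "runit C d"]) (use r in auto)
  show thesis
  proof (rule that[of D], rule allI)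
    fix c
    let ?a = "assoc C c d D" and ?a' = "assoc C c d (D \<star> d)" and ?b = "assoc C c d \<one>"
      and ?e = "assoc C c \<one> d" and ?m = "assoc C c (d \<star> D) d" and ?I = "idn C"
    note inv = arrow_inv[OF assoc_iso[of c d D]] arrow_inv[OF assoc_iso[of c d "D \<star> d"]]
      arrow_inv[OF assoc_iso[of c d \<one>]] arrow_inv[OF assoc_iso[of c \<one> d]]
    let ?\<eta> = "arrow_inv C ?a \<cdot> (?I c \<boxtimes> coev)"
    show "\<exists>\<eta>. src C \<eta> = c \<star> \<one> \<and> tgt C \<eta> = (c \<star> d) \<star> D \<and>
      (\<forall>f. src C f = c \<star> d \<longrightarrow> (f \<boxtimes> idn C D) \<cdot> \<eta> = mzero C (c \<star> \<one>) (tgt C f \<star> D)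
        \<longrightarrow> f = mzero C (c \<star> d) (tgt C f))"
    proof (intro exI[of _ ?\<eta>] conjI allI impI)
      show "src C ?\<eta> = c \<star> \<one>" "tgt C ?\<eta> = (c \<star> d) \<star> D" using inv r by simp_all
      fix f assume f: "src C f = c \<star> d" "(f \<boxtimes> ?I D) \<cdot> ?\<eta> = mzero C (c \<star> \<one>) (tgt C f \<star> D)"
      let ?S = "tgt C f"
      \<comment> \<open>\<open>?\<kappa>\<close> is \<open>?y\<close> tensored with
        \<open>c\<close>, up to structure isomorphisms, hence invertible by the zigzag identity. The
        computation below rewrites \<open>f \<cdot> ?\<kappa>\<close> as a composite containing the
        transpose of \<open>f\<close>, so a zero transpose forces \<open>f = 0\<close>.\<close>
      let ?K = "arrow_inv C ?b \<cdot> ((?I c \<boxtimes> ?y) \<cdot> ?e)"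
      let ?\<kappa> = "runit C (c \<star> d) \<cdot> ?K"
      have \<kappa>: "iso_arrow C ?\<kappa>"
      proof -
        have "iso_arrow C ((?I c \<boxtimes> ?y) \<cdot> ?e)"
          by (rule iso_cmp[OF _ tarr_iso[OF _ y_iso]]) (use r in auto)
        then have "iso_arrow C ?K"
          by (rule iso_cmp) (use r inv iso_arrow_inv in auto)
        then show ?thesis
          by (rule iso_cmp) (use r inv in auto)
      qed
      have n1: "arrow_inv C ?b \<cdot> (?I c \<boxtimes> (?I d \<boxtimes> ev)) = (?I (c \<star> d) \<boxtimes> ev) \<cdot> arrow_inv C ?a'"
      proof -
        have "arrow_inv C ?b \<cdot> (?I c \<boxtimes> (?I d \<boxtimes> ev))
            = arrow_inv C ?b \<cdot> ((?I c \<boxtimes> (?I d \<boxtimes> ev)) \<cdot> (?a' \<cdot> arrow_inv C ?a'))"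
          using inv r by simp
        also have "\<dots> = arrow_inv C ?b \<cdot> (((?I c \<boxtimes> (?I d \<boxtimes> ev)) \<cdot> ?a') \<cdot> arrow_inv C ?a')"
          using inv r by simp
        also have "(?I c \<boxtimes> (?I d \<boxtimes> ev)) \<cdot> ?a' = ?b \<cdot> (?I (c \<star> d) \<boxtimes> ev)"
          using assoc_nat[of "?I c" "?I d" ev] r by simp
        also have "arrow_inv C ?b \<cdot> ((?b \<cdot> (?I (c \<star> d) \<boxtimes> ev)) \<cdot> arrow_inv C ?a')
            = (?I (c \<star> d) \<boxtimes> ev) \<cdot> arrow_inv C ?a'"
          using inv r by (simp add: cmp_reassoc[OF inv(11)])
        finally show ?thesis .
      qed
      have n2: "arrow_inv C ?a' \<cdot> ((?I c \<boxtimes> assoc C d D d) \<cdot> ((?I c \<boxtimes> (coev \<boxtimes> ?I d)) \<cdot> ?e))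
          = assoc C (c \<star> d) D d \<cdot> (?\<eta> \<boxtimes> ?I d)"
      proof -
        have p: "(?I c \<boxtimes> assoc C d D d) \<cdot> (?m \<cdot> (?a \<boxtimes> ?I d)) = ?a' \<cdot> assoc C (c \<star> d) D d"
          using pentagon[of c d D d] by simp
        have "(?I c \<boxtimes> (coev \<boxtimes> ?I d)) \<cdot> ?e = ?m \<cdot> ((?I c \<boxtimes> coev) \<boxtimes> ?I d)"
          using assoc_nat[of "?I c" coev "?I d"] r by simp
        also have "(?I c \<boxtimes> coev) \<boxtimes> ?I d = (?a \<boxtimes> ?I d) \<cdot> (?\<eta> \<boxtimes> ?I d)"
          using inv r by (simp add: tarr_merge cmp_reassoc[OF inv(4)])
        finally have "(?I c \<boxtimes> assoc C d D d) \<cdot> ((?I c \<boxtimes> (coev \<boxtimes> ?I d)) \<cdot> ?e)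
            = ((?I c \<boxtimes> assoc C d D d) \<cdot> (?m \<cdot> (?a \<boxtimes> ?I d))) \<cdot> (?\<eta> \<boxtimes> ?I d)"
          using inv r by simp
        also have "\<dots> = ?a' \<cdot> (assoc C (c \<star> d) D d \<cdot> (?\<eta> \<boxtimes> ?I d))"
          unfolding p using inv r by simp
        finally show ?thesis
          using inv r by (simp add: cmp_reassoc[OF inv(7)])
      qed
      have K: "?K = (?I (c \<star> d) \<boxtimes> ev) \<cdot> (assoc C (c \<star> d) D d \<cdot> (?\<eta> \<boxtimes> ?I d))"
      proof -
        have "?I c \<boxtimes> ?y = (?I c \<boxtimes> (?I d \<boxtimes> ev)) \<cdot> ((?I c \<boxtimes> assoc C d D d) \<cdot> (?I c \<boxtimes> (coev \<boxtimes> ?I d)))"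
          using r by (simp add: tarr_merge)
        then have "?K = (arrow_inv C ?b \<cdot> (?I c \<boxtimes> (?I d \<boxtimes> ev)))
            \<cdot> ((?I c \<boxtimes> assoc C d D d) \<cdot> ((?I c \<boxtimes> (coev \<boxtimes> ?I d)) \<cdot> ?e))"
          using inv r by simp
        also have "\<dots> = (?I (c \<star> d) \<boxtimes> ev) \<cdot> (arrow_inv C ?a'
            \<cdot> ((?I c \<boxtimes> assoc C d D d) \<cdot> ((?I c \<boxtimes> (coev \<boxtimes> ?I d)) \<cdot> ?e)))"
          unfolding n1 using inv r by simp
        finally show ?thesis unfolding n2 .
      qed
      have n3: "f \<cdot> runit C (c \<star> d) = runit C ?S \<cdot> (f \<boxtimes> ?I \<one>)"
        using runit_nat[of f] f by simp
      have "f \<cdot> ?\<kappa> = (f \<cdot> runit C (c \<star> d)) \<cdot> ?K"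
        using f inv r by simp
      also have "\<dots> = (runit C ?S \<cdot> (f \<boxtimes> ?I \<one>))
          \<cdot> ((?I (c \<star> d) \<boxtimes> ev) \<cdot> (assoc C (c \<star> d) D d \<cdot> (?\<eta> \<boxtimes> ?I d)))"
        unfolding K n3 by (rule refl)
      also have "(runit C ?S \<cdot> (f \<boxtimes> ?I \<one>)) \<cdot> ((?I (c \<star> d) \<boxtimes> ev) \<cdot> (assoc C (c \<star> d) D d \<cdot> (?\<eta> \<boxtimes> ?I d)))
          = runit C ?S \<cdot> ((?I ?S \<boxtimes> ev) \<cdot> (((f \<boxtimes> (?I D \<boxtimes> ?I d)) \<cdot> assoc C (c \<star> d) D d) \<cdot> (?\<eta> \<boxtimes> ?I d)))"
        using f inv r by (simp add: tarr_merge_cmp)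
      also have "(f \<boxtimes> (?I D \<boxtimes> ?I d)) \<cdot> assoc C (c \<star> d) D d = assoc C ?S D d \<cdot> ((f \<boxtimes> ?I D) \<boxtimes> ?I d)"
        using assoc_nat[of f "?I D" "?I d"] f by simp
      also have "(assoc C ?S D d \<cdot> ((f \<boxtimes> ?I D) \<boxtimes> ?I d)) \<cdot> (?\<eta> \<boxtimes> ?I d)
          = assoc C ?S D d \<cdot> (((f \<boxtimes> ?I D) \<cdot> ?\<eta>) \<boxtimes> ?I d)"
        using f(1) inv r by (simp add: tarr_merge)
      also have "\<dots> = mzero C ((c \<star> \<one>) \<star> d) (?S \<star> (D \<star> d))"
        unfolding f(2) by simp
      finally have "f \<cdot> ?\<kappa> = mzero C ((c \<star> \<one>) \<star> d) ?S"
        using r by simp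
      then have "f \<cdot> ?\<kappa> = mzero C (c \<star> d) ?S \<cdot> ?\<kappa>"
        using inv r by simp
      then show "f = mzero C (c \<star> d) ?S"
        by (rule iso_cancel_right[OF \<kappa>]) (use f inv r in auto)
    qed
  qed
qed

end

section \<open>Small coproducts\<close>

lemma card_of_bij: "bij_betw f A B \<Longrightarrow> |A| =o |B|"
  using card_of_ordIso by blast

context category
begin

lemma is_coproduct_cong:
  assumes "is_coproduct C I X S \<iota>" "\<And>i. i \<in> I \<Longrightarrow> X i = X' i \<and> \<iota> i = \<iota>' i"
  shows "is_coproduct C I X' S \<iota>'"
proof (rule is_coproductI)
  note inj = coproduct_inj[OF assms(1)]
  show "src C (\<iota>' i) = X' i \<and> tgt C (\<iota>' i) = S" if "i \<in> I" for i
    using inj[OF that] assms(2)[OF that] by simp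
  fix Y f assume f: "\<And>i. i \<in> I \<Longrightarrow> src C (f i) = X' i \<and> tgt C (f i) = Y"
  obtain h where h: "src C h = S" "tgt C h = Y" "\<And>i. i \<in> I \<Longrightarrow> h \<cdot> \<iota> i = f i"
    using coproduct_desc[OF assms(1), of f Y thesis] f assms(2) by auto
  then show "\<exists>h. src C h = S \<and> tgt C h = Y \<and> (\<forall>i \<in> I. h \<cdot> \<iota>' i = f i)"
    using assms(2) by auto
next
  fix h k assume hk: "src C h = S" "src C k = S" "tgt C h = tgt C k" "\<And>i. i \<in> I \<Longrightarrow> h \<cdot> \<iota>' i = k \<cdot> \<iota>' i"
  show "h = k"
    by (rule coproduct_ext[OF assms(1)]) (use hk assms(2) in auto)
qed

end

context big_tt_category
begin

text \<open>Existence of coproducts and closure of localizing subcategories are stated for subsets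
  of the universe only. Transport along this bijection allows index sets of any type, such as sets
  of objects, natural numbers or ideals.\<close>

lemma small_embed:
  assumes "small T I"
  obtains \<phi> J where "small_index T J" "bij_betw \<phi> J I"
proof -
  have "|I| \<le>o |univ T|" using assms by (simp add: small_def ordLess_imp_ordLeq)
  then obtain f where f: "inj_on f I" "f ` I \<subseteq> univ T"
    by (metis card_of_ordLeq)
  then have b: "bij_betw f I (f ` I)" by (simp add: inj_on_imp_bij_betw)
  have "|f ` I| =o |I|" by (rule ordIso_symmetric[OF card_of_bij[OF b]])
  then have "small_index T (f ` I)"
    using f assms ordIso_ordLess_trans unfolding small_index_def small_def by blast
  then show thesis using bij_betw_inv_into[OF b] by (rule that)
qed

lemma small_surj: "small T A \<Longrightarrow> B \<subseteq> f ` A \<Longrightarrow> small T B"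
  unfolding small_def by (metis card_of_image card_of_mono1 ordLeq_ordLess_trans)

lemma small_bij: "bij_betw f A B \<Longrightarrow> small T A \<Longrightarrow> small T B"
  by (rule small_surj[of A B f]) (auto simp: bij_betw_def)

lemma small_inj: "inj_on f A \<Longrightarrow> f ` A \<subseteq> B \<Longrightarrow> small T B \<Longrightarrow> small T A"
  by (rule small_surj[of B A "inv_into A f"]) (auto simp: image_iff, metis inv_into_f_f subsetD imageI)

lemma small_nat: "small T (UNIV :: nat set)"
  using univ_inaccessible by (simp add: inaccessible_def small_def)

text \<open>This is the strong limit property of the universe, transported along a
  bijection.\<close>

lemma small_Pow:
  assumes "small T A" shows "small T (Pow A)"
proof -
  obtain \<phi> J where J: "small_index T J" "bij_betw \<phi> J A"
    using assms by (rule small_embed)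
  have "small T (Pow J)"
    using univ_inaccessible J(1) by (simp add: inaccessible_def small_index_def small_def)
  then show ?thesis by (rule small_bij[OF bij_betw_Pow[OF J(2)]])
qed

text \<open>This is regularity of the universe, which is infinite because the natural numbers are
  small.\<close>

lemma small_UN:
  assumes "small T I" "\<And>i. i \<in> I \<Longrightarrow> small T (A i)"
  shows "small T (\<Union>i \<in> I. A i)"
proof -
  have "infinite (univ T)"
  proof
    assume "finite (univ T)"
    moreover have "|UNIV :: nat set| \<le>o |univ T|"
      using small_nat by (simp add: small_def ordLess_imp_ordLeq)
    ultimately have "finite (UNIV :: nat set)"
      by (rule card_of_ordLeq_finite[rotated])
    then show False by simp
  qed
  then have "Cinfinite |univ T|"
    by (simp add: cinfinite_def)
  then show ?thesis
    using card_of_UNION_ordLess_infinite_Field_regularCard[of "|univ T|" I A] univ_inaccessible assms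
    by (simp add: inaccessible_def small_def)
qed

lemma ex_small_coproduct:
  assumes "small T I"
  obtains S \<iota> where "is_coproduct T I X S \<iota>"
proof -
  obtain \<phi> J where J: "small_index T J" "bij_betw \<phi> J I"
    using assms by (rule small_embed)
  obtain S \<iota> where S: "is_coproduct T J (X \<circ> \<phi>) S \<iota>"
    using ex_coproduct[OF J(1)] by blast
  have "is_coproduct T I ((X \<circ> \<phi>) \<circ> inv_into J \<phi>) S (\<iota> \<circ> inv_into J \<phi>)"
    by (rule coproduct_reindex[OF S bij_betw_inv_into[OF J(2)]])
  then have "is_coproduct T I X S (\<iota> \<circ> inv_into J \<phi>)"
    by (rule is_coproduct_cong) (use J(2) in \<open>auto simp: bij_betw_def f_inv_into_f\<close>)
  then show thesis by (rule that)
qed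

lemma localizing_coproduct:
  assumes "localizing_subcategory T L" "small T I" "is_coproduct T I X S \<iota>" "\<And>i. i \<in> I \<Longrightarrow> X i \<in> L"
  shows "S \<in> L"
proof -
  obtain \<phi> J where J: "small_index T J" "bij_betw \<phi> J I"
    using assms(2) by (rule small_embed)
  have "is_coproduct T J (X \<circ> \<phi>) S (\<iota> \<circ> \<phi>)"
    by (rule coproduct_reindex[OF assms(3) J(2)])
  moreover have "\<forall>j \<in> J. (X \<circ> \<phi>) j \<in> L"
    using J(2) assms(4) by (auto simp: bij_betw_def)
  ultimately show ?thesis
    using assms(1) J(1) unfolding localizing_subcategory_def by blast
qed

lemma localizing_triangulated: "localizing_subcategory T L \<Longrightarrow> triangulated_subcategory T L"
  by (simp add: localizing_subcategory_def)

end

context triangulated_category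
begin

lemma octahedron:
  assumes "dtri C f f' f''" "dtri C g g' g''" "dtri C (g \<cdot> f) h' h''" "tgt C f = src C g"
  obtains u v w where "src C u = tgt C f'" "tgt C u = tgt C h'" "src C v = tgt C h'" "tgt C v = tgt C g'"
    "dtri C u v w" "u \<cdot> f' = h' \<cdot> g" "v \<cdot> h' = g'"
proof -
  have "\<exists>u \<in> Hom C (tgt C f') (tgt C h'). \<exists>v \<in> Hom C (tgt C h') (tgt C g').
      dtri C u v (sarr C f' \<cdot> g'') \<and>
      u \<cdot> f' = h' \<cdot> g \<and> h'' \<cdot> u = f'' \<and> v \<cdot> h' = g' \<and> g'' \<cdot> v = sarr C f \<cdot> h''"
    by (rule octahedral[OF _ _ assms(1-3), of "src C f" "tgt C f" "tgt C g"])
      (use assms(4) dtri_ends[OF assms(1)] dtri_ends[OF assms(2)] dtri_ends[OF assms(3)] in auto)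
  then obtain u v where u: "u \<in> Hom C (tgt C f') (tgt C h')" and v: "v \<in> Hom C (tgt C h') (tgt C g')"
    and d: "dtri C u v (sarr C f' \<cdot> g'')" and e: "u \<cdot> f' = h' \<cdot> g" "v \<cdot> h' = g'"
    by blast
  show thesis
    using u v by (intro that[of u v, OF _ _ _ _ d e]) simp_all
qed

end

section \<open>Telescopes\<close>

context big_tt_category
begin

text \<open>The telescope of \<open>t 0, t 1, \<dots>\<close> is the cone \<open>q\<close> of \<open>s = 1 - shift\<close>; the equation for \<open>s\<close> is
  stated without subtraction.\<close>

definition telescope :: "(nat \<Rightarrow> 'o) \<Rightarrow> (nat \<Rightarrow> 'm) \<Rightarrow> 'o \<Rightarrow> (nat \<Rightarrow> 'm) \<Rightarrow> 'm \<Rightarrow> 'm \<Rightarrow> bool" where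
  "telescope X t S \<iota> s q \<longleftrightarrow> is_coproduct T UNIV X S \<iota> \<and>
     (\<forall>n. src T (t n) = X n \<and> tgt T (t n) = X (Suc n)) \<and> src T s = S \<and> tgt T s = S \<and>
     (\<forall>n. \<iota> (Suc n) \<cdot> t n \<uplus> s \<cdot> \<iota> n = \<iota> n) \<and> (\<exists>h. dtri T s q h)"

lemma ex_telescope:
  assumes "\<And>n. src T (t n) = X n \<and> tgt T (t n) = X (Suc n)"
  obtains S \<iota> s q where "telescope X t S \<iota> s q"
proof -
  obtain S \<iota> where S: "is_coproduct T (UNIV :: nat set) X S \<iota>"
    using small_nat by (rule ex_small_coproduct)
  note inj = coproduct_inj[OF S, simplified]
  obtain s where s: "src T s = S" "tgt T s = S"
      "\<And>n. s \<cdot> \<iota> n = \<iota> n \<uplus> mneg T (\<iota> (Suc n) \<cdot> t n)"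
    using coproduct_desc[OF S, of "\<lambda>n. \<iota> n \<uplus> mneg T (\<iota> (Suc n) \<cdot> t n)" S thesis] inj assms by auto
  obtain q h where "dtri T s q h" by (rule ex_cone)
  then have "telescope X t S \<iota> s q"
    using S s inj assms by (auto simp: telescope_def)
  then show thesis by (rule that)
qed

lemma telescope_tensor:
  assumes "telescope X t S \<iota> s q"
  shows "telescope (\<lambda>n. X n \<star> Y) (\<lambda>n. t n \<boxtimes> idn T Y) (S \<star> Y) (\<lambda>n. \<iota> n \<boxtimes> idn T Y) (s \<boxtimes> idn T Y) (q \<boxtimes> idn T Y)"
proof -
  note a = assms[unfolded telescope_def]
  then have S: "is_coproduct T UNIV X S \<iota>" by blast
  note inj = coproduct_inj[OF S, simplified]
  have te: "src T (t n) = X n" "tgt T (t n) = X (Suc n)" for n using a by auto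
  have se: "src T s = S" "tgt T s = S" using a by auto
  have "(\<iota> (Suc n) \<boxtimes> idn T Y) \<cdot> (t n \<boxtimes> idn T Y) \<uplus> (s \<boxtimes> idn T Y) \<cdot> (\<iota> n \<boxtimes> idn T Y) = \<iota> n \<boxtimes> idn T Y" for n
  proof -
    have "(\<iota> (Suc n) \<boxtimes> idn T Y) \<cdot> (t n \<boxtimes> idn T Y) \<uplus> (s \<boxtimes> idn T Y) \<cdot> (\<iota> n \<boxtimes> idn T Y)
        = (\<iota> (Suc n) \<cdot> t n \<uplus> s \<cdot> \<iota> n) \<boxtimes> idn T Y"
      using te se inj by (simp add: tarr_merge)
    also have "\<iota> (Suc n) \<cdot> t n \<uplus> s \<cdot> \<iota> n = \<iota> n" using a by blast
    finally show ?thesis .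
  qed
  moreover obtain h where "dtri T s q h" using a by blast
  then have "\<exists>h. dtri T (s \<boxtimes> idn T Y) (q \<boxtimes> idn T Y) h" by (blast intro: tensor_dtri)
  ultimately show ?thesis
    using a tensor_coproduct[OF S, of Y] by (auto simp: telescope_def)
qed

text \<open>With zero transition maps the shift vanishes, so \<open>s\<close> is the identity and
  its cone is zero.\<close>

lemma telescope_zero:
  assumes "telescope X t S \<iota> s q" "\<And>n. t n = mzero T (X n) (X (Suc n))"
  shows "zero_object T (tgt T q)"
proof -
  note a = assms(1)[unfolded telescope_def]
  then have S: "is_coproduct T UNIV X S \<iota>" by blast
  note inj = coproduct_inj[OF S, simplified]
  have "s = idn T S"
  proof (rule coproduct_ext[OF S])
    fix n
    have se: "src T s = S" "tgt T s = S" using a by auto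
    have "\<iota> (Suc n) \<cdot> t n \<uplus> s \<cdot> \<iota> n = \<iota> n" using a by blast
    then show "s \<cdot> \<iota> n = idn T S \<cdot> \<iota> n"
      using se inj assms(2) by simp
  qed (use a in auto)
  then have "iso_arrow T s" by simp
  then show ?thesis using a zero_cone_iff by blast
qed

text \<open>\<open>M\<close> carries every stage back to the initial one and kills \<open>s\<close>,
  so it induces a left inverse \<open>M'\<close> of \<open>q \<cdot> \<iota> 0\<close>. For the
  other side, a retraction \<open>r\<close> of \<open>s\<close> forces the connecting map
  \<open>h\<close> to vanish, and then a map out of the telescope that kills \<open>q\<close> is
  zero.\<close>

lemma telescope_iso:
  assumes "telescope X t S \<iota> s q" "\<And>n. iso_arrow T (t n)"
  shows "iso_arrow T (q \<cdot> \<iota> 0)"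
proof -
  note a = assms(1)[unfolded telescope_def]
  then have S: "is_coproduct T UNIV X S \<iota>" by blast
  note inj = coproduct_inj[OF S, simplified]
  have te: "src T (t n) = X n" "tgt T (t n) = X (Suc n)" for n using a by auto
  have se: "src T s = S" "tgt T s = S" using a by auto
  have eq: "\<iota> (Suc n) \<cdot> t n \<uplus> s \<cdot> \<iota> n = \<iota> n" for n using a by blast
  obtain h where d: "dtri T s q h" using a by blast
  note e = dtri_ends[OF d]
  have "\<exists>u. src T u = X (Suc n) \<and> tgt T u = X n \<and> u \<cdot> t n = idn T (X n) \<and> t n \<cdot> u = idn T (X (Suc n))" for n
    using iso_arrowE[OF assms(2)[of n]] te by metis
  then obtain u where u: "\<And>n. src T (u n) = X (Suc n)" "\<And>n. tgt T (u n) = X n"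
      "\<And>n. u n \<cdot> t n = idn T (X n)" "\<And>n. t n \<cdot> u n = idn T (X (Suc n))"
    by metis
  have q: "q \<cdot> (\<iota> (Suc n) \<cdot> t n) = q \<cdot> \<iota> n" for n
  proof -
    have "q \<cdot> (s \<cdot> \<iota> n) = mzero T (X n) (tgt T q)"
      using cmp_reassoc[OF dtri_comp_zero(1)[OF d], of "\<iota> n"] inj se e by simp
    then have "q \<cdot> (\<iota> (Suc n) \<cdot> t n \<uplus> s \<cdot> \<iota> n) = q \<cdot> (\<iota> (Suc n) \<cdot> t n)"
      using inj se e te by simp
    then show ?thesis unfolding eq by simp
  qed
  define m where "m = rec_nat (idn T (X 0)) (\<lambda>n m. m \<cdot> u n)"
  have m: "m 0 = idn T (X 0)" "m (Suc n) = m n \<cdot> u n" for n by (simp_all add: m_def)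
  have me: "src T (m n) = X n \<and> tgt T (m n) = X 0" for n
    by (induction n) (use m u in auto)
  have mt: "m (Suc n) \<cdot> t n = m n" for n using m u me te by simp
  have qm: "q \<cdot> (\<iota> 0 \<cdot> m n) = q \<cdot> \<iota> n" for n
  proof (induction n)
    case 0 show ?case using inj e se m by simp
  next
    case (Suc n)
    have "q \<cdot> (\<iota> 0 \<cdot> m (Suc n)) = (q \<cdot> (\<iota> 0 \<cdot> m n)) \<cdot> u n"
      using inj e se m me u by simp
    also have "\<dots> = (q \<cdot> (\<iota> (Suc n) \<cdot> t n)) \<cdot> u n" unfolding q Suc.IH by simp
    also have "\<dots> = q \<cdot> \<iota> (Suc n)" using inj e se te u by simp
    finally show ?case .
  qed
  obtain M where M: "src T M = S" "tgt T M = X 0" "\<And>n. M \<cdot> \<iota> n = m n"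
    using coproduct_desc[OF S, of m "X 0" thesis] me by auto
  have "M \<cdot> s = mzero T S (X 0)"
  proof (rule coproduct_ext[OF S])
    fix n
    have "M \<cdot> (\<iota> (Suc n) \<cdot> t n \<uplus> s \<cdot> \<iota> n) = (M \<cdot> \<iota> (Suc n)) \<cdot> t n \<uplus> M \<cdot> (s \<cdot> \<iota> n)"
      using M(1,2) inj te se by (subst cmp_add) auto
    then have "m n \<uplus> M \<cdot> (s \<cdot> \<iota> n) = m n \<uplus> mzero T (X n) (X 0)"
      unfolding eq M(3) mt using me by simp
    then have "M \<cdot> (s \<cdot> \<iota> n) = mzero T (X n) (X 0)"
      by (rule madd_left_cancel) (use M(1,2) inj te se me in auto)
    then show "(M \<cdot> s) \<cdot> \<iota> n = mzero T S (X 0) \<cdot> \<iota> n"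
      using M(1,2) inj se by simp
  qed (use M se in auto)
  then obtain M' where M': "src T M' = tgt T q" "tgt T M' = X 0" "M' \<cdot> q = M"
    using weak_coker[OF d, of M] M se by auto
  have 1: "M' \<cdot> (q \<cdot> \<iota> 0) = idn T (X 0)"
    using cmp_reassoc[OF M'(3), of "\<iota> 0"] M M' inj e se m by simp
  \<comment> \<open>On the n-th summand the equation \<open>r \<cdot> s = 1\<close> reads
    \<open>\<rho> n - \<rho> (Suc n) \<cdot> t n = \<iota> n\<close>. As \<open>t n\<close> has the
    inverse \<open>u n\<close>, it can be solved recursively, starting from zero.\<close>
  define \<rho> where "\<rho> = rec_nat (mzero T (X 0) S) (\<lambda>n r. (r \<uplus> mneg T (\<iota> n)) \<cdot> u n)"
  have \<rho>: "\<rho> 0 = mzero T (X 0) S" "\<rho> (Suc n) = (\<rho> n \<uplus> mneg T (\<iota> n)) \<cdot> u n" for n by (simp_all add: \<rho>_def)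
  have \<rho>e: "src T (\<rho> n) = X n \<and> tgt T (\<rho> n) = S" for n
    by (induction n) (use \<rho> u inj in auto)
  have \<rho>t: "\<rho> (Suc n) \<cdot> t n = \<rho> n \<uplus> mneg T (\<iota> n)" for n
    using \<rho>(2) u \<rho>e te inj by simp
  obtain r where r: "src T r = S" "tgt T r = S" "\<And>n. r \<cdot> \<iota> n = \<rho> n"
    using coproduct_desc[OF S, of \<rho> S thesis] \<rho>e by auto
  have rs: "r \<cdot> s = idn T S"
  proof (rule coproduct_ext[OF S])
    fix n
    have "r \<cdot> (\<iota> (Suc n) \<cdot> t n \<uplus> s \<cdot> \<iota> n) = (r \<cdot> \<iota> (Suc n)) \<cdot> t n \<uplus> r \<cdot> (s \<cdot> \<iota> n)"
      using r(1,2) inj te se by (subst cmp_add) auto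
    then have "(\<rho> n \<uplus> mneg T (\<iota> n)) \<uplus> r \<cdot> (s \<cdot> \<iota> n) = \<rho> n"
      unfolding eq r(3) \<rho>t by simp
    also have "\<rho> n = (\<rho> n \<uplus> mneg T (\<iota> n)) \<uplus> \<iota> n"
      using \<rho>e inj by (subst madd_commute) auto
    finally have "r \<cdot> (s \<cdot> \<iota> n) = \<iota> n"
      by (rule madd_left_cancel) (use r(1,2) inj te se \<rho>e in auto)
    then show "(r \<cdot> s) \<cdot> \<iota> n = idn T S \<cdot> \<iota> n"
      using r(1,2) inj se by simp
  qed (use r se in auto)
  have "h = sarr T (r \<cdot> s) \<cdot> h" unfolding rs using e se by simp
  also have "\<dots> = sarr T r \<cdot> (sarr T s \<cdot> h)" using r e se by simp
  also have "\<dots> = mzero T (tgt T q) (sobj T S)" using dtri_comp_zero(3)[OF d] r se by simp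
  finally have h: "h = mzero T (tgt T q) (sobj T S)" .
  let ?k = "(q \<cdot> \<iota> 0) \<cdot> M' \<uplus> mneg T (idn T (tgt T q))"
  have ke: "src T ?k = tgt T q" "tgt T ?k = tgt T q" using inj e se M' by auto
  have "q \<cdot> (\<iota> 0 \<cdot> M) = q"
  proof (rule coproduct_ext[OF S])
    fix n
    show "(q \<cdot> (\<iota> 0 \<cdot> M)) \<cdot> \<iota> n = q \<cdot> \<iota> n"
      using qm[of n] M inj e se by simp
  qed (use inj e se M in auto)
  then have "?k \<cdot> q = mzero T S (tgt T q)"
    using M' inj e se by simp
  then obtain k' where k': "src T k' = sobj T S" "tgt T k' = tgt T q" "k' \<cdot> h = ?k"
    using weak_coker2[OF d, of ?k] ke se by auto
  then have "?k = mzero T (tgt T q) (tgt T q)"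
    unfolding k'(3)[symmetric] h by simp
  then have "(q \<cdot> \<iota> 0) \<cdot> M' = idn T (tgt T q)"
    by (rule sub_eq_zero) (use inj e se M' in auto)
  with 1 show ?thesis
    using inj e se M' by (intro iso_arrowI[of M']) auto
qed

section \<open>Maps whose cone lies in a localizing subcategory\<close>

definition cone_in :: "'o set \<Rightarrow> 'm \<Rightarrow> bool" where
  "cone_in L f \<longleftrightarrow> (\<exists>g h. dtri T f g h \<and> tgt T g \<in> L)"

lemma cone_inD:
  assumes "triangulated_subcategory T L" "cone_in L f" "dtri T f g h"
  shows "tgt T g \<in> L"
  using assms cones_isomorphic tri_sub_iso unfolding cone_in_def by blast

lemma cone_in_iso:
  assumes "triangulated_subcategory T L" "iso_arrow T f"
  shows "cone_in L f"
  by (metis assms cone_in_def ex_cone tri_sub_zero zero_cone_iff)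

lemma cone_in_cmp:
  assumes L: "triangulated_subcategory T L" and "cone_in L f" "cone_in L g" and fg: "tgt T f = src T g"
  shows "cone_in L (g \<cdot> f)"
proof -
  obtain f' f'' where f: "dtri T f f' f''" "tgt T f' \<in> L" using assms(2) by (auto simp: cone_in_def)
  obtain g' g'' where g: "dtri T g g' g''" "tgt T g' \<in> L" using assms(3) by (auto simp: cone_in_def)
  obtain h' h'' where h: "dtri T (g \<cdot> f) h' h''" by (rule ex_cone)
  obtain u v w where uv: "src T u = tgt T f'" "tgt T u = tgt T h'" "tgt T v = tgt T g'" "dtri T u v w"
    using octahedron[OF f(1) g(1) h fg] by blast
  have "tgt T u \<in> L"
    by (rule tri_sub_middle[OF L uv(4)]) (use uv f g in auto)
  then show ?thesis using h uv(2) unfolding cone_in_def by auto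
qed

text \<open>The telescope is compared with the constant one on \<open>X 0\<close> through
  \<open>G\<close>, whose components are the finite composites \<open>c n\<close>. The cone of
  \<open>G\<close> is a coproduct of objects of \<open>L\<close>. Applying the octahedral axiom to
  both sides of \<open>s \<cdot> G = G \<cdot> s'\<close> links the two telescopes by maps with cone
  in \<open>L\<close>.\<close>

lemma cone_in_telescope:
  assumes L: "localizing_subcategory T L" and "telescope X t S \<iota> s q" and t: "\<And>n. cone_in L (t n)"
  shows "cone_in L (q \<cdot> \<iota> 0)"
proof -
  note a = assms(2)[unfolded telescope_def]
  then have S: "is_coproduct T UNIV X S \<iota>" by blast
  note inj = coproduct_inj[OF S, simplified]
  have te: "src T (t n) = X n" "tgt T (t n) = X (Suc n)" for n using a by auto
  have se: "src T s = S" "tgt T s = S" using a by auto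
  have eq: "\<iota> (Suc n) \<cdot> t n \<uplus> s \<cdot> \<iota> n = \<iota> n" for n using a by blast
  obtain h where d: "dtri T s q h" using a by blast
  note e = dtri_ends[OF d] and L' = localizing_triangulated[OF L]
  define c where "c = rec_nat (idn T (X 0)) (\<lambda>n m. t n \<cdot> m)"
  have c: "c 0 = idn T (X 0)" "c (Suc n) = t n \<cdot> c n" for n by (simp_all add: c_def)
  have ce: "src T (c n) = X 0 \<and> tgt T (c n) = X n" for n
    by (induction n) (use c te in auto)
  have cL: "cone_in L (c n)" for n
  proof (induction n)
    case 0 show ?case unfolding c by (rule cone_in_iso[OF L']) simp
  next
    case (Suc n) then show ?case unfolding c by (rule cone_in_cmp[OF L' _ t]) (use ce te in auto)
  qed
  obtain S' \<iota>' s' q' where tel': "telescope (\<lambda>_. X 0) (\<lambda>_. idn T (X 0)) S' \<iota>' s' q'"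
    by (rule ex_telescope[of "\<lambda>_. idn T (X 0)" "\<lambda>_. X 0"]) auto
  note a' = tel'[unfolded telescope_def]
  then have S': "is_coproduct T UNIV (\<lambda>_. X 0) S' \<iota>'" by blast
  note inj' = coproduct_inj[OF S', simplified]
  have se': "src T s' = S'" "tgt T s' = S'" using a' by auto
  have eq': "\<iota>' (Suc n) \<uplus> s' \<cdot> \<iota>' n = \<iota>' n" for n using a' inj' by simp
  obtain h' where d': "dtri T s' q' h'" using a' by blast
  note e' = dtri_ends[OF d']
  obtain G where G: "src T G = S'" "tgt T G = S" "\<And>n. G \<cdot> \<iota>' n = \<iota> n \<cdot> c n"
    using coproduct_desc[OF S', of "\<lambda>n. \<iota> n \<cdot> c n" S thesis] ce inj by auto
  have "\<exists>g h. dtri T (c n) g h \<and> tgt T g \<in> L" for n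
    using cL by (auto simp: cone_in_def)
  then obtain cg ch where cd: "\<And>n. dtri T (c n) (cg n) (ch n)" "\<And>n. tgt T (cg n) \<in> L" by metis
  obtain SZ \<iota>Z where SZ: "is_coproduct T (UNIV :: nat set) (\<lambda>n. tgt T (cg n)) SZ \<iota>Z"
    using small_nat by (rule ex_small_coproduct)
  have "SZ \<in> L"
    by (rule localizing_coproduct[OF L small_nat SZ]) (use cd in auto)
  obtain b b' where dG: "dtri T G b b'" by (rule ex_cone)
  have "isomorphic T SZ (tgt T b)"
    by (rule coproduct_of_triangles[OF S' S SZ, where F = G and H = b'])
      (use cd ce G dG in auto)
  then have bL: "tgt T b \<in> L" using tri_sub_iso[OF L' _ \<open>SZ \<in> L\<close>] by blast
  have comm: "s \<cdot> G = G \<cdot> s'"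
  proof (rule coproduct_ext[OF S'])
    fix n
    have "G \<cdot> (\<iota>' (Suc n) \<uplus> s' \<cdot> \<iota>' n) = G \<cdot> \<iota>' (Suc n) \<uplus> G \<cdot> (s' \<cdot> \<iota>' n)"
      using G(1,2) inj' se' by (subst cmp_add) auto
    then have 1: "\<iota> (Suc n) \<cdot> c (Suc n) \<uplus> G \<cdot> (s' \<cdot> \<iota>' n) = \<iota> n \<cdot> c n"
      unfolding eq' G(3) by simp
    have "(\<iota> (Suc n) \<cdot> t n \<uplus> s \<cdot> \<iota> n) \<cdot> c n = (\<iota> (Suc n) \<cdot> t n) \<cdot> c n \<uplus> (s \<cdot> \<iota> n) \<cdot> c n"
      using inj te se ce by (subst add_cmp) auto
    also have "(\<iota> (Suc n) \<cdot> t n) \<cdot> c n = \<iota> (Suc n) \<cdot> c (Suc n)"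
      using inj te ce c by simp
    also have "(s \<cdot> \<iota> n) \<cdot> c n = (s \<cdot> G) \<cdot> \<iota>' n"
      using inj inj' se ce G by simp
    finally have "\<iota> (Suc n) \<cdot> c (Suc n) \<uplus> (s \<cdot> G) \<cdot> \<iota>' n = \<iota> (Suc n) \<cdot> c (Suc n) \<uplus> G \<cdot> (s' \<cdot> \<iota>' n)"
      unfolding eq 1 by simp
    then have "(s \<cdot> G) \<cdot> \<iota>' n = G \<cdot> (s' \<cdot> \<iota>' n)"
      by (rule madd_left_cancel) (use inj inj' se se' ce G(1,2) in auto)
    then show "(s \<cdot> G) \<cdot> \<iota>' n = (G \<cdot> s') \<cdot> \<iota>' n"
      using G(1,2) inj' se' by simp
  qed (use G se se' in auto)
  obtain k k' where dk: "dtri T (s \<cdot> G) k k'" by (rule ex_cone)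
  note ek = dtri_ends[OF dk] and eG = dtri_ends[OF dG]
  have "tgt T G = src T s" "tgt T s' = src T G" using G se se' by simp_all
  note ends = this
  obtain u v w where uv: "src T u = tgt T b" "tgt T u = tgt T k" "src T v = tgt T k" "tgt T v = tgt T q"
      "dtri T u v w" "u \<cdot> b = k \<cdot> s" "v \<cdot> k = q"
    by (rule octahedron[OF dG d dk ends(1)])
  \<comment> \<open>The cone of \<open>v\<close> is the suspended cone of \<open>G\<close>, by
    rotating the octahedral triangle.\<close>
  have vL: "cone_in L v"
    using dtri_rot[OF uv(5)] dtri_ends[OF uv(5)] uv(1) bL tri_sub_shift[OF L'] unfolding cone_in_def by metis
  obtain u2 v2 w2 where uv2: "src T u2 = tgt T q'" "tgt T u2 = tgt T k" "src T v2 = tgt T k"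
      "tgt T v2 = tgt T b" "dtri T u2 v2 w2" "u2 \<cdot> q' = k \<cdot> G" "v2 \<cdot> k = b"
    by (rule octahedron[OF d' dG dk[unfolded comm] ends(2)])
  have uL: "cone_in L u2" using uv2(4,5) bL by (auto simp: cone_in_def)
  \<comment> \<open>In the constant telescope the map from the initial stage is invertible, which
    starts the chain of composites ending in \<open>q \<cdot> \<iota> 0\<close>.\<close>
  have "cone_in L (q' \<cdot> \<iota>' 0)"
    by (rule cone_in_iso[OF L' telescope_iso[OF tel']]) simp
  then have "cone_in L (u2 \<cdot> (q' \<cdot> \<iota>' 0))"
    by (rule cone_in_cmp[OF L' _ uL]) (use inj' e' se' uv2(1-4) in auto)
  then have "cone_in L (v \<cdot> (u2 \<cdot> (q' \<cdot> \<iota>' 0)))"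
    by (rule cone_in_cmp[OF L' _ vL]) (use inj' e' se' uv(1-4) uv2(1-4) in auto)
  also have "v \<cdot> (u2 \<cdot> (q' \<cdot> \<iota>' 0)) = v \<cdot> ((k \<cdot> G) \<cdot> \<iota>' 0)"
    using cmp_reassoc[OF uv2(6), of "\<iota>' 0"] inj' e' se' uv(1-4) uv2(1-4) by simp
  also have "\<dots> = (v \<cdot> k) \<cdot> (G \<cdot> \<iota>' 0)"
    using inj' G(1,2) ek se uv(1-4) by simp
  also have "\<dots> = q \<cdot> \<iota> 0"
    unfolding uv(7) G(3) c(1) using inj e se by simp
  finally show ?thesis .
qed

end

section \<open>Smashing ideals\<close>

context big_tt_category
begin

abbreviation big_unit_object (\<open>\<one>\<close>) where "\<one> \<equiv> tunit T"

lemma zero_whisker_assoc: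
  assumes "f \<boxtimes> idn T (X \<star> Y) = mzero T (src T f \<star> (X \<star> Y)) (tgt T f \<star> (X \<star> Y))"
  shows "(f \<boxtimes> idn T X) \<boxtimes> idn T Y = mzero T ((src T f \<star> X) \<star> Y) ((tgt T f \<star> X) \<star> Y)"
proof (rule iso_cancel_left[OF assoc_iso])
  show "assoc T (tgt T f) X Y \<cdot> ((f \<boxtimes> idn T X) \<boxtimes> idn T Y)
      = assoc T (tgt T f) X Y \<cdot> mzero T ((src T f \<star> X) \<star> Y) ((tgt T f \<star> X) \<star> Y)"
    using assoc_nat[of f "idn T X" "idn T Y"] assms by simp
qed auto

text \<open>Up to a unitor, each transition map is \<open>u\<close> tensored with the previous
  stage. Hence vanishing or invertibility of \<open>u\<close> after tensoring with an object, and
  cones in \<open>L\<close>, pass to every transition map, and from there to the telescope by the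
  three lemmas above.\<close>

lemma unit_telescope:
  assumes u: "src T u = \<one>"
  obtains f where "src T f = \<one>"
    "\<And>B. u \<boxtimes> idn T B = mzero T (\<one> \<star> B) (tgt T u \<star> B) \<Longrightarrow> zero_object T (tgt T f \<star> B)"
    "\<And>Y. iso_arrow T (u \<boxtimes> idn T Y) \<Longrightarrow> iso_arrow T (f \<boxtimes> idn T Y)"
    "\<And>L. localizing_subcategory T L \<Longrightarrow> (\<And>Y. cone_in L (u \<boxtimes> idn T Y)) \<Longrightarrow> cone_in L f"
proof -
  define X where "X = rec_nat \<one> (\<lambda>n Y. tgt T u \<star> Y)"
  have X: "X 0 = \<one>" "X (Suc n) = tgt T u \<star> X n" for n by (simp_all add: X_def)
  define l where "l = (\<lambda>n. arrow_inv T (lunit T (X n)))"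
  have l: "src T (l n) = X n" "tgt T (l n) = \<one> \<star> X n" "iso_arrow T (l n)" for n
    using arrow_inv[OF lunit_iso[of "X n"]] iso_arrow_inv[OF lunit_iso[of "X n"]] by (simp_all add: l_def)
  define t where "t = (\<lambda>n. (u \<boxtimes> idn T (X n)) \<cdot> l n)"
  have t: "src T (t n) = X n \<and> tgt T (t n) = X (Suc n)" for n
    using l u by (simp add: t_def X)
  obtain S \<iota> s q where tel: "telescope X t S \<iota> s q"
    using ex_telescope[of t X thesis] t by blast
  note a = tel[unfolded telescope_def]
  then have S: "is_coproduct T UNIV X S \<iota>" by blast
  note inj = coproduct_inj[OF S, simplified]
  have q: "src T q = S" using a dtri_ends(1) by metis
  let ?f = "q \<cdot> \<iota> 0"
  have tB: "t n \<boxtimes> idn T B = ((u \<boxtimes> idn T (X n)) \<boxtimes> idn T B) \<cdot> (l n \<boxtimes> idn T B)" for n B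
    using l u by (simp add: t_def tarr_merge)
  show thesis
  proof (rule that[of ?f])
    show "src T ?f = \<one>" using inj q X by simp
  next
    fix B assume B: "u \<boxtimes> idn T B = mzero T (\<one> \<star> B) (tgt T u \<star> B)"
    have "t n \<boxtimes> idn T B = mzero T (X n \<star> B) (X (Suc n) \<star> B)" for n
    proof -
      have "u \<boxtimes> idn T (B \<star> X n) = mzero T (src T u \<star> (B \<star> X n)) (tgt T u \<star> (B \<star> X n))"
        by (rule zero_whisker_tensor) (use B u in simp)
      then have "u \<boxtimes> idn T (X n \<star> B) = mzero T (src T u \<star> (X n \<star> B)) (tgt T u \<star> (X n \<star> B))"
        by (rule zero_whisker_iso[OF _ tobj_commute])
      then show ?thesis
        unfolding tB using zero_whisker_assoc l u by (simp add: X)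
    qed
    then have "zero_object T (tgt T (q \<boxtimes> idn T B))"
      by (rule telescope_zero[OF telescope_tensor[OF tel]])
    then show "zero_object T (tgt T ?f \<star> B)" using inj q by simp
  next
    fix Y assume Y: "iso_arrow T (u \<boxtimes> idn T Y)"
    have "iso_arrow T (t n \<boxtimes> idn T Y)" for n
    proof -
      have "iso_arrow T (u \<boxtimes> idn T (Y \<star> X n))" by (rule iso_whisker_tensor[OF Y])
      then have "iso_arrow T (u \<boxtimes> idn T (X n \<star> Y))" by (rule iso_whisker_iso[OF _ tobj_commute])
      then have "iso_arrow T ((u \<boxtimes> idn T (X n)) \<boxtimes> idn T Y)" by (simp add: iso_whisker_assoc)
      then show ?thesis
        unfolding tB by - (rule iso_cmp, use l u in \<open>auto intro: tarr_iso\<close>)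
    qed
    then have "iso_arrow T ((q \<boxtimes> idn T Y) \<cdot> (\<iota> 0 \<boxtimes> idn T Y))"
      by (rule telescope_iso[OF telescope_tensor[OF tel]])
    then show "iso_arrow T (?f \<boxtimes> idn T Y)" using inj q by (simp add: tarr_merge)
  next
    fix L assume L: "localizing_subcategory T L" "\<And>Y. cone_in L (u \<boxtimes> idn T Y)"
    note L' = localizing_triangulated[OF L(1)]
    have "cone_in L (t n)" for n
      unfolding t_def using cone_in_cmp[OF L' cone_in_iso[OF L' l(3)] L(2)] l u by simp
    then show "cone_in L ?f" by (rule cone_in_telescope[OF L(1) tel])
  qed
qed

text \<open>The assumption on \<open>s\<close> makes each \<open>B i\<close> killed by
  \<open>tgt T f\<close>. The assumption relating \<open>B i \<star> Y\<close> to
  \<open>src T (a i) \<star> Y\<close> makes the coproduct \<open>A\<close> vanish on every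
  \<open>Y\<close> orthogonal to all \<open>B i\<close>. The last conclusion, membership of the
  fibre in localizing ideals, is what identifies finite localizations.\<close>

lemma bousfield_triangle:
  assumes I: "small T I" and a: "\<And>i. i \<in> I \<Longrightarrow> tgt T (a i) = \<one>"
    and s: "\<And>i. i \<in> I \<Longrightarrow> src T (s i) = \<one> \<star> B i \<and> tgt T (s i) = src T (a i) \<star> B i \<and>
      (a i \<boxtimes> idn T (B i)) \<cdot> s i = idn T (\<one> \<star> B i)"
    and z: "\<And>i Y. i \<in> I \<Longrightarrow> zero_object T (B i \<star> Y) \<Longrightarrow> zero_object T (src T (a i) \<star> Y)"
  obtains e f d where "dtri T e f d" "tgt T e = \<one>" "\<And>i. i \<in> I \<Longrightarrow> zero_object T (B i \<star> tgt T f)"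
    "\<And>Y. (\<And>i. i \<in> I \<Longrightarrow> zero_object T (B i \<star> Y)) \<Longrightarrow> zero_object T (src T e \<star> Y)"
    "\<And>L. localizing_ideal T L \<Longrightarrow> (\<And>i. i \<in> I \<Longrightarrow> src T (a i) \<in> L) \<Longrightarrow> src T e \<in> L"
proof -
  obtain A \<iota> where A: "is_coproduct T I (\<lambda>i. src T (a i)) A \<iota>"
    using I by (rule ex_small_coproduct)
  note inj = coproduct_inj[OF A]
  obtain a' where a': "src T a' = A" "tgt T a' = \<one>" "\<And>i. i \<in> I \<Longrightarrow> a' \<cdot> \<iota> i = a i"
    using coproduct_desc[OF A, of a \<one> thesis] a by auto
  obtain u d0 where d0: "dtri T a' u d0" by (rule ex_cone)
  have u: "src T u = \<one>" using dtri_ends[OF d0] a' by simp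
  obtain f where f: "src T f = \<one>"
    "\<And>B. u \<boxtimes> idn T B = mzero T (\<one> \<star> B) (tgt T u \<star> B) \<Longrightarrow> zero_object T (tgt T f \<star> B)"
    "\<And>Y. iso_arrow T (u \<boxtimes> idn T Y) \<Longrightarrow> iso_arrow T (f \<boxtimes> idn T Y)"
    "\<And>L. localizing_subcategory T L \<Longrightarrow> (\<And>Y. cone_in L (u \<boxtimes> idn T Y)) \<Longrightarrow> cone_in L f"
    using unit_telescope[OF u] by metis
  obtain e d where d: "dtri T e f d" by (rule ex_fibre)
  show thesis
  proof (rule that[OF d])
    show "tgt T e = \<one>" using dtri_ends[OF d] f by simp
  next
    fix i assume i: "i \<in> I"
    have "u \<cdot> a i = (u \<cdot> a') \<cdot> \<iota> i" using inj[OF i] u a'(1,2) a'(3)[OF i] by simp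
    also have "\<dots> = mzero T (src T (a i)) (tgt T u)"
      using dtri_comp_zero(1)[OF d0] inj[OF i] a'(1) by simp
    finally have ua: "u \<cdot> a i = mzero T (src T (a i)) (tgt T u)" .
    \<comment> \<open>Inserting the splitting \<open>s i\<close> turns
      \<open>u \<boxtimes> idn T (B i)\<close> into a composite through
      \<open>u \<cdot> a i\<close>, which is zero since \<open>u\<close> is the cone map of
      \<open>a'\<close>.\<close>
    have "u \<boxtimes> idn T (B i) = (u \<boxtimes> idn T (B i)) \<cdot> ((a i \<boxtimes> idn T (B i)) \<cdot> s i)"
      using s[OF i] u by simp
    also have "\<dots> = ((u \<cdot> a i) \<boxtimes> idn T (B i)) \<cdot> s i"
      by (subst tarr_merge_cmp) (use s[OF i] u a[OF i] in auto)
    also have "\<dots> = mzero T (\<one> \<star> B i) (tgt T u \<star> B i)"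
      unfolding ua using s[OF i] by simp
    finally have "zero_object T (tgt T f \<star> B i)" by (rule f(2))
    then show "zero_object T (B i \<star> tgt T f)" using zero_tensor_commute by blast
  next
    fix Y assume Y: "\<And>i. i \<in> I \<Longrightarrow> zero_object T (B i \<star> Y)"
    have "zero_object T (A \<star> Y)"
      by (rule zero_object_coproduct[OF tensor_coproduct[OF A]]) (use z Y in auto)
    then have "iso_arrow T (u \<boxtimes> idn T Y)"
      using zero_fibre_tensor[OF d0] a' by simp
    then show "zero_object T (src T e \<star> Y)"
      using zero_fibre_tensor[OF d] f(3) by simp
  next
    fix L assume L: "localizing_ideal T L" "\<And>i. i \<in> I \<Longrightarrow> src T (a i) \<in> L"
    then have L1: "localizing_subcategory T L" by (simp add: localizing_ideal_def)
    note L2 = localizing_triangulated[OF L1]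
    have "A \<in> L" by (rule localizing_coproduct[OF L1 I A L(2)])
    then have "sobj T A \<in> L" by (simp add: tri_sub_shift[OF L2])
    then have "sobj T A \<star> Y \<in> L" for Y using L(1) by (simp add: localizing_ideal_def)
    then have "tgt T (d0 \<boxtimes> idn T Y) \<in> L" for Y
      using dtri_ends[OF d0] a'(1) by simp
    then have "cone_in L (u \<boxtimes> idn T Y)" for Y
      using tensor_dtri[OF dtri_rot[OF d0], of Y] unfolding cone_in_def by blast
    then have "cone_in L f" by (rule f(4)[OF L1])
    then have "tgt T d \<in> L" by (rule cone_inD[OF L2 _ dtri_rot[OF d]])
    then show "src T e \<in> L" using dtri_ends[OF d] tri_sub_shift[OF L2] by simp
  qed
qed

section \<open>Smashing ideals as kernels and as double orthogonals\<close>

lemma kernel_localizing_ideal: "localizing_ideal T {X. zero_object T (X \<star> F)}"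
  unfolding localizing_ideal_def localizing_subcategory_def
proof (intro conjI ballI allI impI)
  show "triangulated_subcategory T {X. zero_object T (X \<star> F)}"
    using tensor_preimage_triangulated[OF zero_triangulated, of F] by simp
  show "S \<in> {X. zero_object T (X \<star> F)}"
    if "small_index T I \<and> is_coproduct T I X S \<iota> \<and> (\<forall>i \<in> I. X i \<in> {X. zero_object T (X \<star> F)})" for I X S \<iota>
  proof -
    have "is_coproduct T I (\<lambda>i. X i \<star> F) (S \<star> F) (\<lambda>i. \<iota> i \<boxtimes> idn T F)"
      using that tensor_coproduct by blast
    then have "zero_object T (S \<star> F)"
      by (rule zero_object_coproduct) (use that in auto)
    then show ?thesis by simp
  qed
  show "X \<star> Y \<in> {X. zero_object T (X \<star> F)}" if "X \<in> {X. zero_object T (X \<star> F)}" for X Y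
  proof -
    have "zero_object T ((X \<star> F) \<star> Y)" using that zero_tensor by simp
    then show ?thesis using zero_object_cong[OF tobj_right_commute] by blast
  qed
qed

lemma smashing_idealI:
  assumes "dtri T e f d" "tgt T e = \<one>" "zero_object T (src T e \<star> tgt T f)"
  shows "smashing_ideal T {X. zero_object T (X \<star> tgt T f)}"
  unfolding smashing_ideal_def
proof (intro conjI exI bexI)
  show "localizing_ideal T {X. zero_object T (X \<star> tgt T f)}" by (rule kernel_localizing_ideal)
qed (use assms dtri_ends[OF assms(1)] in auto)

lemma smashing_idealE:
  assumes "smashing_ideal T S"
  obtains e f d where "dtri T e f d" "tgt T e = \<one>" "zero_object T (src T e \<star> tgt T f)"
    "S = {X. zero_object T (X \<star> tgt T f)}"
proof -
  obtain E F e f d where "e \<in> Hom T E \<one>" "f \<in> Hom T \<one> F" "dtri T e f d" "zero_object T (E \<star> F)"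
      "S = {X. zero_object T (X \<star> F)}"
    using assms unfolding smashing_ideal_def by blast
  then show thesis by (intro that[of e f d]) auto
qed


lemma smashing_localizing: "smashing_ideal T S \<Longrightarrow> localizing_subcategory T S"
  by (simp add: smashing_ideal_def localizing_ideal_def)

lemma smashing_triangulated: "smashing_ideal T S \<Longrightarrow> triangulated_subcategory T S"
  by (simp add: smashing_localizing localizing_triangulated)

lemma smashing_tensor: "smashing_ideal T S \<Longrightarrow> X \<in> S \<Longrightarrow> X \<star> Y \<in> S"
  by (simp add: smashing_ideal_def localizing_ideal_def)

lemma smashing_UNIV: "smashing_ideal T UNIV"
proof -
  obtain Z where Z: "zero_object T Z" using ex_zero_object by blast
  have "smashing_ideal T {X. zero_object T (X \<star> tgt T (mzero T \<one> Z))}"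
    by (rule smashing_idealI[OF dtri_idn[OF Z]]) (use Z zero_tensor_right in auto)
  then show ?thesis using Z zero_tensor_right by simp
qed

text \<open>The double orthogonal of a class of objects with respect to the relation \<open>X \<otimes> Y = 0\<close>. Smashing
  ideals are closed under it, and all the smashing ideals constructed below have this form.\<close>

definition bhull :: "'o set \<Rightarrow> 'o set" where
  "bhull A = {X. \<forall>Y. (\<forall>a \<in> A. zero_object T (a \<star> Y)) \<longrightarrow> zero_object T (X \<star> Y)}"

lemma bhull_subset: "A \<subseteq> bhull A"
  by (auto simp: bhull_def)

lemma bhull_least: "A \<subseteq> bhull B \<Longrightarrow> bhull A \<subseteq> bhull B"
  unfolding bhull_def by blast

lemma smashing_bhull_subset:
  assumes "smashing_ideal T S" "A \<subseteq> S" shows "bhull A \<subseteq> S"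
proof -
  obtain e f d where "S = {X. zero_object T (X \<star> tgt T f)}"
    using assms(1) by (rule smashing_idealE)
  with assms(2) show ?thesis by (auto simp: bhull_def)
qed

lemma kernel_cmp_iso:
  assumes "dtri T e f d" "tgt T e = \<one>" "zero_object T (X \<star> tgt T f)"
  shows "isomorphic T (src T e \<star> X) X"
proof -
  have "zero_object T (tgt T f \<star> X)" using assms(3) zero_tensor_commute by blast
  then have "iso_arrow T (e \<boxtimes> idn T X)" using zero_cone_tensor[OF assms(1)] by simp
  then have "isomorphic T (src T e \<star> X) (\<one> \<star> X)"
    using assms(2) by (intro isomorphicI[of "e \<boxtimes> idn T X"]) auto
  then show ?thesis using tobj_lunit isomorphic_trans by blast
qed

text \<open>If all of \<open>A\<close> kills \<open>Y\<close>, then \<open>src T e\<close> kills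
  \<open>Y\<close> and \<open>Y\<close> is isomorphic to \<open>tgt T f \<star> Y\<close>. Every
  \<open>X\<close> in the kernel of \<open>tgt T f\<close> then kills \<open>Y\<close> as well. The
  other inclusion is the definition of \<open>bhull\<close>, tested on
  \<open>tgt T f\<close>.\<close>

lemma bhull_eq_kernel:
  assumes d: "dtri T e f d" "tgt T e = \<one>" and A: "\<And>a. a \<in> A \<Longrightarrow> zero_object T (a \<star> tgt T f)"
    and e: "\<And>Y. (\<And>a. a \<in> A \<Longrightarrow> zero_object T (a \<star> Y)) \<Longrightarrow> zero_object T (src T e \<star> Y)"
  shows "bhull A = {X. zero_object T (X \<star> tgt T f)}" "smashing_ideal T (bhull A)"
proof -
  show eq: "bhull A = {X. zero_object T (X \<star> tgt T f)}"
  proof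
    show "bhull A \<subseteq> {X. zero_object T (X \<star> tgt T f)}"
      using A by (auto simp: bhull_def)
    show "{X. zero_object T (X \<star> tgt T f)} \<subseteq> bhull A"
    proof
      fix X assume X: "X \<in> {X. zero_object T (X \<star> tgt T f)}"
      have "zero_object T (X \<star> Y)" if "\<forall>a \<in> A. zero_object T (a \<star> Y)" for Y
      proof -
        have "iso_arrow T (f \<boxtimes> idn T Y)"
          using e[of Y] that zero_fibre_tensor[OF d(1)] by blast
        then have "isomorphic T (\<one> \<star> Y) (tgt T f \<star> Y)"
          using d dtri_ends[OF d(1)] by (intro isomorphicI[of "f \<boxtimes> idn T Y"]) auto
        then have "isomorphic T Y (tgt T f \<star> Y)"
          using tobj_lunit isomorphic_sym isomorphic_trans by blast
        then have "isomorphic T (X \<star> Y) (X \<star> (tgt T f \<star> Y))"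
          by (intro tobj_cong) auto
        also have "isomorphic T (X \<star> (tgt T f \<star> Y)) ((X \<star> tgt T f) \<star> Y)"
          by (rule isomorphic_sym[OF tobj_assoc])
        finally show ?thesis
          using zero_tensor X zero_object_cong by blast
      qed
      then show "X \<in> bhull A" by (simp add: bhull_def)
    qed
  qed
  show "smashing_ideal T (bhull A)"
    unfolding eq by (rule smashing_idealI[OF d]) (rule e, rule A)
qed

text \<open>The idempotent object \<open>src T e\<close> alone generates the ideal as a double
  orthogonal, and on the ideal \<open>e\<close> acts invertibly.\<close>

lemma smashing_generator:
  assumes "smashing_ideal T S"
  obtains e where "tgt T e = \<one>" "src T e \<in> S" "bhull {src T e} = S"
    "\<And>X. X \<in> S \<Longrightarrow> iso_arrow T (e \<boxtimes> idn T X)"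
proof -
  obtain e f d where d: "dtri T e f d" "tgt T e = \<one>" "zero_object T (src T e \<star> tgt T f)"
    and S: "S = {X. zero_object T (X \<star> tgt T f)}"
    using assms by (rule smashing_idealE)
  have "bhull {src T e} = {X. zero_object T (X \<star> tgt T f)}"
    by (rule bhull_eq_kernel[OF d(1,2)]) (use d(3) in auto)
  moreover have "iso_arrow T (e \<boxtimes> idn T X)" if "X \<in> S" for X
    using zero_cone_tensor[OF d(1)] that zero_tensor_commute unfolding S by blast
  ultimately show thesis
    using d S by (intro that[of e]) auto
qed

lemma whisker_iso_section:
  assumes "iso_arrow T (a \<boxtimes> idn T B)" "tgt T a = \<one>"
  shows "\<exists>s. src T s = \<one> \<star> B \<and> tgt T s = src T a \<star> B \<and> (a \<boxtimes> idn T B) \<cdot> s = idn T (\<one> \<star> B)"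
proof -
  obtain s where "src T s = tgt T (a \<boxtimes> idn T B)" "tgt T s = src T (a \<boxtimes> idn T B)"
      "(a \<boxtimes> idn T B) \<cdot> s = idn T (tgt T (a \<boxtimes> idn T B))"
    using assms(1) by (rule iso_arrowE)
  then show ?thesis using assms(2) by (intro exI[of _ s]) simp
qed

text \<open>Each ideal is replaced by its idempotent object, so that the coproduct runs over the
  small set of ideals and not over their objects. The splittings exist because \<open>e S\<close>
  becomes invertible after tensoring with its own source.\<close>

lemma smashing_join:
  assumes "small T \<S>" "\<And>S. S \<in> \<S> \<Longrightarrow> smashing_ideal T S"
  shows "smashing_ideal T (bhull (\<Union>\<S>))"
proof -
  have "\<exists>e. tgt T e = \<one> \<and> src T e \<in> S \<and> bhull {src T e} = S \<and> (\<forall>X \<in> S. iso_arrow T (e \<boxtimes> idn T X))"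
    if "S \<in> \<S>" for S
    using smashing_generator[OF assms(2)[OF that]] by metis
  then obtain e where e: "\<And>S. S \<in> \<S> \<Longrightarrow> tgt T (e S) = \<one>" "\<And>S. S \<in> \<S> \<Longrightarrow> src T (e S) \<in> S"
      "\<And>S. S \<in> \<S> \<Longrightarrow> bhull {src T (e S)} = S" "\<And>S X. S \<in> \<S> \<Longrightarrow> X \<in> S \<Longrightarrow> iso_arrow T (e S \<boxtimes> idn T X)"
    by metis
  have "\<exists>s. src T s = \<one> \<star> src T (e S) \<and> tgt T s = src T (e S) \<star> src T (e S) \<and>
      (e S \<boxtimes> idn T (src T (e S))) \<cdot> s = idn T (\<one> \<star> src T (e S))" if "S \<in> \<S>" for S
    using whisker_iso_section e that by blast
  then obtain s where s: "\<And>S. S \<in> \<S> \<Longrightarrow> src T (s S) = \<one> \<star> src T (e S) \<and>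
      tgt T (s S) = src T (e S) \<star> src T (e S) \<and>
      (e S \<boxtimes> idn T (src T (e S))) \<cdot> s S = idn T (\<one> \<star> src T (e S))"
    by metis
  obtain e' f d where d: "dtri T e' f d" "tgt T e' = \<one>"
    "\<And>S. S \<in> \<S> \<Longrightarrow> zero_object T (src T (e S) \<star> tgt T f)"
    "\<And>Y. (\<And>S. S \<in> \<S> \<Longrightarrow> zero_object T (src T (e S) \<star> Y)) \<Longrightarrow> zero_object T (src T e' \<star> Y)"
    by (rule bousfield_triangle[OF assms(1) e(1) s]) blast+
  let ?G = "(\<lambda>S. src T (e S)) ` \<S>"
  have "smashing_ideal T (bhull ?G)"
    by (rule bhull_eq_kernel(2)[OF d(1,2)]) (use d(3,4) in auto)
  moreover have "bhull ?G = bhull (\<Union>\<S>)"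
  proof
    show "bhull ?G \<subseteq> bhull (\<Union>\<S>)"
      using e(2) bhull_subset[of "\<Union>\<S>"] by (intro bhull_least) blast
    have "S \<subseteq> bhull ?G" if "S \<in> \<S>" for S
    proof -
      have "bhull {src T (e S)} \<subseteq> bhull ?G"
        using bhull_subset[of ?G] that by (intro bhull_least) auto
      then show ?thesis using e(3)[OF that] by simp
    qed
    then show "bhull (\<Union>\<S>) \<subseteq> bhull ?G" by (intro bhull_least) blast
  qed
  ultimately show ?thesis by simp
qed

lemma smashing_Int:
  assumes S: "smashing_ideal T S" and R: "smashing_ideal T R"
  shows "smashing_ideal T (S \<inter> R)"
proof -
  obtain e1 where e1: "tgt T e1 = \<one>" "src T e1 \<in> S" "bhull {src T e1} = S"
    "\<And>X. X \<in> S \<Longrightarrow> iso_arrow T (e1 \<boxtimes> idn T X)"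
    using S by (rule smashing_generator) blast
  obtain e2 where e2: "tgt T e2 = \<one>" "src T e2 \<in> R" "bhull {src T e2} = R"
    "\<And>X. X \<in> R \<Longrightarrow> iso_arrow T (e2 \<boxtimes> idn T X)"
    using R by (rule smashing_generator) blast
  let ?E1 = "src T e1" and ?E2 = "src T e2"
  let ?B = "?E1 \<star> ?E2"
  have BS: "?B \<in> S" using smashing_tensor[OF S e1(2)] .
  have "?E2 \<star> ?E1 \<in> R" using smashing_tensor[OF R e2(2)] .
  then have BR: "?B \<in> R" using tri_sub_iso[OF smashing_triangulated[OF R] tobj_commute] by blast
  \<comment> \<open>This is \<open>e1\<close> tensored with \<open>e2\<close>, up to a unitor. Both
    factors become invertible after tensoring with \<open>?B\<close>, because \<open>?B\<close> lies
    in both ideals.\<close>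
  let ?a = "e1 \<cdot> (runit T ?E1 \<cdot> (idn T ?E1 \<boxtimes> e2))"
  have ae: "tgt T ?a = \<one>" "src T ?a = ?B" using e1 e2 by simp_all
  have "iso_arrow T ((idn T ?E1 \<boxtimes> e2) \<boxtimes> idn T ?B)"
  proof -
    have "iso_arrow T (e2 \<boxtimes> idn T ?B)" by (rule e2(4)[OF BR])
    then have "iso_arrow T (idn T ?E1 \<boxtimes> (e2 \<boxtimes> idn T ?B))" by (rule tarr_iso[OF iso_idn])
    then have "iso_arrow T ((idn T ?E1 \<boxtimes> (e2 \<boxtimes> idn T ?B)) \<cdot> assoc T ?E1 ?E2 ?B)"
      by (rule iso_cmp[OF assoc_iso]) simp
    also have "\<dots> = assoc T ?E1 \<one> ?B \<cdot> ((idn T ?E1 \<boxtimes> e2) \<boxtimes> idn T ?B)"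
      using assoc_nat[of "idn T ?E1" e2 "idn T ?B"] e2 by simp
    finally show ?thesis by (rule iso_cmp_cancel_left) (use e2 in auto)
  qed
  then have "iso_arrow T ((runit T ?E1 \<boxtimes> idn T ?B) \<cdot> ((idn T ?E1 \<boxtimes> e2) \<boxtimes> idn T ?B))"
    by (rule iso_cmp) (use e2 in \<open>auto intro: tarr_iso\<close>)
  then have "iso_arrow T ((e1 \<boxtimes> idn T ?B) \<cdot> ((runit T ?E1 \<boxtimes> idn T ?B) \<cdot> ((idn T ?E1 \<boxtimes> e2) \<boxtimes> idn T ?B)))"
    by (rule iso_cmp) (use e1 e2 BS in auto)
  then have "iso_arrow T (?a \<boxtimes> idn T ?B)"
    using e1(1) e2(1) by (simp add: tarr_merge)
  then obtain s where s: "src T s = \<one> \<star> ?B" "tgt T s = src T ?a \<star> ?B" "(?a \<boxtimes> idn T ?B) \<cdot> s = idn T (\<one> \<star> ?B)"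
    using whisker_iso_section ae by blast
  have unit: "small T {()}" by (rule small_surj[OF small_nat, of _ "\<lambda>_. ()"]) auto
  obtain e' f d where d: "dtri T e' f d" "tgt T e' = \<one>"
    "\<And>i. i \<in> {()} \<Longrightarrow> zero_object T (?B \<star> tgt T f)"
    "\<And>Y. (\<And>i. i \<in> {()} \<Longrightarrow> zero_object T (?B \<star> Y)) \<Longrightarrow> zero_object T (src T e' \<star> Y)"
  proof (rule bousfield_triangle[OF unit, of "\<lambda>_. ?a" "\<lambda>_. s" "\<lambda>_. ?B"])
    show "zero_object T (src T ?a \<star> Y)" if "zero_object T (?B \<star> Y)" for Y
      unfolding ae(2) by (rule that)
  qed (use ae s in auto)
  have "smashing_ideal T (bhull {?B})"
    by (rule bhull_eq_kernel(2)[OF d(1,2)]) (use d(3,4) in auto)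
  moreover have "bhull {?B} = S \<inter> R"
  proof
    show "bhull {?B} \<subseteq> S \<inter> R"
      using smashing_bhull_subset[OF S, of "{?B}"] smashing_bhull_subset[OF R, of "{?B}"] BS BR by blast
    show "S \<inter> R \<subseteq> bhull {?B}"
    proof
      fix X assume X: "X \<in> S \<inter> R"
      have "zero_object T (X \<star> Y)" if Y: "zero_object T (?B \<star> Y)" for Y
      proof -
        \<comment> \<open>For \<open>X\<close> in both ideals, tensoring with \<open>?E2\<close> and
          then with \<open>?E1\<close> returns \<open>X\<close>, so whatever is killed by
          \<open>?B\<close> is killed by \<open>X\<close>.\<close>
        have "isomorphic T (?E2 \<star> X) (\<one> \<star> X)"
          using e2(1) e2(4)[of X] X by (intro isomorphicI[of "e2 \<boxtimes> idn T X"]) auto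
        then have 2: "isomorphic T (?E2 \<star> X) X" using tobj_lunit isomorphic_trans by blast
        have "isomorphic T (?E1 \<star> X) (\<one> \<star> X)"
          using e1(1) e1(4)[of X] X by (intro isomorphicI[of "e1 \<boxtimes> idn T X"]) auto
        then have 1: "isomorphic T (?E1 \<star> X) X" using tobj_lunit isomorphic_trans by blast
        have "isomorphic T (?B \<star> X) (?E1 \<star> (?E2 \<star> X))" by (rule tobj_assoc)
        also have "isomorphic T \<dots> (?E1 \<star> X)" by (rule tobj_cong[OF isomorphic_refl 2])
        also have "isomorphic T \<dots> X" by (rule 1)
        finally have "isomorphic T ((?B \<star> X) \<star> Y) (X \<star> Y)" by (rule tobj_cong[OF _ isomorphic_refl])
        moreover have "zero_object T ((?B \<star> X) \<star> Y)"
          using zero_object_cong[OF tobj_right_commute] zero_tensor[OF Y] by blast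
        ultimately show ?thesis using zero_object_cong by blast
      qed
      then show "X \<in> bhull {?B}" by (simp add: bhull_def)
    qed
  qed
  ultimately show ?thesis by simp
qed

text \<open>Finite localization, with the evaluations of chosen representatives as the family of
  maps to the unit. Minimality among all localizing ideals, not only smashing ones, holds because
  the fibre \<open>src T e\<close> is built inside \<open>L\<close> and every \<open>X\<close> in
  the hull is isomorphic to \<open>src T e \<star> X\<close>.\<close>

lemma bhull_compacts:
  assumes "A \<subseteq> compacts T"
  shows "smashing_ideal T (bhull A)" "\<And>L. localizing_ideal T L \<Longrightarrow> A \<subseteq> L \<Longrightarrow> bhull A \<subseteq> L"
proof -
  obtain R where R: "R \<subseteq> compacts T" "small T R" "\<forall>c \<in> compacts T. \<exists>r \<in> R. isomorphic T c r"
    using compacts_essentially_small by blast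
  \<comment> \<open>\<open>A\<close> need not be small; its isomorphism classes are represented by a
    subset of the small set \<open>R\<close>, and replacing objects by isomorphic ones does not
    change the double orthogonal.\<close>
  let ?I = "{r \<in> R. \<exists>a \<in> A. isomorphic T a r}"
  have I: "small T ?I" by (rule small_surj[OF R(2), of _ id]) auto
  define P where "P = (\<lambda>r D ev s. src T ev = D \<star> r \<and> tgt T ev = \<one> \<and> src T s = \<one> \<star> r \<and>
      tgt T s = (D \<star> r) \<star> r \<and> (ev \<boxtimes> idn T r) \<cdot> s = idn T (\<one> \<star> r))"
  have "\<exists>D ev s. P r D ev s" if "r \<in> ?I" for r
  proof -
    have "rigid T r" using that R(1) compact_iff_rigid by (auto simp: compacts_def)
    then show ?thesis unfolding P_def by (rule rigid_counit_split_epi) blast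
  qed
  then obtain D ev s where "\<And>r. r \<in> ?I \<Longrightarrow> P r (D r) (ev r) (s r)"
    by metis
  then have ev: "src T (ev r) = D r \<star> r" "tgt T (ev r) = \<one>" "src T (s r) = \<one> \<star> r"
      "tgt T (s r) = (D r \<star> r) \<star> r" "(ev r \<boxtimes> idn T r) \<cdot> s r = idn T (\<one> \<star> r)" if "r \<in> ?I" for r
    using that unfolding P_def by blast+
  obtain e f d where d: "dtri T e f d" "tgt T e = \<one>"
    "\<And>r. r \<in> ?I \<Longrightarrow> zero_object T (r \<star> tgt T f)"
    "\<And>Y. (\<And>r. r \<in> ?I \<Longrightarrow> zero_object T (r \<star> Y)) \<Longrightarrow> zero_object T (src T e \<star> Y)"
    "\<And>L. localizing_ideal T L \<Longrightarrow> (\<And>r. r \<in> ?I \<Longrightarrow> src T (ev r) \<in> L) \<Longrightarrow> src T e \<in> L"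
  proof (rule bousfield_triangle[OF I, of ev s "\<lambda>r. r"])
    fix r Y assume r: "r \<in> ?I" and z: "zero_object T (r \<star> Y)"
    have "zero_object T (D r \<star> (r \<star> Y))" by (rule zero_tensor_right[OF z])
    then have "zero_object T ((D r \<star> r) \<star> Y)" using zero_object_cong[OF tobj_assoc] by blast
    then show "zero_object T (src T (ev r) \<star> Y)" using ev(1)[OF r] by simp
  next
    fix r assume "r \<in> ?I"
    then show "tgt T (ev r) = \<one>" by (rule ev(2))
  next
    fix r assume r: "r \<in> ?I"
    show "src T (s r) = \<one> \<star> r \<and> tgt T (s r) = src T (ev r) \<star> r \<and> (ev r \<boxtimes> idn T r) \<cdot> s r = idn T (\<one> \<star> r)"
      using ev[OF r] by simp
  qed blast
  have sm: "smashing_ideal T (bhull ?I)" and ker: "bhull ?I = {X. zero_object T (X \<star> tgt T f)}"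
    by (rule bhull_eq_kernel[OF d(1,2)]; use d(3,4) in blast)+
  have "bhull ?I = bhull A"
  proof
    have killed: "zero_object T (r \<star> Y)" if "isomorphic T a r" "zero_object T (a \<star> Y)" for a r Y
      using tobj_cong[OF that(1) isomorphic_refl] that(2) zero_object_cong by blast
    show "bhull ?I \<subseteq> bhull A"
      using killed by (intro bhull_least) (auto simp: bhull_def)
    show "bhull A \<subseteq> bhull ?I"
    proof (intro bhull_least subsetI)
      fix a assume a: "a \<in> A"
      then obtain r where r: "r \<in> R" "isomorphic T a r" using R(3) assms by blast
      then have "r \<in> ?I" using a by blast
      then show "a \<in> bhull ?I"
        using killed[OF isomorphic_sym[OF r(2)]] by (auto simp: bhull_def)
    qed
  qed
  then show "smashing_ideal T (bhull A)" using sm by simp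
  fix L assume L: "localizing_ideal T L" "A \<subseteq> L"
  then have L': "triangulated_subcategory T L" by (simp add: localizing_ideal_def localizing_triangulated)
  have "src T (ev r) \<in> L" if "r \<in> ?I" for r
  proof -
    have "r \<in> L" using that L tri_sub_iso[OF L'] by blast
    then have "r \<star> D r \<in> L" using L(1) by (simp add: localizing_ideal_def)
    then have "D r \<star> r \<in> L" using tri_sub_iso[OF L' tobj_commute] by blast
    then show ?thesis using ev(1)[OF that] by simp
  qed
  then have e: "src T e \<in> L" using d(5)[OF L(1)] by blast
  show "bhull A \<subseteq> L"
  proof
    fix X assume "X \<in> bhull A"
    then have "zero_object T (X \<star> tgt T f)" using \<open>bhull ?I = bhull A\<close> ker by blast
    then have "isomorphic T (src T e \<star> X) X" by (rule kernel_cmp_iso[OF d(1,2)])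
    moreover have "src T e \<star> X \<in> L" using e L(1) by (simp add: localizing_ideal_def)
    ultimately show "X \<in> L" using tri_sub_iso[OF L'] by blast
  qed
qed

text \<open>If \<open>a \<star> b\<close> kills \<open>Y\<close>, then \<open>a\<close> kills
  \<open>b \<star> Y\<close>, hence so does \<open>X\<close>. Read as \<open>b\<close> killing
  \<open>X \<star> Y\<close>, this passes to the idempotent object of \<open>bhull {b}\<close>,
  which does not change \<open>X\<close>. The primeness of \<open>psi T P\<close> depends on
  this.\<close>

lemma bhull_tensor:
  assumes "smashing_ideal T (bhull {b})"
  shows "bhull {a} \<inter> bhull {b} \<subseteq> bhull {a \<star> b}"
proof
  obtain e where e: "tgt T e = \<one>" "src T e \<in> bhull {b}"
    "\<And>X. X \<in> bhull {b} \<Longrightarrow> iso_arrow T (e \<boxtimes> idn T X)"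
    using assms by (rule smashing_generator) blast
  fix X assume X: "X \<in> bhull {a} \<inter> bhull {b}"
  have "zero_object T (X \<star> Y)" if "zero_object T ((a \<star> b) \<star> Y)" for Y
  proof -
    have "zero_object T (a \<star> (b \<star> Y))" using that zero_object_cong[OF tobj_assoc] by blast
    then have "zero_object T (X \<star> (b \<star> Y))" using X by (simp add: bhull_def)
    then have "zero_object T (b \<star> (X \<star> Y))" using zero_object_cong[OF tobj_left_commute] by blast
    then have "zero_object T (src T e \<star> (X \<star> Y))" using e(2) by (simp add: bhull_def)
    then have "zero_object T ((src T e \<star> X) \<star> Y)" using zero_object_cong[OF tobj_assoc] by blast
    moreover have "isomorphic T (src T e \<star> X) (\<one> \<star> X)"
      using e(1) e(3)[of X] X by (intro isomorphicI[of "e \<boxtimes> idn T X"]) auto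
    then have "isomorphic T (src T e \<star> X) X" using tobj_lunit isomorphic_trans by blast
    then have "isomorphic T ((src T e \<star> X) \<star> Y) (X \<star> Y)" by (rule tobj_cong[OF _ isomorphic_refl])
    ultimately show ?thesis using zero_object_cong by blast
  qed
  then show "X \<in> bhull {a \<star> b}" by (simp add: bhull_def)
qed

end

section \<open>Compact objects\<close>

context category
begin

lemma coproduct_compare:
  assumes "is_coproduct C I X S \<iota>" "is_coproduct C I X S' \<iota>'"
  obtains h where "iso_arrow C h" "src C h = S" "tgt C h = S'" "\<And>i. i \<in> I \<Longrightarrow> h \<cdot> \<iota> i = \<iota>' i"
proof -
  note inj = coproduct_inj[OF assms(1)] coproduct_inj[OF assms(2)]
  obtain h where h: "src C h = S" "tgt C h = S'" "\<And>i. i \<in> I \<Longrightarrow> h \<cdot> \<iota> i = \<iota>' i"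
    by (rule coproduct_desc[OF assms(1), of \<iota>' S']) (use inj in auto)
  obtain k where k: "src C k = S'" "tgt C k = S" "\<And>i. i \<in> I \<Longrightarrow> k \<cdot> \<iota>' i = \<iota> i"
    by (rule coproduct_desc[OF assms(2), of \<iota> S]) (use inj in auto)
  have "k \<cdot> h = idn C S"
    by (rule coproduct_ext[OF assms(1)]) (use h k inj in auto)
  moreover have "h \<cdot> k = idn C S'"
    by (rule coproduct_ext[OF assms(2)]) (use h k inj in auto)
  ultimately have "iso_arrow C h"
    using h k by (intro iso_arrowI[of k]) auto
  with h that show thesis by blast
qed

lemma coproduct_iso_components:
  assumes "is_coproduct C I X S \<iota>"
    and \<psi>: "\<And>i. i \<in> I \<Longrightarrow> iso_arrow C (\<psi> i) \<and> src C (\<psi> i) = X' i \<and> tgt C (\<psi> i) = X i"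
  shows "is_coproduct C I X' S (\<lambda>i. \<iota> i \<cdot> \<psi> i)"
proof (rule is_coproductI)
  note inj = coproduct_inj[OF assms(1)]
  show "src C (\<iota> i \<cdot> \<psi> i) = X' i \<and> tgt C (\<iota> i \<cdot> \<psi> i) = S" if "i \<in> I" for i
    using inj[OF that] \<psi>[OF that] by simp
  fix Y f assume f: "\<And>i. i \<in> I \<Longrightarrow> src C (f i) = X' i \<and> tgt C (f i) = Y"
  have inv: "src C (arrow_inv C (\<psi> i)) = X i" "tgt C (arrow_inv C (\<psi> i)) = X' i"
    "arrow_inv C (\<psi> i) \<cdot> \<psi> i = idn C (X' i)" if "i \<in> I" for i
    using arrow_inv[of "\<psi> i"] \<psi>[OF that] by auto
  obtain h where h: "src C h = S" "tgt C h = Y" "\<And>i. i \<in> I \<Longrightarrow> h \<cdot> \<iota> i = f i \<cdot> arrow_inv C (\<psi> i)"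
    using coproduct_desc[OF assms(1), of "\<lambda>i. f i \<cdot> arrow_inv C (\<psi> i)" Y thesis] f inv by auto
  have "h \<cdot> (\<iota> i \<cdot> \<psi> i) = f i" if i: "i \<in> I" for i
  proof -
    have "h \<cdot> (\<iota> i \<cdot> \<psi> i) = (h \<cdot> \<iota> i) \<cdot> \<psi> i"
      using h(1) inj[OF i] \<psi>[OF i] by simp
    also have "\<dots> = f i" unfolding h(3)[OF i] using f[OF i] inv[OF i] \<psi>[OF i] by simp
    finally show ?thesis .
  qed
  with h show "\<exists>h. src C h = S \<and> tgt C h = Y \<and> (\<forall>i \<in> I. h \<cdot> (\<iota> i \<cdot> \<psi> i) = f i)" by blast
next
  note inj = coproduct_inj[OF assms(1)]
  fix h k assume hk: "src C h = S" "src C k = S" "tgt C h = tgt C k"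
    "\<And>i. i \<in> I \<Longrightarrow> h \<cdot> (\<iota> i \<cdot> \<psi> i) = k \<cdot> (\<iota> i \<cdot> \<psi> i)"
  show "h = k"
  proof (rule coproduct_ext[OF assms(1) hk(1-3)])
    fix i assume i: "i \<in> I"
    show "h \<cdot> \<iota> i = k \<cdot> \<iota> i"
    proof (rule iso_cancel_right)
      show "iso_arrow C (\<psi> i)" using \<psi>[OF i] by blast
      show "(h \<cdot> \<iota> i) \<cdot> \<psi> i = (k \<cdot> \<iota> i) \<cdot> \<psi> i"
        using hk(1,2) hk(4)[OF i] inj[OF i] \<psi>[OF i] by simp
    qed (use hk(1,2) inj[OF i] \<psi>[OF i] in auto)
  qed
qed

end

section \<open>Maps into a coproduct that are supported on finitely many summands\<close>

context additive_category
begin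

text \<open>For \<open>f\<close> into the coproduct this says that \<open>f\<close> factors through
  the summands in \<open>J\<close>, but it is phrased by annihilation: whatever kills these summands
  kills \<open>f\<close>. In this form the condition transfers easily along suspensions, tensor
  products and retracts.\<close>

definition supported :: "('i \<Rightarrow> 'm) \<Rightarrow> 'i set \<Rightarrow> 'm \<Rightarrow> bool" where
  "supported \<iota> J f \<longleftrightarrow> (\<forall>h. src C h = tgt C f \<longrightarrow>
     (\<forall>i \<in> J. h \<cdot> \<iota> i = mzero C (src C (\<iota> i)) (tgt C h)) \<longrightarrow> h \<cdot> f = mzero C (src C f) (tgt C h))"

lemma supportedD:
  "\<lbrakk>supported \<iota> J f; src C h = tgt C f; \<And>i. i \<in> J \<Longrightarrow> h \<cdot> \<iota> i = mzero C (src C (\<iota> i)) (tgt C h)\<rbrakk>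
    \<Longrightarrow> h \<cdot> f = mzero C (src C f) (tgt C h)"
  by (simp add: supported_def)

text \<open>The idempotent endomorphism that projects onto the summands in \<open>J\<close>.\<close>

definition truncation :: "'i set \<Rightarrow> ('i \<Rightarrow> 'o) \<Rightarrow> 'o \<Rightarrow> ('i \<Rightarrow> 'm) \<Rightarrow> 'i set \<Rightarrow> 'm \<Rightarrow> bool" where
  "truncation I X S \<iota> J \<theta> \<longleftrightarrow> src C \<theta> = S \<and> tgt C \<theta> = S \<and> (\<forall>i \<in> J. \<theta> \<cdot> \<iota> i = \<iota> i) \<and>
     (\<forall>i \<in> I - J. \<theta> \<cdot> \<iota> i = mzero C (X i) S)"

lemma ex_truncation:
  assumes "is_coproduct C I X S \<iota>" "J \<subseteq> I"
  obtains \<theta> where "truncation I X S \<iota> J \<theta>"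
proof -
  define f where "f = (\<lambda>j. if j \<in> J then \<iota> j else mzero C (X j) S)"
  have "src C (f j) = X j \<and> tgt C (f j) = S" if "j \<in> I" for j
    using coproduct_inj[OF assms(1) that] by (auto simp: f_def)
  then obtain \<theta> where "src C \<theta> = S" "tgt C \<theta> = S" "\<And>j. j \<in> I \<Longrightarrow> \<theta> \<cdot> \<iota> j = f j"
    using coproduct_desc[OF assms(1), of f S] by metis
  then have "truncation I X S \<iota> J \<theta>"
    using assms(2) by (auto simp: truncation_def f_def)
  then show thesis by (rule that)
qed

lemma truncation_supported:
  assumes S: "is_coproduct C I X S \<iota>" "J \<subseteq> I" and \<theta>: "truncation I X S \<iota> J \<theta>"
    and f: "supported \<iota> J f" "tgt C f = S"
  shows "\<theta> \<cdot> f = f"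
proof -
  note t = \<theta>[unfolded truncation_def]
  have "(idn C S \<uplus> mneg C \<theta>) \<cdot> f = mzero C (src C f) (tgt C (idn C S \<uplus> mneg C \<theta>))"
  proof (rule supportedD[OF f(1)])
    fix i assume i: "i \<in> J"
    then have ii: "i \<in> I" using S(2) by blast
    have "\<theta> \<cdot> \<iota> i = \<iota> i" using i t by blast
    then show "(idn C S \<uplus> mneg C \<theta>) \<cdot> \<iota> i = mzero C (src C (\<iota> i)) (tgt C (idn C S \<uplus> mneg C \<theta>))"
      using t coproduct_inj[OF S(1) ii] by simp
  qed (use t f(2) in auto)
  then have "f \<uplus> mneg C (\<theta> \<cdot> f) = mzero C (src C f) S"
    using t f(2) by simp
  then have "f = \<theta> \<cdot> f"
    by (rule sub_eq_zero) (use t f(2) in auto)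
  then show ?thesis by simp
qed

text \<open>Induction on \<open>J\<close>: a new index \<open>j\<close> adds the summand
  \<open>\<iota> j \<cdot> p\<close> to the truncation, so \<open>\<theta> \<cdot> f\<close> is a
  finite sum of components of \<open>f\<close>.\<close>

lemma truncation_sum:
  assumes S: "is_coproduct C I X S \<iota>" and J: "finite J" "J \<subseteq> I" and \<theta>: "truncation I X S \<iota> J \<theta>"
    and f: "tgt C f = S" and z: "\<Phi> (mzero C (src C f) S)"
    and add: "\<And>g h. \<lbrakk>src C g = src C f; tgt C g = S; src C h = src C f; tgt C h = S; \<Phi> g; \<Phi> h\<rbrakk> \<Longrightarrow> \<Phi> (g \<uplus> h)"
    and comp: "\<And>i p. i \<in> I \<Longrightarrow> is_projection I X S \<iota> i p \<Longrightarrow> \<Phi> (\<iota> i \<cdot> (p \<cdot> f))"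
  shows "\<Phi> (\<theta> \<cdot> f)"
  using J \<theta>
proof (induction J arbitrary: \<theta> rule: finite_induct)
  case empty
  note t = empty(2)[unfolded truncation_def]
  have "\<theta> = mzero C S S"
    by (rule coproduct_ext[OF S]) (use t coproduct_inj[OF S] in auto)
  then show ?case using z f by simp
next
  case (insert j J)
  note t = insert.prems(2)[unfolded truncation_def]
  have j: "j \<in> I" "J \<subseteq> I" using insert.prems(1) by auto
  obtain \<theta>' where \<theta>': "truncation I X S \<iota> J \<theta>'" using S j(2) by (rule ex_truncation)
  note t' = \<theta>'[unfolded truncation_def]
  obtain p where p: "is_projection I X S \<iota> j p" using S j(1) by (rule coproduct_projection)
  note p' = p[unfolded is_projection_def] and ij = coproduct_inj[OF S j(1)]
  have te: "src C \<theta>' = S" "tgt C \<theta>' = S" "src C p = S" "tgt C p = X j" using t' p' by auto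
  have "\<theta> = \<theta>' \<uplus> \<iota> j \<cdot> p"
  proof (rule coproduct_ext[OF S])
    fix i assume i: "i \<in> I"
    note ii = coproduct_inj[OF S i]
    have "(\<theta>' \<uplus> \<iota> j \<cdot> p) \<cdot> \<iota> i = \<theta>' \<cdot> \<iota> i \<uplus> \<iota> j \<cdot> (p \<cdot> \<iota> i)"
      using te ii ij by simp
    also have "\<dots> = \<theta> \<cdot> \<iota> i"
    proof -
      consider "i = j" | "i \<in> J" "i \<noteq> j" | "i \<in> I - insert j J" using i by blast
      then show ?thesis
      proof cases
        case 1
        have "\<theta>' \<cdot> \<iota> i = mzero C (X i) S" using i 1 insert.hyps t' by blast
        moreover have "p \<cdot> \<iota> i = idn C (X i)" using 1 p' by blast
        moreover have "\<theta> \<cdot> \<iota> i = \<iota> i" using t 1 by blast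
        ultimately show ?thesis using ii ij 1 by simp
      next
        case 2
        have "\<theta>' \<cdot> \<iota> i = \<iota> i" using 2 t' by blast
        moreover have "p \<cdot> \<iota> i = mzero C (X i) (X j)" using 2 i p' by blast
        moreover have "\<theta> \<cdot> \<iota> i = \<iota> i" using t 2 by blast
        ultimately show ?thesis using ii ij by simp
      next
        case 3
        have "\<theta>' \<cdot> \<iota> i = mzero C (X i) S" using 3 t' by blast
        moreover have "p \<cdot> \<iota> i = mzero C (X i) (X j)" using 3 p' by blast
        moreover have "\<theta> \<cdot> \<iota> i = mzero C (X i) S" using t 3 by blast
        ultimately show ?thesis using ij by simp
      qed
    qed
    finally show "\<theta> \<cdot> \<iota> i = (\<theta>' \<uplus> \<iota> j \<cdot> p) \<cdot> \<iota> i" by simp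
  qed (use t te ij in auto)
  then have "\<theta> \<cdot> f = \<theta>' \<cdot> f \<uplus> \<iota> j \<cdot> (p \<cdot> f)"
    using te ij f by simp
  then show ?case
    using add[of "\<theta>' \<cdot> f" "\<iota> j \<cdot> (p \<cdot> f)"] insert.IH[OF j(2) \<theta>'] comp[OF j(1) p] te ij f by simp
qed

lemma gfinprod_hom_induct:
  assumes fin: "finite {i \<in> I. y i \<noteq> mzero C c S}" and y: "\<And>i. i \<in> I \<Longrightarrow> src C (y i) = c \<and> tgt C (y i) = S"
    and z: "\<Phi> (mzero C c S)"
    and add: "\<And>g h. \<lbrakk>src C g = c; tgt C g = S; src C h = c; tgt C h = S; \<Phi> g; \<Phi> h\<rbrakk> \<Longrightarrow> \<Phi> (g \<uplus> h)"
    and comp: "\<And>i. i \<in> I \<Longrightarrow> \<Phi> (y i)"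
  shows "\<Phi> (gfinprod (hom_group C c S) y I)"
proof -
  let ?G = "hom_group C c S"
  note cm = hom_group_axioms(2)[of c S]
  have "\<Phi> (finprod ?G y K) \<and> finprod ?G y K \<in> carrier ?G" if "finite K" "K \<subseteq> I" for K
    using that
  proof (induction K rule: finite_induct)
    case empty
    then show ?case using comm_monoid.finprod_empty[OF cm, of y] z by simp
  next
    case (insert k K)
    have "finprod ?G y (insert k K) = y k \<otimes>\<^bsub>?G\<^esub> finprod ?G y K"
      by (rule comm_monoid.finprod_insert[OF cm]) (use insert y in auto)
    then show ?case using insert add y comp by auto
  qed
  then have "\<Phi> (finprod ?G y {i \<in> I. y i \<noteq> mzero C c S})" using fin by blast
  then show ?thesis using fin by (simp add: gfinprod_def)
qed

lemma gfinprod_hom_project: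
  assumes S: "is_coproduct C I X S \<iota>" and x: "\<And>i. i \<in> I \<Longrightarrow> src C (x i) = c \<and> tgt C (x i) = X i"
    and fin: "finite {i \<in> I. x i \<noteq> mzero C c (X i)}" and p: "j \<in> I" "is_projection I X S \<iota> j p"
  shows "p \<cdot> gfinprod (hom_group C c S) (\<lambda>i. \<iota> i \<cdot> x i) I = x j"
proof -
  let ?G = "hom_group C c S" and ?y = "\<lambda>i. \<iota> i \<cdot> x i"
  note cm = hom_group_axioms(2)[of c S] and p' = p(2)[unfolded is_projection_def]
  have pe: "src C p = S" "tgt C p = X j" and pj: "p \<cdot> \<iota> j = idn C (X j)" using p' by auto
  have y: "src C (?y i) = c" "tgt C (?y i) = S" if "i \<in> I" for i
    using x[OF that] coproduct_inj[OF S that] by auto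
  have py: "p \<cdot> ?y i = (if i = j then x j else mzero C c (X j))" if i: "i \<in> I" for i
  proof (cases "i = j")
    case True
    then show ?thesis using cmp_reassoc[OF pj, of "x j"] x[OF i] coproduct_inj[OF S i] pe by simp
  next
    case False
    then have "p \<cdot> \<iota> i = mzero C (X i) (X j)" using i p' by blast
    then show ?thesis using cmp_reassoc[of p "\<iota> i" _ "x i"] x[OF i] coproduct_inj[OF S i] pe False by simp
  qed
  have *: "p \<cdot> finprod ?G ?y K = (if j \<in> K then x j else mzero C c (X j)) \<and> finprod ?G ?y K \<in> carrier ?G"
    if "finite K" "K \<subseteq> I" for K
    using that
  proof (induction K rule: finite_induct)
    case empty
    then show ?case using comm_monoid.finprod_empty[OF cm, of ?y] pe by simp
  next
    case (insert k K)
    have k: "k \<in> I" using insert by auto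
    have f: "src C (finprod ?G ?y K) = c" "tgt C (finprod ?G ?y K) = S" using insert by auto
    have "finprod ?G ?y (insert k K) = ?y k \<otimes>\<^bsub>?G\<^esub> finprod ?G ?y K"
      by (rule comm_monoid.finprod_insert[OF cm]) (use insert y in auto)
    then have eq: "finprod ?G ?y (insert k K) = ?y k \<uplus> finprod ?G ?y K" by simp
    have "p \<cdot> finprod ?G ?y (insert k K) = p \<cdot> ?y k \<uplus> p \<cdot> finprod ?G ?y K"
      unfolding eq using f y[OF k] pe by (intro cmp_add) auto
    also have "\<dots> = (if j \<in> insert k K then x j else mzero C c (X j))"
      unfolding py[OF k] using insert x[OF p(1)] by auto
    finally show ?case using eq f y[OF k] by simp
  qed
  let ?K = "{i \<in> I. ?y i \<noteq> mzero C c S}"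
  have "?K \<subseteq> {i \<in> I. x i \<noteq> mzero C c (X i)}"
    using coproduct_inj[OF S] by auto
  then have K: "finite ?K" using fin finite_subset by blast
  have "x j = mzero C c (X j)" if "j \<notin> ?K"
    using py[OF p(1)] that p(1) pe by simp
  then have "p \<cdot> finprod ?G ?y ?K = x j" using *[OF K] by auto
  then show ?thesis using K by (simp add: gfinprod_def)
qed

end

context big_tt_category
begin

text \<open>Surjectivity of the canonical group homomorphism writes \<open>f\<close> as a finite sum
  of maps \<open>\<iota> i \<cdot> x i\<close>; the indices with nonzero \<open>x i\<close> support
  \<open>f\<close>.\<close>

lemma compact_supported_index:
  assumes c: "compact_object T c" and I: "small_index T I" and S: "is_coproduct T I X S \<iota>"
    and f: "src T f = c" "tgt T f = S"
  obtains J where "finite J" "J \<subseteq> I" "supported \<iota> J f"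
proof -
  let ?G = "hom_group T c S" and ?A = "sum_group I (\<lambda>i. hom_group T c (X i))"
  have "(\<lambda>x. gfinprod ?G (\<lambda>i. \<iota> i \<cdot> x i) I) \<in> iso ?A ?G"
    using c I S unfolding compact_object_def by blast
  then have "(\<lambda>x. gfinprod ?G (\<lambda>i. \<iota> i \<cdot> x i) I) ` carrier ?A = carrier ?G"
    by (simp add: iso_def bij_betw_def)
  moreover have "f \<in> carrier ?G" using f by simp
  ultimately obtain x where x: "x \<in> carrier ?A" "f = gfinprod ?G (\<lambda>i. \<iota> i \<cdot> x i) I" by blast
  have x': "\<And>i. i \<in> I \<Longrightarrow> src T (x i) = c \<and> tgt T (x i) = X i" and fin: "finite {i \<in> I. x i \<noteq> mzero T c (X i)}"
    using x(1) carrier_sum_group[of I "\<lambda>i. hom_group T c (X i)"] hom_group_axioms(1)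
    by (auto simp: PiE_iff)
  let ?J = "{i \<in> I. x i \<noteq> mzero T c (X i)}"
  have "supported \<iota> ?J f"
    unfolding supported_def
  proof (intro allI impI)
    fix h assume h: "src T h = tgt T f" "\<forall>i \<in> ?J. h \<cdot> \<iota> i = mzero T (src T (\<iota> i)) (tgt T h)"
    have "h \<cdot> gfinprod ?G (\<lambda>i. \<iota> i \<cdot> x i) I = mzero T c (tgt T h)"
    proof (rule gfinprod_hom_induct)
      have "{i \<in> I. \<iota> i \<cdot> x i \<noteq> mzero T c S} \<subseteq> ?J" using coproduct_inj[OF S] by auto
      then show "finite {i \<in> I. \<iota> i \<cdot> x i \<noteq> mzero T c S}" using fin finite_subset by blast
      fix i assume i: "i \<in> I"
      show "src T (\<iota> i \<cdot> x i) = c \<and> tgt T (\<iota> i \<cdot> x i) = S" using x'[OF i] coproduct_inj[OF S i] by simp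
      show "h \<cdot> (\<iota> i \<cdot> x i) = mzero T c (tgt T h)"
      proof (cases "i \<in> ?J")
        case True
        then have "h \<cdot> \<iota> i = mzero T (X i) (tgt T h)" using h(2) coproduct_inj[OF S i] by auto
        then show ?thesis
          using cmp_reassoc[of h "\<iota> i" _ "x i"] x'[OF i] coproduct_inj[OF S i] h(1) f by simp
      next
        case False
        then have "x i = mzero T c (X i)" using i by blast
        then show ?thesis using coproduct_inj[OF S i] h(1) f by simp
      qed
    qed (use h(1) f in auto)
    then show "h \<cdot> f = mzero T (src T f) (tgt T h)" using x(2) f by simp
  qed
  with fin that[of ?J] show thesis by auto
qed

lemma compact_supported:
  assumes c: "compact_object T c" and I: "small T I" and S: "is_coproduct T I X S \<iota>"
    and f: "src T f = c" "tgt T f = S"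
  obtains J where "finite J" "J \<subseteq> I" "supported \<iota> J f"
proof -
  obtain \<phi> J where J: "small_index T J" "bij_betw \<phi> J I"
    using I by (rule small_embed)
  obtain K where K: "finite K" "K \<subseteq> J" "supported (\<iota> \<circ> \<phi>) K f"
    using compact_supported_index[OF c J(1) coproduct_reindex[OF S J(2)] f] by blast
  have "supported \<iota> (\<phi> ` K) f"
    using K(3) by (simp add: supported_def)
  then show thesis
    using K J(2) by (intro that[of "\<phi> ` K"]) (auto simp: bij_betw_def)
qed

text \<open>The working form of compactness: \<open>f\<close> equals its truncation to a finite
  support, and that is a sum of components.\<close>

lemma compact_sum_induct:
  assumes c: "compact_object T c" and I: "small T I" and S: "is_coproduct T I X S \<iota>"
    and f: "src T f = c" "tgt T f = S" and z: "\<Phi> (mzero T c S)"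
    and add: "\<And>g h. \<lbrakk>src T g = c; tgt T g = S; src T h = c; tgt T h = S; \<Phi> g; \<Phi> h\<rbrakk> \<Longrightarrow> \<Phi> (g \<uplus> h)"
    and comp: "\<And>i p. i \<in> I \<Longrightarrow> is_projection I X S \<iota> i p \<Longrightarrow> \<Phi> (\<iota> i \<cdot> (p \<cdot> f))"
  shows "\<Phi> f"
proof -
  obtain J where J: "finite J" "J \<subseteq> I" "supported \<iota> J f"
    using c I S f by (rule compact_supported)
  obtain \<theta> where \<theta>: "truncation I X S \<iota> J \<theta>" using S J(2) by (rule ex_truncation)
  have "\<Phi> (\<theta> \<cdot> f)"
    by (rule truncation_sum[OF S J(1,2) \<theta>]) (use f z add comp in auto)
  then show ?thesis using truncation_supported[OF S J(2) \<theta> J(3)] f by simp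
qed

text \<open>The canonical map is injective because projections recover the components. Finite
  support gives surjectivity, the preimage of \<open>f\<close> being the family of its components in
  \<open>J\<close>, extended by zero.\<close>

lemma compactI:
  assumes "\<And>(I :: 'u set) X S \<iota> f. \<lbrakk>small_index T I; is_coproduct T I X S \<iota>; src T f = c; tgt T f = S\<rbrakk>
    \<Longrightarrow> \<exists>J. finite J \<and> J \<subseteq> I \<and> supported \<iota> J f"
  shows "compact_object T c"
  unfolding compact_object_def
proof (intro allI impI)
  fix I :: "'u set" and X S \<iota> assume "small_index T I \<and> is_coproduct T I X S \<iota>"
  then have I: "small_index T I" and S: "is_coproduct T I X S \<iota>" by auto
  let ?G = "hom_group T c S" and ?A = "sum_group I (\<lambda>i. hom_group T c (X i))"
  let ?\<sigma> = "\<lambda>x. gfinprod ?G (\<lambda>i. \<iota> i \<cdot> x i) I"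
  note inj = coproduct_inj[OF S]
  have A: "carrier ?A = {x \<in> \<Pi>\<^sub>E i\<in>I. Hom T c (X i). finite {i \<in> I. x i \<noteq> mzero T c (X i)}}"
    using carrier_sum_group[of I "\<lambda>i. hom_group T c (X i)"] hom_group_axioms(1) by simp
  have hom: "?\<sigma> \<in> hom ?A ?G"
  proof (rule comm_group.hom_group_sum[OF hom_comm_group])
    fix i assume i: "i \<in> I"
    show "cmp T (\<iota> i) \<in> hom (hom_group T c (X i)) ?G"
      using inj[OF i] by (auto simp: hom_def)
  qed (use hom_group_axioms in auto)
  have proj: "p \<cdot> ?\<sigma> x = x j" if "x \<in> carrier ?A" "j \<in> I" "is_projection I X S \<iota> j p" for x j p
    using that unfolding A by (intro gfinprod_hom_project[OF S]) (auto simp: PiE_iff)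
  have "inj_on ?\<sigma> (carrier ?A)"
  proof (rule inj_onI)
    fix x y assume xy: "x \<in> carrier ?A" "y \<in> carrier ?A" "?\<sigma> x = ?\<sigma> y"
    show "x = y"
    proof (rule PiE_ext)
      show "x \<in> (\<Pi>\<^sub>E i\<in>I. Hom T c (X i))" "y \<in> (\<Pi>\<^sub>E i\<in>I. Hom T c (X i))"
        using xy unfolding A by auto
      fix j assume j: "j \<in> I"
      obtain p where "is_projection I X S \<iota> j p" using S j by (rule coproduct_projection)
      then show "x j = y j" using proj[OF xy(1) j] proj[OF xy(2) j] xy(3) by metis
    qed
  qed
  moreover have "?\<sigma> ` carrier ?A = carrier ?G"
  proof
    show "?\<sigma> ` carrier ?A \<subseteq> carrier ?G" using hom by (auto simp: hom_def)
    show "carrier ?G \<subseteq> ?\<sigma> ` carrier ?A"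
    proof
      fix f assume "f \<in> carrier ?G"
      then have f: "src T f = c" "tgt T f = S" by auto
      obtain J where J: "finite J" "J \<subseteq> I" "supported \<iota> J f" using assms[OF I S f] by blast
      have "\<exists>p. is_projection I X S \<iota> i p" if "i \<in> I" for i
        using S that by (rule coproduct_projection) blast
      then obtain p where p: "\<And>i. i \<in> I \<Longrightarrow> is_projection I X S \<iota> i (p i)" by metis
      have pe: "src T (p i) = S" "tgt T (p i) = X i" if "i \<in> I" for i
        using p[OF that] by (auto simp: is_projection_def)
      define x where "x = (\<lambda>i\<in>I. if i \<in> J then p i \<cdot> f else mzero T c (X i))"
      have fin: "finite {i \<in> I. x i \<noteq> mzero T c (X i)}"
        by (rule finite_subset[OF _ J(1)]) (auto simp: x_def)
      have x: "x \<in> carrier ?A"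
        unfolding A using fin pe f by (auto simp: x_def)
      have x': "src T (x i) = c" "tgt T (x i) = X i" if "i \<in> I" for i
        using pe[OF that] f that by (auto simp: x_def)
      have fe: "src T (?\<sigma> x) = c" "tgt T (?\<sigma> x) = S"
        using x hom by (auto simp: hom_def Pi_iff)
      \<comment> \<open>Both \<open>f\<close> and the sum of its components are supported on
        \<open>J\<close>, so the difference is unchanged by truncation. All its components vanish,
        so the truncation is also zero.\<close>
      let ?r = "f \<uplus> mneg T (?\<sigma> x)"
      have re: "src T ?r = c" "tgt T ?r = S" using f fe by simp_all
      obtain \<theta> where \<theta>: "truncation I X S \<iota> J \<theta>" using S J(2) by (rule ex_truncation)
      note t = \<theta>[unfolded truncation_def]
      have te: "src T \<theta> = S" "tgt T \<theta> = S" using t by blast+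
      have "supported \<iota> J ?r"
        unfolding supported_def
      proof (intro allI impI)
        fix h assume h: "src T h = tgt T ?r" "\<forall>i \<in> J. h \<cdot> \<iota> i = mzero T (src T (\<iota> i)) (tgt T h)"
        have hf: "h \<cdot> f = mzero T c (tgt T h)"
          using supportedD[OF J(3), of h] h f re by simp
        have "h \<cdot> ?\<sigma> x = mzero T c (tgt T h)"
        proof (rule gfinprod_hom_induct)
          have "{i \<in> I. \<iota> i \<cdot> x i \<noteq> mzero T c S} \<subseteq> {i \<in> I. x i \<noteq> mzero T c (X i)}" using inj by auto
          then show "finite {i \<in> I. \<iota> i \<cdot> x i \<noteq> mzero T c S}" using fin finite_subset by blast
          fix i assume i: "i \<in> I"
          show "src T (\<iota> i \<cdot> x i) = c \<and> tgt T (\<iota> i \<cdot> x i) = S" using x'[OF i] inj[OF i] by simp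
          show "h \<cdot> (\<iota> i \<cdot> x i) = mzero T c (tgt T h)"
          proof (cases "i \<in> J")
            case True
            then have "h \<cdot> \<iota> i = mzero T (X i) (tgt T h)" using h(2) inj[OF i] by auto
            then show ?thesis
              using cmp_reassoc[of h "\<iota> i" _ "x i"] x'[OF i] inj[OF i] h(1) re by simp
          next
            case False
            then have "x i = mzero T c (X i)" using i by (simp add: x_def)
            then show ?thesis using inj[OF i] h(1) re by simp
          qed
        qed (use h(1) re in auto)
        then show "h \<cdot> ?r = mzero T (src T ?r) (tgt T h)"
          using hf f fe h(1) re by simp
      qed
      then have "\<theta> \<cdot> ?r = ?r" using truncation_supported[OF S J(2) \<theta>] re by blast
      moreover have "\<theta> \<cdot> ?r = mzero T c S"
      proof (rule truncation_sum[OF S J(1,2) \<theta>])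
        fix i q assume i: "i \<in> I" and q: "is_projection I X S \<iota> i q"
        have qe: "src T q = S" "tgt T q = X i" using q by (auto simp: is_projection_def)
        have "q \<cdot> f = x i"
        proof (cases "i \<in> J")
          case True
          have "q = p i"
            by (rule coproduct_ext[OF S])
              (use q p[OF i] in \<open>auto simp: is_projection_def, metis Diff_iff singletonD\<close>)
          then show ?thesis using True i by (simp add: x_def)
        next
          case False
          have "q \<cdot> \<theta> = mzero T S (X i)"
          proof (rule coproduct_ext[OF S])
            fix k assume k: "k \<in> I"
            show "(q \<cdot> \<theta>) \<cdot> \<iota> k = mzero T S (X i) \<cdot> \<iota> k"
            proof (cases "k \<in> J")
              case True
              then have "\<theta> \<cdot> \<iota> k = \<iota> k" using t by blast
              moreover have "q \<cdot> \<iota> k = mzero T (X k) (X i)"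
                using q k True False unfolding is_projection_def by blast
              ultimately show ?thesis using qe te inj[OF k] by simp
            next
              case False
              then have "\<theta> \<cdot> \<iota> k = mzero T (X k) S" using t k by blast
              then show ?thesis using qe te inj[OF k] by simp
            qed
          qed (use qe te in auto)
          then have "q \<cdot> (\<theta> \<cdot> f) = mzero T c (X i)"
            using cmp_reassoc[of q \<theta> _ f] qe te f by simp
          moreover have "\<theta> \<cdot> f = f" by (rule truncation_supported[OF S J(2) \<theta> J(3) f(2)])
          ultimately show ?thesis using False i by (simp add: x_def)
        qed
        moreover have "q \<cdot> ?\<sigma> x = x i" by (rule proj[OF x i q])
        ultimately show "\<iota> i \<cdot> (q \<cdot> ?r) = mzero T c S"
          using f fe qe x'[OF i] inj[OF i] by simp
      qed (use re f fe in auto)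
      ultimately have "?r = mzero T c S" by simp
      then have "f = ?\<sigma> x" by (rule sub_eq_zero) (use f fe in auto)
      then show "f \<in> ?\<sigma> ` carrier ?A" using x by blast
    qed
  qed
  ultimately show "?\<sigma> \<in> iso ?A ?G"
    using hom by (simp add: iso_def bij_betw_def)
qed

section \<open>Closure properties of compact objects\<close>

lemma retract_compact:
  assumes "compact_object T c" "retract_of T b c"
  shows "compact_object T b"
proof (rule compactI)
  fix I :: "'u set" and X S \<iota> f
  assume I: "small_index T I" and S: "is_coproduct T I X S \<iota>" and f: "src T f = b" "tgt T f = S"
  obtain i r where ir: "src T i = b" "tgt T i = c" "src T r = c" "tgt T r = b" "r \<cdot> i = idn T b"
    using assms(2) by (rule retract_ofE)
  have fr: "src T (f \<cdot> r) = c" "tgt T (f \<cdot> r) = S" using f ir by simp_all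
  obtain J where J: "finite J" "J \<subseteq> I" "supported \<iota> J (f \<cdot> r)"
    by (rule compact_supported_index[OF assms(1) I S fr])
  have "supported \<iota> J f"
    unfolding supported_def
  proof (intro allI impI)
    fix h assume h: "src T h = tgt T f" "\<forall>i \<in> J. h \<cdot> \<iota> i = mzero T (src T (\<iota> i)) (tgt T h)"
    have "h \<cdot> (f \<cdot> r) = mzero T c (tgt T h)"
      using supportedD[OF J(3), of h] h f ir by simp
    moreover have "h \<cdot> f = (h \<cdot> (f \<cdot> r)) \<cdot> i" using h f ir by simp
    ultimately show "h \<cdot> f = mzero T (src T f) (tgt T h)" using ir f by simp
  qed
  with J show "\<exists>J. finite J \<and> J \<subseteq> I \<and> supported \<iota> J f" by blast
qed

lemma compact_iso: "isomorphic T b c \<Longrightarrow> compact_object T b \<longleftrightarrow> compact_object T c"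
  using retract_compact isomorphic_retract isomorphic_sym by blast

lemma compact_zero: assumes "zero_object T Z" shows "compact_object T Z"
proof (rule compactI)
  fix I :: "'u set" and X S f and \<iota> :: "'u \<Rightarrow> 'm"
  assume f: "src T f = Z" "tgt T f = S"
  have "f = mzero T Z S" using arrow_from_zero[OF assms f(1)] f by simp
  then have "supported \<iota> {} f" by (auto simp: supported_def)
  then show "\<exists>J. finite J \<and> J \<subseteq> I \<and> supported \<iota> J f" by blast
qed

lemma compact_desuspend: assumes "compact_object T (sobj T c)" shows "compact_object T c"
proof (rule compactI)
  fix I :: "'u set" and X S \<iota> f
  assume I: "small_index T I" and S: "is_coproduct T I X S \<iota>" and f: "src T f = c" "tgt T f = S"
  have fs: "src T (sarr T f) = sobj T c" "tgt T (sarr T f) = sobj T S" using f by simp_all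
  obtain J where J: "finite J" "J \<subseteq> I" "supported (\<lambda>i. sarr T (\<iota> i)) J (sarr T f)"
    by (rule compact_supported_index[OF assms I sobj_coproduct[OF S] fs])
  have "supported \<iota> J f"
    unfolding supported_def
  proof (intro allI impI)
    fix h assume h: "src T h = tgt T f" "\<forall>i \<in> J. h \<cdot> \<iota> i = mzero T (src T (\<iota> i)) (tgt T h)"
    have "sarr T h \<cdot> sarr T (\<iota> i) = mzero T (src T (sarr T (\<iota> i))) (tgt T (sarr T h))" if i: "i \<in> J" for i
    proof -
      have ii: "i \<in> I" using i J(2) by blast
      have "tgt T (\<iota> i) = src T h" using coproduct_inj[OF S ii] h(1) f by simp
      then have "sarr T h \<cdot> sarr T (\<iota> i) = sarr T (h \<cdot> \<iota> i)" by simp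
      then show ?thesis using h(2) i by simp
    qed
    then have "sarr T h \<cdot> sarr T f = mzero T (src T (sarr T f)) (tgt T (sarr T h))"
      by - (rule supportedD[OF J(3)], use h(1) in auto)
    then show "h \<cdot> f = mzero T (src T f) (tgt T h)"
      by - (rule sarr_eq_zero, use h(1) in auto)
  qed
  with J show "\<exists>J. finite J \<and> J \<subseteq> I \<and> supported \<iota> J f" by blast
qed

text \<open>The given summands are not suspensions, so they are replaced by isomorphic ones
  \<open>sobj T (Y i)\<close>. The coproduct is then, up to the isomorphism \<open>k\<close>, a
  suspended coproduct, and \<open>f\<close> can be desuspended.\<close>

lemma compact_suspend: assumes "compact_object T c" shows "compact_object T (sobj T c)"
proof (rule compactI)
  fix I :: "'u set" and X S \<iota> f
  assume I: "small_index T I" and S: "is_coproduct T I X S \<iota>" and f: "src T f = sobj T c" "tgt T f = S"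
  have "\<exists>Y \<psi>. iso_arrow T \<psi> \<and> src T \<psi> = sobj T Y \<and> tgt T \<psi> = X i" for i
  proof -
    obtain Y where "isomorphic T (sobj T Y) (X i)" by (rule desuspend)
    then show ?thesis by (blast elim: isomorphicE)
  qed
  then obtain Y \<psi> where \<psi>: "\<And>i. iso_arrow T (\<psi> i) \<and> src T (\<psi> i) = sobj T (Y i) \<and> tgt T (\<psi> i) = X i"
    by metis
  have S1: "is_coproduct T I (\<lambda>i. sobj T (Y i)) S (\<lambda>i. \<iota> i \<cdot> \<psi> i)"
    by (rule coproduct_iso_components[OF S \<psi>])
  obtain S' \<iota>' where S': "is_coproduct T I Y S' \<iota>'" using ex_coproduct[OF I] by blast
  obtain k where k: "iso_arrow T k" "src T k = sobj T S'" "tgt T k = S"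
      "\<And>i. i \<in> I \<Longrightarrow> k \<cdot> sarr T (\<iota>' i) = \<iota> i \<cdot> \<psi> i"
    using coproduct_compare[OF sobj_coproduct[OF S'] S1] by blast
  obtain k' where k': "src T k' = S" "tgt T k' = sobj T S'" "k \<cdot> k' = idn T S"
    using iso_arrowE[OF k(1)] k by metis
  obtain f0 where f0: "src T f0 = c" "tgt T f0 = S'" "sarr T f0 = k' \<cdot> f"
    by (rule sarr_surj[of "k' \<cdot> f" c S']) (use f k' in auto)
  obtain J where J: "finite J" "J \<subseteq> I" "supported \<iota>' J f0"
    by (rule compact_supported_index[OF assms I S' f0(1,2)])
  have "supported \<iota> J f"
    unfolding supported_def
  proof (intro allI impI)
    fix h assume h: "src T h = tgt T f" "\<forall>i \<in> J. h \<cdot> \<iota> i = mzero T (src T (\<iota> i)) (tgt T h)"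
    obtain W where "isomorphic T (sobj T W) (tgt T h)" by (rule desuspend)
    then have "isomorphic T (tgt T h) (sobj T W)" by (rule isomorphic_sym)
    then obtain \<rho> where \<rho>: "iso_arrow T \<rho>" "src T \<rho> = tgt T h" "tgt T \<rho> = sobj T W"
      by (rule isomorphicE)
    obtain h0 where h0: "src T h0 = S'" "tgt T h0 = W" "sarr T h0 = \<rho> \<cdot> (h \<cdot> k)"
      by (rule sarr_surj[of "\<rho> \<cdot> (h \<cdot> k)" S' W]) (use \<rho> h f k in auto)
    have "h0 \<cdot> \<iota>' i = mzero T (src T (\<iota>' i)) (tgt T h0)" if i: "i \<in> J" for i
    proof (rule sarr_eq_zero)
      have ii: "i \<in> I" using i J(2) by blast
      note e = coproduct_inj[OF S ii] coproduct_inj[OF S' ii]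
      have hi: "h \<cdot> \<iota> i = mzero T (X i) (tgt T h)" using h(2) i e by auto
      have "sarr T (h0 \<cdot> \<iota>' i) = (\<rho> \<cdot> (h \<cdot> k)) \<cdot> sarr T (\<iota>' i)"
        using h0 e by simp
      also have "\<dots> = \<rho> \<cdot> (h \<cdot> (k \<cdot> sarr T (\<iota>' i)))"
        using \<rho> h(1) f k(2,3) e by simp
      also have "\<dots> = \<rho> \<cdot> ((h \<cdot> \<iota> i) \<cdot> \<psi> i)"
        unfolding k(4)[OF ii] using h(1) f e \<psi>[of i] by simp
      also have "\<dots> = mzero T (sobj T (src T (\<iota>' i))) (sobj T (tgt T h0))"
        unfolding hi using \<rho> e \<psi>[of i] h0 by simp
      finally show "sarr T (h0 \<cdot> \<iota>' i) = mzero T (sobj T (src T (\<iota>' i))) (sobj T (tgt T h0))" .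
      show "src T (h0 \<cdot> \<iota>' i) = src T (\<iota>' i)" "tgt T (h0 \<cdot> \<iota>' i) = tgt T h0" using e h0 by simp_all
    qed
    then have z: "h0 \<cdot> f0 = mzero T c W"
      using supportedD[OF J(3), of h0] h0 f0 by simp
    have "\<rho> \<cdot> (h \<cdot> f) = (\<rho> \<cdot> (h \<cdot> k)) \<cdot> (k' \<cdot> f)"
      using \<rho> h(1) f k(2,3) k' by (simp add: cmp_reassoc[OF k'(3)])
    also have "\<dots> = sarr T (h0 \<cdot> f0)" using h0 f0 by simp
    also have "\<dots> = \<rho> \<cdot> mzero T (src T f) (tgt T h)" unfolding z using f \<rho> by simp
    finally show "h \<cdot> f = mzero T (src T f) (tgt T h)"
      by (rule iso_cancel_left[OF \<rho>(1)]) (use \<rho> h(1) in auto)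
  qed
  with J show "\<exists>J. finite J \<and> J \<subseteq> I \<and> supported \<iota> J f" by blast
qed

text \<open>The composite \<open>f \<cdot> g\<close> has a finite support \<open>J\<close>.
  Truncating \<open>f\<close> to \<open>J\<close> leaves a remainder that kills \<open>g\<close>,
  hence factors through the compact object \<open>sobj T (src T u)\<close> with a finite support
  \<open>K\<close>. So \<open>f\<close> is supported on \<open>J \<union> K\<close>.\<close>

lemma compact_cone:
  assumes d: "dtri T u g \<delta>" and c: "compact_object T (src T u)" "compact_object T (tgt T u)"
  shows "compact_object T (tgt T g)"
proof (rule compactI)
  fix I :: "'u set" and X S \<iota> f
  assume I: "small_index T I" and S: "is_coproduct T I X S \<iota>" and f: "src T f = tgt T g" "tgt T f = S"
  note e = dtri_ends[OF d]
  have fg: "src T (f \<cdot> g) = tgt T u" "tgt T (f \<cdot> g) = S" using f e by simp_all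
  obtain J where J: "finite J" "J \<subseteq> I" "supported \<iota> J (f \<cdot> g)"
    by (rule compact_supported_index[OF c(2) I S fg])
  obtain \<theta> where \<theta>: "truncation I X S \<iota> J \<theta>" using S J(2) by (rule ex_truncation)
  note t = \<theta>[unfolded truncation_def]
  have te: "src T \<theta> = S" "tgt T \<theta> = S" using t by auto
  have "\<theta> \<cdot> (f \<cdot> g) = f \<cdot> g"
    by (rule truncation_supported[OF S J(2) \<theta> J(3)]) (use f e in auto)
  then have "(f \<uplus> mneg T (\<theta> \<cdot> f)) \<cdot> g = mzero T (tgt T u) S"
    using f e te by simp
  then obtain m where m: "src T m = sobj T (src T u)" "tgt T m = S" "m \<cdot> \<delta> = f \<uplus> mneg T (\<theta> \<cdot> f)"
    using weak_coker2[OF d, of "f \<uplus> mneg T (\<theta> \<cdot> f)"] f te by auto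
  obtain K where K: "finite K" "K \<subseteq> I" "supported \<iota> K m"
    by (rule compact_supported_index[OF compact_suspend[OF c(1)] I S m(1,2)])
  have "supported \<iota> (J \<union> K) f"
    unfolding supported_def
  proof (intro allI impI)
    fix h assume h: "src T h = tgt T f" "\<forall>i \<in> J \<union> K. h \<cdot> \<iota> i = mzero T (src T (\<iota> i)) (tgt T h)"
    have "h \<cdot> \<theta> = mzero T S (tgt T h)"
    proof (rule coproduct_ext[OF S])
      fix i assume i: "i \<in> I"
      show "(h \<cdot> \<theta>) \<cdot> \<iota> i = mzero T S (tgt T h) \<cdot> \<iota> i"
      proof (cases "i \<in> J")
        case True
        then have "\<theta> \<cdot> \<iota> i = \<iota> i" using t by blast
        then show ?thesis using h True te f coproduct_inj[OF S i] by simp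
      next
        case False
        then have "\<theta> \<cdot> \<iota> i = mzero T (X i) S" using t i by blast
        then show ?thesis using h(1) te f coproduct_inj[OF S i] by simp
      qed
    qed (use h f te in auto)
    then have 1: "h \<cdot> (\<theta> \<cdot> f) = mzero T (tgt T g) (tgt T h)"
      using cmp_reassoc[of h \<theta> _ f] h(1) f te by simp
    have "h \<cdot> m = mzero T (sobj T (src T u)) (tgt T h)"
      using supportedD[OF K(3), of h] h f m by simp
    then have "h \<cdot> (m \<cdot> \<delta>) = mzero T (tgt T g) (tgt T h)"
      using cmp_reassoc[of h m _ \<delta>] h(1) f m(1,2) e by simp
    moreover have "f = \<theta> \<cdot> f \<uplus> m \<cdot> \<delta>" unfolding m(3) using f te by simp
    then have "h \<cdot> f = h \<cdot> (\<theta> \<cdot> f \<uplus> m \<cdot> \<delta>)" by (rule arg_cong)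
    then have "h \<cdot> f = h \<cdot> (\<theta> \<cdot> f) \<uplus> h \<cdot> (m \<cdot> \<delta>)"
      using h(1) f te m(1,2) e by (subst (asm) cmp_add) auto
    ultimately show "h \<cdot> f = mzero T (src T f) (tgt T h)" using 1 f by simp
  qed
  with J K show "\<exists>J. finite J \<and> J \<subseteq> I \<and> supported \<iota> J f" by (intro exI[of _ "J \<union> K"]) auto
qed

lemma compacts_triangulated: "triangulated_subcategory T (compacts T)"
  unfolding triangulated_subcategory_def compacts_def mem_Collect_eq
  using compact_zero compact_iso compact_suspend compact_desuspend compact_cone by blast

lemma compact_unit: "compact_object T \<one>"
  using compact_iff_rigid rigid_unit by blast

text \<open>The dual \<open>D\<close> of \<open>d\<close> turns a map from
  \<open>c \<star> d\<close> to \<open>S\<close> into a map from \<open>c \<star> \<one>\<close> to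
  \<open>S \<star> D\<close>. Finite support of the transpose gives finite support of
  \<open>f\<close>, because a map with zero transpose is zero.\<close>

lemma compact_tensor:
  assumes c: "compact_object T c" and d: "compact_object T d"
  shows "compact_object T (c \<star> d)"
proof (rule compactI)
  fix I :: "'u set" and X S \<iota> f
  assume I: "small_index T I" and S: "is_coproduct T I X S \<iota>" and f: "src T f = c \<star> d" "tgt T f = S"
  have "rigid T d" using d compact_iff_rigid by blast
  then obtain D where D: "\<forall>c. \<exists>\<eta>. src T \<eta> = c \<star> \<one> \<and> tgt T \<eta> = (c \<star> d) \<star> D \<and>
    (\<forall>f. src T f = c \<star> d \<longrightarrow> (f \<boxtimes> idn T D) \<cdot> \<eta> = mzero T (c \<star> \<one>) (tgt T f \<star> D)
      \<longrightarrow> f = mzero T (c \<star> d) (tgt T f))"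
    by (rule rigid_transpose_zero)
  obtain \<eta> where \<eta>: "src T \<eta> = c \<star> \<one>" "tgt T \<eta> = (c \<star> d) \<star> D"
    and \<eta>': "\<forall>f. src T f = c \<star> d \<longrightarrow> (f \<boxtimes> idn T D) \<cdot> \<eta> = mzero T (c \<star> \<one>) (tgt T f \<star> D)
      \<longrightarrow> f = mzero T (c \<star> d) (tgt T f)"
    using D[THEN spec, of c] by (elim exE conjE)
  have c1: "compact_object T (c \<star> \<one>)" using c compact_iso[OF tobj_runit] by blast
  have ft: "src T ((f \<boxtimes> idn T D) \<cdot> \<eta>) = c \<star> \<one>" "tgt T ((f \<boxtimes> idn T D) \<cdot> \<eta>) = S \<star> D"
    using f \<eta> by simp_all
  obtain J where J: "finite J" "J \<subseteq> I" "supported (\<lambda>i. \<iota> i \<boxtimes> idn T D) J ((f \<boxtimes> idn T D) \<cdot> \<eta>)"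
    by (rule compact_supported_index[OF c1 I tensor_coproduct[OF S, of D] ft])
  have "supported \<iota> J f"
    unfolding supported_def
  proof (intro allI impI)
    fix h assume h: "src T h = tgt T f" "\<forall>i \<in> J. h \<cdot> \<iota> i = mzero T (src T (\<iota> i)) (tgt T h)"
    have "(h \<boxtimes> idn T D) \<cdot> ((f \<boxtimes> idn T D) \<cdot> \<eta>)
        = mzero T (src T ((f \<boxtimes> idn T D) \<cdot> \<eta>)) (tgt T (h \<boxtimes> idn T D))"
    proof (rule supportedD[OF J(3)])
      fix i assume i: "i \<in> J"
      then have ii: "i \<in> I" using J(2) by blast
      have "h \<cdot> \<iota> i = mzero T (X i) (tgt T h)" using h(2) i coproduct_inj[OF S ii] by auto
      then show "(h \<boxtimes> idn T D) \<cdot> (\<iota> i \<boxtimes> idn T D) = mzero T (src T (\<iota> i \<boxtimes> idn T D)) (tgt T (h \<boxtimes> idn T D))"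
        using h(1) f coproduct_inj[OF S ii] by (simp add: tarr_merge)
    qed (use h f \<eta>(1,2) in auto)
    then have "((h \<cdot> f) \<boxtimes> idn T D) \<cdot> \<eta> = mzero T (c \<star> \<one>) (tgt T h \<star> D)"
      using h(1) f \<eta>(1,2) by (simp add: tarr_merge_cmp)
    then show "h \<cdot> f = mzero T (src T f) (tgt T h)"
      using \<eta>'[rule_format, of "h \<cdot> f"] h(1) f by simp
  qed
  with J show "\<exists>J. finite J \<and> J \<subseteq> I \<and> supported \<iota> J f" by blast
qed

end

section \<open>Localizing subcategories generated by compact objects\<close>

context big_tt_category
begin

lemma generated_subset: "A \<subseteq> generated_localizing T A"
  by (auto simp: generated_localizing_def)

lemma generated_least: "localizing_subcategory T L \<Longrightarrow> A \<subseteq> L \<Longrightarrow> generated_localizing T A \<subseteq> L"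
  by (auto simp: generated_localizing_def)

lemma localizingI:
  assumes "triangulated_subcategory T L"
    and "\<And>(I :: 'u set) X S \<iota>. \<lbrakk>small_index T I; is_coproduct T I X S \<iota>; \<And>i. i \<in> I \<Longrightarrow> X i \<in> L\<rbrakk> \<Longrightarrow> S \<in> L"
  shows "localizing_subcategory T L"
  unfolding localizing_subcategory_def
proof (intro conjI allI impI)
  fix I :: "'u set" and X S \<iota>
  assume "small_index T I \<and> is_coproduct T I X S \<iota> \<and> (\<forall>i \<in> I. X i \<in> L)"
  then have "small_index T I" "is_coproduct T I X S \<iota>" "\<And>i. i \<in> I \<Longrightarrow> X i \<in> L" by auto
  then show "S \<in> L" by (rule assms(2))
qed (rule assms(1))

lemma generated_localizing: "localizing_subcategory T (generated_localizing T A)"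
proof (rule localizingI)
  have mem: "X \<in> generated_localizing T A \<longleftrightarrow> (\<forall>L. localizing_subcategory T L \<and> A \<subseteq> L \<longrightarrow> X \<in> L)" for X
    by (auto simp: generated_localizing_def)
  show "triangulated_subcategory T (generated_localizing T A)"
    unfolding triangulated_subcategory_def mem
  proof (intro conjI allI impI)
    show "Z \<in> L" if "zero_object T Z" "localizing_subcategory T L \<and> A \<subseteq> L" for Z L
      using tri_sub_zero localizing_triangulated that by blast
    show "Y \<in> L" if "(\<forall>L. localizing_subcategory T L \<and> A \<subseteq> L \<longrightarrow> X \<in> L) \<and> isomorphic T X Y"
      "localizing_subcategory T L \<and> A \<subseteq> L" for X Y L
      using tri_sub_iso localizing_triangulated that by blast
    show "(\<forall>L. localizing_subcategory T L \<and> A \<subseteq> L \<longrightarrow> sobj T X \<in> L)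
        \<longleftrightarrow> (\<forall>L. localizing_subcategory T L \<and> A \<subseteq> L \<longrightarrow> X \<in> L)" for X
      using tri_sub_shift localizing_triangulated by blast
    show "tgt T g \<in> L" if "dtri T f g h \<and> (\<forall>L. localizing_subcategory T L \<and> A \<subseteq> L \<longrightarrow> src T f \<in> L) \<and>
        (\<forall>L. localizing_subcategory T L \<and> A \<subseteq> L \<longrightarrow> tgt T f \<in> L)"
      "localizing_subcategory T L \<and> A \<subseteq> L" for f g h L
      using tri_sub_cone[OF localizing_triangulated, of L f g h] that by blast
  qed
  fix I :: "'u set" and X S \<iota>
  assume I: "small_index T I" "is_coproduct T I X S \<iota>" "\<And>i. i \<in> I \<Longrightarrow> X i \<in> generated_localizing T A"
  have "small T I" using I(1) by (simp add: small_index_def)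
  then show "S \<in> generated_localizing T A"
    unfolding mem using localizing_coproduct[OF _ _ I(2)] I(3) mem by blast
qed

lemma tensor_preimage_localizing:
  assumes "localizing_subcategory T L"
  shows "localizing_subcategory T {X. X \<star> Y \<in> L}"
proof (rule localizingI)
  show "triangulated_subcategory T {X. X \<star> Y \<in> L}"
    by (rule tensor_preimage_triangulated[OF localizing_triangulated[OF assms]])
  fix I :: "'u set" and X S \<iota>
  assume I: "small_index T I" "is_coproduct T I X S \<iota>" "\<And>i. i \<in> I \<Longrightarrow> X i \<in> {X. X \<star> Y \<in> L}"
  have "small T I" using I(1) by (simp add: small_index_def)
  then have "S \<star> Y \<in> L"
    by (rule localizing_coproduct[OF assms _ tensor_coproduct[OF I(2)]]) (use I(3) in auto)
  then show "S \<in> {X. X \<star> Y \<in> L}" by simp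
qed

text \<open>Two reductions to generators: for \<open>a\<close> in \<open>p\<close>, the objects
  whose tensor product with \<open>a\<close> stays inside form a localizing subcategory containing
  all compacts, hence everything. For a fixed \<open>Y\<close>, the objects \<open>X\<close> with
  \<open>X \<star> Y\<close> inside then form one containing \<open>p\<close>.\<close>

lemma generated_localizing_ideal:
  assumes "\<And>a k. a \<in> p \<Longrightarrow> compact_object T k \<Longrightarrow> a \<star> k \<in> p"
  shows "localizing_ideal T (generated_localizing T p)"
proof -
  let ?L = "generated_localizing T p"
  note L = generated_localizing[of p]
  note L' = localizing_triangulated[OF L]
  have 1: "a \<star> Y \<in> ?L" if a: "a \<in> p" for a Y
  proof -
    have "generated_localizing T (compacts T) \<subseteq> {Y. Y \<star> a \<in> ?L}"
    proof (rule generated_least[OF tensor_preimage_localizing[OF L]], rule subsetI)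
      fix k assume "k \<in> compacts T"
      then have "a \<star> k \<in> ?L" using assms[OF a] generated_subset by (auto simp: compacts_def)
      then show "k \<in> {Y. Y \<star> a \<in> ?L}" using tri_sub_iso[OF L' tobj_commute] by blast
    qed
    then have "Y \<star> a \<in> ?L" using compacts_generate by blast
    then show ?thesis using tri_sub_iso[OF L' tobj_commute] by blast
  qed
  have "?L \<subseteq> {X. X \<star> Y \<in> ?L}" for Y
    by (rule generated_least[OF tensor_preimage_localizing[OF L]]) (use 1 in auto)
  then show ?thesis using L by (auto simp: localizing_ideal_def)
qed

text \<open>Tensoring with all compact objects takes care of the closure under (de)suspension, since
  \<open>\<Sigma>X \<otimes> k\<close> is isomorphic to \<open>X \<otimes> \<Sigma>k\<close>.\<close>

lemma localizing_induct:
  assumes X: "X \<in> generated_localizing T p"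
    and gen: "\<And>a k. a \<in> p \<Longrightarrow> compact_object T k \<Longrightarrow> G (a \<star> k)"
    and iso: "\<And>X Y. isomorphic T X Y \<Longrightarrow> G X \<Longrightarrow> G Y"
    and zero: "\<And>Z. zero_object T Z \<Longrightarrow> G Z"
    and cop: "\<And>(I :: 'u set) X S \<iota>. \<lbrakk>small T I; is_coproduct T I X S \<iota>; \<And>i. i \<in> I \<Longrightarrow> G (X i)\<rbrakk> \<Longrightarrow> G S"
    and cone: "\<And>f g h. \<lbrakk>dtri T f g h; G (src T f); G (tgt T f); G (sobj T (src T f)); G (sobj T (tgt T f))\<rbrakk>
      \<Longrightarrow> G (tgt T g)"
  shows "G X"
proof -
  let ?L = "{X. \<forall>k. compact_object T k \<longrightarrow> G (X \<star> k)}"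
  have shift: "G (sobj T (X \<star> k))" if "X \<in> ?L" "compact_object T k" for X k
  proof -
    have "G (X \<star> sobj T k)" using that compact_suspend by blast
    then show ?thesis
      using iso isomorphic_trans[OF isomorphic_sym[OF tobj_sobj_swap] tobj_sobj_left] by blast
  qed
  have "triangulated_subcategory T ?L"
    unfolding triangulated_subcategory_def
  proof (intro conjI allI impI)
    show "Z \<in> ?L" if "zero_object T Z" for Z
      using zero zero_tensor[OF that] by blast
    show "Y \<in> ?L" if "X \<in> ?L \<and> isomorphic T X Y" for X Y
      using that iso[OF tobj_cong[OF _ isomorphic_refl]] by blast
    show "sobj T X \<in> ?L \<longleftrightarrow> X \<in> ?L" for X
    proof
      assume "X \<in> ?L"
      then show "sobj T X \<in> ?L"
        using compact_suspend iso[OF isomorphic_sym[OF tobj_sobj_swap]] by blast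
    next
      assume SX: "sobj T X \<in> ?L"
      have "G (X \<star> k)" if k: "compact_object T k" for k
      proof -
        obtain k0 where k0: "isomorphic T (sobj T k0) k" by (rule desuspend)
        then have "compact_object T k0" using k compact_iso compact_desuspend by blast
        then have "G (sobj T X \<star> k0)" using SX by blast
        moreover have "isomorphic T (sobj T X \<star> k0) (X \<star> k)"
          using tobj_sobj_swap tobj_cong[OF isomorphic_refl k0] isomorphic_trans by blast
        ultimately show ?thesis using iso by blast
      qed
      then show "X \<in> ?L" by blast
    qed
    show "tgt T g \<in> ?L" if "dtri T f g h \<and> src T f \<in> ?L \<and> tgt T f \<in> ?L" for f g h
    proof -
      have "G (tgt T g \<star> k)" if k: "compact_object T k" for k
        using cone[OF tensor_dtri, of f g h k] \<open>dtri T f g h \<and> src T f \<in> ?L \<and> tgt T f \<in> ?L\<close> shift k by simp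
      then show ?thesis by blast
    qed
  qed
  then have "localizing_subcategory T ?L"
  proof (rule localizingI)
    fix I :: "'u set" and X S \<iota>
    assume I: "small_index T I" "is_coproduct T I X S \<iota>" "\<And>i. i \<in> I \<Longrightarrow> X i \<in> ?L"
    have "small T I" using I(1) by (simp add: small_index_def)
    then have "G (S \<star> k)" if "compact_object T k" for k
      by (rule cop[OF _ tensor_coproduct[OF I(2)]]) (use I(3) that in auto)
    then show "S \<in> ?L" by blast
  qed
  then have "generated_localizing T p \<subseteq> ?L"
    by (rule generated_least) (use gen in auto)
  then have "G (X \<star> \<one>)" using X compact_unit by blast
  then show ?thesis using iso[OF tobj_runit] by blast
qed

lemma compact_induct:
  assumes "\<And>k. compact_object T k \<Longrightarrow> G k"
    and iso: "\<And>X Y. isomorphic T X Y \<Longrightarrow> G X \<Longrightarrow> G Y"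
    and cop: "\<And>(I :: 'u set) X S \<iota>. \<lbrakk>small T I; is_coproduct T I X S \<iota>; \<And>i. i \<in> I \<Longrightarrow> G (X i)\<rbrakk> \<Longrightarrow> G S"
    and cone: "\<And>f g h. \<lbrakk>dtri T f g h; G (src T f); G (tgt T f); G (sobj T (src T f)); G (sobj T (tgt T f))\<rbrakk>
      \<Longrightarrow> G (tgt T g)"
  shows "G X"
proof (rule localizing_induct[of X "compacts T"])
  show "X \<in> generated_localizing T (compacts T)" using compacts_generate by simp
  show "G (a \<star> k)" if "a \<in> compacts T" "compact_object T k" for a k
    using assms(1) compact_tensor that by (simp add: compacts_def)
  show "G Z" if "zero_object T Z" for Z using assms(1) compact_zero[OF that] by blast
qed (use iso cop cone in blast)+

text \<open>The objects without nonzero maps to \<open>X\<close> satisfy the closure conditions of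
  the induction, so they include \<open>X\<close> itself, whose identity is then zero.\<close>

lemma compact_orthogonal_zero:
  assumes "\<And>f. \<lbrakk>compact_object T (src T f); tgt T f = X\<rbrakk> \<Longrightarrow> f = mzero T (src T f) X"
  shows "zero_object T X"
proof -
  let ?G = "\<lambda>Y. \<forall>f. src T f = Y \<and> tgt T f = X \<longrightarrow> f = mzero T Y X"
  have "?G X"
  proof (rule compact_induct[of ?G])
    show "?G k" if "compact_object T k" for k using assms that by blast
    show "?G Y" if WY: "isomorphic T W Y" and GW: "?G W" for W Y
    proof (intro allI impI)
      fix f assume f: "src T f = Y \<and> tgt T f = X"
      obtain k where k: "iso_arrow T k" "src T k = W" "tgt T k = Y" using WY by (rule isomorphicE)
      have "f \<cdot> k = mzero T W X" using GW f k by simp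
      then have "f \<cdot> k = mzero T Y X \<cdot> k" using k by simp
      then show "f = mzero T Y X" by (rule iso_cancel_right[OF k(1)]) (use f k in auto)
    qed
    show "?G S" if S: "is_coproduct T I Y S \<iota>" "\<And>i. i \<in> I \<Longrightarrow> ?G (Y i)" for I :: "'u set" and Y S \<iota>
    proof (intro allI impI)
      fix f assume f: "src T f = S \<and> tgt T f = X"
      show "f = mzero T S X"
      proof (rule coproduct_ext[OF S(1)])
        fix i assume i: "i \<in> I"
        have "f \<cdot> \<iota> i = mzero T (Y i) X" using S(2)[OF i] coproduct_inj[OF S(1) i] f by simp
        then show "f \<cdot> \<iota> i = mzero T S X \<cdot> \<iota> i" using coproduct_inj[OF S(1) i] by simp
      qed (use f in auto)
    qed
    show "?G (tgt T g)" if d: "dtri T u g h" "?G (tgt T u)" "?G (sobj T (src T u))" for u g h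
    proof (intro allI impI)
      fix f assume f: "src T f = tgt T g \<and> tgt T f = X"
      note e = dtri_ends[OF d(1)]
      have "f \<cdot> g = mzero T (tgt T u) (tgt T f)" using d(2) f e by simp
      then obtain m where m: "src T m = sobj T (src T u)" "tgt T m = tgt T f" "m \<cdot> h = f"
        using weak_coker2[OF d(1), of f] f by blast
      then have "m = mzero T (sobj T (src T u)) X" using d(3) f by simp
      then show "f = mzero T (tgt T g) X" using m e by simp
    qed
  qed
  then have "idn T X = mzero T X X" by simp
  then show ?thesis by (simp add: zero_object_iff)
qed

section \<open>Factoring maps from compact objects through a thick ideal\<close>

definition factors :: "'o set \<Rightarrow> 'm \<Rightarrow> bool" where
  "factors A \<alpha> \<longleftrightarrow> (\<exists>\<phi> \<gamma>. src T \<phi> = src T \<alpha> \<and> tgt T \<phi> = src T \<gamma> \<and> tgt T \<gamma> = tgt T \<alpha> \<and> src T \<gamma> \<in> A \<and> \<gamma> \<cdot> \<phi> = \<alpha>)"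

lemma factorsI:
  "\<lbrakk>tgt T \<phi> = src T \<gamma>; src T \<gamma> \<in> A\<rbrakk> \<Longrightarrow> factors A (\<gamma> \<cdot> \<phi>)"
  unfolding factors_def by (intro exI[of _ \<phi>] exI[of _ \<gamma>]) simp

lemma factorsE:
  assumes "factors A \<alpha>"
  obtains \<phi> \<gamma> where "src T \<phi> = src T \<alpha>" "tgt T \<phi> = src T \<gamma>" "tgt T \<gamma> = tgt T \<alpha>" "src T \<gamma> \<in> A" "\<gamma> \<cdot> \<phi> = \<alpha>"
  using assms unfolding factors_def by blast

lemma factors_cmp:
  assumes "factors A \<alpha>" "tgt T \<alpha> = src T g" shows "factors A (g \<cdot> \<alpha>)"
proof -
  obtain \<phi> \<gamma> where f: "src T \<phi> = src T \<alpha>" "tgt T \<phi> = src T \<gamma>" "tgt T \<gamma> = tgt T \<alpha>" "src T \<gamma> \<in> A" "\<gamma> \<cdot> \<phi> = \<alpha>"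
    using assms(1) by (rule factorsE)
  have "factors A ((g \<cdot> \<gamma>) \<cdot> \<phi>)" by (rule factorsI) (use f assms in auto)
  then show ?thesis using f assms by simp
qed

lemma factors_precmp:
  assumes "factors A \<alpha>" "tgt T g = src T \<alpha>" shows "factors A (\<alpha> \<cdot> g)"
proof -
  obtain \<phi> \<gamma> where f: "src T \<phi> = src T \<alpha>" "tgt T \<phi> = src T \<gamma>" "tgt T \<gamma> = tgt T \<alpha>" "src T \<gamma> \<in> A" "\<gamma> \<cdot> \<phi> = \<alpha>"
    using assms(1) by (rule factorsE)
  have "factors A (\<gamma> \<cdot> (\<phi> \<cdot> g))" by (rule factorsI) (use f assms in auto)
  moreover have "\<gamma> \<cdot> (\<phi> \<cdot> g) = \<alpha> \<cdot> g" by (rule cmp_reassoc[OF f(5)]) (use f assms in auto)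
  ultimately show ?thesis by simp
qed

lemma factors_add:
  assumes A: "triangulated_subcategory T A" and ab: "factors A \<alpha>" "factors A \<beta>"
    and par: "src T \<alpha> = src T \<beta>" "tgt T \<alpha> = tgt T \<beta>"
  shows "factors A (\<alpha> \<uplus> \<beta>)"
proof -
  obtain \<phi> \<gamma> where f: "src T \<phi> = src T \<alpha>" "tgt T \<phi> = src T \<gamma>" "tgt T \<gamma> = tgt T \<alpha>" "src T \<gamma> \<in> A" "\<gamma> \<cdot> \<phi> = \<alpha>"
    using ab(1) by (rule factorsE)
  obtain \<phi>' \<gamma>' where f': "src T \<phi>' = src T \<beta>" "tgt T \<phi>' = src T \<gamma>'" "tgt T \<gamma>' = tgt T \<beta>" "src T \<gamma>' \<in> A"
      "\<gamma>' \<cdot> \<phi>' = \<beta>"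
    using ab(2) by (rule factorsE)
  obtain B in1 in2 p1 p2 where b: "biproduct (src T \<gamma>) (src T \<gamma>') B in1 in2 p1 p2" by (rule binary_biproduct)
  note b' = b[unfolded biproduct_def]
  have "B \<in> A" by (rule biproduct_sub[OF A b f(4) f'(4)])
  then have "factors A ((\<gamma> \<cdot> p1 \<uplus> \<gamma>' \<cdot> p2) \<cdot> (in1 \<cdot> \<phi> \<uplus> in2 \<cdot> \<phi>'))"
    by - (rule factorsI, use b' f f' par in auto)
  also have "(\<gamma> \<cdot> p1 \<uplus> \<gamma>' \<cdot> p2) \<cdot> (in1 \<cdot> \<phi> \<uplus> in2 \<cdot> \<phi>') = \<gamma> \<cdot> \<phi> \<uplus> \<gamma>' \<cdot> \<phi>'"
  proof -
    have 1: "p1 \<cdot> (in1 \<cdot> \<phi> \<uplus> in2 \<cdot> \<phi>') = \<phi>" "p2 \<cdot> (in1 \<cdot> \<phi> \<uplus> in2 \<cdot> \<phi>') = \<phi>'"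
      using b' f(1-3) f'(1-3) par cmp_reassoc[of p1 in1 _ \<phi>] cmp_reassoc[of p1 in2 _ \<phi>']
        cmp_reassoc[of p2 in1 _ \<phi>] cmp_reassoc[of p2 in2 _ \<phi>'] by simp_all
    have e: "src T (in1 \<cdot> \<phi> \<uplus> in2 \<cdot> \<phi>') = src T \<alpha>" "tgt T (in1 \<cdot> \<phi> \<uplus> in2 \<cdot> \<phi>') = B"
      using b' f(1-3) f'(1-3) par by simp_all
    have "(\<gamma> \<cdot> p1 \<uplus> \<gamma>' \<cdot> p2) \<cdot> (in1 \<cdot> \<phi> \<uplus> in2 \<cdot> \<phi>')
        = \<gamma> \<cdot> (p1 \<cdot> (in1 \<cdot> \<phi> \<uplus> in2 \<cdot> \<phi>')) \<uplus> \<gamma>' \<cdot> (p2 \<cdot> (in1 \<cdot> \<phi> \<uplus> in2 \<cdot> \<phi>'))"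
      using b' f(1-3) f'(1-3) par e by (subst add_cmp) auto
    then show ?thesis unfolding 1 .
  qed
  finally show ?thesis using f f' by simp
qed

text \<open>This is the factorization argument of Neeman's localization theorem, by induction over
  the localizing subcategory. In the cone case \<open>\<alpha>\<close> is exhibited as a sum of two
  maps, one through the cone of a map inside \<open>p\<close> and one through a suspension of an
  object of \<open>p\<close>.\<close>

lemma compact_factors:
  assumes p: "p \<subseteq> compacts T" "triangulated_subcategory T p"
    and tens: "\<And>a k. a \<in> p \<Longrightarrow> compact_object T k \<Longrightarrow> a \<star> k \<in> p"
    and X: "X \<in> generated_localizing T p" and \<alpha>: "compact_object T (src T \<alpha>)" "tgt T \<alpha> = X"
  shows "factors p \<alpha>"
proof -
  let ?G = "\<lambda>X. \<forall>\<alpha>. compact_object T (src T \<alpha>) \<and> tgt T \<alpha> = X \<longrightarrow> factors p \<alpha>"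
  have self: "factors p \<alpha>" if "tgt T \<alpha> \<in> p" for \<alpha>
    using factorsI[of \<alpha> "idn T (tgt T \<alpha>)" p] that by simp
  have zero: "factors p (mzero T A B)" for A B
  proof -
    obtain Z where Z: "zero_object T Z" using ex_zero_object by blast
    have "factors p (mzero T Z B \<cdot> mzero T A Z)"
      by (rule factorsI) (use tri_sub_zero[OF p(2) Z] in auto)
    then show ?thesis by simp
  qed
  have "?G X"
  proof (rule localizing_induct[OF X, of ?G])
    show "?G (a \<star> k)" if "a \<in> p" "compact_object T k" for a k
      using tens[OF that] by (intro allI impI self) simp
    show "?G Y" if WY: "isomorphic T W Y" and GW: "?G W" for W Y
    proof (intro allI impI)
      fix \<alpha> assume a: "compact_object T (src T \<alpha>) \<and> tgt T \<alpha> = Y"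
      obtain k where k: "iso_arrow T k" "src T k = W" "tgt T k = Y" using WY by (rule isomorphicE)
      obtain k' where k': "src T k' = Y" "tgt T k' = W" "k \<cdot> k' = idn T Y"
        using iso_arrowE[OF k(1)] k by metis
      have "factors p (k' \<cdot> \<alpha>)" using GW a k' by simp
      then have "factors p (k \<cdot> (k' \<cdot> \<alpha>))" by (rule factors_cmp) (use k k' a in auto)
      then show "factors p \<alpha>" using cmp_reassoc[OF k'(3), of \<alpha>] k k' a by simp
    qed
    show "?G Z" if "zero_object T Z" for Z
      using tri_sub_zero[OF p(2) that] by (intro allI impI self) simp
    show "?G S" if I: "small T I" and S: "is_coproduct T I Y S \<iota>" and G: "\<And>i. i \<in> I \<Longrightarrow> ?G (Y i)"
      for I :: "'u set" and Y S \<iota>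
    proof (intro allI impI)
      fix \<alpha> assume a: "compact_object T (src T \<alpha>) \<and> tgt T \<alpha> = S"
      show "factors p \<alpha>"
      proof (rule compact_sum_induct[OF _ I S, of "src T \<alpha>" \<alpha> "factors p"])
        fix i q assume i: "i \<in> I" and q: "is_projection I Y S \<iota> i q"
        have qe: "src T q = S" "tgt T q = Y i" using q by (auto simp: is_projection_def)
        have "factors p (q \<cdot> \<alpha>)" using G[OF i] qe a by simp
        then show "factors p (\<iota> i \<cdot> (q \<cdot> \<alpha>))"
          by (rule factors_cmp) (use qe a coproduct_inj[OF S i] in auto)
      next
        fix g h assume "src T g = src T \<alpha>" "tgt T g = S" "src T h = src T \<alpha>" "tgt T h = S"
          "factors p g" "factors p h"
        then show "factors p (g \<uplus> h)" by (intro factors_add[OF p(2)]) auto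
      qed (use a zero in auto)
    qed
    show "?G (tgt T g)" if d: "dtri T f g h" and Y: "?G (tgt T f)" and SX: "?G (sobj T (src T f))" for f g h
    proof (intro allI impI)
      fix \<alpha> assume a: "compact_object T (src T \<alpha>) \<and> tgt T \<alpha> = tgt T g"
      note e = dtri_ends[OF d]
      have "factors p (h \<cdot> \<alpha>)" using SX a e by simp
      then obtain \<phi>' \<chi>' where ff: "src T \<phi>' = src T (h \<cdot> \<alpha>)" "tgt T \<phi>' = src T \<chi>'"
          "tgt T \<chi>' = tgt T (h \<cdot> \<alpha>)" "src T \<chi>' \<in> p" "\<chi>' \<cdot> \<phi>' = h \<cdot> \<alpha>"
        by (rule factorsE)
      have ffe: "src T \<phi>' = src T \<alpha>" "tgt T \<chi>' = sobj T (src T f)" using ff a e by simp_all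
      \<comment> \<open>The object of \<open>p\<close> through which
        \<open>h \<cdot> \<alpha>\<close> factors is written as a suspension, so that
        \<open>?\<phi>\<close> can be made the connecting map of a triangle.\<close>
      obtain j0 where j0: "isomorphic T (sobj T j0) (src T \<chi>')" by (rule desuspend)
      then obtain s where s: "iso_arrow T s" "src T s = sobj T j0" "tgt T s = src T \<chi>'"
        by (rule isomorphicE)
      obtain s' where s': "src T s' = src T \<chi>'" "tgt T s' = sobj T j0" "s \<cdot> s' = idn T (src T \<chi>')"
        using iso_arrowE[OF s(1)] s by metis
      have j0p: "j0 \<in> p"
        using tri_sub_iso[OF p(2) isomorphic_sym[OF j0] ff(4)] tri_sub_shift[OF p(2)] by simp
      let ?\<phi> = "s' \<cdot> \<phi>'" and ?\<chi> = "\<chi>' \<cdot> s"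
      have \<phi>e: "src T ?\<phi> = src T \<alpha>" "tgt T ?\<phi> = sobj T j0" using ff(2) ffe s' by simp_all
      have \<chi>e: "src T ?\<chi> = sobj T j0" "tgt T ?\<chi> = sobj T (src T f)" using ffe s by simp_all
      have \<chi>\<phi>: "?\<chi> \<cdot> ?\<phi> = h \<cdot> \<alpha>"
        using ff(2,5) ffe s s' by (simp add: cmp_reassoc[OF s'(3)])
      \<comment> \<open>On the fibre \<open>w\<close> of \<open>?\<phi>\<close> the obstruction
        \<open>h \<cdot> \<alpha>\<close> vanishes, and the fibre is still compact, so
        \<open>\<alpha> \<cdot> w\<close> lifts to \<open>tgt T f\<close> and the induction
        hypothesis factors the lift through \<open>p\<close>.\<close>
      obtain k w where kw: "dtri T k w ?\<phi>" "src T k = j0" using \<phi>e(2) by (rule ex_dtri_third)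
      note ekw = dtri_ends[OF kw(1)]
      have "tgt T k \<in> compacts T"
        by (rule tri_sub_middle[OF compacts_triangulated kw(1)])
          (use kw j0p p a ekw \<phi>e in \<open>auto simp: compacts_def\<close>)
      then have W: "compact_object T (src T w)" using ekw by (simp add: compacts_def)
      have we: "src T w = tgt T k" "tgt T w = src T \<alpha>" using ekw \<phi>e by simp_all
      have "h \<cdot> (\<alpha> \<cdot> w) = mzero T (src T (\<alpha> \<cdot> w)) (sobj T (src T f))"
      proof -
        have "h \<cdot> (\<alpha> \<cdot> w) = (?\<chi> \<cdot> ?\<phi>) \<cdot> w" unfolding \<chi>\<phi> using a e we by simp
        also have "\<dots> = ?\<chi> \<cdot> (?\<phi> \<cdot> w)" by (rule cmp_assoc_right) (use we \<phi>e \<chi>e in simp_all)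
        also have "?\<phi> \<cdot> w = mzero T (tgt T k) (sobj T j0)" using dtri_comp_zero(2)[OF kw(1)] kw(2) by simp
        finally show ?thesis using \<chi>e we by simp
      qed
      then obtain \<beta> where b: "src T \<beta> = src T (\<alpha> \<cdot> w)" "tgt T \<beta> = tgt T f" "g \<cdot> \<beta> = \<alpha> \<cdot> w"
        using weak_ker2[OF d, of "\<alpha> \<cdot> w"] a we by auto
      have be: "src T \<beta> = tgt T k" using b a we by simp
      have "factors p \<beta>" using Y b be W we by simp
      then obtain \<psi> \<epsilon> where pe: "src T \<psi> = src T \<beta>" "tgt T \<psi> = src T \<epsilon>" "tgt T \<epsilon> = tgt T \<beta>" "src T \<epsilon> \<in> p"
          "\<epsilon> \<cdot> \<psi> = \<beta>"
        by (rule factorsE)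
      \<comment> \<open>The map \<open>\<psi> \<cdot> k\<close> connects two objects of
        \<open>p\<close>, so its cone lies in \<open>p\<close>. It serves as a target for
        \<open>src T \<alpha>\<close>, via \<open>\<kappa>\<close>, and as a source of
        \<open>\<Lambda>\<close> because \<open>g \<cdot> \<epsilon>\<close> kills
        \<open>\<psi> \<cdot> k\<close>.\<close>
      obtain q b' where dq: "dtri T (\<psi> \<cdot> k) q b'" by (rule ex_cone)
      note eq = dtri_ends[OF dq]
      have \<psi>k: "src T (\<psi> \<cdot> k) = j0" "tgt T (\<psi> \<cdot> k) = src T \<epsilon>" using pe be kw by simp_all
      have qp: "tgt T q \<in> p"
        by (rule tri_sub_cone[OF p(2) dq]) (use \<psi>k j0p pe in auto)
      obtain \<kappa> where \<kappa>: "src T \<kappa> = tgt T w" "tgt T \<kappa> = tgt T q" "\<kappa> \<cdot> w = q \<cdot> \<psi>"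
          "sarr T (idn T j0) \<cdot> ?\<phi> = b' \<cdot> \<kappa>"
        by (rule dtri_fill[OF kw(1) dq, of "idn T j0" \<psi>]) (use kw \<psi>k pe be in simp_all)
      have "(g \<cdot> \<epsilon>) \<cdot> (\<psi> \<cdot> k) = mzero T (src T (\<psi> \<cdot> k)) (tgt T (g \<cdot> \<epsilon>))"
      proof -
        have "(g \<cdot> \<epsilon>) \<cdot> (\<psi> \<cdot> k) = g \<cdot> ((\<epsilon> \<cdot> \<psi>) \<cdot> k)" using pe(1-3) be b(2) e by simp
        also have "\<dots> = (g \<cdot> \<beta>) \<cdot> k" unfolding pe(5) using be b(2) e by simp
        also have "\<dots> = \<alpha> \<cdot> (w \<cdot> k)" unfolding b(3) using a we by simp
        also have "w \<cdot> k = mzero T j0 (tgt T w)" using dtri_comp_zero(1)[OF kw(1)] kw(2) by simp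
        finally show ?thesis using a we pe(3) b(2) e \<psi>k by simp
      qed
      then obtain \<Lambda> where L: "src T \<Lambda> = tgt T q" "tgt T \<Lambda> = tgt T (g \<cdot> \<epsilon>)" "\<Lambda> \<cdot> q = g \<cdot> \<epsilon>"
        using weak_coker[OF dq, of "g \<cdot> \<epsilon>"] \<psi>k pe b e by auto
      have Le: "tgt T \<Lambda> = tgt T g" using L pe(3) b(2) e by simp
      have \<kappa>e: "src T \<kappa> = src T \<alpha>" using \<kappa> we by simp
      \<comment> \<open>\<open>\<Lambda> \<cdot> \<kappa>\<close> agrees with
        \<open>\<alpha>\<close> along \<open>w\<close>, so the difference factors through
        \<open>?\<phi>\<close>, that is, through the suspension of \<open>j0\<close>.\<close>
      let ?\<delta> = "\<alpha> \<uplus> mneg T (\<Lambda> \<cdot> \<kappa>)"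
      have \<delta>e: "src T ?\<delta> = src T \<alpha>" "tgt T ?\<delta> = tgt T g" using a L Le \<kappa> \<kappa>e by simp_all
      have "(\<Lambda> \<cdot> \<kappa>) \<cdot> w = \<Lambda> \<cdot> (q \<cdot> \<psi>)" using \<kappa> \<kappa>e L(1) by simp
      also have "\<dots> = (\<Lambda> \<cdot> q) \<cdot> \<psi>" using L(1) eq \<psi>k pe(2) by simp
      also have "\<dots> = g \<cdot> (\<epsilon> \<cdot> \<psi>)" unfolding L(3) using pe(1-3) b(2) e by simp
      also have "\<dots> = \<alpha> \<cdot> w" unfolding pe(5) by (rule b(3))
      finally have "?\<delta> \<cdot> w = mzero T (tgt T k) (tgt T ?\<delta>)"
        using a L(1) Le \<kappa>(1,2) \<kappa>e we \<delta>e by simp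
      then obtain \<mu> where m: "src T \<mu> = sobj T (src T k)" "tgt T \<mu> = tgt T ?\<delta>" "\<mu> \<cdot> ?\<phi> = ?\<delta>"
        using weak_coker2[OF kw(1), of ?\<delta>] \<delta>e we by auto
      have f1: "factors p (\<mu> \<cdot> ?\<phi>)"
        by (rule factorsI) (use m(1) kw \<phi>e j0p tri_sub_shift[OF p(2)] in auto)
      have f2: "factors p (\<Lambda> \<cdot> \<kappa>)"
        by (rule factorsI) (use L \<kappa> qp in auto)
      have "factors p (\<Lambda> \<cdot> \<kappa> \<uplus> ?\<delta>)"
        by (rule factors_add[OF p(2) f2 f1[unfolded m(3)]]) (use L(1) Le \<kappa> \<kappa>e \<delta>e in auto)
      also have "\<Lambda> \<cdot> \<kappa> \<uplus> ?\<delta> = \<alpha>" using a L(1) Le \<kappa>(2) \<kappa>e by (intro madd_sub) auto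
      finally show "factors p \<alpha>" .
    qed
  qed
  then show ?thesis using \<alpha> by blast
qed

text \<open>Applied to the identity of a compact object of the generated subcategory, the
  factorization makes it a retract of an object of \<open>p\<close>; thickness does the
  rest.\<close>

lemma thick_ideal_compacts:
  assumes "thick_tensor_ideal T p" shows "generated_localizing T p \<inter> compacts T = p"
proof
  have p: "p \<subseteq> compacts T" "triangulated_subcategory T p"
    and tens: "\<And>a k. a \<in> p \<Longrightarrow> compact_object T k \<Longrightarrow> a \<star> k \<in> p"
    and ret: "\<And>X Y. X \<in> p \<Longrightarrow> retract_of T Y X \<Longrightarrow> Y \<in> p"
    using assms by (auto simp: thick_tensor_ideal_def compacts_def)
  show "p \<subseteq> generated_localizing T p \<inter> compacts T"
    using p generated_subset by blast
  show "generated_localizing T p \<inter> compacts T \<subseteq> p"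
  proof
    fix c assume c: "c \<in> generated_localizing T p \<inter> compacts T"
    have "factors p (idn T c)"
      by (rule compact_factors[OF p tens]) (use c in \<open>auto simp: compacts_def\<close>)
    then obtain \<phi> \<gamma> where "src T \<phi> = src T (idn T c)" "tgt T \<phi> = src T \<gamma>" "tgt T \<gamma> = tgt T (idn T c)"
        "src T \<gamma> \<in> p" "\<gamma> \<cdot> \<phi> = idn T c"
      by (rule factorsE)
    then have "retract_of T c (src T \<gamma>)" by (intro retract_ofI[of \<phi> _ _ \<gamma>]) auto
    then show "c \<in> p" using ret \<open>src T \<gamma> \<in> p\<close> by blast
  qed
qed

end

section \<open>The smashing ideals form a small set\<close>

context big_tt_category
begin

text \<open>For an object \<open>F\<close>, the homological functor \<open>X \<mapsto> Hom(c, X \<otimes> F)\<close> is the left Kan extension of its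
  restriction to compact objects. The next two definitions express surjectivity and injectivity of
  the canonical map from the colimit over all \<open>j \<rightarrow> X\<close> with \<open>j\<close> compact.\<close>

definition kan_surj :: "'o \<Rightarrow> 'o \<Rightarrow> 'm \<Rightarrow> bool" where
  "kan_surj F X y \<longleftrightarrow> (\<exists>\<beta> x. compact_object T (src T \<beta>) \<and> tgt T \<beta> = X \<and> src T x = src T y \<and>
     tgt T x = src T \<beta> \<star> F \<and> (\<beta> \<boxtimes> idn T F) \<cdot> x = y)"

definition kan_inj :: "'o \<Rightarrow> 'm \<Rightarrow> 'm \<Rightarrow> bool" where
  "kan_inj F x \<beta> \<longleftrightarrow> (\<exists>\<phi> \<gamma>. src T \<phi> = src T \<beta> \<and> tgt T \<phi> = src T \<gamma> \<and> tgt T \<gamma> = tgt T \<beta> \<and>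
     compact_object T (src T \<gamma>) \<and> \<gamma> \<cdot> \<phi> = \<beta> \<and>
     (\<phi> \<boxtimes> idn T F) \<cdot> x = mzero T (src T x) (src T \<gamma> \<star> F))"

definition kan_extended :: "'o \<Rightarrow> 'o \<Rightarrow> bool" where
  "kan_extended F X \<longleftrightarrow>
     (\<forall>y. compact_object T (src T y) \<and> tgt T y = X \<star> F \<longrightarrow> kan_surj F X y) \<and>
     (\<forall>x \<beta>. compact_object T (src T x) \<and> compact_object T (src T \<beta>) \<and> tgt T \<beta> = X \<and>
        tgt T x = src T \<beta> \<star> F \<and> (\<beta> \<boxtimes> idn T F) \<cdot> x = mzero T (src T x) (X \<star> F) \<longrightarrow> kan_inj F x \<beta>)"

lemma kan_surjE:
  assumes "kan_surj F X y"
  obtains \<beta> x where "compact_object T (src T \<beta>)" "tgt T \<beta> = X" "src T x = src T y"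
    "tgt T x = src T \<beta> \<star> F" "(\<beta> \<boxtimes> idn T F) \<cdot> x = y"
  using assms unfolding kan_surj_def by blast

lemma kan_injE:
  assumes "kan_inj F x \<beta>"
  obtains \<phi> \<gamma> where "src T \<phi> = src T \<beta>" "tgt T \<phi> = src T \<gamma>" "tgt T \<gamma> = tgt T \<beta>"
    "compact_object T (src T \<gamma>)" "\<gamma> \<cdot> \<phi> = \<beta>" "(\<phi> \<boxtimes> idn T F) \<cdot> x = mzero T (src T x) (src T \<gamma> \<star> F)"
  using assms unfolding kan_inj_def by blast

lemma kan_surjI:
  "\<lbrakk>compact_object T (src T \<beta>); tgt T \<beta> = X; tgt T x = src T \<beta> \<star> F\<rbrakk> \<Longrightarrow> kan_surj F X ((\<beta> \<boxtimes> idn T F) \<cdot> x)"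
  unfolding kan_surj_def by (intro exI[of _ \<beta>] exI[of _ x]) simp

lemma kan_injI:
  "\<lbrakk>tgt T \<phi> = src T \<gamma>; compact_object T (src T \<gamma>);
    (\<phi> \<boxtimes> idn T F) \<cdot> x = mzero T (src T x) (src T \<gamma> \<star> F)\<rbrakk> \<Longrightarrow> kan_inj F x (\<gamma> \<cdot> \<phi>)"
  unfolding kan_inj_def by (intro exI[of _ \<phi>] exI[of _ \<gamma>]) simp

lemma kan_extendedD:
  assumes "kan_extended F X"
  shows "\<lbrakk>compact_object T (src T y); tgt T y = X \<star> F\<rbrakk> \<Longrightarrow> kan_surj F X y"
    "\<lbrakk>compact_object T (src T x); compact_object T (src T \<beta>); tgt T \<beta> = X; tgt T x = src T \<beta> \<star> F;
      (\<beta> \<boxtimes> idn T F) \<cdot> x = mzero T (src T x) (X \<star> F)\<rbrakk> \<Longrightarrow> kan_inj F x \<beta>"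
  using assms by (simp_all add: kan_extended_def)

lemma compact_biproduct:
  "\<lbrakk>biproduct X Y B in1 in2 p1 p2; compact_object T X; compact_object T Y\<rbrakk> \<Longrightarrow> compact_object T B"
  using biproduct_sub[OF compacts_triangulated] by (simp add: compacts_def)

text \<open>Representatives over two compact objects are compared over their biproduct; this is part
  of the filteredness of the indexing category.\<close>

lemma kan_surj_add:
  assumes "kan_surj F X y" "kan_surj F X y'" "src T y = src T y'"
  shows "kan_surj F X (y \<uplus> y')"
proof -
  obtain \<beta> x where x: "compact_object T (src T \<beta>)" "tgt T \<beta> = X" "src T x = src T y"
    "tgt T x = src T \<beta> \<star> F" "(\<beta> \<boxtimes> idn T F) \<cdot> x = y"
    using assms(1) by (rule kan_surjE)
  obtain \<beta>' x' where x': "compact_object T (src T \<beta>')" "tgt T \<beta>' = X" "src T x' = src T y'"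
    "tgt T x' = src T \<beta>' \<star> F" "(\<beta>' \<boxtimes> idn T F) \<cdot> x' = y'"
    using assms(2) by (rule kan_surjE)
  obtain B in1 in2 p1 p2 where b: "biproduct (src T \<beta>) (src T \<beta>') B in1 in2 p1 p2" by (rule binary_biproduct)
  note b' = b[unfolded biproduct_def]
  let ?\<beta> = "\<beta> \<cdot> p1 \<uplus> \<beta>' \<cdot> p2" and ?x = "(in1 \<boxtimes> idn T F) \<cdot> x \<uplus> (in2 \<boxtimes> idn T F) \<cdot> x'"
  have e: "src T ?\<beta> = B" "tgt T ?\<beta> = X" "tgt T ?x = B \<star> F"
    using b' x(1-4) x'(1-4) assms(3) by simp_all
  have i: "?\<beta> \<cdot> in1 = \<beta>" "?\<beta> \<cdot> in2 = \<beta>'" using b' x(1-4) x'(1-4) by simp_all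
  have "(?\<beta> \<boxtimes> idn T F) \<cdot> ?x = (?\<beta> \<boxtimes> idn T F) \<cdot> ((in1 \<boxtimes> idn T F) \<cdot> x) \<uplus> (?\<beta> \<boxtimes> idn T F) \<cdot> ((in2 \<boxtimes> idn T F) \<cdot> x')"
    by (rule cmp_add) (use b' x(1-4) x'(1-4) assms(3) e in simp_all)
  also have "(?\<beta> \<boxtimes> idn T F) \<cdot> ((in1 \<boxtimes> idn T F) \<cdot> x) = ((?\<beta> \<cdot> in1) \<boxtimes> idn T F) \<cdot> x"
    by (subst tarr_merge_cmp) (use b' x(1-4) e in simp_all)
  also have "(?\<beta> \<boxtimes> idn T F) \<cdot> ((in2 \<boxtimes> idn T F) \<cdot> x') = ((?\<beta> \<cdot> in2) \<boxtimes> idn T F) \<cdot> x'"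
    by (subst tarr_merge_cmp) (use b' x'(1-4) e in simp_all)
  finally have "(?\<beta> \<boxtimes> idn T F) \<cdot> ?x = y \<uplus> y'" unfolding i x(5) x'(5) .
  moreover have "kan_surj F X ((?\<beta> \<boxtimes> idn T F) \<cdot> ?x)"
    by (rule kan_surjI) (use e compact_biproduct[OF b x(1) x'(1)] in simp_all)
  ultimately show ?thesis by simp
qed

lemma kan_inj_add:
  assumes "kan_inj F x \<beta>" "kan_inj F x \<beta>'" "src T \<beta> = src T \<beta>'" "tgt T \<beta> = tgt T \<beta>'" "tgt T x = src T \<beta> \<star> F"
  shows "kan_inj F x (\<beta> \<uplus> \<beta>')"
proof -
  obtain \<phi> \<gamma> where f: "src T \<phi> = src T \<beta>" "tgt T \<phi> = src T \<gamma>" "tgt T \<gamma> = tgt T \<beta>"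
    "compact_object T (src T \<gamma>)" "\<gamma> \<cdot> \<phi> = \<beta>" "(\<phi> \<boxtimes> idn T F) \<cdot> x = mzero T (src T x) (src T \<gamma> \<star> F)"
    using assms(1) by (rule kan_injE)
  obtain \<phi>' \<gamma>' where f': "src T \<phi>' = src T \<beta>'" "tgt T \<phi>' = src T \<gamma>'" "tgt T \<gamma>' = tgt T \<beta>'"
    "compact_object T (src T \<gamma>')" "\<gamma>' \<cdot> \<phi>' = \<beta>'" "(\<phi>' \<boxtimes> idn T F) \<cdot> x = mzero T (src T x) (src T \<gamma>' \<star> F)"
    using assms(2) by (rule kan_injE)
  obtain B in1 in2 p1 p2 where b: "biproduct (src T \<gamma>) (src T \<gamma>') B in1 in2 p1 p2" by (rule binary_biproduct)
  note b' = b[unfolded biproduct_def]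
  let ?\<phi> = "in1 \<cdot> \<phi> \<uplus> in2 \<cdot> \<phi>'" and ?\<gamma> = "\<gamma> \<cdot> p1 \<uplus> \<gamma>' \<cdot> p2"
  have e: "src T ?\<phi> = src T \<beta>" "tgt T ?\<phi> = B" "src T ?\<gamma> = B" "tgt T ?\<gamma> = tgt T \<beta>"
    using b' f(1-3) f'(1-3) assms(3,4) by simp_all
  have i: "?\<gamma> \<cdot> in1 = \<gamma>" "?\<gamma> \<cdot> in2 = \<gamma>'" using b' f(2,3) f'(2,3) assms(4) by simp_all
  have "?\<gamma> \<cdot> ?\<phi> = ?\<gamma> \<cdot> (in1 \<cdot> \<phi>) \<uplus> ?\<gamma> \<cdot> (in2 \<cdot> \<phi>')"
    by (rule cmp_add) (use b' f(1-3) f'(1-3) assms(3,4) e in simp_all)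
  also have "?\<gamma> \<cdot> (in1 \<cdot> \<phi>) = \<gamma> \<cdot> \<phi>"
    by (rule cmp_reassoc[OF i(1)]) (use b' f(1-3) e in simp_all)
  also have "?\<gamma> \<cdot> (in2 \<cdot> \<phi>') = \<gamma>' \<cdot> \<phi>'"
    by (rule cmp_reassoc[OF i(2)]) (use b' f'(1-3) e in simp_all)
  finally have eq: "?\<gamma> \<cdot> ?\<phi> = \<beta> \<uplus> \<beta>'" unfolding f(5) f'(5) .
  have "(in1 \<boxtimes> idn T F) \<cdot> ((\<phi> \<boxtimes> idn T F) \<cdot> x) = mzero T (src T x) (B \<star> F)"
    unfolding f(6) using b' by simp
  then have z1: "((in1 \<cdot> \<phi>) \<boxtimes> idn T F) \<cdot> x = mzero T (src T x) (B \<star> F)"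
    using b' f(1,2) assms(5) by (simp add: tarr_merge_cmp)
  have "(in2 \<boxtimes> idn T F) \<cdot> ((\<phi>' \<boxtimes> idn T F) \<cdot> x) = mzero T (src T x) (B \<star> F)"
    unfolding f'(6) using b' by simp
  then have z2: "((in2 \<cdot> \<phi>') \<boxtimes> idn T F) \<cdot> x = mzero T (src T x) (B \<star> F)"
    using b' f'(1,2) assms(3,5) by (simp add: tarr_merge_cmp)
  have "?\<phi> \<boxtimes> idn T F = ((in1 \<cdot> \<phi>) \<boxtimes> idn T F) \<uplus> ((in2 \<cdot> \<phi>') \<boxtimes> idn T F)"
    by (rule tarr_add_left) (use b' f(1,2) f'(1,2) assms(3) in simp_all)
  then have "(?\<phi> \<boxtimes> idn T F) \<cdot> x = ((in1 \<cdot> \<phi>) \<boxtimes> idn T F) \<cdot> x \<uplus> ((in2 \<cdot> \<phi>') \<boxtimes> idn T F) \<cdot> x"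
    using b' f(1,2) f'(1,2) assms(3,5) by simp
  then have "(?\<phi> \<boxtimes> idn T F) \<cdot> x = mzero T (src T x) (B \<star> F)"
    unfolding z1 z2 by simp
  then have "kan_inj F x (?\<gamma> \<cdot> ?\<phi>)"
    by - (rule kan_injI, use e compact_biproduct[OF b f(4) f'(4)] in simp_all)
  then show ?thesis unfolding eq .
qed

lemma kan_surj_cmp:
  assumes "kan_surj F X y" "src T g = X" shows "kan_surj F (tgt T g) ((g \<boxtimes> idn T F) \<cdot> y)"
proof -
  obtain \<beta> x where x: "compact_object T (src T \<beta>)" "tgt T \<beta> = X" "src T x = src T y"
    "tgt T x = src T \<beta> \<star> F" "(\<beta> \<boxtimes> idn T F) \<cdot> x = y"
    using assms(1) by (rule kan_surjE)
  have "kan_surj F (tgt T g) (((g \<cdot> \<beta>) \<boxtimes> idn T F) \<cdot> x)"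
    by (rule kan_surjI) (use x assms(2) in simp_all)
  also have "((g \<cdot> \<beta>) \<boxtimes> idn T F) \<cdot> x = (g \<boxtimes> idn T F) \<cdot> ((\<beta> \<boxtimes> idn T F) \<cdot> x)"
    using x(1-4) assms(2) by (simp add: tarr_merge_cmp)
  finally show ?thesis unfolding x(5) .
qed

lemma kan_inj_cmp:
  assumes "kan_inj F x \<beta>" "src T g = tgt T \<beta>" shows "kan_inj F x (g \<cdot> \<beta>)"
proof -
  obtain \<phi> \<gamma> where f: "src T \<phi> = src T \<beta>" "tgt T \<phi> = src T \<gamma>" "tgt T \<gamma> = tgt T \<beta>"
    "compact_object T (src T \<gamma>)" "\<gamma> \<cdot> \<phi> = \<beta>" "(\<phi> \<boxtimes> idn T F) \<cdot> x = mzero T (src T x) (src T \<gamma> \<star> F)"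
    using assms(1) by (rule kan_injE)
  have "kan_inj F x ((g \<cdot> \<gamma>) \<cdot> \<phi>)"
    by (rule kan_injI) (use f assms(2) in simp_all)
  also have "(g \<cdot> \<gamma>) \<cdot> \<phi> = g \<cdot> \<beta>" using f(1-3,5) assms(2) by simp
  finally show ?thesis .
qed

lemma whisker_exact:
  assumes d: "dtri T u g h" and y: "tgt T y = tgt T u \<star> F" "(g \<boxtimes> idn T F) \<cdot> y = mzero T (src T y) (tgt T g \<star> F)"
  obtains x where "src T x = src T y" "tgt T x = src T u \<star> F" "(u \<boxtimes> idn T F) \<cdot> x = y"
proof -
  have "(g \<boxtimes> idn T F) \<cdot> y = mzero T (src T y) (tgt T (g \<boxtimes> idn T F))" using y by simp
  then obtain x where "src T x = src T y" "tgt T x = src T (u \<boxtimes> idn T F)" "(u \<boxtimes> idn T F) \<cdot> x = y"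
    using weak_ker[OF tensor_dtri[OF d, of F], of y] y(1) by auto
  then show thesis by (intro that) auto
qed

lemma whisker_exact2:
  assumes d: "dtri T u g h" and y: "tgt T y = tgt T g \<star> F" "(h \<boxtimes> idn T F) \<cdot> y = mzero T (src T y) (tgt T h \<star> F)"
  obtains x where "src T x = src T y" "tgt T x = tgt T u \<star> F" "(g \<boxtimes> idn T F) \<cdot> x = y"
  using whisker_exact[OF dtri_rot[OF d], of y F] y dtri_ends[OF d] that by auto

text \<open>An element killed by \<open>\<phi>\<close> comes from the fibre of
  \<open>\<phi>\<close>, which is compact again. In this way a representative is replaced by one on
  which \<open>\<phi>\<close> vanishes before tensoring with \<open>F\<close>.\<close>

lemma kan_fibre:
  assumes "(\<phi> \<boxtimes> idn T F) \<cdot> x = mzero T (src T x) (tgt T \<phi> \<star> F)" "tgt T x = src T \<phi> \<star> F"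
    and c: "compact_object T (src T \<phi>)" "compact_object T (tgt T \<phi>)"
  obtains v w where "compact_object T (src T v)" "tgt T v = src T \<phi>" "\<phi> \<cdot> v = mzero T (src T v) (tgt T \<phi>)"
    "src T w = src T x" "tgt T w = src T v \<star> F" "(v \<boxtimes> idn T F) \<cdot> w = x"
proof -
  obtain v m where d: "dtri T v \<phi> m" by (rule ex_fibre)
  note e = dtri_ends[OF d]
  obtain w where w: "src T w = src T x" "tgt T w = src T v \<star> F" "(v \<boxtimes> idn T F) \<cdot> w = x"
    by (rule whisker_exact[OF d _ assms(1)]) (use assms(2) e in simp_all)
  have "src T v \<in> compacts T"
    by (rule tri_sub_fibre[OF compacts_triangulated d]) (use c e in \<open>simp_all add: compacts_def\<close>)
  then show thesis
    using dtri_comp_zero(1)[OF d] e w by (intro that[of v w]) (simp_all add: compacts_def)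
qed

text \<open>A four lemma chase with representatives. The image of \<open>z\<close> over
  \<open>sobj T (src T u)\<close> is represented by \<open>(\<beta>, x)\<close> and dies one step
  further, so injectivity there allows a change to a representative along which
  \<open>\<beta>\<close> lifts to the cone. What remains of \<open>z\<close> comes from
  \<open>tgt T u\<close>.\<close>

lemma kan_extended_cone_surj:
  assumes d: "dtri T u g h" and Y: "kan_extended F (tgt T u)"
    and SX: "kan_extended F (sobj T (src T u))" and SY: "kan_extended F (sobj T (tgt T u))"
    and z: "compact_object T (src T z)" "tgt T z = tgt T g \<star> F"
  shows "kan_surj F (tgt T g) z"
proof -
  note e = dtri_ends[OF d]
  have "kan_surj F (sobj T (src T u)) ((h \<boxtimes> idn T F) \<cdot> z)"
    by (rule kan_extendedD(1)[OF SX]) (use z e in simp_all)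
  then obtain \<beta> x where x: "compact_object T (src T \<beta>)" "tgt T \<beta> = sobj T (src T u)" "src T x = src T ((h \<boxtimes> idn T F) \<cdot> z)"
    "tgt T x = src T \<beta> \<star> F" "(\<beta> \<boxtimes> idn T F) \<cdot> x = (h \<boxtimes> idn T F) \<cdot> z"
    by (rule kan_surjE)
  have xe: "src T x = src T z" using x(3) z e by simp
  have "((sarr T u \<cdot> \<beta>) \<boxtimes> idn T F) \<cdot> x = (sarr T u \<boxtimes> idn T F) \<cdot> ((\<beta> \<boxtimes> idn T F) \<cdot> x)"
    using x(1,2,4) by (simp add: tarr_merge_cmp)
  also have "\<dots> = ((sarr T u \<cdot> h) \<boxtimes> idn T F) \<cdot> z"
    unfolding x(5) using z e by (simp add: tarr_merge_cmp)
  also have "\<dots> = mzero T (src T x) (sobj T (tgt T u) \<star> F)"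
    unfolding dtri_comp_zero(3)[OF d] using z xe by simp
  finally have "kan_inj F x (sarr T u \<cdot> \<beta>)"
    by - (rule kan_extendedD(2)[OF SY], use x xe z in simp_all)
  then obtain \<phi> \<gamma> where f: "src T \<phi> = src T (sarr T u \<cdot> \<beta>)" "tgt T \<phi> = src T \<gamma>" "tgt T \<gamma> = tgt T (sarr T u \<cdot> \<beta>)"
    "compact_object T (src T \<gamma>)" "\<gamma> \<cdot> \<phi> = sarr T u \<cdot> \<beta>" "(\<phi> \<boxtimes> idn T F) \<cdot> x = mzero T (src T x) (src T \<gamma> \<star> F)"
    by (rule kan_injE)
  have fe: "src T \<phi> = src T \<beta>" using f(1) x by simp
  obtain v w where vw: "compact_object T (src T v)" "tgt T v = src T \<phi>" "\<phi> \<cdot> v = mzero T (src T v) (tgt T \<phi>)"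
    "src T w = src T x" "tgt T w = src T v \<star> F" "(v \<boxtimes> idn T F) \<cdot> w = x"
    by (rule kan_fibre[of \<phi> F x]) (use f(2,4,6) fe x in simp_all)
  have "sarr T u \<cdot> (\<beta> \<cdot> v) = (\<gamma> \<cdot> \<phi>) \<cdot> v"
    unfolding f(5) using x(1,2) vw(2) fe by simp
  also have "\<dots> = \<gamma> \<cdot> (\<phi> \<cdot> v)" using f(2) vw(2) by simp
  finally have "mneg T (sarr T u) \<cdot> (\<beta> \<cdot> v) = mzero T (src T (\<beta> \<cdot> v)) (sobj T (tgt T u))"
    unfolding vw(3) using f(2,3) vw(2) fe x(2) by simp
  then obtain \<zeta> where \<zeta>: "src T \<zeta> = src T (\<beta> \<cdot> v)" "tgt T \<zeta> = tgt T g" "h \<cdot> \<zeta> = \<beta> \<cdot> v"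
    using weak_ker2[OF dtri_rot[OF d], of "\<beta> \<cdot> v"] vw(2) fe x(2) e by auto
  have \<zeta>e: "src T \<zeta> = src T v" using \<zeta>(1) vw(2) fe by simp
  let ?t = "(\<zeta> \<boxtimes> idn T F) \<cdot> w"
  have te: "src T ?t = src T z" "tgt T ?t = tgt T g \<star> F" using \<zeta>(2) \<zeta>e vw(4,5) xe by simp_all
  have "(h \<boxtimes> idn T F) \<cdot> ?t = ((\<beta> \<cdot> v) \<boxtimes> idn T F) \<cdot> w"
    using \<zeta> \<zeta>e vw(5) e by (simp add: tarr_merge_cmp)
  also have "\<dots> = (\<beta> \<boxtimes> idn T F) \<cdot> ((v \<boxtimes> idn T F) \<cdot> w)"
    using vw(2,5) fe by (simp add: tarr_merge_cmp)
  also have "\<dots> = (h \<boxtimes> idn T F) \<cdot> z" unfolding vw(6) by (rule x(5))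
  finally have "(h \<boxtimes> idn T F) \<cdot> (z \<uplus> mneg T ?t) = mzero T (src T (z \<uplus> mneg T ?t)) (tgt T h \<star> F)"
    using z te e by simp
  then obtain y where y: "src T y = src T (z \<uplus> mneg T ?t)" "tgt T y = tgt T u \<star> F" "(g \<boxtimes> idn T F) \<cdot> y = z \<uplus> mneg T ?t"
    using whisker_exact2[OF d, of "z \<uplus> mneg T ?t" F] z te by auto
  have ye: "src T y = src T z" using y(1) z te by simp
  have "kan_surj F (tgt T u) y"
    by (rule kan_extendedD(1)[OF Y]) (use y(2) ye z in simp_all)
  then have 1: "kan_surj F (tgt T g) ((g \<boxtimes> idn T F) \<cdot> y)"
    by (rule kan_surj_cmp) (use e in simp)
  have 2: "kan_surj F (tgt T g) ?t"
    by (rule kan_surjI) (use vw(1,5) \<zeta> \<zeta>e in simp_all)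
  have "kan_surj F (tgt T g) (?t \<uplus> (g \<boxtimes> idn T F) \<cdot> y)"
    by (rule kan_surj_add[OF 2 1]) (use te ye e y(2) in simp)
  also have "?t \<uplus> (g \<boxtimes> idn T F) \<cdot> y = z"
    unfolding y(3) by (rule madd_sub) (use te z in simp_all)
  finally show ?thesis .
qed

text \<open>The dual chase. The pair \<open>(\<beta>, x)\<close> is refined by \<open>(v, w)\<close>
  until \<open>\<beta> \<cdot> v\<close> lifts to \<open>\<tau>\<close> over \<open>tgt T u\<close>,
  where the vanishing can be tested. The resulting witness lives on \<open>src T v\<close> and is
  transferred to \<open>src T \<beta>\<close> by a weak pushout, since no uniqueness is
  available.\<close>

lemma kan_extended_cone_inj:
  assumes d: "dtri T u g h" and X: "kan_extended F (src T u)" and Y: "kan_extended F (tgt T u)"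
    and SX: "kan_extended F (sobj T (src T u))"
    and x: "compact_object T (src T x)" "compact_object T (src T \<beta>)" "tgt T \<beta> = tgt T g" "tgt T x = src T \<beta> \<star> F"
      "(\<beta> \<boxtimes> idn T F) \<cdot> x = mzero T (src T x) (tgt T g \<star> F)"
  shows "kan_inj F x \<beta>"
proof -
  note e = dtri_ends[OF d]
  have "((h \<cdot> \<beta>) \<boxtimes> idn T F) \<cdot> x = (h \<boxtimes> idn T F) \<cdot> ((\<beta> \<boxtimes> idn T F) \<cdot> x)"
    using x(3,4) e by (simp add: tarr_merge_cmp)
  also have "\<dots> = mzero T (src T x) (sobj T (src T u) \<star> F)"
    unfolding x(5) using e by simp
  finally have "kan_inj F x (h \<cdot> \<beta>)"
    by - (rule kan_extendedD(2)[OF SX], use x e in simp_all)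
  then obtain \<phi> \<gamma> where f: "src T \<phi> = src T (h \<cdot> \<beta>)" "tgt T \<phi> = src T \<gamma>" "tgt T \<gamma> = tgt T (h \<cdot> \<beta>)"
    "compact_object T (src T \<gamma>)" "\<gamma> \<cdot> \<phi> = h \<cdot> \<beta>" "(\<phi> \<boxtimes> idn T F) \<cdot> x = mzero T (src T x) (src T \<gamma> \<star> F)"
    by (rule kan_injE)
  have fe: "src T \<phi> = src T \<beta>" "tgt T \<gamma> = sobj T (src T u)" using f(1,3) x e by simp_all
  obtain v w where vw: "compact_object T (src T v)" "tgt T v = src T \<phi>" "\<phi> \<cdot> v = mzero T (src T v) (tgt T \<phi>)"
    "src T w = src T x" "tgt T w = src T v \<star> F" "(v \<boxtimes> idn T F) \<cdot> w = x"
    by (rule kan_fibre[of \<phi> F x]) (use f(2,4,6) fe x in simp_all)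
  have "h \<cdot> (\<beta> \<cdot> v) = (\<gamma> \<cdot> \<phi>) \<cdot> v"
    unfolding f(5) using x(3) vw(2) fe e by simp
  also have "\<dots> = \<gamma> \<cdot> (\<phi> \<cdot> v)" using f(2) vw(2) by simp
  finally have "h \<cdot> (\<beta> \<cdot> v) = mzero T (src T (\<beta> \<cdot> v)) (sobj T (src T u))"
    unfolding vw(3) using f(2) vw(2) fe by simp
  then obtain \<tau> where \<tau>: "src T \<tau> = src T (\<beta> \<cdot> v)" "tgt T \<tau> = tgt T u" "g \<cdot> \<tau> = \<beta> \<cdot> v"
    using weak_ker2[OF d, of "\<beta> \<cdot> v"] vw(2) fe x(3) by auto
  have \<tau>e: "src T \<tau> = src T v" using \<tau>(1) vw(2) fe by simp
  let ?t = "(\<tau> \<boxtimes> idn T F) \<cdot> w"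
  have te: "src T ?t = src T x" "tgt T ?t = tgt T u \<star> F" using \<tau>(2) \<tau>e vw(4,5) by simp_all
  have "(g \<boxtimes> idn T F) \<cdot> ?t = ((\<beta> \<cdot> v) \<boxtimes> idn T F) \<cdot> w"
    using \<tau> \<tau>e vw(5) e by (simp add: tarr_merge_cmp)
  also have "\<dots> = (\<beta> \<boxtimes> idn T F) \<cdot> ((v \<boxtimes> idn T F) \<cdot> w)"
    using vw(2,5) fe by (simp add: tarr_merge_cmp)
  finally have "(g \<boxtimes> idn T F) \<cdot> ?t = mzero T (src T ?t) (tgt T g \<star> F)"
    unfolding vw(6) x(5) te(1) .
  then obtain x1 where x1: "src T x1 = src T ?t" "tgt T x1 = src T u \<star> F" "(u \<boxtimes> idn T F) \<cdot> x1 = ?t"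
    using whisker_exact[OF d te(2)] by metis
  have x1e: "src T x1 = src T x" using x1(1) te by simp
  have "kan_surj F (src T u) x1"
    by (rule kan_extendedD(1)[OF X]) (use x1(2) x1e x(1) in simp_all)
  then obtain \<xi> y where y: "compact_object T (src T \<xi>)" "tgt T \<xi> = src T u" "src T y = src T x1"
    "tgt T y = src T \<xi> \<star> F" "(\<xi> \<boxtimes> idn T F) \<cdot> y = x1"
    by (rule kan_surjE)
  obtain B in1 in2 p1 p2 where b: "biproduct (src T v) (src T \<xi>) B in1 in2 p1 p2" by (rule binary_biproduct)
  note b' = b[unfolded biproduct_def]
  have B: "compact_object T B" by (rule compact_biproduct[OF b vw(1) y(1)])
  \<comment> \<open>The lifted element maps to zero in the cone, so it comes from
    \<open>src T u\<close> and is represented by \<open>(\<xi>, y)\<close>. On the sum of both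
    sources the two representatives cancel, which brings injectivity for \<open>tgt T u\<close> to
    bear.\<close>
  let ?m = "\<tau> \<cdot> p1 \<uplus> mneg T ((u \<cdot> \<xi>) \<cdot> p2)"
  let ?b = "(in1 \<boxtimes> idn T F) \<cdot> w \<uplus> (in2 \<boxtimes> idn T F) \<cdot> y"
  have me: "src T ?m = B" "tgt T ?m = tgt T u" using b' \<tau>(2) \<tau>e y(2) by simp_all
  have be: "src T ?b = src T x" "tgt T ?b = B \<star> F" using b' vw(4,5) y(3,4) x1e by simp_all
  have m1: "?m \<cdot> in1 = \<tau>" and m2: "?m \<cdot> in2 = mneg T (u \<cdot> \<xi>)"
    using b' \<tau>(2) \<tau>e y(2) by simp_all
  have "(?m \<boxtimes> idn T F) \<cdot> ?b = (?m \<boxtimes> idn T F) \<cdot> ((in1 \<boxtimes> idn T F) \<cdot> w) \<uplus> (?m \<boxtimes> idn T F) \<cdot> ((in2 \<boxtimes> idn T F) \<cdot> y)"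
    by (rule cmp_add) (use b' vw(4,5) y(3,4) x1e me in simp_all)
  also have "(?m \<boxtimes> idn T F) \<cdot> ((in1 \<boxtimes> idn T F) \<cdot> w) = ((?m \<cdot> in1) \<boxtimes> idn T F) \<cdot> w"
    by (subst tarr_merge_cmp) (use b' vw(5) me in simp_all)
  also have "(?m \<boxtimes> idn T F) \<cdot> ((in2 \<boxtimes> idn T F) \<cdot> y) = ((?m \<cdot> in2) \<boxtimes> idn T F) \<cdot> y"
    by (subst tarr_merge_cmp) (use b' y(4) me in simp_all)
  also have "((?m \<cdot> in2) \<boxtimes> idn T F) \<cdot> y = mneg T ?t"
  proof -
    have "((u \<cdot> \<xi>) \<boxtimes> idn T F) \<cdot> y = (u \<boxtimes> idn T F) \<cdot> ((\<xi> \<boxtimes> idn T F) \<cdot> y)"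
      using y(2,4) by (simp add: tarr_merge_cmp)
    then have "((u \<cdot> \<xi>) \<boxtimes> idn T F) \<cdot> y = ?t" unfolding y(5) x1(3) .
    then show ?thesis unfolding m2 using y(2,4) by simp
  qed
  finally have mb: "(?m \<boxtimes> idn T F) \<cdot> ?b = mzero T (src T ?b) (tgt T u \<star> F)"
    unfolding m1 be(1) using te by simp
  have "kan_inj F ?b ?m"
    by (rule kan_extendedD(2)[OF Y]) (use mb B me be x(1) in simp_all)
  then obtain \<phi>2 \<gamma>2 where f2: "src T \<phi>2 = src T ?m" "tgt T \<phi>2 = src T \<gamma>2" "tgt T \<gamma>2 = tgt T ?m"
    "compact_object T (src T \<gamma>2)" "\<gamma>2 \<cdot> \<phi>2 = ?m" "(\<phi>2 \<boxtimes> idn T F) \<cdot> ?b = mzero T (src T ?b) (src T \<gamma>2 \<star> F)"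
    by (rule kan_injE)
  have f2e: "src T \<phi>2 = B" "tgt T \<gamma>2 = tgt T u" using f2(1,3) me by simp_all
  let ?\<chi> = "\<phi>2 \<cdot> in2"
  \<comment> \<open>Dividing out the second summand makes the part coming from
    \<open>src T u\<close> disappear. It is invisible in the cone anyway, because
    \<open>g \<cdot> u = 0\<close>, so \<open>g \<cdot> \<gamma>2\<close> still factors, through
    \<open>\<gamma>3\<close>.\<close>
  obtain q r where dq: "dtri T ?\<chi> q r" by (rule ex_cone)
  have \<chi>e: "src T ?\<chi> = src T \<xi>" "tgt T ?\<chi> = src T \<gamma>2" using f2(2) f2e b' by simp_all
  have qe: "src T q = src T \<gamma>2" using dtri_ends[OF dq] \<chi>e by simp
  have D3: "compact_object T (tgt T q)"
    by (rule compact_cone[OF dq]) (use \<chi>e y(1) f2(4) in simp_all)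
  have "(g \<cdot> \<gamma>2) \<cdot> ?\<chi> = g \<cdot> ((\<gamma>2 \<cdot> \<phi>2) \<cdot> in2)"
    using f2(2) f2e e b' by simp
  also have "\<dots> = mneg T ((g \<cdot> u) \<cdot> \<xi>)"
    unfolding f2(5) m2 using e y(2) by simp
  also have "\<dots> = mzero T (src T ?\<chi>) (tgt T (g \<cdot> \<gamma>2))"
    unfolding dtri_comp_zero(1)[OF d] using y(2) \<chi>e f2e e by simp
  finally obtain \<gamma>3 where g3: "src T \<gamma>3 = tgt T q" "tgt T \<gamma>3 = tgt T (g \<cdot> \<gamma>2)" "\<gamma>3 \<cdot> q = g \<cdot> \<gamma>2"
    using weak_coker[OF dq, of "g \<cdot> \<gamma>2"] \<chi>e f2e e by auto
  have g3e: "tgt T \<gamma>3 = tgt T g" using g3(2) f2e e by simp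
  let ?\<psi> = "q \<cdot> (\<phi>2 \<cdot> in1)"
  have \<psi>e: "src T ?\<psi> = src T v" "tgt T ?\<psi> = tgt T q" using f2(2) f2e b' qe by simp_all
  have \<psi>w: "(?\<psi> \<boxtimes> idn T F) \<cdot> w = mzero T (src T x) (tgt T q \<star> F)"
  proof -
    have q\<chi>: "q \<cdot> (\<phi>2 \<cdot> in2) = mzero T (src T \<xi>) (tgt T q)"
      using dtri_comp_zero(1)[OF dq] \<chi>e by simp
    have "((q \<cdot> \<phi>2) \<boxtimes> idn T F) \<cdot> ?b = (q \<boxtimes> idn T F) \<cdot> ((\<phi>2 \<boxtimes> idn T F) \<cdot> ?b)"
      by (subst tarr_merge_cmp) (use f2(2) f2e qe be in simp_all)
    also have "\<dots> = mzero T (src T x) (tgt T q \<star> F)"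
      unfolding f2(6) using be(1) qe by simp
    finally have z: "((q \<cdot> \<phi>2) \<boxtimes> idn T F) \<cdot> ?b = mzero T (src T x) (tgt T q \<star> F)" .
    have "((q \<cdot> \<phi>2) \<boxtimes> idn T F) \<cdot> ?b
        = ((q \<cdot> \<phi>2) \<boxtimes> idn T F) \<cdot> ((in1 \<boxtimes> idn T F) \<cdot> w) \<uplus> ((q \<cdot> \<phi>2) \<boxtimes> idn T F) \<cdot> ((in2 \<boxtimes> idn T F) \<cdot> y)"
      by (rule cmp_add) (use b' vw(4,5) y(3,4) x1e f2(2) f2e qe in simp_all)
    also have "((q \<cdot> \<phi>2) \<boxtimes> idn T F) \<cdot> ((in1 \<boxtimes> idn T F) \<cdot> w) = (?\<psi> \<boxtimes> idn T F) \<cdot> w"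
      using b' vw(5) f2(2) f2e qe by (simp add: tarr_merge_cmp)
    also have "((q \<cdot> \<phi>2) \<boxtimes> idn T F) \<cdot> ((in2 \<boxtimes> idn T F) \<cdot> y) = ((q \<cdot> (\<phi>2 \<cdot> in2)) \<boxtimes> idn T F) \<cdot> y"
      using b' y(4) f2(2) f2e qe by (simp add: tarr_merge_cmp)
    also have "\<dots> = mzero T (src T x) (tgt T q \<star> F)"
      unfolding q\<chi> using y(3,4) x1e by simp
    finally have "mzero T (src T x) (tgt T q \<star> F) = (?\<psi> \<boxtimes> idn T F) \<cdot> w \<uplus> mzero T (src T x) (tgt T q \<star> F)"
      unfolding z .
    then show ?thesis using \<psi>e vw(4,5) by simp
  qed
  have \<gamma>3\<psi>: "\<gamma>3 \<cdot> ?\<psi> = \<beta> \<cdot> v"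
  proof -
    have "\<gamma>3 \<cdot> ?\<psi> = (g \<cdot> \<gamma>2) \<cdot> (\<phi>2 \<cdot> in1)"
      by (rule cmp_reassoc[OF g3(3)]) (use g3(1) qe f2(2) f2e b' in simp_all)
    also have "\<dots> = g \<cdot> ((\<gamma>2 \<cdot> \<phi>2) \<cdot> in1)" using f2(2) f2e e b' by simp
    also have "\<dots> = \<beta> \<cdot> v" unfolding f2(5) m1 by (rule \<tau>(3))
    finally show ?thesis .
  qed
  \<comment> \<open>The witness \<open>?\<psi>\<close> kills \<open>w\<close> over
    \<open>src T v\<close>. Pushing it out along \<open>v\<close> gives a map \<open>a\<close> on
    \<open>src T \<beta>\<close> that kills \<open>x\<close>, through a compact object over which
    \<open>\<beta>\<close> still factors.\<close>
  obtain P a a' where P: "src T a = tgt T v" "tgt T a = P" "src T a' = tgt T ?\<psi>" "tgt T a' = P" "a \<cdot> v = a' \<cdot> ?\<psi>"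
    and uni: "\<And>s t. \<lbrakk>src T s = tgt T v; src T t = tgt T ?\<psi>; tgt T s = tgt T t; s \<cdot> v = t \<cdot> ?\<psi>\<rbrakk>
      \<Longrightarrow> \<exists>r. src T r = P \<and> tgt T r = tgt T t \<and> r \<cdot> a = s \<and> r \<cdot> a' = t"
    and sub: "\<And>A. \<lbrakk>triangulated_subcategory T A; src T v \<in> A; tgt T v \<in> A; tgt T ?\<psi> \<in> A\<rbrakk> \<Longrightarrow> P \<in> A"
    by (rule weak_pushout[of v ?\<psi>]) (use \<psi>e in simp, blast)
  have Pc: "compact_object T P"
    using sub[OF compacts_triangulated] vw(1,2) fe x(2) \<psi>e D3 by (simp add: compacts_def)
  obtain \<rho> where \<rho>: "src T \<rho> = P" "tgt T \<rho> = tgt T \<gamma>3" "\<rho> \<cdot> a = \<beta>"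
    using uni[of \<beta> \<gamma>3] vw(2) fe g3(1) g3e \<psi>e x(3) \<gamma>3\<psi> by auto
  have "(a \<boxtimes> idn T F) \<cdot> ((v \<boxtimes> idn T F) \<cdot> w) = ((a \<cdot> v) \<boxtimes> idn T F) \<cdot> w"
    using P(1) vw(5) by (simp add: tarr_merge_cmp)
  also have "\<dots> = (a' \<boxtimes> idn T F) \<cdot> ((?\<psi> \<boxtimes> idn T F) \<cdot> w)"
    unfolding P(5) by (subst tarr_merge_cmp) (use P(3) vw(5) \<psi>e in simp_all)
  also have "\<dots> = mzero T (src T x) (P \<star> F)"
    unfolding \<psi>w using P(3,4) \<psi>e by simp
  finally have "(a \<boxtimes> idn T F) \<cdot> x = mzero T (src T x) (src T \<rho> \<star> F)"
    unfolding vw(6) \<rho>(1) .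
  then have "kan_inj F x (\<rho> \<cdot> a)"
    by - (rule kan_injI, use P(2) \<rho>(1) Pc in simp_all)
  then show ?thesis unfolding \<rho>(3) .
qed

text \<open>For compact \<open>X\<close> the identity of \<open>X\<close> is a terminal index, so
  the colimit is attained there. Coproducts reduce to components by compactness of the sources, and
  cones are the two chases above.\<close>

lemma kan_extended: "kan_extended F X"
proof (rule compact_induct[of "kan_extended F"])
  show "kan_extended F k" if k: "compact_object T k" for k
    unfolding kan_extended_def
  proof (intro conjI allI impI)
    fix y assume y: "compact_object T (src T y) \<and> tgt T y = k \<star> F"
    have "kan_surj F k ((idn T k \<boxtimes> idn T F) \<cdot> y)" by (rule kan_surjI) (use y k in simp_all)
    then show "kan_surj F k y" using y by simp
  next
    fix x \<beta> assume x: "compact_object T (src T x) \<and> compact_object T (src T \<beta>) \<and> tgt T \<beta> = k \<and>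
        tgt T x = src T \<beta> \<star> F \<and> (\<beta> \<boxtimes> idn T F) \<cdot> x = mzero T (src T x) (k \<star> F)"
    have "kan_inj F x (idn T k \<cdot> \<beta>)" by (rule kan_injI) (use x k in simp_all)
    then show "kan_inj F x \<beta>" using x by simp
  qed
next
  fix X Y assume XY: "isomorphic T X Y" and X: "kan_extended F X"
  obtain k where k: "iso_arrow T k" "src T k = X" "tgt T k = Y" using XY by (rule isomorphicE)
  obtain k' where k': "src T k' = Y" "tgt T k' = X" "k \<cdot> k' = idn T Y"
    using iso_arrowE[OF k(1)] k by metis
  show "kan_extended F Y"
    unfolding kan_extended_def
  proof (intro conjI allI impI)
    fix y assume y: "compact_object T (src T y) \<and> tgt T y = Y \<star> F"
    have "kan_surj F X ((k' \<boxtimes> idn T F) \<cdot> y)"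
      by (rule kan_extendedD(1)[OF X]) (use y k' in simp_all)
    then have "kan_surj F (tgt T k) ((k \<boxtimes> idn T F) \<cdot> ((k' \<boxtimes> idn T F) \<cdot> y))"
      by (rule kan_surj_cmp) (use k in simp)
    then show "kan_surj F Y y" using k k' y by (simp add: tarr_merge_cmp)
  next
    fix x \<beta> assume x: "compact_object T (src T x) \<and> compact_object T (src T \<beta>) \<and> tgt T \<beta> = Y \<and>
        tgt T x = src T \<beta> \<star> F \<and> (\<beta> \<boxtimes> idn T F) \<cdot> x = mzero T (src T x) (Y \<star> F)"
    then have z: "(\<beta> \<boxtimes> idn T F) \<cdot> x = mzero T (src T x) (Y \<star> F)" by blast
    have "((k' \<cdot> \<beta>) \<boxtimes> idn T F) \<cdot> x = (k' \<boxtimes> idn T F) \<cdot> ((\<beta> \<boxtimes> idn T F) \<cdot> x)"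
      by (subst tarr_merge_cmp) (use x k' in simp_all)
    also have "\<dots> = mzero T (src T x) (X \<star> F)" unfolding z using k' by simp
    finally have "kan_inj F x (k' \<cdot> \<beta>)"
      by - (rule kan_extendedD(2)[OF X], use x k' in simp_all)
    then have "kan_inj F x (k \<cdot> (k' \<cdot> \<beta>))" by (rule kan_inj_cmp) (use k k' x in simp)
    then show "kan_inj F x \<beta>" using cmp_reassoc[OF k'(3), of \<beta>] k k' x by simp
  qed
next
  fix I :: "'u set" and X S \<iota>
  assume I: "small T I" and S: "is_coproduct T I X S \<iota>" and X: "\<And>i. i \<in> I \<Longrightarrow> kan_extended F (X i)"
  obtain Z where Z: "zero_object T Z" using ex_zero_object by blast
  note Zc = compact_zero[OF Z]
  show "kan_extended F S"
    unfolding kan_extended_def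
  proof (intro conjI allI impI)
    fix y assume y: "compact_object T (src T y) \<and> tgt T y = S \<star> F"
    show "kan_surj F S y"
    proof (rule compact_sum_induct[OF _ I tensor_coproduct[OF S, of F], of "src T y" y "kan_surj F S"])
      have "kan_surj F S ((mzero T Z S \<boxtimes> idn T F) \<cdot> mzero T (src T y) (Z \<star> F))"
        by (rule kan_surjI) (use Zc in simp_all)
      then show "kan_surj F S (mzero T (src T y) (S \<star> F))" by simp
    next
      fix i p assume i: "i \<in> I" and p: "is_projection I (\<lambda>i. X i \<star> F) (S \<star> F) (\<lambda>i. \<iota> i \<boxtimes> idn T F) i p"
      have pe: "src T p = S \<star> F" "tgt T p = X i \<star> F" using p by (auto simp: is_projection_def)
      have "kan_surj F (X i) (p \<cdot> y)"
        by (rule kan_extendedD(1)[OF X[OF i]]) (use pe y in simp_all)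
      then have "kan_surj F (tgt T (\<iota> i)) ((\<iota> i \<boxtimes> idn T F) \<cdot> (p \<cdot> y))"
        by (rule kan_surj_cmp) (use coproduct_inj[OF S i] in simp)
      then show "kan_surj F S ((\<iota> i \<boxtimes> idn T F) \<cdot> (p \<cdot> y))" using coproduct_inj[OF S i] by simp
    next
      fix g h assume "src T g = src T y" "src T h = src T y" "kan_surj F S g" "kan_surj F S h"
      then show "kan_surj F S (g \<uplus> h)" by (intro kan_surj_add) simp_all
    qed (use y in simp_all)
  next
    fix x \<beta> assume x: "compact_object T (src T x) \<and> compact_object T (src T \<beta>) \<and> tgt T \<beta> = S \<and>
        tgt T x = src T \<beta> \<star> F \<and> (\<beta> \<boxtimes> idn T F) \<cdot> x = mzero T (src T x) (S \<star> F)"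
    then have z: "(\<beta> \<boxtimes> idn T F) \<cdot> x = mzero T (src T x) (S \<star> F)" by blast
    show "kan_inj F x \<beta>"
    proof (rule compact_sum_induct[OF _ I S, of "src T \<beta>" \<beta> "kan_inj F x"])
      have "kan_inj F x (mzero T Z S \<cdot> mzero T (src T \<beta>) Z)"
        by (rule kan_injI) (use Zc x in simp_all)
      then show "kan_inj F x (mzero T (src T \<beta>) S)" by simp
    next
      fix i p assume i: "i \<in> I" and p: "is_projection I X S \<iota> i p"
      have pe: "src T p = S" "tgt T p = X i" using p by (auto simp: is_projection_def)
      have "((p \<cdot> \<beta>) \<boxtimes> idn T F) \<cdot> x = (p \<boxtimes> idn T F) \<cdot> ((\<beta> \<boxtimes> idn T F) \<cdot> x)"
        by (subst tarr_merge_cmp) (use x pe in simp_all)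
      also have "\<dots> = mzero T (src T x) (X i \<star> F)" unfolding z using pe by simp
      finally have "kan_inj F x (p \<cdot> \<beta>)"
        by - (rule kan_extendedD(2)[OF X[OF i]], use x pe in simp_all)
      then show "kan_inj F x (\<iota> i \<cdot> (p \<cdot> \<beta>))"
        by (rule kan_inj_cmp) (use coproduct_inj[OF S i] pe x in simp)
    next
      fix g h assume "src T g = src T \<beta>" "tgt T g = S" "src T h = src T \<beta>" "tgt T h = S"
        "kan_inj F x g" "kan_inj F x h"
      then show "kan_inj F x (g \<uplus> h)" using x by (intro kan_inj_add) simp_all
    qed (use x in simp_all)
  qed
next
  fix u g h assume d: "dtri T u g h" and G: "kan_extended F (src T u)" "kan_extended F (tgt T u)"
    "kan_extended F (sobj T (src T u))" "kan_extended F (sobj T (tgt T u))"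
  show "kan_extended F (tgt T g)"
    unfolding kan_extended_def
    using kan_extended_cone_surj[OF d G(2,3,4)] kan_extended_cone_inj[OF d G(1,2,3)] by blast
qed

section \<open>Recovering a smashing ideal from maps between compact objects\<close>

definition smashing_trace :: "'o set \<Rightarrow> 'o set \<Rightarrow> 'm set" where
  "smashing_trace R S = {\<phi>. src T \<phi> \<in> R \<and> tgt T \<phi> \<in> R \<and> factors S \<phi>}"

text \<open>For \<open>X\<close> in \<open>S\<close> the object \<open>X \<star> tgt T f'\<close> is
  tested on maps from compact objects. It lies in \<open>S\<close>, so such a map factors as
  \<open>\<gamma> \<cdot> \<phi>\<close> with \<open>\<phi>\<close> a map between compacts through
  \<open>S\<close>, hence through \<open>S'\<close>; but a map from an object of \<open>S'\<close>
  into this local object vanishes.\<close>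

lemma smashing_trace_determines:
  assumes S: "smashing_ideal T S" and S': "smashing_ideal T S'"
    and R: "\<forall>c \<in> compacts T. \<exists>r \<in> R. isomorphic T c r"
    and sub: "smashing_trace R S \<subseteq> smashing_trace R S'"
  shows "S \<subseteq> S'"
proof
  fix X assume X: "X \<in> S"
  obtain e f d where d: "dtri T e f d" "tgt T e = \<one>" "zero_object T (src T e \<star> tgt T f)"
    and Sk: "S = {X. zero_object T (X \<star> tgt T f)}"
    using S by (rule smashing_idealE)
  obtain e' f' d' where d': "dtri T e' f' d'" "tgt T e' = \<one>" "zero_object T (src T e' \<star> tgt T f')"
    and Sk': "S' = {X. zero_object T (X \<star> tgt T f')}"
    using S' by (rule smashing_idealE)
  let ?F = "tgt T f" and ?F' = "tgt T f'"
  have fe: "src T f = \<one>" "src T f' = \<one>" using dtri_ends d d' by metis+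
  define \<rho> where "\<rho> = (\<lambda>Y. arrow_inv T (runit T Y))"
  have \<rho>: "src T (\<rho> Y) = Y" "tgt T (\<rho> Y) = Y \<star> \<one>" "iso_arrow T (\<rho> Y)" "runit T Y \<cdot> \<rho> Y = idn T Y"
      "\<rho> Y \<cdot> runit T Y = idn T (Y \<star> \<one>)" for Y
    using arrow_inv[OF runit_iso[of Y]] iso_arrow_inv[OF runit_iso[of Y]] by (simp_all add: \<rho>_def)
  have \<rho>nat: "(g \<boxtimes> idn T \<one>) \<cdot> \<rho> (src T g) = \<rho> (tgt T g) \<cdot> g" for g
  proof (rule iso_cancel_left[OF runit_iso])
    show "runit T (tgt T g) \<cdot> ((g \<boxtimes> idn T \<one>) \<cdot> \<rho> (src T g)) = runit T (tgt T g) \<cdot> (\<rho> (tgt T g) \<cdot> g)"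
      using cmp_reassoc[OF runit_nat[of g], of "\<rho> (src T g)"] cmp_reassoc[OF \<rho>(4)[of "tgt T g"], of g] \<rho> by simp
  qed (use \<rho> in simp_all)
  \<comment> \<open>The localization map from \<open>Y\<close> to \<open>Y \<star> ?F\<close>. The
    unitor is on the right because the Kan extension statements tensor with \<open>F\<close> on the
    right.\<close>
  define \<eta> where "\<eta> = (\<lambda>Y. (idn T Y \<boxtimes> f) \<cdot> \<rho> Y)"
  define \<eta>' where "\<eta>' = (\<lambda>Y. (idn T Y \<boxtimes> f') \<cdot> \<rho> Y)"
  have \<eta>: "src T (\<eta> Y) = Y" "tgt T (\<eta> Y) = Y \<star> ?F" for Y using \<rho> fe by (simp_all add: \<eta>_def)
  have \<eta>': "src T (\<eta>' Y) = Y" "tgt T (\<eta>' Y) = Y \<star> ?F'" for Y using \<rho> fe by (simp_all add: \<eta>'_def)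
  have nat: "(g \<boxtimes> idn T ?F) \<cdot> \<eta> (src T g) = \<eta> (tgt T g) \<cdot> g" for g
  proof -
    have "(g \<boxtimes> idn T ?F) \<cdot> \<eta> (src T g) = (idn T (tgt T g) \<boxtimes> f) \<cdot> ((g \<boxtimes> idn T \<one>) \<cdot> \<rho> (src T g))"
      using \<rho> fe by (simp add: \<eta>_def tarr_merge_cmp)
    then show ?thesis unfolding \<rho>nat using \<rho> fe by (simp add: \<eta>_def)
  qed
  have nat': "(g \<boxtimes> idn T ?F') \<cdot> \<eta>' (src T g) = \<eta>' (tgt T g) \<cdot> g" for g
  proof -
    have "(g \<boxtimes> idn T ?F') \<cdot> \<eta>' (src T g) = (idn T (tgt T g) \<boxtimes> f') \<cdot> ((g \<boxtimes> idn T \<one>) \<cdot> \<rho> (src T g))"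
      using \<rho> fe by (simp add: \<eta>'_def tarr_merge_cmp)
    then show ?thesis unfolding \<rho>nat using \<rho> fe by (simp add: \<eta>'_def)
  qed
  let ?X = "X \<star> ?F'"
  have "zero_object T ?X"
  proof (rule compact_orthogonal_zero)
    fix \<alpha> assume \<alpha>: "compact_object T (src T \<alpha>)" "tgt T \<alpha> = ?X"
    let ?c = "src T \<alpha>"
    have "?X \<in> S" by (rule smashing_tensor[OF S X])
    then have "zero_object T (?X \<star> ?F)" using Sk by blast
    then have z: "(\<alpha> \<boxtimes> idn T ?F) \<cdot> \<eta> ?c = mzero T (src T (\<eta> ?c)) (?X \<star> ?F)"
      using arrow_to_zero[of "?X \<star> ?F" "(\<alpha> \<boxtimes> idn T ?F) \<cdot> \<eta> ?c"] \<alpha> \<eta> by simp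
    have "kan_inj ?F (\<eta> ?c) \<alpha>"
      by (rule kan_extendedD(2)[OF kan_extended]) (use \<alpha> \<eta> z in simp_all)
    then obtain \<phi> \<gamma> where f1: "src T \<phi> = src T \<alpha>" "tgt T \<phi> = src T \<gamma>" "tgt T \<gamma> = tgt T \<alpha>"
      "compact_object T (src T \<gamma>)" "\<gamma> \<cdot> \<phi> = \<alpha>" "(\<phi> \<boxtimes> idn T ?F) \<cdot> \<eta> ?c = mzero T (src T (\<eta> ?c)) (src T \<gamma> \<star> ?F)"
      by (rule kan_injE)
    let ?d = "src T \<gamma>"
    \<comment> \<open>The image of \<open>\<phi>\<close> under localization is zero, so
      \<open>\<phi>\<close> lifts to the acyclic part \<open>src T e \<star> ?d\<close>, which
      belongs to \<open>S\<close>. The braiding is needed because the triangle is tensored on the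
      other side.\<close>
    have "factors S \<phi>"
    proof -
      have b: "braid T ?d ?F \<cdot> (idn T ?d \<boxtimes> f) = (f \<boxtimes> idn T ?d) \<cdot> braid T ?d \<one>"
        using braid_nat[of "idn T ?d" f] fe by simp
      let ?k = "braid T ?d \<one> \<cdot> \<rho> ?d"
      have ke: "src T ?k = ?d" "tgt T ?k = \<one> \<star> ?d" "iso_arrow T ?k"
        using \<rho> by (auto intro: iso_cmp)
      have "\<eta> ?d \<cdot> \<phi> = mzero T ?c (?d \<star> ?F)"
        using nat[of \<phi>] f1(1,2,6) \<eta> by simp
      then have "braid T ?d ?F \<cdot> (\<eta> ?d \<cdot> \<phi>) = mzero T ?c (?F \<star> ?d)" by simp
      also have "braid T ?d ?F \<cdot> (\<eta> ?d \<cdot> \<phi>) = (f \<boxtimes> idn T ?d) \<cdot> (?k \<cdot> \<phi>)"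
        using cmp_reassoc[OF b, of "\<rho> ?d \<cdot> \<phi>"] \<rho> fe f1(1,2) by (simp add: \<eta>_def)
      finally have z: "(f \<boxtimes> idn T ?d) \<cdot> (?k \<cdot> \<phi>) = mzero T (src T (?k \<cdot> \<phi>)) (tgt T f \<star> ?d)"
        using ke f1(1,2) by simp
      have ky: "tgt T (?k \<cdot> \<phi>) = tgt T e \<star> ?d" using ke f1(2) d(2) by simp
      obtain m where m: "src T m = src T (?k \<cdot> \<phi>)" "tgt T m = src T e \<star> ?d" "(e \<boxtimes> idn T ?d) \<cdot> m = ?k \<cdot> \<phi>"
        by (rule whisker_exact[OF d(1) ky z])
      obtain k' where k': "src T k' = \<one> \<star> ?d" "tgt T k' = ?d" "k' \<cdot> ?k = idn T ?d"
        using iso_arrowE[OF ke(3)] ke(1,2) by metis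
      have "src T e \<in> S" using d(3) Sk by blast
      then have "src T e \<star> ?d \<in> S" by (rule smashing_tensor[OF S])
      then have "factors S ((k' \<cdot> (e \<boxtimes> idn T ?d)) \<cdot> m)"
        by (intro factorsI) (use m(2) k' d(2) in simp_all)
      also have "(k' \<cdot> (e \<boxtimes> idn T ?d)) \<cdot> m = k' \<cdot> ((e \<boxtimes> idn T ?d) \<cdot> m)"
        using m(2) k' d(2) by simp
      also have "\<dots> = \<phi>" unfolding m(3) using cmp_reassoc[OF k'(3), of \<phi>] k' ke f1(2) by simp
      finally show ?thesis .
    qed
    \<comment> \<open>Traces only record maps between the chosen representatives, so
      \<open>\<phi>\<close> is conjugated by isomorphisms with objects of \<open>R\<close> and
      transported back afterwards.\<close>
    obtain r where r: "r \<in> R" "isomorphic T ?c r" using R \<alpha>(1) by (auto simp: compacts_def)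
    obtain s where s: "s \<in> R" "isomorphic T ?d s" using R f1(4) by (auto simp: compacts_def)
    obtain a where a: "iso_arrow T a" "src T a = ?c" "tgt T a = r" using r(2) by (rule isomorphicE)
    obtain a' where a': "src T a' = r" "tgt T a' = ?c" "a' \<cdot> a = idn T ?c" using iso_arrowE[OF a(1)] a by metis
    obtain b where b: "iso_arrow T b" "src T b = ?d" "tgt T b = s" using s(2) by (rule isomorphicE)
    obtain b' where b': "src T b' = s" "tgt T b' = ?d" "b' \<cdot> b = idn T ?d" using iso_arrowE[OF b(1)] b by metis
    have "factors S (\<phi> \<cdot> a')"
      by (rule factors_precmp[OF \<open>factors S \<phi>\<close>]) (use a' f1(1) in simp)
    then have "factors S (b \<cdot> (\<phi> \<cdot> a'))"
      by (rule factors_cmp) (use a' b f1(1,2) in simp)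
    then have "b \<cdot> (\<phi> \<cdot> a') \<in> smashing_trace R S"
      using a' b f1(1,2) r(1) s(1) by (simp add: smashing_trace_def)
    then have "factors S' (b \<cdot> (\<phi> \<cdot> a'))" using sub by (auto simp: smashing_trace_def)
    then have "factors S' (b' \<cdot> (b \<cdot> (\<phi> \<cdot> a')))"
      by (rule factors_cmp) (use a' b b' f1(1,2) in simp)
    also have "b' \<cdot> (b \<cdot> (\<phi> \<cdot> a')) = \<phi> \<cdot> a'"
      using cmp_reassoc[OF b'(3), of "\<phi> \<cdot> a'"] a' b b' f1(1,2) by simp
    finally have "factors S' ((\<phi> \<cdot> a') \<cdot> a)"
      by (rule factors_precmp) (use a a' f1(1) in simp)
    also have "(\<phi> \<cdot> a') \<cdot> a = \<phi>" using a a' f1(1) by simp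
    finally have "factors S' (\<gamma> \<cdot> \<phi>)" by (rule factors_cmp) (use f1(2) in simp)
    then have "factors S' \<alpha>" unfolding f1(5) .
    then obtain \<delta> \<epsilon> where f2: "src T \<delta> = src T \<alpha>" "tgt T \<delta> = src T \<epsilon>" "tgt T \<epsilon> = tgt T \<alpha>" "src T \<epsilon> \<in> S'" "\<epsilon> \<cdot> \<delta> = \<alpha>"
      by (rule factorsE)
    have "zero_object T (src T \<epsilon> \<star> ?F')" using f2(4) Sk' by blast
    then have "(\<epsilon> \<boxtimes> idn T ?F') \<cdot> \<eta>' (src T \<epsilon>) = mzero T (src T \<epsilon>) (?X \<star> ?F')"
      using arrow_to_zero[of "src T \<epsilon> \<star> ?F'" "\<eta>' (src T \<epsilon>)"] \<eta>' f2(3) \<alpha> by simp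
    then have "\<eta>' ?X \<cdot> \<epsilon> = \<eta>' ?X \<cdot> mzero T (src T \<epsilon>) ?X"
      using nat'[of \<epsilon>] f2(3) \<alpha> \<eta>' by simp
    \<comment> \<open>\<open>?X\<close> is local for \<open>S'\<close>: its tensor product with the
      idempotent object of \<open>S'\<close> is zero, so the localization map at \<open>?X\<close>
      is invertible.\<close>
    moreover have "iso_arrow T (\<eta>' ?X)"
    proof -
      have "zero_object T (X \<star> (src T e' \<star> ?F'))" by (rule zero_tensor_right[OF d'(3)])
      then have "zero_object T (src T e' \<star> ?X)" using zero_object_cong[OF tobj_left_commute] by blast
      then have "iso_arrow T (f' \<boxtimes> idn T ?X)" using zero_fibre_tensor[OF d'(1)] by blast
      then have "iso_arrow T (idn T ?X \<boxtimes> f')" by (simp add: iso_whisker_commute)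
      then show ?thesis unfolding \<eta>'_def by (rule iso_cmp[OF \<rho>(3)]) (use \<rho> fe in simp)
    qed
    ultimately have "\<epsilon> = mzero T (src T \<epsilon>) ?X"
      using iso_cancel_left[of "\<eta>' ?X" \<epsilon> "mzero T (src T \<epsilon>) ?X"] \<eta>' f2(3) \<alpha> by simp
    then have "\<epsilon> \<cdot> \<delta> = mzero T (src T \<epsilon>) ?X \<cdot> \<delta>" by simp
    then show "\<alpha> = mzero T ?c ?X" using f2 by simp
  qed
  then show "X \<in> S'" using Sk' by simp
qed

text \<open>The traces are subsets of the small set of maps between representatives, and by the
  previous lemma the trace determines the ideal.\<close>

lemma small_smashing_frame: "small T (smashing_frame T)"
proof -
  obtain R where R: "R \<subseteq> compacts T" "small T R" "\<forall>c \<in> compacts T. \<exists>r \<in> R. isomorphic T c r"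
    using compacts_essentially_small by blast
  let ?M = "\<Union>r \<in> R. \<Union>s \<in> R. Hom T r s"
  have "small T ?M"
    by (intro small_UN R(2) locally_small)
  moreover have "inj_on (smashing_trace R) (smashing_frame T)"
    by (rule inj_onI) (use smashing_trace_determines[OF _ _ R(3)] in \<open>auto simp: smashing_frame_def\<close>)
  moreover have "smashing_trace R ` smashing_frame T \<subseteq> Pow ?M"
    by (auto simp: smashing_trace_def)
  ultimately show ?thesis
    using small_inj small_Pow by blast
qed

end

section \<open>The smashing spectrum\<close>

lemma frame_pointD:
  assumes "frame_point L p"
  shows "p \<in> extensional L"
    and "A \<subseteq> L \<Longrightarrow> finite A \<Longrightarrow> glb_in L A m \<Longrightarrow> p m \<longleftrightarrow> (\<forall>a \<in> A. p a)"
    and "A \<subseteq> L \<Longrightarrow> lub_in L A m \<Longrightarrow> p m \<longleftrightarrow> (\<exists>a \<in> A. p a)"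
proof -
  note d = assms[unfolded frame_point_def]
  note m = d[THEN conjunct2, THEN conjunct1] and j = d[THEN conjunct2, THEN conjunct2]
  show "p \<in> extensional L" by (rule d[THEN conjunct1])
  show "A \<subseteq> L \<Longrightarrow> finite A \<Longrightarrow> glb_in L A m \<Longrightarrow> p m \<longleftrightarrow> (\<forall>a \<in> A. p a)"
    by (rule m[THEN spec, THEN spec, THEN mp]) (intro conjI)
  show "A \<subseteq> L \<Longrightarrow> lub_in L A m \<Longrightarrow> p m \<longleftrightarrow> (\<exists>a \<in> A. p a)"
    by (rule j[THEN spec, THEN spec, THEN mp]) (intro conjI)
qed

context big_tt_category
begin

lemma mem_smashing_frame [simp]: "S \<in> smashing_frame T \<longleftrightarrow> smashing_ideal T S"
  by (simp add: smashing_frame_def)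

lemma smashing_Union_bhull:
  assumes "A \<subseteq> smashing_frame T" shows "smashing_ideal T (bhull (\<Union>A))"
proof (rule smashing_join)
  show "small T A" by (rule small_surj[OF small_smashing_frame, of _ id]) (use assms in auto)
qed (use assms in auto)

lemma bhull_subset_iff: "smashing_ideal T P \<Longrightarrow> bhull A \<subseteq> P \<longleftrightarrow> A \<subseteq> P"
  using smashing_bhull_subset bhull_subset by blast

text \<open>The double orthogonal of the union is the least smashing ideal above all members. Points
  of the frame depend on the order alone, so this description of joins suffices for them.\<close>

lemma lub_smashing_frame:
  assumes "A \<subseteq> smashing_frame T" shows "lub_in (smashing_frame T) A (bhull (\<Union>A))"
  using smashing_Union_bhull[OF assms] bhull_subset[of "\<Union>A"] bhull_subset_iff
  by (auto simp: lub_in_def)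

lemma smashing_Inter:
  assumes "finite A" "A \<subseteq> smashing_frame T" shows "smashing_ideal T (\<Inter>A)"
  using assms by (induction A rule: finite_induct) (auto simp: smashing_UNIV smashing_Int)

lemma glb_smashing_frame:
  assumes "finite A" "A \<subseteq> smashing_frame T" shows "glb_in (smashing_frame T) A (\<Inter>A)"
  using smashing_Inter[OF assms] by (auto simp: glb_in_def)


lemma glb_in_unique: "glb_in L A j \<Longrightarrow> glb_in L A k \<Longrightarrow> j = k"
  unfolding glb_in_def by (meson order_antisym)

lemma primeD:
  assumes "prime_smashing_ideal T P"
  shows "smashing_ideal T P" "P \<noteq> UNIV"
    "\<lbrakk>smashing_ideal T S; smashing_ideal T R; S \<inter> R \<subseteq> P\<rbrakk> \<Longrightarrow> S \<subseteq> P \<or> R \<subseteq> P"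
  using assms by (auto simp: prime_smashing_ideal_def)

lemma prime_Inter:
  assumes P: "prime_smashing_ideal T P" and A: "finite A" "A \<subseteq> smashing_frame T" "\<Inter>A \<subseteq> P"
  shows "\<exists>a \<in> A. a \<subseteq> P"
  using A
proof (induction A rule: finite_induct)
  case empty
  then show ?case using primeD(2)[OF P] by auto
next
  case (insert a A)
  have "a \<subseteq> P \<or> \<Inter>A \<subseteq> P"
    using primeD(3)[OF P, of a "\<Inter>A"] smashing_Inter[OF insert.hyps(1)] insert.prems by auto
  then show ?case using insert by auto
qed

lemma point_of_prime_point:
  assumes P: "prime_smashing_ideal T P"
  shows "frame_point (smashing_frame T) (point_of_prime T P)"
  unfolding frame_point_def
proof (intro conjI allI impI)
  show "point_of_prime T P \<in> extensional (smashing_frame T)"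
    by (simp add: point_of_prime_def)
next
  fix A m assume a: "A \<subseteq> smashing_frame T \<and> finite A \<and> glb_in (smashing_frame T) A m"
  then have m: "m = \<Inter>A" using glb_in_unique glb_smashing_frame by blast
  have sm: "smashing_ideal T (\<Inter>A)" using smashing_Inter a by blast
  have "\<Inter>A \<subseteq> P \<longleftrightarrow> (\<exists>a \<in> A. a \<subseteq> P)"
    using prime_Inter[OF P, of A] a by (meson Inter_lower order_trans)
  moreover have "point_of_prime T P m \<longleftrightarrow> \<not> m \<subseteq> P"
    using sm m by (simp add: point_of_prime_def)
  moreover have "point_of_prime T P a \<longleftrightarrow> \<not> a \<subseteq> P" if "a \<in> A" for a
    using a that by (simp add: point_of_prime_def subset_iff)
  ultimately show "point_of_prime T P m = (\<forall>a \<in> A. point_of_prime T P a)"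
    unfolding m by simp
next
  fix A j assume a: "A \<subseteq> smashing_frame T \<and> lub_in (smashing_frame T) A j"
  then have j: "smashing_ideal T j" "\<And>a. a \<in> A \<Longrightarrow> a \<subseteq> j" "(\<forall>a \<in> A. a \<subseteq> P) \<Longrightarrow> j \<subseteq> P"
    using primeD(1)[OF P] by (auto simp: lub_in_def)
  have "j \<subseteq> P \<longleftrightarrow> (\<forall>a \<in> A. a \<subseteq> P)"
    using j(2,3) by (meson order_trans)
  moreover have "point_of_prime T P j \<longleftrightarrow> \<not> j \<subseteq> P"
    using j(1) by (simp add: point_of_prime_def)
  moreover have "point_of_prime T P a \<longleftrightarrow> \<not> a \<subseteq> P" if "a \<in> A" for a
    using a that by (simp add: point_of_prime_def subset_iff)
  ultimately show "point_of_prime T P j = (\<exists>a \<in> A. point_of_prime T P a)"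
    by simp
qed

text \<open>\<open>?P\<close> is the join of all ideals that \<open>p\<close> sends to false. Since
  \<open>p\<close> preserves joins it sends \<open>?P\<close> to false as well, so \<open>S\<close>
  is contained in \<open>?P\<close> exactly when \<open>p\<close> sends it to false.\<close>

lemma point_prime:
  assumes p: "frame_point (smashing_frame T) p"
  obtains P where "prime_smashing_ideal T P" "p = point_of_prime T P"
proof -
  let ?L = "smashing_frame T"
  let ?A = "{S. smashing_ideal T S \<and> \<not> p S}"
  let ?P = "bhull (\<Union>?A)"
  have meet: "A \<subseteq> ?L \<Longrightarrow> finite A \<Longrightarrow> p (\<Inter>A) = (\<forall>a \<in> A. p a)" for A
    by (rule frame_pointD(2)[OF p _ _ glb_smashing_frame])
  have join: "A \<subseteq> ?L \<Longrightarrow> p (bhull (\<Union>A)) = (\<exists>a \<in> A. p a)" for A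
    by (rule frame_pointD(3)[OF p _ lub_smashing_frame])
  have AL: "?A \<subseteq> ?L" by auto
  have P: "smashing_ideal T ?P" by (rule smashing_Union_bhull[OF AL])
  have pP: "\<not> p ?P" using join[OF AL] by auto
  have iff: "S \<subseteq> ?P \<longleftrightarrow> \<not> p S" if S: "smashing_ideal T S" for S
  proof
    assume "S \<subseteq> ?P"
    show "\<not> p S"
    proof
      assume "p S"
      then have "p (S \<inter> ?P)" using \<open>S \<subseteq> ?P\<close> by (simp add: inf.absorb1)
      then show False using meet[of "{S, ?P}"] S P pP by auto
    qed
  next
    assume "\<not> p S"
    then show "S \<subseteq> ?P" using S bhull_subset[of "\<Union>?A"] by blast
  qed
  have "p UNIV" using meet[of "{}"] by simp
  then have "?P \<noteq> UNIV" using pP by auto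
  moreover have "S \<subseteq> ?P \<or> R \<subseteq> ?P" if SR: "smashing_ideal T S" "smashing_ideal T R" "S \<inter> R \<subseteq> ?P" for S R
  proof -
    have "\<not> p (S \<inter> R)" using iff[OF smashing_Int[OF SR(1,2)]] SR(3) by blast
    then have "\<not> p S \<or> \<not> p R" using meet[of "{S, R}"] SR(1,2) by auto
    then show ?thesis using iff SR(1,2) by blast
  qed
  ultimately have "prime_smashing_ideal T ?P" using P by (simp add: prime_smashing_ideal_def)
  moreover have "p = point_of_prime T ?P"
  proof
    fix S show "p S = point_of_prime T ?P S"
    proof (cases "smashing_ideal T S")
      case True
      then show ?thesis using iff[OF True] by (simp add: point_of_prime_def)
    next
      case False
      have "p \<in> extensional ?L" by (rule frame_pointD(1)[OF p])
      then show ?thesis using False by (simp add: point_of_prime_def extensional_def)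
    qed
  qed
  ultimately show thesis by (rule that)
qed


lemma point_of_prime_inj: "inj_on (point_of_prime T) {P. prime_smashing_ideal T P}"
proof (rule inj_onI)
  fix P Q assume PQ: "P \<in> {P. prime_smashing_ideal T P}" "Q \<in> {P. prime_smashing_ideal T P}"
    "point_of_prime T P = point_of_prime T Q"
  then have P: "smashing_ideal T P" "smashing_ideal T Q" using primeD(1) by auto
  have "S \<subseteq> P \<longleftrightarrow> S \<subseteq> Q" if "smashing_ideal T S" for S
    using fun_cong[OF PQ(3), of S] that by (simp add: point_of_prime_def)
  then show "P = Q" using P by blast
qed

section \<open>Open sets of the smashing spectrum and Stone duality\<close>

lemma smashing_open_UNIV: "smashing_open T UNIV = {P. prime_smashing_ideal T P}"
  using primeD(2) by (auto simp: smashing_open_def)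

lemma smashing_open_Int:
  assumes "smashing_ideal T S" "smashing_ideal T R"
  shows "smashing_open T (S \<inter> R) = smashing_open T S \<inter> smashing_open T R"
  using primeD(3)[OF _ assms] by (auto simp: smashing_open_def)

lemma smashing_open_bhull: "smashing_open T (bhull A) = {P. prime_smashing_ideal T P \<and> \<not> A \<subseteq> P}"
  using bhull_subset_iff primeD(1) by (auto simp: smashing_open_def)


lemma smashing_open_join: "smashing_open T (bhull (\<Union>A)) = (\<Union>S \<in> A. smashing_open T S)"
  unfolding smashing_open_bhull by (auto simp: smashing_open_def)

text \<open>The generating sets already form a topology: intersections are handled by primeness,
  unions by joins of arbitrary families.\<close>

lemma openin_smashing_iff:
  "openin (smashing_spectrum T) W \<longleftrightarrow> (\<exists>S. smashing_ideal T S \<and> W = smashing_open T S)"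
proof
  assume "openin (smashing_spectrum T) W"
  then have "generate_topology_on (smashing_open T ` smashing_frame T) W"
    by (simp add: smashing_spectrum_def openin_topology_generated_by_iff)
  then show "\<exists>S. smashing_ideal T S \<and> W = smashing_open T S"
  proof (induction rule: generate_topology_on.induct)
    case Empty
    have "smashing_ideal T (bhull (\<Union>{}))" by (rule smashing_Union_bhull) simp
    then show ?case using smashing_open_join[of "{}"] by auto
  next
    case (Int a b)
    then show ?case using smashing_open_Int smashing_Int by metis
  next
    case (UN K)
    let ?A = "{S. smashing_ideal T S \<and> smashing_open T S \<in> K}"
    have "\<Union>K = (\<Union>S \<in> ?A. smashing_open T S)" using UN by blast
    moreover have "smashing_ideal T (bhull (\<Union>?A))" by (rule smashing_Union_bhull) auto
    ultimately show ?case using smashing_open_join[of ?A] by metis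
  next
    case (Basis s)
    then show ?case by auto
  qed
next
  assume "\<exists>S. smashing_ideal T S \<and> W = smashing_open T S"
  then show "openin (smashing_spectrum T) W"
    unfolding smashing_spectrum_def by (auto intro!: topology_generated_by_Basis)
qed

lemma topspace_smashing_spectrum [simp]: "topspace (smashing_spectrum T) = {P. prime_smashing_ideal T P}"
proof -
  have "topspace (smashing_spectrum T) = (\<Union>S \<in> smashing_frame T. smashing_open T S)"
    by (simp add: smashing_spectrum_def)
  also have "\<dots> = {P. prime_smashing_ideal T P}"
  proof
    show "{P. prime_smashing_ideal T P} \<subseteq> (\<Union>S \<in> smashing_frame T. smashing_open T S)"
      using smashing_UNIV by (intro UN_upper[of UNIV, THEN subset_trans[rotated]])
        (simp_all add: smashing_open_UNIV)
  qed (auto simp: smashing_open_def)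
  finally show ?thesis .
qed

lemma point_of_prime_image: "point_of_prime T ` {P. prime_smashing_ideal T P} = Collect (frame_point (smashing_frame T))"
proof
  show "point_of_prime T ` {P. prime_smashing_ideal T P} \<subseteq> Collect (frame_point (smashing_frame T))"
    using point_of_prime_point by blast
  show "Collect (frame_point (smashing_frame T)) \<subseteq> point_of_prime T ` {P. prime_smashing_ideal T P}"
  proof
    fix p assume "p \<in> Collect (frame_point (smashing_frame T))"
    then have "frame_point (smashing_frame T) p" by simp
    then obtain P where "prime_smashing_ideal T P" "p = point_of_prime T P" by (rule point_prime)
    then show "p \<in> point_of_prime T ` {P. prime_smashing_ideal T P}" by blast
  qed
qed

lemma point_of_prime_image_open:
  assumes S: "smashing_ideal T S"
  shows "point_of_prime T ` smashing_open T S = {p. frame_point (smashing_frame T) p \<and> p S}"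
proof -
  have "smashing_open T S = {P. prime_smashing_ideal T P \<and> point_of_prime T P S}"
    using S by (auto simp: smashing_open_def point_of_prime_def)
  then have "point_of_prime T ` smashing_open T S = {p \<in> point_of_prime T ` {P. prime_smashing_ideal T P}. p S}"
    by auto
  then show ?thesis unfolding point_of_prime_image by simp
qed

lemma point_of_prime_homeomorphic:
  "homeomorphic_map (smashing_spectrum T) (frame_spectrum (smashing_frame T)) (point_of_prime T)"
proof (rule bijective_open_imp_homeomorphic_map)
  let ?L = "smashing_frame T"
  have top: "\<Union>{{p. frame_point ?L p \<and> p a} | a. a \<in> ?L} = Collect (frame_point ?L)"
  proof
    show "Collect (frame_point ?L) \<subseteq> \<Union>{{p. frame_point ?L p \<and> p a} | a. a \<in> ?L}"
    proof
      fix p assume "p \<in> Collect (frame_point ?L)"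
      then have p: "frame_point ?L p" by simp
      moreover have "p UNIV"
        using frame_pointD(2)[OF p _ _ glb_smashing_frame[of "{}"]] by simp
      ultimately show "p \<in> \<Union>{{p. frame_point ?L p \<and> p a} | a. a \<in> ?L}"
        using smashing_UNIV by auto
    qed
  qed auto
  show "continuous_map (smashing_spectrum T) (frame_spectrum ?L) (point_of_prime T)"
    unfolding frame_spectrum_def
  proof (rule continuous_on_generated_topo)
    fix U assume "U \<in> {{p. frame_point ?L p \<and> p a} | a. a \<in> ?L}"
    then obtain S where S: "smashing_ideal T S" "U = {p. frame_point ?L p \<and> p S}" by auto
    have "point_of_prime T -` U \<inter> topspace (smashing_spectrum T) = smashing_open T S"
      using S point_of_prime_point by (auto simp: smashing_open_def point_of_prime_def)
    then show "openin (smashing_spectrum T) (point_of_prime T -` U \<inter> topspace (smashing_spectrum T))"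
      using S openin_smashing_iff by metis
  next
    show "point_of_prime T ` topspace (smashing_spectrum T) \<subseteq> \<Union>{{p. frame_point ?L p \<and> p a} | a. a \<in> ?L}"
      unfolding top using point_of_prime_image by simp
  qed
  show "open_map (smashing_spectrum T) (frame_spectrum ?L) (point_of_prime T)"
    unfolding open_map_def
  proof (intro allI impI)
    fix W assume "openin (smashing_spectrum T) W"
    then obtain S where S: "smashing_ideal T S" "W = smashing_open T S"
      unfolding openin_smashing_iff by blast
    then show "openin (frame_spectrum ?L) (point_of_prime T ` W)"
      using point_of_prime_image_open[OF S(1)] unfolding frame_spectrum_def
      by (auto intro!: topology_generated_by_Basis)
  qed
  show "point_of_prime T ` topspace (smashing_spectrum T) = topspace (frame_spectrum ?L)"
    using point_of_prime_image top by (simp add: frame_spectrum_def)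
  show "inj_on (point_of_prime T) (topspace (smashing_spectrum T))"
    using point_of_prime_inj by simp
qed

text \<open>A point separating \<open>S\<close> from \<open>R\<close> is the point of a prime that
  contains \<open>R\<close> but not \<open>S\<close>.\<close>

lemma smashing_open_mono_iff:
  assumes sp: "spatial (smashing_frame T)" and S: "smashing_ideal T S" "smashing_ideal T R"
  shows "S \<subseteq> R \<longleftrightarrow> smashing_open T S \<subseteq> smashing_open T R"
proof
  show "S \<subseteq> R \<Longrightarrow> smashing_open T S \<subseteq> smashing_open T R" by (auto simp: smashing_open_def)
  assume sub: "smashing_open T S \<subseteq> smashing_open T R"
  show "S \<subseteq> R"
  proof (rule ccontr)
    assume "\<not> S \<subseteq> R"
    then have "\<exists>p. frame_point (smashing_frame T) p \<and> p S \<and> \<not> p R"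
      using sp[unfolded spatial_def, THEN bspec, of S, THEN bspec, of R, THEN mp] S by simp
    then obtain p where p: "frame_point (smashing_frame T) p" "p S" "\<not> p R" by blast
    obtain P where P: "prime_smashing_ideal T P" "p = point_of_prime T P"
      using p(1) by (rule point_prime)
    have "P \<in> smashing_open T S" "P \<notin> smashing_open T R"
      using p P S by (auto simp: smashing_open_def point_of_prime_def)
    then show False using sub by blast
  qed
qed

lemma smashing_open_bij:
  assumes sp: "spatial (smashing_frame T)"
  shows "bij_betw (smashing_open T) (smashing_frame T) {W. openin (smashing_spectrum T) W}"
  unfolding bij_betw_def
proof
  show "inj_on (smashing_open T) (smashing_frame T)"
  proof (rule inj_onI)
    fix S R assume "S \<in> smashing_frame T" "R \<in> smashing_frame T" "smashing_open T S = smashing_open T R"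
    then show "S = R" using smashing_open_mono_iff[OF sp, of S R] smashing_open_mono_iff[OF sp, of R S] by auto
  qed
  show "smashing_open T ` smashing_frame T = {W. openin (smashing_spectrum T) W}"
    using openin_smashing_iff by auto
qed

lemma closure_of_prime:
  assumes P: "prime_smashing_ideal T P"
  shows "smashing_spectrum T closure_of {P} = {Q. prime_smashing_ideal T Q \<and> P \<subseteq> Q}"
proof
  show "smashing_spectrum T closure_of {P} \<subseteq> {Q. prime_smashing_ideal T Q \<and> P \<subseteq> Q}"
  proof
    fix Q assume "Q \<in> smashing_spectrum T closure_of {P}"
    then have Q: "prime_smashing_ideal T Q" "\<And>W. Q \<in> W \<Longrightarrow> openin (smashing_spectrum T) W \<Longrightarrow> P \<in> W"
      by (auto simp: in_closure_of)
    have "openin (smashing_spectrum T) (smashing_open T P)"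
      using primeD(1)[OF P] openin_smashing_iff by blast
    then have "Q \<notin> smashing_open T P" using Q(2)[of "smashing_open T P"] by (auto simp: smashing_open_def)
    then show "Q \<in> {Q. prime_smashing_ideal T Q \<and> P \<subseteq> Q}" using Q(1) by (simp add: smashing_open_def)
  qed
  show "{Q. prime_smashing_ideal T Q \<and> P \<subseteq> Q} \<subseteq> smashing_spectrum T closure_of {P}"
  proof
    fix Q assume Q: "Q \<in> {Q. prime_smashing_ideal T Q \<and> P \<subseteq> Q}"
    have "P \<in> W" if "Q \<in> W" "openin (smashing_spectrum T) W" for W
    proof -
      have "\<exists>S. W = smashing_open T S" using that(2) openin_smashing_iff by blast
      then obtain S where "W = smashing_open T S" by blast
      then show ?thesis using that(1) Q P unfolding smashing_open_def by blast
    qed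
    then show "Q \<in> smashing_spectrum T closure_of {P}" using Q by (auto simp: in_closure_of)
  qed
qed

text \<open>The complement of an irreducible closed set is the open set of some \<open>P0\<close>.
  If \<open>S \<inter> R\<close> lies in \<open>P0\<close>, the set is covered by the complements of
  the two open sets, so one of them contains it, and spatiality turns this into an inclusion of
  ideals. Thus \<open>P0\<close> is prime and is the generic point.\<close>

lemma sober_smashing_spectrum:
  assumes sp: "spatial (smashing_frame T)"
  shows "sober (smashing_spectrum T)"
  unfolding sober_def
proof (intro allI impI)
  let ?X = "smashing_spectrum T"
  fix C assume C: "irreducible_closed ?X C"
  then have cl: "closedin ?X C" and ne: "C \<noteq> {}"
    and irr: "\<And>A B. closedin ?X A \<Longrightarrow> closedin ?X B \<Longrightarrow> C \<subseteq> A \<union> B \<Longrightarrow> C \<subseteq> A \<or> C \<subseteq> B"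
    unfolding irreducible_closed_def by blast+
  obtain P0 where P0: "smashing_ideal T P0" "topspace ?X - C = smashing_open T P0"
    using cl openin_smashing_iff unfolding closedin_def by blast
  have Cs: "C \<subseteq> topspace ?X" using cl by (rule closedin_subset)
  then have CP: "C = {Q. prime_smashing_ideal T Q \<and> P0 \<subseteq> Q}"
    using P0(2) by (auto simp: smashing_open_def)
  have "P0 \<noteq> UNIV"
    using ne CP primeD(2) by auto
  moreover have "S \<subseteq> P0 \<or> R \<subseteq> P0" if SR: "smashing_ideal T S" "smashing_ideal T R" "S \<inter> R \<subseteq> P0" for S R
  proof -
    have "C \<subseteq> (topspace ?X - smashing_open T S) \<union> (topspace ?X - smashing_open T R)"
    proof
      fix Q assume Q: "Q \<in> C"
      then have "S \<inter> R \<subseteq> Q" "prime_smashing_ideal T Q" using CP SR(3) by auto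
      then show "Q \<in> (topspace ?X - smashing_open T S) \<union> (topspace ?X - smashing_open T R)"
        using primeD(3)[OF _ SR(1,2)] by (auto simp: smashing_open_def)
    qed
    moreover have "closedin ?X (topspace ?X - smashing_open T S)" "closedin ?X (topspace ?X - smashing_open T R)"
      using SR(1,2) openin_smashing_iff by (blast intro: openin_closedin_eq[THEN iffD1, THEN conjunct2])+
    ultimately have "C \<subseteq> topspace ?X - smashing_open T S \<or> C \<subseteq> topspace ?X - smashing_open T R"
      by (intro irr)
    then have "smashing_open T S \<subseteq> smashing_open T P0 \<or> smashing_open T R \<subseteq> smashing_open T P0"
      unfolding CP by (auto simp: smashing_open_def)
    then show ?thesis using smashing_open_mono_iff[OF sp] SR(1,2) P0(1) by blast
  qed
  ultimately have prime: "prime_smashing_ideal T P0" using P0(1) by (simp add: prime_smashing_ideal_def)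
  show "\<exists>!x. x \<in> topspace ?X \<and> ?X closure_of {x} = C"
  proof (rule ex1I[of _ P0])
    show "P0 \<in> topspace ?X \<and> ?X closure_of {P0} = C"
      using prime closure_of_prime[OF prime] CP by simp
    fix Q assume Q: "Q \<in> topspace ?X \<and> ?X closure_of {Q} = C"
    then have q: "prime_smashing_ideal T Q" by simp
    have "{R. prime_smashing_ideal T R \<and> Q \<subseteq> R} = {R. prime_smashing_ideal T R \<and> P0 \<subseteq> R}"
      using Q closure_of_prime[OF q] CP by simp
    then show "Q = P0" using q prime by blast
  qed
qed

section \<open>The Balmer spectrum\<close>

lemma retract_tensor: "retract_of T X Y \<Longrightarrow> retract_of T (X \<star> Z) (Y \<star> Z)"
proof (erule retract_ofE)
  fix i r assume ir: "src T i = X" "tgt T i = Y" "src T r = Y" "tgt T r = X" "r \<cdot> i = idn T X"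
  show "retract_of T (X \<star> Z) (Y \<star> Z)"
    by (rule retract_ofI[of "i \<boxtimes> idn T Z" _ _ "r \<boxtimes> idn T Z"]) (use ir in \<open>simp_all add: tarr_merge\<close>)
qed

lemma smashing_retract:
  assumes "smashing_ideal T S" "X \<in> S" "retract_of T Y X" shows "Y \<in> S"
proof -
  obtain e f d where S: "S = {X. zero_object T (X \<star> tgt T f)}" using assms(1) by (rule smashing_idealE)
  then show ?thesis using zero_object_retract[OF _ retract_tensor[OF assms(3)]] assms(2) by blast
qed

lemma thickD:
  assumes "thick_tensor_ideal T J"
  shows "J \<subseteq> compacts T" "triangulated_subcategory T J" "\<lbrakk>X \<in> J; retract_of T Y X\<rbrakk> \<Longrightarrow> Y \<in> J"
    "\<lbrakk>X \<in> J; compact_object T k\<rbrakk> \<Longrightarrow> X \<star> k \<in> J" "\<lbrakk>X \<in> J; compact_object T k\<rbrakk> \<Longrightarrow> k \<star> X \<in> J"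
proof -
  show J: "J \<subseteq> compacts T" "triangulated_subcategory T J" "\<lbrakk>X \<in> J; retract_of T Y X\<rbrakk> \<Longrightarrow> Y \<in> J"
    "\<lbrakk>X \<in> J; compact_object T k\<rbrakk> \<Longrightarrow> X \<star> k \<in> J"
    using assms by (auto simp: thick_tensor_ideal_def compacts_def)
  assume "X \<in> J" "compact_object T k"
  then have "X \<star> k \<in> J" using assms by (auto simp: thick_tensor_ideal_def compacts_def)
  then show "k \<star> X \<in> J" using tri_sub_iso[OF J(2) tobj_commute] by blast
qed

lemma thick_Int:
  assumes "triangulated_subcategory T A" "\<And>X Y. X \<in> A \<Longrightarrow> retract_of T Y X \<Longrightarrow> Y \<in> A"
    "\<And>X k. X \<in> A \<Longrightarrow> compact_object T k \<Longrightarrow> X \<star> k \<in> A"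
  shows "thick_tensor_ideal T (A \<inter> compacts T)"
  unfolding thick_tensor_ideal_def
proof (intro conjI ballI allI impI)
  show "triangulated_subcategory T (A \<inter> compacts T)"
    using assms(1) compacts_triangulated unfolding triangulated_subcategory_def by blast
  show "Y \<in> A \<inter> compacts T" if "X \<in> A \<inter> compacts T" "retract_of T Y X" for X Y
    using assms(2) retract_compact that by (auto simp: compacts_def)
  show "a \<star> b \<in> A \<inter> compacts T" if "a \<in> A \<inter> compacts T" "b \<in> compacts T" for a b
    using assms(3) compact_tensor that by (auto simp: compacts_def)
qed simp

lemma thick_psi:
  assumes "smashing_ideal T S" shows "thick_tensor_ideal T (psi T S)"
  unfolding psi_def
  by (rule thick_Int) (use smashing_triangulated[OF assms] smashing_retract[OF assms] smashing_tensor[OF assms] in auto)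

text \<open>The restriction is proper because an ideal containing all compacts is everything. For
  primeness, \<open>a\<close> and \<open>b\<close> are replaced by the smashing ideals they
  generate, whose intersection lies in the one generated by \<open>a \<star> b\<close>.\<close>

lemma psi_prime:
  assumes P: "prime_smashing_ideal T P" shows "prime_thick_ideal T (psi T P)"
  unfolding prime_thick_ideal_def
proof (intro conjI ballI impI)
  note P' = primeD(1)[OF P]
  show "thick_tensor_ideal T (psi T P)" by (rule thick_psi[OF P'])
  show "psi T P \<noteq> compacts T"
  proof
    assume "psi T P = compacts T"
    then have "compacts T \<subseteq> P" by (auto simp: psi_def)
    then have "P = UNIV" using generated_least[OF smashing_localizing[OF P']] compacts_generate by blast
    then show False using primeD(2)[OF P] by simp
  qed
  fix a b assume ab: "a \<in> compacts T" "b \<in> compacts T" "a \<star> b \<in> psi T P"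
  have sm: "smashing_ideal T (bhull {a})" "smashing_ideal T (bhull {b})"
    using bhull_compacts(1) ab by auto
  have "bhull {a} \<inter> bhull {b} \<subseteq> bhull {a \<star> b}" by (rule bhull_tensor[OF sm(2)])
  also have "\<dots> \<subseteq> P" using bhull_subset_iff[OF P'] ab(3) by (simp add: psi_def)
  finally have "bhull {a} \<subseteq> P \<or> bhull {b} \<subseteq> P" by (rule primeD(3)[OF P sm])
  then show "a \<in> psi T P \<or> b \<in> psi T P"
    using bhull_subset_iff[OF P'] ab(1,2) by (simp add: psi_def)
qed

lemma prime_thickD:
  assumes "prime_thick_ideal T J"
  shows "thick_tensor_ideal T J" "J \<noteq> compacts T"
    "\<lbrakk>compact_object T a; compact_object T b; a \<star> b \<in> J\<rbrakk> \<Longrightarrow> a \<in> J \<or> b \<in> J"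
  using assms by (auto simp: prime_thick_ideal_def compacts_def)

lemma unit_not_in_prime:
  assumes "prime_thick_ideal T J" shows "\<one> \<notin> J"
proof
  note J = thickD[OF prime_thickD(1)[OF assms]]
  assume "\<one> \<in> J"
  then have "k \<in> J" if "compact_object T k" for k
    using J(4)[OF _ that] tri_sub_iso[OF J(2) tobj_lunit] by blast
  then show False using J(1) prime_thickD(2)[OF assms] by (auto simp: compacts_def)
qed

lemma psi_supp:
  assumes "t \<in> compacts T" "prime_smashing_ideal T P"
  shows "psi T P \<in> supp T t \<longleftrightarrow> t \<notin> P"
  using assms psi_prime by (auto simp: supp_def psi_def)

section \<open>Basic open sets of the Balmer spectrum and their quasi-compactness\<close>

definition cosupp :: "'o \<Rightarrow> 'o set set" where
  "cosupp t = {J. prime_thick_ideal T J \<and> t \<in> J}"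

lemma cosupp_eq: "{J. prime_thick_ideal T J} - supp T t = cosupp t"
  by (auto simp: cosupp_def supp_def)

text \<open>Direct sums realize intersections of basic open sets, as tensor products realize unions:
  a thick ideal contains a sum exactly when it contains both summands.\<close>

lemma cosupp_biproduct:
  assumes "compact_object T t" "compact_object T s"
  obtains r where "compact_object T r" "cosupp r = cosupp t \<inter> cosupp s"
proof -
  obtain B in1 in2 p1 p2 where b: "biproduct t s B in1 in2 p1 p2" by (rule binary_biproduct)
  note b' = b[unfolded biproduct_def]
  have B: "compact_object T B" by (rule compact_biproduct[OF b assms])
  have r: "retract_of T t B" "retract_of T s B"
    by (rule retract_ofI[of in1 t B p1]; use b' in blast) (rule retract_ofI[of in2 s B p2]; use b' in blast)
  have "B \<in> J \<longleftrightarrow> t \<in> J \<and> s \<in> J" if "prime_thick_ideal T J" for J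
    using thickD(2,3)[OF prime_thickD(1)[OF that]] biproduct_sub[OF _ b] r by blast
  then have "cosupp B = cosupp t \<inter> cosupp s" by (auto simp: cosupp_def)
  then show thesis by (rule that[OF B])
qed

lemma cosupp_tensor:
  assumes "compact_object T t" "compact_object T s"
  shows "cosupp (t \<star> s) = cosupp t \<union> cosupp s"
proof -
  have "t \<star> s \<in> J \<longleftrightarrow> t \<in> J \<or> s \<in> J" if J: "prime_thick_ideal T J" for J
    using prime_thickD(3)[OF J assms] thickD(4,5)[OF prime_thickD(1)[OF J]] assms by blast
  then show ?thesis by (auto simp: cosupp_def)
qed

lemma cosupp_unit: "cosupp \<one> = {}"
  using unit_not_in_prime by (auto simp: cosupp_def)

lemma supp_tensor:
  "compact_object T t \<Longrightarrow> compact_object T s \<Longrightarrow> supp T (t \<star> s) = supp T t \<inter> supp T s"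
  using cosupp_tensor[of t s] by (auto simp: cosupp_def supp_def)

lemma openin_balmer:
  assumes "openin (balmer_spectrum T) W"
  obtains B where "B \<subseteq> compacts T" "W = (\<Union>t \<in> B. cosupp t)"
proof -
  have "generate_topology_on {cosupp t | t. t \<in> compacts T} W"
    using assms by (simp add: balmer_spectrum_def openin_topology_generated_by_iff cosupp_eq)
  then have "\<exists>B \<subseteq> compacts T. W = (\<Union>t \<in> B. cosupp t)"
  proof (induction rule: generate_topology_on.induct)
    case Empty
    show ?case by (intro exI[of _ "{}"]) auto
  next
    case (Int a b)
    then obtain A B where AB: "A \<subseteq> compacts T" "a = (\<Union>t \<in> A. cosupp t)" "B \<subseteq> compacts T" "b = (\<Union>t \<in> B. cosupp t)"
      by blast
    let ?C = "{r \<in> compacts T. \<exists>t \<in> A. \<exists>s \<in> B. cosupp r = cosupp t \<inter> cosupp s}"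
    have "a \<inter> b = (\<Union>t \<in> ?C. cosupp t)"
    proof
      show "a \<inter> b \<subseteq> (\<Union>t \<in> ?C. cosupp t)"
      proof
        fix J assume "J \<in> a \<inter> b"
        then obtain t s where ts: "t \<in> A" "s \<in> B" "J \<in> cosupp t" "J \<in> cosupp s" using AB by blast
        have c: "compact_object T t" "compact_object T s" using ts(1,2) AB(1,3) by (auto simp: compacts_def)
        obtain r where r: "compact_object T r" "cosupp r = cosupp t \<inter> cosupp s"
          using c by (rule cosupp_biproduct)
        then have "r \<in> ?C" using ts(1,2) by (auto simp: compacts_def)
        then show "J \<in> (\<Union>t \<in> ?C. cosupp t)" using r(2) ts by blast
      qed
      show "(\<Union>t \<in> ?C. cosupp t) \<subseteq> a \<inter> b" using AB by blast
    qed
    then show ?case by (intro exI[of _ ?C]) auto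
  next
    case (UN K)
    let ?C = "{t \<in> compacts T. \<exists>k \<in> K. cosupp t \<subseteq> k}"
    have "\<Union>K = (\<Union>t \<in> ?C. cosupp t)"
    proof
      show "\<Union>K \<subseteq> (\<Union>t \<in> ?C. cosupp t)"
      proof
        fix J assume "J \<in> \<Union>K"
        then obtain k where k: "k \<in> K" "J \<in> k" by blast
        obtain B where B: "B \<subseteq> compacts T" "k = (\<Union>t \<in> B. cosupp t)" using UN.IH[OF k(1)] by blast
        then obtain t where "t \<in> B" "J \<in> cosupp t" using k(2) by blast
        then show "J \<in> (\<Union>t \<in> ?C. cosupp t)" using B k(1) by blast
      qed
    qed blast
    then show ?case by (intro exI[of _ ?C]) auto
  next
    case (Basis s)
    then obtain t where "t \<in> compacts T" "s = cosupp t" by blast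
    then show ?case by (intro exI[of _ "{t}"]) auto
  qed
  then show thesis using that by blast
qed

lemma openin_cosupp: "t \<in> compacts T \<Longrightarrow> openin (balmer_spectrum T) (cosupp t)"
  unfolding balmer_spectrum_def cosupp_eq by (rule topology_generated_by_Basis) blast

lemma topspace_balmer [simp]: "topspace (balmer_spectrum T) = {J. prime_thick_ideal T J}"
proof -
  obtain Z where Z: "zero_object T Z" using ex_zero_object by blast
  have "cosupp Z = {J. prime_thick_ideal T J}"
    using tri_sub_zero[OF thickD(2)[OF prime_thickD(1)] Z] by (auto simp: cosupp_def)
  moreover have "Z \<in> compacts T" using compact_zero[OF Z] by (simp add: compacts_def)
  ultimately show ?thesis
    by (auto simp: balmer_spectrum_def cosupp_eq cosupp_def)
qed

text \<open>An ideal maximal among those containing \<open>J0\<close> and avoiding the multiplicative set \<open>M\<close> is prime.\<close>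

lemma prime_avoiding:
  assumes J0: "thick_tensor_ideal T J0" "J0 \<inter> M = {}" "M \<subseteq> compacts T" "\<one> \<in> M"
    and mult: "\<And>m n. m \<in> M \<Longrightarrow> n \<in> M \<Longrightarrow> m \<star> n \<in> M"
  obtains J where "prime_thick_ideal T J" "J0 \<subseteq> J" "J \<inter> M = {}"
proof -
  let ?\<A> = "{J. thick_tensor_ideal T J \<and> J0 \<subseteq> J \<and> J \<inter> M = {}}"
  have "\<exists>J \<in> ?\<A>. \<forall>K \<in> ?\<A>. J \<subseteq> K \<longrightarrow> K = J"
  proof (rule subset_Zorn_nonempty)
    show "?\<A> \<noteq> {}" using J0 by blast
    fix \<C> assume ne: "\<C> \<noteq> {}" and ch: "subset.chain ?\<A> \<C>"
    have \<C>: "thick_tensor_ideal T J" "J0 \<subseteq> J" "J \<inter> M = {}" if "J \<in> \<C>" for J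
      using ch that unfolding subset.chain_def by auto
    have tot: "J \<subseteq> K \<or> K \<subseteq> J" if "J \<in> \<C>" "K \<in> \<C>" for J K
      using ch that unfolding subset.chain_def by blast
    have "thick_tensor_ideal T (\<Union>\<C>)"
      unfolding thick_tensor_ideal_def
    proof (intro conjI ballI allI impI)
      show "\<Union>\<C> \<subseteq> compacts T" using thickD(1)[OF \<C>(1)] by blast
      show "triangulated_subcategory T (\<Union>\<C>)"
        unfolding triangulated_subcategory_def
      proof (intro conjI allI impI)
        show "Z \<in> \<Union>\<C>" if "zero_object T Z" for Z
          using ne tri_sub_zero[OF thickD(2)[OF \<C>(1)] that] by blast
        show "Y \<in> \<Union>\<C>" if "X \<in> \<Union>\<C> \<and> isomorphic T X Y" for X Y
          using tri_sub_iso[OF thickD(2)[OF \<C>(1)]] that by blast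
        show "sobj T X \<in> \<Union>\<C> \<longleftrightarrow> X \<in> \<Union>\<C>" for X
          using tri_sub_shift[OF thickD(2)[OF \<C>(1)]] by blast
        show "tgt T g \<in> \<Union>\<C>" if fgh: "dtri T f g h \<and> src T f \<in> \<Union>\<C> \<and> tgt T f \<in> \<Union>\<C>" for f g h
        proof -
          obtain J K where JK: "J \<in> \<C>" "K \<in> \<C>" "src T f \<in> J" "tgt T f \<in> K" using fgh by blast
          then obtain L where L: "L \<in> \<C>" "src T f \<in> L" "tgt T f \<in> L" using tot[OF JK(1,2)] by blast
          have "tgt T g \<in> L"
            by (rule tri_sub_cone[OF thickD(2)[OF \<C>(1)[OF L(1)]], of f g h]) (use fgh L in auto)
          then show ?thesis using L(1) by blast
        qed
      qed
      show "Y \<in> \<Union>\<C>" if "X \<in> \<Union>\<C>" "retract_of T Y X" for X Y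
        using thickD(3)[OF \<C>(1)] that by blast
      show "a \<star> b \<in> \<Union>\<C>" if "a \<in> \<Union>\<C>" "b \<in> compacts T" for a b
        using thickD(4)[OF \<C>(1)] that by (auto simp: compacts_def)
    qed
    then show "\<Union>\<C> \<in> ?\<A>" using \<C>(2,3) ne by blast
  qed
  then obtain J where Ja: "J \<in> ?\<A>" and Jm: "\<forall>K \<in> ?\<A>. J \<subseteq> K \<longrightarrow> K = J"
    by (rule bexE)
  have J: "thick_tensor_ideal T J" "J0 \<subseteq> J" "J \<inter> M = {}" using Ja by simp_all
  have max: "K = J" if "thick_tensor_ideal T K" "J \<subseteq> K" "K \<inter> M = {}" for K
    using Jm[THEN bspec, of K, THEN mp] that order_trans[OF J(2) that(2)] by simp
  note JD = thickD[OF J(1)]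
  have quot: "thick_tensor_ideal T ({x. x \<star> c \<in> J} \<inter> compacts T)" for c
  proof (rule thick_Int)
    show "triangulated_subcategory T {x. x \<star> c \<in> J}" by (rule tensor_preimage_triangulated[OF JD(2)])
    show "Y \<in> {x. x \<star> c \<in> J}" if "X \<in> {x. x \<star> c \<in> J}" "retract_of T Y X" for X Y
      using JD(3)[OF _ retract_tensor[OF that(2)]] that(1) by blast
    show "X \<star> k \<in> {x. x \<star> c \<in> J}" if "X \<in> {x. x \<star> c \<in> J}" "compact_object T k" for X k
      using JD(4)[of "X \<star> c" k] that tri_sub_iso[OF JD(2) tobj_right_commute] by blast
  qed
  \<comment> \<open>The quotient of \<open>J\<close> by \<open>c\<close> contains \<open>J\<close>
    and also \<open>b\<close>, so it is strictly larger and meets \<open>M\<close> by maximality.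
    Using this for \<open>b\<close> and \<open>c\<close> in turn produces an element of
    \<open>M\<close> inside \<open>J\<close>.\<close>
  have enlarge: "\<exists>s \<in> M. s \<star> c \<in> J" if c: "compact_object T c" and b: "compact_object T b" "b \<notin> J" "b \<star> c \<in> J" for b c
  proof (rule ccontr)
    assume "\<not> (\<exists>s \<in> M. s \<star> c \<in> J)"
    then have "({x. x \<star> c \<in> J} \<inter> compacts T) \<inter> M = {}" by blast
    moreover have "J \<subseteq> {x. x \<star> c \<in> J} \<inter> compacts T" using JD(1) JD(4)[OF _ c] by blast
    ultimately have "{x. x \<star> c \<in> J} \<inter> compacts T = J" by (intro max[OF quot])
    then show False using b by (auto simp: compacts_def)
  qed
  have "prime_thick_ideal T J"
    unfolding prime_thick_ideal_def
  proof (intro conjI ballI impI)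
    show "thick_tensor_ideal T J" by (rule J(1))
    show "J \<noteq> compacts T" using J(3) J0(3,4) by blast
    fix b c assume bc: "b \<in> compacts T" "c \<in> compacts T" "b \<star> c \<in> J"
    then have cc: "compact_object T b" "compact_object T c" by (auto simp: compacts_def)
    show "b \<in> J \<or> c \<in> J"
    proof (rule ccontr)
      assume n: "\<not> (b \<in> J \<or> c \<in> J)"
      obtain s where s: "s \<in> M" "s \<star> c \<in> J" using enlarge[OF cc(2,1)] n bc(3) by blast
      have "c \<star> s \<in> J" using s(2) tri_sub_iso[OF JD(2) tobj_commute] by blast
      moreover have "compact_object T s" using s(1) J0(3) by (auto simp: compacts_def)
      ultimately obtain s' where "s' \<in> M" "s' \<star> s \<in> J" using enlarge[of s c] cc(2) n by blast
      then show False using mult[OF _ s(1)] J(3) by blast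
    qed
  qed
  then show thesis using J(2,3) by (rule that)
qed

text \<open>If no finite subfamily covers, the objects whose basic open set is finitely covered form
  a multiplicative set disjoint from the ideal of objects lying in every prime of
  \<open>cosupp a\<close>. A prime containing that ideal and avoiding this set contains
  \<open>a\<close> but cannot be covered.\<close>

lemma compactin_cosupp:
  assumes a: "a \<in> compacts T" shows "compactin (balmer_spectrum T) (cosupp a)"
  unfolding compactin_def
proof (intro conjI allI impI)
  show "cosupp a \<subseteq> topspace (balmer_spectrum T)" by (auto simp: cosupp_def)
  fix \<U> assume U: "(\<forall>U \<in> \<U>. openin (balmer_spectrum T) U) \<and> cosupp a \<subseteq> \<Union>\<U>"
  let ?M = "{m \<in> compacts T. \<exists>\<F>. finite \<F> \<and> \<F> \<subseteq> \<U> \<and> cosupp m \<subseteq> \<Union>\<F>}"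
  show "\<exists>\<F>. finite \<F> \<and> \<F> \<subseteq> \<U> \<and> cosupp a \<subseteq> \<Union>\<F>"
  proof (rule ccontr)
    assume n: "\<not> (\<exists>\<F>. finite \<F> \<and> \<F> \<subseteq> \<U> \<and> cosupp a \<subseteq> \<Union>\<F>)"
    let ?J0 = "{m \<in> compacts T. cosupp a \<subseteq> cosupp m}"
    \<comment> \<open>Compactness is imposed only afterwards, by intersecting with the compacts.
      This covers the case in which \<open>cosupp a\<close> is empty and \<open>?A\<close> is
      everything.\<close>
    let ?A = "{m. cosupp a \<subseteq> {J. prime_thick_ideal T J \<and> m \<in> J}}"
    have J: "thick_tensor_ideal T J" if "J \<in> cosupp a" for J using that prime_thickD(1) by (simp add: cosupp_def)
    have A: "m \<in> ?A \<longleftrightarrow> (\<forall>J \<in> cosupp a. m \<in> J)" for m by (auto simp: cosupp_def)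
    have "thick_tensor_ideal T (?A \<inter> compacts T)"
    proof (rule thick_Int)
      show "triangulated_subcategory T ?A"
        unfolding triangulated_subcategory_def A
      proof (intro conjI allI impI ballI)
        show "Z \<in> J" if "zero_object T Z" "J \<in> cosupp a" for Z J
          using tri_sub_zero[OF thickD(2)[OF J] that(1)] that(2) by blast
        show "Y \<in> J" if "(\<forall>J \<in> cosupp a. X \<in> J) \<and> isomorphic T X Y" "J \<in> cosupp a" for X Y J
          using tri_sub_iso[OF thickD(2)[OF J]] that by blast
        show "(\<forall>J \<in> cosupp a. sobj T X \<in> J) \<longleftrightarrow> (\<forall>J \<in> cosupp a. X \<in> J)" for X
          using tri_sub_shift[OF thickD(2)[OF J]] by blast
        show "tgt T g \<in> J" if "dtri T f g h \<and> (\<forall>J \<in> cosupp a. src T f \<in> J) \<and> (\<forall>J \<in> cosupp a. tgt T f \<in> J)"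
            "J \<in> cosupp a" for f g h J
          using tri_sub_cone[OF thickD(2)[OF J], of J f g h] that by blast
      qed
      show "Y \<in> ?A" if "X \<in> ?A" "retract_of T Y X" for X Y
        using that thickD(3)[OF J] unfolding A by blast
      show "X \<star> k \<in> ?A" if "X \<in> ?A" "compact_object T k" for X k
        using that thickD(4)[OF J] unfolding A by blast
    qed
    moreover have "?A \<inter> compacts T = ?J0" by (auto simp: cosupp_def)
    ultimately have J0: "thick_tensor_ideal T ?J0" by simp
    have dis: "?J0 \<inter> ?M = {}" using n by blast
    have one: "\<one> \<in> ?M"
      using compact_unit cosupp_unit by (auto simp: compacts_def intro!: exI[of _ "{}"])
    have mult: "m \<star> k \<in> ?M" if mk: "m \<in> ?M" "k \<in> ?M" for m k
    proof -
      obtain \<F> \<G> where FG: "finite \<F>" "\<F> \<subseteq> \<U>" "cosupp m \<subseteq> \<Union>\<F>" "finite \<G>" "\<G> \<subseteq> \<U>" "cosupp k \<subseteq> \<Union>\<G>"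
        using mk by blast
      have c: "compact_object T m" "compact_object T k" using mk by (auto simp: compacts_def)
      have "cosupp (m \<star> k) \<subseteq> \<Union>(\<F> \<union> \<G>)" using cosupp_tensor[OF c] FG by blast
      moreover have "m \<star> k \<in> compacts T" using compact_tensor[OF c] by (simp add: compacts_def)
      ultimately show ?thesis using FG by (intro CollectI conjI exI[of _ "\<F> \<union> \<G>"]) auto
    qed
    obtain J where J: "prime_thick_ideal T J" "?J0 \<subseteq> J" "J \<inter> ?M = {}"
      using J0 dis _ one mult by (rule prime_avoiding) auto
    have "a \<in> J" using J(2) a by blast
    then have "J \<in> cosupp a" using J(1) by (simp add: cosupp_def)
    then obtain U where U': "U \<in> \<U>" "J \<in> U" using U by blast
    have "openin (balmer_spectrum T) U" using U U'(1) by blast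
    then obtain B where B: "B \<subseteq> compacts T" "U = (\<Union>t \<in> B. cosupp t)"
      by (rule openin_balmer)
    then obtain t where t: "t \<in> B" "J \<in> cosupp t" using U'(2) by blast
    have "t \<in> ?M"
      using t(1) B U'(1) by (intro CollectI conjI exI[of _ "{U}"]) auto
    moreover have "t \<in> J" using t(2) by (simp add: cosupp_def)
    ultimately show False using J(3) by blast
  qed
qed

section \<open>The Hochster dual: its generating sets are the supports\<close>

definition hochster_basis :: "'o set set set" where
  "hochster_basis = {C. closedin (balmer_spectrum T) C \<and>
     compactin (balmer_spectrum T) (topspace (balmer_spectrum T) - C)}"

lemma hochster_dual_eq: "hochster_dual (balmer_spectrum T) = topology_generated_by hochster_basis"
  by (simp add: hochster_dual_def hochster_basis_def)

lemma supp_hochster_basis: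
  assumes "t \<in> compacts T" shows "supp T t \<in> hochster_basis"
proof -
  have "topspace (balmer_spectrum T) - supp T t = cosupp t" by (simp add: cosupp_eq)
  moreover have "supp T t \<subseteq> topspace (balmer_spectrum T)" by (auto simp: supp_def)
  ultimately show ?thesis
    using openin_cosupp[OF assms] compactin_cosupp[OF assms] by (simp add: hochster_basis_def closedin_def)
qed

text \<open>The complement is a union of basic open sets, finite by quasi-compactness, and a finite
  union is basic again: tensor the indices together, starting with the unit for the empty
  union.\<close>

lemma hochster_basis_supp:
  assumes "C \<in> hochster_basis" obtains t where "t \<in> compacts T" "C = supp T t"
proof -
  let ?X = "balmer_spectrum T"
  have C: "C \<subseteq> topspace ?X" "openin ?X (topspace ?X - C)" "compactin ?X (topspace ?X - C)"
    using assms by (auto simp: hochster_basis_def closedin_def)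
  obtain B where B: "B \<subseteq> compacts T" "topspace ?X - C = (\<Union>t \<in> B. cosupp t)"
    using C(2) by (rule openin_balmer)
  have "\<exists>\<F>. finite \<F> \<and> \<F> \<subseteq> cosupp ` B \<and> topspace ?X - C \<subseteq> \<Union>\<F>"
  proof (rule C(3)[unfolded compactin_def, THEN conjunct2, THEN spec, THEN mp], intro conjI ballI)
    show "openin ?X U" if "U \<in> cosupp ` B" for U using that B(1) openin_cosupp by blast
    show "topspace ?X - C \<subseteq> \<Union>(cosupp ` B)" using B(2) by blast
  qed
  then obtain \<F> where F: "finite \<F>" "\<F> \<subseteq> cosupp ` B" "topspace ?X - C \<subseteq> \<Union>\<F>" by blast
  obtain B0 where B0: "finite B0" "B0 \<subseteq> B" "\<F> = cosupp ` B0"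
    using finite_subset_image[OF F(1,2)] by blast
  have eq: "topspace ?X - C = (\<Union>t \<in> B0. cosupp t)"
    using B(2) F(3) B0(2,3) by blast
  have fin: "\<exists>t. compact_object T t \<and> cosupp t = (\<Union>t \<in> A. cosupp t)" if "finite A" "A \<subseteq> compacts T" for A
    using that
  proof (induction A rule: finite_induct)
    case empty
    then show ?case using compact_unit cosupp_unit by auto
  next
    case (insert s A)
    then obtain t where t: "compact_object T t" "cosupp t = (\<Union>t \<in> A. cosupp t)" by blast
    have s: "compact_object T s" using insert by (simp add: compacts_def)
    show ?case using compact_tensor[OF s t(1)] cosupp_tensor[OF s t(1)] t(2) by auto
  qed
  have "B0 \<subseteq> compacts T" using B0(2) B(1) by blast
  from fin[OF B0(1) this] obtain t where t: "compact_object T t" "cosupp t = (\<Union>t \<in> B0. cosupp t)"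
    by (elim exE conjE)
  have "C = topspace ?X - (topspace ?X - C)" using C(1) by auto
  also have "\<dots> = topspace ?X - cosupp t" by (simp only: eq t(2))
  also have "\<dots> = supp T t" by (auto simp: cosupp_def supp_def)
  finally show thesis using t(1) that by (simp add: compacts_def)
qed

lemma topspace_hochster [simp]: "topspace (hochster_dual (balmer_spectrum T)) = {J. prime_thick_ideal T J}"
proof
  show "topspace (hochster_dual (balmer_spectrum T)) \<subseteq> {J. prime_thick_ideal T J}"
    unfolding hochster_dual_eq using hochster_basis_supp by (auto simp: supp_def)
  have "supp T \<one> = {J. prime_thick_ideal T J}" using unit_not_in_prime by (auto simp: supp_def)
  moreover have "\<one> \<in> compacts T" using compact_unit by (simp add: compacts_def)
  ultimately show "{J. prime_thick_ideal T J} \<subseteq> topspace (hochster_dual (balmer_spectrum T))"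
    unfolding hochster_dual_eq using supp_hochster_basis[of \<one>] by auto
qed

lemma openin_hochster:
  assumes "openin (hochster_dual (balmer_spectrum T)) W"
  obtains B where "B \<subseteq> compacts T" "W = (\<Union>t \<in> B. supp T t)"
proof -
  have "generate_topology_on hochster_basis W"
    using assms by (simp add: hochster_dual_eq openin_topology_generated_by_iff)
  then have "\<exists>B \<subseteq> compacts T. W = (\<Union>t \<in> B. supp T t)"
  proof (induction rule: generate_topology_on.induct)
    case Empty
    show ?case by (intro exI[of _ "{}"]) auto
  next
    case (Int a b)
    then obtain A B where AB: "A \<subseteq> compacts T" "a = (\<Union>t \<in> A. supp T t)" "B \<subseteq> compacts T" "b = (\<Union>t \<in> B. supp T t)"
      by blast
    let ?C = "{t \<star> s | t s. t \<in> A \<and> s \<in> B}"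
    have ts: "supp T (t \<star> s) = supp T t \<inter> supp T s \<and> t \<star> s \<in> compacts T" if "t \<in> A" "s \<in> B" for t s
    proof -
      have "compact_object T t" "compact_object T s" using that AB(1,3) by (auto simp: compacts_def)
      then show ?thesis using supp_tensor compact_tensor by (simp add: compacts_def)
    qed
    then have "a \<inter> b = (\<Union>t \<in> ?C. supp T t)" unfolding AB(2,4) by blast
    moreover have "?C \<subseteq> compacts T" using ts by blast
    ultimately show ?case by blast
  next
    case (UN K)
    let ?C = "{t \<in> compacts T. \<exists>k \<in> K. supp T t \<subseteq> k}"
    have "\<Union>K = (\<Union>t \<in> ?C. supp T t)"
    proof
      show "\<Union>K \<subseteq> (\<Union>t \<in> ?C. supp T t)"
      proof
        fix J assume "J \<in> \<Union>K"
        then obtain k where k: "k \<in> K" "J \<in> k" by blast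
        obtain B where B: "B \<subseteq> compacts T" "k = (\<Union>t \<in> B. supp T t)" using UN.IH[OF k(1)] by blast
        then obtain t where "t \<in> B" "J \<in> supp T t" using k(2) by blast
        then show "J \<in> (\<Union>t \<in> ?C. supp T t)" using B k(1) by blast
      qed
    qed blast
    then show ?case by (intro exI[of _ ?C]) auto
  next
    case (Basis s)
    then obtain t where "t \<in> compacts T" "s = supp T t" by (rule hochster_basis_supp)
    then show ?case by (intro exI[of _ "{t}"]) auto
  qed
  then show thesis using that by blast
qed

text \<open>The preimage of \<open>supp T t\<close> is the open set of the finite localization
  \<open>bhull {t}\<close>, as a smashing ideal contains \<open>bhull {t}\<close> exactly when it
  contains \<open>t\<close>.\<close>

lemma psi_continuous: "continuous_map (smashing_spectrum T) (hochster_dual (balmer_spectrum T)) (psi T)"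
  unfolding hochster_dual_eq
proof (rule continuous_on_generated_topo)
  fix U assume "U \<in> hochster_basis"
  then obtain t where t: "t \<in> compacts T" "U = supp T t" by (rule hochster_basis_supp)
  have "psi T -` U \<inter> topspace (smashing_spectrum T) = smashing_open T (bhull {t})"
    using psi_supp[OF t(1)] t(2) by (auto simp: smashing_open_bhull)
  moreover have "smashing_ideal T (bhull {t})" using bhull_compacts(1) t(1) by simp
  ultimately show "openin (smashing_spectrum T) (psi T -` U \<inter> topspace (smashing_spectrum T))"
    using openin_smashing_iff by metis
next
  show "psi T ` topspace (smashing_spectrum T) \<subseteq> \<Union>hochster_basis"
    using psi_prime topspace_hochster by (auto simp: hochster_dual_eq)
qed

section \<open>The telescope conjecture\<close>

text \<open>Closure of \<open>p\<close> under tensoring with compacts makes the generated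
  subcategory an ideal, so the minimality of finite localization applies; conversely the hull is
  smashing and hence localizing.\<close>

lemma bhull_generated:
  assumes "p \<subseteq> compacts T" "\<And>a k. a \<in> p \<Longrightarrow> compact_object T k \<Longrightarrow> a \<star> k \<in> p"
  shows "bhull p = generated_localizing T p"
proof
  show "bhull p \<subseteq> generated_localizing T p"
    by (rule bhull_compacts(2)[OF assms(1) generated_localizing_ideal[OF assms(2)] generated_subset])
  show "generated_localizing T p \<subseteq> bhull p"
    by (rule generated_least[OF smashing_localizing[OF bhull_compacts(1)[OF assms(1)]] bhull_subset])
qed

text \<open>Under the conjecture a smashing ideal is determined by its compact objects, which gives
  injectivity. A prime thick ideal \<open>p\<close> is hit by the localizing subcategory it
  generates, and the image of the open set of \<open>S\<close> is the union of the supports of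
  compact generators of \<open>S\<close>.\<close>

lemma telescope_imp_homeomorphic:
  assumes tc: "telescope_conjecture T"
  shows "homeomorphic_map (smashing_spectrum T) (hochster_dual (balmer_spectrum T)) (psi T)"
proof (rule bijective_open_imp_homeomorphic_map[OF psi_continuous])
  have gen: "\<exists>A \<subseteq> compacts T. S = generated_localizing T A" if "smashing_ideal T S" for S
    using tc that by (simp add: telescope_conjecture_def)
  have sub: "P \<subseteq> Q" if P: "smashing_ideal T P" and Q: "smashing_ideal T Q" and le: "psi T P \<subseteq> psi T Q" for P Q
  proof -
    obtain A where A: "A \<subseteq> compacts T" "P = generated_localizing T A" using gen[OF P] by blast
    then have "A \<subseteq> psi T P" using generated_subset by (auto simp: psi_def)
    then have "A \<subseteq> Q" using le by (auto simp: psi_def)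
    then show ?thesis unfolding A(2) by (rule generated_least[OF smashing_localizing[OF Q]])
  qed
  show "inj_on (psi T) (topspace (smashing_spectrum T))"
    by (rule inj_onI) (use sub primeD(1) in \<open>simp add: subset_antisym\<close>)
  have surj: "\<exists>P. prime_smashing_ideal T P \<and> psi T P = p" if p: "prime_thick_ideal T p" for p
  proof -
    note pD = thickD[OF prime_thickD(1)[OF p]]
    let ?P = "generated_localizing T p"
    have P: "smashing_ideal T ?P"
      using bhull_compacts(1)[OF pD(1)] bhull_generated[OF pD(1) pD(4)] by simp
    have psi: "psi T ?P = p" unfolding psi_def by (rule thick_ideal_compacts[OF prime_thickD(1)[OF p]])
    have "?P \<noteq> UNIV" using psi prime_thickD(2)[OF p] by (auto simp: psi_def)
    \<comment> \<open>Compact generators \<open>a\<close> of \<open>S\<close> and \<open>b\<close>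
      of \<open>R\<close> outside \<open>?P\<close> have their tensor product in both ideals, hence
      in \<open>p\<close>, which contradicts the primeness of \<open>p\<close>.\<close>
    moreover have "S \<subseteq> ?P \<or> R \<subseteq> ?P" if SR: "smashing_ideal T S" "smashing_ideal T R" "S \<inter> R \<subseteq> ?P" for S R
    proof (rule ccontr)
      assume n: "\<not> (S \<subseteq> ?P \<or> R \<subseteq> ?P)"
      obtain A where A: "A \<subseteq> compacts T" "S = generated_localizing T A" using gen[OF SR(1)] by blast
      obtain B where B: "B \<subseteq> compacts T" "R = generated_localizing T B" using gen[OF SR(2)] by blast
      have "\<not> A \<subseteq> ?P" using n A(2) generated_least[OF smashing_localizing[OF P]] by blast
      then obtain a where a: "a \<in> A" "a \<notin> ?P" by blast
      have "\<not> B \<subseteq> ?P" using n B(2) generated_least[OF smashing_localizing[OF P]] by blast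
      then obtain b where b: "b \<in> B" "b \<notin> ?P" by blast
      have "a \<in> S" "b \<in> R" using a b A(2) B(2) generated_subset by blast+
      then have "a \<star> b \<in> S" "b \<star> a \<in> R" using smashing_tensor SR(1,2) by blast+
      then have "a \<star> b \<in> S \<inter> R" using tri_sub_iso[OF smashing_triangulated[OF SR(2)] tobj_commute] by blast
      moreover have c: "compact_object T a" "compact_object T b" using a b A(1) B(1) by (auto simp: compacts_def)
      ultimately have "a \<star> b \<in> psi T ?P"
        using SR(3) compact_tensor[OF c] by (auto simp: psi_def compacts_def)
      then have "a \<in> p \<or> b \<in> p" using psi prime_thickD(3)[OF p c] by simp
      then show False using a(2) b(2) generated_subset by blast
    qed
    ultimately have "prime_smashing_ideal T ?P" using P by (simp add: prime_smashing_ideal_def)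
    then show ?thesis using psi by blast
  qed
  show "psi T ` topspace (smashing_spectrum T) = topspace (hochster_dual (balmer_spectrum T))"
    using psi_prime surj by (auto simp: image_iff)
  show "open_map (smashing_spectrum T) (hochster_dual (balmer_spectrum T)) (psi T)"
    unfolding open_map_def
  proof (intro allI impI)
    fix W assume "openin (smashing_spectrum T) W"
    then obtain S where S: "smashing_ideal T S" "W = smashing_open T S"
      unfolding openin_smashing_iff by blast
    obtain A where A: "A \<subseteq> compacts T" "S = generated_localizing T A" using gen[OF S(1)] by blast
    have iff: "S \<subseteq> P \<longleftrightarrow> A \<subseteq> P" if "prime_smashing_ideal T P" for P
      using generated_least[OF smashing_localizing[OF primeD(1)[OF that]]] generated_subset A(2) by blast
    have "psi T ` W = (\<Union>a \<in> A. supp T a)"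
    proof
      show "psi T ` W \<subseteq> (\<Union>a \<in> A. supp T a)"
      proof
        fix J assume "J \<in> psi T ` W"
        then obtain P where P: "prime_smashing_ideal T P" "\<not> S \<subseteq> P" "J = psi T P"
          using S(2) by (auto simp: smashing_open_def)
        then obtain a where "a \<in> A" "a \<notin> P" using iff by blast
        then show "J \<in> (\<Union>a \<in> A. supp T a)" using psi_supp[OF _ P(1)] A(1) P(3) by blast
      qed
      show "(\<Union>a \<in> A. supp T a) \<subseteq> psi T ` W"
      proof
        fix J assume "J \<in> (\<Union>a \<in> A. supp T a)"
        then obtain a where a: "a \<in> A" "J \<in> supp T a" by blast
        then have "prime_thick_ideal T J" by (simp add: supp_def)
        then obtain P where P: "prime_smashing_ideal T P" "psi T P = J" using surj by blast
        then have "a \<notin> P" using psi_supp[OF _ P(1)] a A(1) by blast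
        then have "P \<in> W" using iff[OF P(1)] a(1) P(1) S(2) by (auto simp: smashing_open_def)
        then show "J \<in> psi T ` W" using P(2) by blast
      qed
    qed
    moreover have "openin (hochster_dual (balmer_spectrum T)) (supp T a)" if "a \<in> A" for a
      unfolding hochster_dual_eq using supp_hochster_basis that A(1) by (intro topology_generated_by_Basis) blast
    ultimately show "openin (hochster_dual (balmer_spectrum T)) (psi T ` W)" by auto
  qed
qed

text \<open>The image of the open set of \<open>S\<close> is a union of supports over some
  \<open>B\<close>. Injectivity of \<open>psi T\<close> shows that \<open>S\<close> and
  \<open>bhull B\<close> have the same open set, and spatiality makes them equal.\<close>

lemma homeomorphic_imp_telescope:
  assumes sp: "spatial (smashing_frame T)"
    and hom: "homeomorphic_map (smashing_spectrum T) (hochster_dual (balmer_spectrum T)) (psi T)"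
  shows "telescope_conjecture T"
  unfolding telescope_conjecture_def
proof (intro allI impI)
  fix S assume S: "smashing_ideal T S"
  have "openin (smashing_spectrum T) (smashing_open T S)" using S openin_smashing_iff by blast
  then have "openin (hochster_dual (balmer_spectrum T)) (psi T ` smashing_open T S)"
    using homeomorphic_imp_open_map[OF hom] by (simp add: open_map_def)
  then obtain B where B: "B \<subseteq> compacts T" "psi T ` smashing_open T S = (\<Union>t \<in> B. supp T t)"
    by (rule openin_hochster)
  have inj: "inj_on (psi T) {P. prime_smashing_ideal T P}"
    using homeomorphic_imp_injective_map[OF hom] by simp
  have "P \<in> smashing_open T S \<longleftrightarrow> P \<in> smashing_open T (bhull B)" if P: "prime_smashing_ideal T P" for P
  proof -
    have "smashing_open T S \<subseteq> {P. prime_smashing_ideal T P}" by (auto simp: smashing_open_def)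
    then have "P \<in> smashing_open T S \<longleftrightarrow> psi T P \<in> psi T ` smashing_open T S"
      using inj_on_image_mem_iff[OF inj] P by blast
    also have "\<dots> \<longleftrightarrow> (\<exists>t \<in> B. t \<notin> P)" unfolding B(2) using psi_supp[OF _ P] B(1) by blast
    finally show ?thesis using P by (auto simp: smashing_open_bhull)
  qed
  then have "smashing_open T S = smashing_open T (bhull B)" by (auto simp: smashing_open_def)
  moreover have "smashing_ideal T (bhull B)" by (rule bhull_compacts(1)[OF B(1)])
  ultimately have SB: "S = bhull B"
    using smashing_open_mono_iff[OF sp] S by blast
  \<comment> \<open>\<open>B\<close> need not be closed under tensoring with compacts, so the hull
    of \<open>B\<close> is not directly a generated localizing subcategory. The set of all compact
    objects of \<open>S\<close> has this closure and the same hull.\<close>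
  let ?A = "psi T S"
  have A: "?A \<subseteq> compacts T" by (auto simp: psi_def)
  have "S = generated_localizing T ?A"
  proof
    have "bhull B \<subseteq> bhull ?A"
      using B(1) bhull_subset[of B] bhull_subset[of ?A] SB by (intro bhull_least) (auto simp: psi_def)
    also have "bhull ?A = generated_localizing T ?A"
      by (rule bhull_generated[OF A]) (rule thickD(4)[OF thick_psi[OF S]])
    finally show "S \<subseteq> generated_localizing T ?A" unfolding SB .
    show "generated_localizing T ?A \<subseteq> S"
      by (rule generated_least[OF smashing_localizing[OF S]]) (auto simp: psi_def)
  qed
  with A show "\<exists>A \<subseteq> compacts T. S = generated_localizing T A" by blast
qed

end

text \<open>Stone duality is spelled out as three facts: the primes are homeomorphic to the space of
  frame maps, this space is sober, and its open sets are order isomorphic to the frame.\<close>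

theorem theoremA:
  fixes T :: "('o, 'm, 'u) big_ttcat"
  assumes "big_tt_category T"
    and "spatial (smashing_frame T)"
  shows
    "topspace (smashing_spectrum T) = {P. prime_smashing_ideal T P}
     \<and> homeomorphic_map (smashing_spectrum T) (frame_spectrum (smashing_frame T)) (point_of_prime T)
     \<and> sober (smashing_spectrum T)
     \<and> bij_betw (smashing_open T) (smashing_frame T) {W. openin (smashing_spectrum T) W}
     \<and> (\<forall>S \<in> smashing_frame T. \<forall>R \<in> smashing_frame T.
           S \<subseteq> R \<longleftrightarrow> smashing_open T S \<subseteq> smashing_open T R)
     \<and> continuous_map (smashing_spectrum T) (hochster_dual (balmer_spectrum T)) (psi T)
     \<and> (\<forall>t \<in> compacts T.
           {P. prime_smashing_ideal T P \<and> psi T P \<in> supp T t} = smashing_support T t)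
     \<and> (homeomorphic_map (smashing_spectrum T) (hochster_dual (balmer_spectrum T)) (psi T)
           \<longleftrightarrow> telescope_conjecture T)"
proof -
  interpret big_tt_category T by (rule assms(1))
  show ?thesis
  proof (intro conjI ballI iffI)
    show "topspace (smashing_spectrum T) = {P. prime_smashing_ideal T P}"
      by (rule topspace_smashing_spectrum)
    show "homeomorphic_map (smashing_spectrum T) (frame_spectrum (smashing_frame T)) (point_of_prime T)"
      by (rule point_of_prime_homeomorphic)
    show "sober (smashing_spectrum T)"
      by (rule sober_smashing_spectrum[OF assms(2)])
    show "bij_betw (smashing_open T) (smashing_frame T) {W. openin (smashing_spectrum T) W}"
      by (rule smashing_open_bij[OF assms(2)])
    show "smashing_open T S \<subseteq> smashing_open T R"
      if "S \<in> smashing_frame T" "R \<in> smashing_frame T" "S \<subseteq> R" for S R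
      using smashing_open_mono_iff[OF assms(2)] that by simp
    show "S \<subseteq> R"
      if "S \<in> smashing_frame T" "R \<in> smashing_frame T" "smashing_open T S \<subseteq> smashing_open T R" for S R
      using smashing_open_mono_iff[OF assms(2)] that by simp
    show "continuous_map (smashing_spectrum T) (hochster_dual (balmer_spectrum T)) (psi T)"
      by (rule psi_continuous)
    show "{P. prime_smashing_ideal T P \<and> psi T P \<in> supp T t} = smashing_support T t"
      if "t \<in> compacts T" for t
      using psi_supp[OF that] by (auto simp: smashing_support_def)
    show "telescope_conjecture T"
      if "homeomorphic_map (smashing_spectrum T) (hochster_dual (balmer_spectrum T)) (psi T)"
      by (rule homeomorphic_imp_telescope[OF assms(2) that])
    show "homeomorphic_map (smashing_spectrum T) (hochster_dual (balmer_spectrum T)) (psi T)"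
      if "telescope_conjecture T"
      by (rule telescope_imp_homeomorphic[OF that])
  qed
qed

end
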